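(* Let $F\in\mathbb{C}[x_0,x_1,x_2]_3$ be any (nonzero) ternary cubic form. Then either $\underline{\mathrm{VSP}}(F,\underline{\mathbf{rk}}(F))\cong\mathbb{P}^2$ or $\underline{\mathrm{VSP}}(F,\underline{\mathbf{rk}}(F))$ is a point.
   Context: $X=\mathbb{P}^2$; $S=\mathbb{C}[y_0,y_1,y_2]$ and $T=\mathbb{C}[x_0,x_1,x_2]$ are standard graded, $S$ acting on $T$ by differentiation ($y_i\circ x_j=\delta_{ij}$); $\mathrm{Ann}(F)=\{\psi\in S:\psi\circ F=0\}$. The border rank $\underline{\mathbf{rk}}(F)$ is the least $r$ such that $[F]$ lies in the $r$-th secant variety of the Veronese variety $\nu_3(\mathbb{P}^2)\subset\mathbb{P}(T_3)$. $h_{r,\mathbb{P}^2}(k)=\min\{r,\dim_{\mathbb C}S_k\}$; $\mathrm{Hilb}_S^{h_{r,\mathbb{P}^2}}$ is the multigraded (Haiman–Sturmfels) Hilbert scheme of homogeneous ideals $I\subset S$ such that $S/I$ has Hilbert function $h_{r,\mathbb{P}^2}$; $\mathrm{Slip}_{r,\mathbb{P}^2}$ is its irreducible component that is the closure of the locus of saturated ideals of $r$ distinct points with Hilbert function $h_{r,\mathbb{P}^2}$. $\underline{\mathrm{VSP}}(F,r)=\{J\in\mathrm{Slip}_{r,\mathbb{P}^2}:J\subset\mathrm{Ann}(F)\}$, with reduced structure. *)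

theory Defs
  imports "HOL-Analysis.Analysis" "HOL-Library.Poly_Mapping" "HOL-Library.Numeral_Type"
begin

section \<open>Complex vector spaces of finitely supported functions\<close>

definition scale :: "complex \<Rightarrow> ('i \<Rightarrow>\<^sub>0 complex) \<Rightarrow> ('i \<Rightarrow>\<^sub>0 complex)" where
  "scale c v = Poly_Mapping.map ((*) c) v"

lemma lookup_scale [simp]: "Poly_Mapping.lookup (scale c v) i = c * Poly_Mapping.lookup v i"
  unfolding scale_def by transfer (simp add: when_def)

interpretation cvs: vector_space "scale :: complex \<Rightarrow> ('i \<Rightarrow>\<^sub>0 complex) \<Rightarrow> ('i \<Rightarrow>\<^sub>0 complex)"
  by unfold_locales (auto intro!: poly_mapping_eqI simp: lookup_add algebra_simps)


section \<open>Classical varieties: Zariski topology and regular functions\<close>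

text \<open>
  A chart \<open>(U, C)\<close> is a set \<open>U\<close> of points with a set \<open>C\<close> of affine coordinate functions on it;
  values outside \<open>U\<close> are irrelevant. An atlas on an ambient space puts on every subset
  \<open>X\<close> the induced Zariski topology and the induced sheaf of regular functions. For a closed set
  \<open>X\<close> of complex points this is the variety \<open>X\<close> with its reduced structure.
\<close>

type_synonym 'a atlas = "('a set \<times> ('a \<Rightarrow> complex) set) set"

inductive_set generated_algebra :: "('a \<Rightarrow> complex) set \<Rightarrow> ('a \<Rightarrow> complex) set"
  for C :: "('a \<Rightarrow> complex) set" where
  const: "(\<lambda>_. c) \<in> generated_algebra C"
| coord: "f \<in> C \<Longrightarrow> f \<in> generated_algebra C"
| add: "\<lbrakk>f \<in> generated_algebra C; g \<in> generated_algebra C\<rbrakk>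
        \<Longrightarrow> (\<lambda>x. f x + g x) \<in> generated_algebra C"
| mult: "\<lbrakk>f \<in> generated_algebra C; g \<in> generated_algebra C\<rbrakk>
        \<Longrightarrow> (\<lambda>x. f x * g x) \<in> generated_algebra C"

definition zariski :: "'a atlas \<Rightarrow> 'a set \<Rightarrow> 'a topology" where
  "zariski \<A> X = topology_generated_by
     {{x \<in> X \<inter> U. q x \<noteq> 0} | U C q. (U, C) \<in> \<A> \<and> q \<in> generated_algebra C}"

definition regular_on :: "'a atlas \<Rightarrow> 'a set \<Rightarrow> 'a set \<Rightarrow> ('a \<Rightarrow> complex) \<Rightarrow> bool" where
  "regular_on \<A> X W f \<longleftrightarrow>
     (\<forall>x\<in>W. \<exists>V U C p q. openin (zariski \<A> X) V \<and> x \<in> V \<and> V \<subseteq> W \<and>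
        (U, C) \<in> \<A> \<and> V \<subseteq> U \<and> p \<in> generated_algebra C \<and> q \<in> generated_algebra C \<and>
        (\<forall>y\<in>V. q y \<noteq> 0 \<and> f y = p y / q y))"

definition variety_iso :: "'a atlas \<Rightarrow> 'a set \<Rightarrow> 'b atlas \<Rightarrow> 'b set \<Rightarrow> ('a \<Rightarrow> 'b) \<Rightarrow> bool" where
  "variety_iso \<A> X \<B> Y \<phi> \<longleftrightarrow>
     homeomorphic_map (zariski \<A> X) (zariski \<B> Y) \<phi> \<and>
     (\<forall>W f. openin (zariski \<B> Y) W \<longrightarrow>
        (regular_on \<B> Y W f \<longleftrightarrow> regular_on \<A> X {x \<in> X. \<phi> x \<in> W} (f \<circ> \<phi>)))"

definition isomorphic_varieties :: "'a atlas \<Rightarrow> 'a set \<Rightarrow> 'b atlas \<Rightarrow> 'b set \<Rightarrow> bool" where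
  "isomorphic_varieties \<A> X \<B> Y \<longleftrightarrow> (\<exists>\<phi>. variety_iso \<A> X \<B> Y \<phi>)"


section \<open>Projective spaces\<close>

definition proj :: "('i \<Rightarrow>\<^sub>0 complex) set \<Rightarrow> ('i \<Rightarrow>\<^sub>0 complex) set set" where
  "proj V = {cvs.span {v} | v. v \<in> V \<and> v \<noteq> 0}"

text \<open>On the chart of all lines on which the \<open>i\<close>-th coordinate does not vanish identically, the
  affine coordinates are the ratios of the \<open>j\<close>-th by the \<open>i\<close>-th coordinate.\<close>

definition coord_ratio :: "'i \<Rightarrow> 'i \<Rightarrow> ('i \<Rightarrow>\<^sub>0 complex) set \<Rightarrow> complex" where
  "coord_ratio i j p =
     (THE c. \<forall>v\<in>p. Poly_Mapping.lookup v j = c * Poly_Mapping.lookup v i)"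

definition proj_atlas :: "('i \<Rightarrow>\<^sub>0 complex) set atlas" where
  "proj_atlas =
     {({p. \<exists>v\<in>p. Poly_Mapping.lookup v i \<noteq> 0}, range (\<lambda>j. coord_ratio i j)) | i. True}"

definition P2 :: "(3 \<Rightarrow>\<^sub>0 complex) set set" where
  "P2 = proj UNIV"


section \<open>Polynomials in three variables and the differentiation action\<close>

text \<open>Both \<open>S\<close> and \<open>T\<close> are represented by the monoid algebra \<open>poly3\<close>, with variables indexed
  by the three-element type \<open>3\<close>.\<close>

type_synonym mon3 = "3 \<Rightarrow>\<^sub>0 nat"
type_synonym poly3 = "mon3 \<Rightarrow>\<^sub>0 complex"

abbreviation monom3 :: "mon3 \<Rightarrow> poly3" where
  "monom3 m \<equiv> Poly_Mapping.single m 1"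

definition mdeg :: "mon3 \<Rightarrow> nat" where
  "mdeg m = (\<Sum>i\<in>UNIV. Poly_Mapping.lookup m i)"

definition forms :: "nat \<Rightarrow> poly3 set" where
  "forms k = {p. \<forall>m\<in>Poly_Mapping.keys p. mdeg m = k}"

definition component :: "nat \<Rightarrow> poly3 \<Rightarrow> poly3" where
  "component k p = (\<Sum>m | m \<in> Poly_Mapping.keys p \<and> mdeg m = k.
                      Poly_Mapping.single m (Poly_Mapping.lookup p m))"

definition eval3 :: "poly3 \<Rightarrow> (3 \<Rightarrow>\<^sub>0 complex) \<Rightarrow> complex" where
  "eval3 p v = (\<Sum>m\<in>Poly_Mapping.keys p. Poly_Mapping.lookup p m *
                  (\<Prod>i\<in>UNIV. Poly_Mapping.lookup v i ^ Poly_Mapping.lookup m i))"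

definition partial_deriv :: "3 \<Rightarrow> poly3 \<Rightarrow> poly3" where
  "partial_deriv i F = (\<Sum>m\<in>Poly_Mapping.keys F. Poly_Mapping.single (m - Poly_Mapping.single i 1)
                          (of_nat (Poly_Mapping.lookup m i) * Poly_Mapping.lookup F m))"

definition mon_action :: "mon3 \<Rightarrow> poly3 \<Rightarrow> poly3" where
  "mon_action a F = (partial_deriv 0 ^^ Poly_Mapping.lookup a 0)
                      ((partial_deriv 1 ^^ Poly_Mapping.lookup a 1)
                        ((partial_deriv 2 ^^ Poly_Mapping.lookup a 2) F))"

definition diff_action :: "poly3 \<Rightarrow> poly3 \<Rightarrow> poly3" where
  "diff_action \<psi> F =
     (\<Sum>a\<in>Poly_Mapping.keys \<psi>. scale (Poly_Mapping.lookup \<psi> a) (mon_action a F))"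

definition Ann :: "poly3 \<Rightarrow> poly3 set" where
  "Ann F = {\<psi>. diff_action \<psi> F = 0}"


section \<open>Border rank of ternary cubics\<close>

definition linear_form :: "(3 \<Rightarrow>\<^sub>0 complex) \<Rightarrow> poly3" where
  "linear_form v = (\<Sum>i\<in>UNIV. Poly_Mapping.single (Poly_Mapping.single i 1) (Poly_Mapping.lookup v i))"

definition veronese3 :: "(3 \<Rightarrow>\<^sub>0 complex) set \<Rightarrow> poly3 set" where
  "veronese3 p = cvs.span ((\<lambda>v. linear_form v ^ 3) ` p)"

definition secant_variety :: "nat \<Rightarrow> poly3 set set" where
  "secant_variety r = zariski proj_atlas (proj (forms 3)) closure_of
     {q \<in> proj (forms 3). \<exists>p :: nat \<Rightarrow> poly3 set.
        (\<forall>i<r. p i \<in> veronese3 ` P2) \<and> q \<subseteq> cvs.span (\<Union>i<r. p i)}"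

definition border_rank :: "poly3 \<Rightarrow> nat" where
  "border_rank F = (LEAST r. cvs.span {F} \<in> secant_variety r)"


section \<open>The multigraded Hilbert scheme, Slip and the border VSP\<close>

definition homogeneous_ideal :: "poly3 set \<Rightarrow> bool" where
  "homogeneous_ideal I \<longleftrightarrow>
     module.subspace ((*) :: poly3 \<Rightarrow> poly3 \<Rightarrow> poly3) I \<and> (\<forall>p\<in>I. \<forall>k. component k p \<in> I)"

text \<open>The dimension of \<open>(S/I)\<^sub>k = S\<^sub>k/I\<^sub>k\<close> for a homogeneous ideal \<open>I\<close>.\<close>

definition hilbert_function :: "poly3 set \<Rightarrow> nat \<Rightarrow> nat" where
  "hilbert_function I k = cvs.dim (forms k) - cvs.dim (I \<inter> forms k)"

definition generic_hf :: "nat \<Rightarrow> nat \<Rightarrow> nat" where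
  "generic_hf r k = min r (cvs.dim (forms k))"

definition Hilb :: "nat \<Rightarrow> poly3 set set" where
  "Hilb r = {I. homogeneous_ideal I \<and> hilbert_function I = generic_hf r}"

text \<open>
  The Haiman--Sturmfels Hilbert scheme is a closed subscheme of the product of the Grassmannians of
  quotients of \<open>S\<^sub>k\<close>, \<open>k \<le> d\<close>, for all large \<open>d\<close>. It is covered by the standard affine charts in
  which a chosen set \<open>B\<close> of monomials is a basis of \<open>(S/I)\<^sub>k\<close> for \<open>k \<le> d\<close>; the coordinates there
  are the coefficients of the normal forms, modulo \<open>I\<close>, of the monomials of degree at most \<open>d\<close>.
  All \<open>d\<close> are allowed here: the smaller ones give coarser, compatible charts.
\<close>

definition is_normal_form :: "mon3 set \<Rightarrow> poly3 set \<Rightarrow> mon3 \<Rightarrow> poly3 \<Rightarrow> bool" where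
  "is_normal_form B I m p \<longleftrightarrow>
     Poly_Mapping.keys p \<subseteq> {b \<in> B. mdeg b = mdeg m} \<and> monom3 m - p \<in> I"

definition hilb_chart :: "nat \<Rightarrow> mon3 set \<Rightarrow> poly3 set set" where
  "hilb_chart d B = {I. \<forall>m. mdeg m \<le> d \<longrightarrow> (\<exists>!p. is_normal_form B I m p)}"

definition hilb_coord :: "mon3 set \<Rightarrow> mon3 \<Rightarrow> mon3 \<Rightarrow> poly3 set \<Rightarrow> complex" where
  "hilb_coord B m b I = Poly_Mapping.lookup (THE p. is_normal_form B I m p) b"

definition hilb_atlas :: "poly3 set atlas" where
  "hilb_atlas = {(hilb_chart d B, {hilb_coord B m b | m b. mdeg m \<le> d}) | d B. True}"

text \<open>The vanishing ideal of a set of points of the projective plane (points are lines, so all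
  homogeneous components of its elements vanish, too); it is automatically saturated.\<close>

definition vanishing_ideal :: "(3 \<Rightarrow>\<^sub>0 complex) set set \<Rightarrow> poly3 set" where
  "vanishing_ideal Z = {\<psi>. \<forall>p\<in>Z. \<forall>v\<in>p. eval3 \<psi> v = 0}"

definition Slip :: "nat \<Rightarrow> poly3 set set" where
  "Slip r = zariski hilb_atlas (Hilb r) closure_of
     {I \<in> Hilb r. \<exists>Z. Z \<subseteq> P2 \<and> finite Z \<and> card Z = r \<and> I = vanishing_ideal Z}"

definition border_VSP :: "poly3 \<Rightarrow> nat \<Rightarrow> poly3 set set" where
  "border_VSP F r = {J \<in> Slip r. J \<subseteq> Ann F}"

end

theory Submission
  imports "Jordan_Normal_Form.Determinant" "HOL-Computational_Algebra.Fundamental_Theorem_Algebra" Defs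
begin

text \<open>
  Suppose first that the derivative of \<open>F\<close> along some nonzero vector is the square of a (possibly
  zero) linear form. Then \<open>F\<close> is, in suitable coordinates, one of \<open>X\<^sup>3\<close>, \<open>X\<^sup>3 + Y\<^sup>3\<close>, \<open>X\<^sup>2Y\<close>,
  \<open>X\<^sup>3 + Y\<^sup>3 + Z\<^sup>3\<close>, \<open>X\<^sup>2Y + Z\<^sup>3\<close>, \<open>X\<^sup>2Z + XY\<^sup>2\<close>, of border rank \<open>r \<le> 3\<close>. In degrees one and two the ideal
  \<open>Ann F\<close> has just the dimension that the Hilbert function forces upon any \<open>J\<close> inside it, so \<open>J\<close> is unique.

  Otherwise \<open>Ann F\<close> contains a product of two independent linear forms. Hence \<open>F\<close> is a sum of binary
  cubics in \<open>x, z\<close> and in \<open>y, z\<close>, and has border rank at most \<open>4\<close>; the Aronhold invariant of \<open>F\<close> is the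
  product of the discriminants of two polars that are not squares, so the border rank is \<open>4\<close>. The conics in
  \<open>Ann F\<close> form a net without common factors between its members. So every pencil in the net generates
  an ideal of colength \<open>4\<close>, which is a limit of ideals of four points, and every \<open>J\<close> arises from
  the pencil \<open>J\<^sub>2\<close>. The pencils in a net are parametrized by the (dual) plane.
\<close>

section \<open>Zariski topologies and morphisms\<close>

text \<open>Membership in \<open>Slip r\<close> is membership in a Zariski closure, so limits are
  taken analytically: generators depending continuously on t are followed to t = 0. Semicontinuity,
  a consequence of Cramer's rule, bounds the Hilbert function of the limit from one side; only the
  other bound, dim S_k \<le> dim J_k + r for all k, is proved for the particular ideals, by explicit
  spanning sets and by residuals with respect to a line. The same use of Cramer's rule, with
  rational functions in place of continuous ones, shows that the plane of pencils maps to the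
  Hilbert scheme by regular functions. For the inverse map, three conics spanning the net have
  normal forms modulo J whose coefficients are proportional to the homogeneous coordinates of the
  point. Changes of coordinates are never substituted into polynomials. Dual bases
  (\<open>frame\<close>) replace them: derivatives along one basis are paired with linear forms of
  the other, and Euler's relation rebuilds a form from its derivatives. Lower bounds on border rank
  come from polynomials in the coefficients that vanish on sums of few cubes.\<close>

definition fun_algebra :: "('y \<Rightarrow> complex) set \<Rightarrow> bool" where
  "fun_algebra R \<longleftrightarrow> (\<forall>c. (\<lambda>_. c) \<in> R) \<and>
     (\<forall>f\<in>R. \<forall>g\<in>R. (\<lambda>x. f x + g x) \<in> R) \<and> (\<forall>f\<in>R. \<forall>g\<in>R. (\<lambda>x. f x * g x) \<in> R)"

lemma fun_algebra_const: "fun_algebra R \<Longrightarrow> (\<lambda>_. c) \<in> R"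
  and fun_algebra_add: "fun_algebra R \<Longrightarrow> f \<in> R \<Longrightarrow> g \<in> R \<Longrightarrow> (\<lambda>x. f x + g x) \<in> R"
  and fun_algebra_mult: "fun_algebra R \<Longrightarrow> f \<in> R \<Longrightarrow> g \<in> R \<Longrightarrow> (\<lambda>x. f x * g x) \<in> R"
  by (simp_all add: fun_algebra_def)

lemma fun_algebra_generated: "fun_algebra (generated_algebra C)"
  by (auto simp: fun_algebra_def intro: generated_algebra.intros)

text \<open>With this instance the statements about families below become statements about limits at
  a point; with \<open>generated_algebra\<close> they become statements about regular
  functions.\<close>

lemma fun_algebra_continuous: "fun_algebra {f. isCont f (a::complex)}"
  by (auto simp: fun_algebra_def)

lemma fun_algebra_cmult: "fun_algebra R \<Longrightarrow> f \<in> R \<Longrightarrow> (\<lambda>x. c * f x) \<in> R"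
  using fun_algebra_mult[OF _ fun_algebra_const] by blast

lemma fun_algebra_diff:
  assumes "fun_algebra R" "f \<in> R" "g \<in> R" shows "(\<lambda>x. f x - g x) \<in> R"
  using fun_algebra_add[OF assms(1,2) fun_algebra_cmult[OF assms(1,3), of "-1"]] by simp

lemma fun_algebra_sum:
  assumes "fun_algebra R" "\<And>i. i \<in> I \<Longrightarrow> f i \<in> R"
  shows "(\<lambda>x. \<Sum>i\<in>I. f i x) \<in> R"
  using assms(2)
proof (induction I rule: infinite_finite_induct)
  case (insert j I)
  then show ?case using fun_algebra_add[OF assms(1), of "f j" "\<lambda>x. \<Sum> i\<in>I. f i x"] by simp
qed (use fun_algebra_const[OF assms(1), of 0] in simp_all)

lemma fun_algebra_prod:
  assumes "fun_algebra R" "\<And>i. i \<in> I \<Longrightarrow> f i \<in> R"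
  shows "(\<lambda>x. \<Prod>i\<in>I. f i x) \<in> R"
  using assms(2)
proof (induction I rule: infinite_finite_induct)
  case (insert j I)
  then show ?case using fun_algebra_mult[OF assms(1), of "f j" "\<lambda>x. \<Prod> i\<in>I. f i x"] by simp
qed (use fun_algebra_const[OF assms(1), of 1] in simp_all)

lemma topspace_zariski_subset: "topspace (zariski \<A> X) \<subseteq> X"
  by (auto simp: zariski_def topology_generated_by_topspace)

lemma openin_zariski_basic:
  assumes "(U, C) \<in> \<A>" "q \<in> generated_algebra C"
  shows "openin (zariski \<A> X) {x \<in> X \<inter> U. q x \<noteq> 0}"
  unfolding zariski_def using assms by (intro topology_generated_by_Basis) auto

lemma openin_zariski_chart:
  assumes "(U, C) \<in> \<A>" shows "openin (zariski \<A> X) (X \<inter> U)"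
  using openin_zariski_basic[OF assms generated_algebra.const[of 1], of X] by (simp add: Int_def)

lemma topspace_zariski:
  assumes "\<And>x. x \<in> X \<Longrightarrow> \<exists>U C. (U, C) \<in> \<A> \<and> x \<in> U"
  shows "topspace (zariski \<A> X) = X"
proof
  show "X \<subseteq> topspace (zariski \<A> X)"
  proof
    fix x assume x: "x \<in> X"
    then obtain U C where "(U, C) \<in> \<A>" "x \<in> U" using assms by blast
    with x show "x \<in> topspace (zariski \<A> X)"
      using openin_subset[OF openin_zariski_chart] by blast
  qed
qed (rule topspace_zariski_subset)

lemma openin_zariskiI:
  assumes "\<And>x. x \<in> W \<Longrightarrow> \<exists>V. openin (zariski \<A> X) V \<and> x \<in> V \<and> V \<subseteq> W"
  shows "openin (zariski \<A> X) W"
  using assms by (subst openin_subopen) blast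

text \<open>The basic sets are only known to be a subbasis, so the claim is proved by induction on
  the generated topology; finite intersections are harmless because \<open>eventually\<close>
  respects conjunction.\<close>

lemma openin_zariski_eventually:
  assumes "openin (zariski \<A> X) W" and "a \<in> W"
    and ev: "\<And>U C q. \<lbrakk>(U, C) \<in> \<A>; q \<in> generated_algebra C; a \<in> U; q a \<noteq> 0\<rbrakk>
              \<Longrightarrow> \<forall>\<^sub>F t in G. x t \<in> X \<inter> U \<and> q (x t) \<noteq> 0"
  shows "\<forall>\<^sub>F t in G. x t \<in> W"
proof -
  have "generate_topology_on {{x \<in> X \<inter> U. q x \<noteq> 0} | U C q. (U, C) \<in> \<A> \<and> q \<in> generated_algebra C} W"
    using assms(1) by (simp add: zariski_def openin_topology_generated_by_iff)
  then show ?thesis using \<open>a \<in> W\<close>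
  proof induction
    case (Int A B)
    then show ?case by (auto intro: eventually_conj)
  next
    case (UN K)
    then obtain k where k: "k \<in> K" "a \<in> k" by blast
    from UN.IH[OF this] show ?case by (rule eventually_mono) (use k in blast)
  next
    case (Basis S)
    then obtain U C q where "S = {x \<in> X \<inter> U. q x \<noteq> 0}" "(U, C) \<in> \<A>" "q \<in> generated_algebra C"
      by (elim CollectE exE conjE) (rule that)
    with ev[of U C q] Basis show ?case by simp
  qed simp
qed

lemma generated_algebra_tendsto:
  assumes "q \<in> generated_algebra C" and "\<And>f. f \<in> C \<Longrightarrow> ((\<lambda>t. f (x t)) \<longlongrightarrow> f a) G"
  shows "((\<lambda>t. q (x t)) \<longlongrightarrow> q a) G"
  using assms(1) by induction (auto intro: tendsto_add tendsto_mult assms(2))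

text \<open>A polynomial in the chart coordinates that is nonzero at \<open>a\<close> stays nonzero
  along \<open>x t\<close> once the coordinates converge. So analytic convergence implies that every
  Zariski neighbourhood of \<open>a\<close> meets \<open>S\<close>.\<close>

lemma in_zariski_closure:
  assumes "a \<in> topspace (zariski \<A> X)" and "G \<noteq> bot" and mem: "\<forall>\<^sub>F t in G. x t \<in> S" and "S \<subseteq> X"
    and ch: "\<And>U C. \<lbrakk>(U, C) \<in> \<A>; a \<in> U\<rbrakk> \<Longrightarrow> \<forall>\<^sub>F t in G. x t \<in> U"
    and lim: "\<And>U C f. \<lbrakk>(U, C) \<in> \<A>; a \<in> U; f \<in> C\<rbrakk> \<Longrightarrow> ((\<lambda>t. f (x t)) \<longlongrightarrow> f a) G"
  shows "a \<in> zariski \<A> X closure_of S"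
  unfolding in_closure_of
proof (intro conjI allI impI)
  fix W assume W: "a \<in> W \<and> openin (zariski \<A> X) W"
  have "\<forall>\<^sub>F t in G. x t \<in> W"
  proof (rule openin_zariski_eventually[of \<A> X W a])
    fix U C q assume q: "(U, C) \<in> \<A>" "q \<in> generated_algebra C" "a \<in> U" "q a \<noteq> 0"
    have "((\<lambda>t. q (x t)) \<longlongrightarrow> q a) G"
      by (rule generated_algebra_tendsto[OF q(2) lim[OF q(1,3)]])
    then have "\<forall>\<^sub>F t in G. q (x t) \<noteq> 0" using q(4) by (rule tendsto_imp_eventually_ne)
    with ch[OF q(1,3)] mem show "\<forall>\<^sub>F t in G. x t \<in> X \<inter> U \<and> q (x t) \<noteq> 0"
      by eventually_elim (use \<open>S \<subseteq> X\<close> in auto)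
  qed (use W in auto)
  with mem have "\<forall>\<^sub>F t in G. x t \<in> S \<inter> W" by eventually_elim auto
  then obtain t where "x t \<in> S \<inter> W"
    using \<open>G \<noteq> bot\<close> eventually_happens' by blast
  then show "\<exists>y. y \<in> S \<and> y \<in> W" by auto
qed fact

text \<open>One neighbourhood \<open>V\<close> has to serve all coordinates of the target chart at
  once. A chart may carry infinitely many of them, and with a common \<open>V\<close> polynomials in
  them pull back without further shrinking.\<close>

definition morph :: "'a atlas \<Rightarrow> 'a set \<Rightarrow> 'b atlas \<Rightarrow> 'b set \<Rightarrow> ('a \<Rightarrow> 'b) \<Rightarrow> bool" where
  "morph \<A> X \<B> Y \<phi> \<longleftrightarrow> \<phi> ` X \<subseteq> Y \<and>
     (\<forall>x\<in>X. \<forall>(U', C')\<in>\<B>. \<phi> x \<in> U' \<longrightarrow>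
        (\<exists>U C V. (U, C) \<in> \<A> \<and> openin (zariski \<A> X) V \<and> x \<in> V \<and> V \<subseteq> U \<and> \<phi> ` V \<subseteq> U' \<and>
           (\<forall>f\<in>C'. \<exists>p\<in>generated_algebra C. \<exists>q\<in>generated_algebra C.
              \<forall>y\<in>V. q y \<noteq> 0 \<and> f (\<phi> y) = p y / q y)))"

lemma morph_image: "morph \<A> X \<B> Y \<phi> \<Longrightarrow> \<phi> ` X \<subseteq> Y"
  unfolding morph_def by (rule conjunct1)

lemma morphD:
  assumes "morph \<A> X \<B> Y \<phi>" "x \<in> X" "(U', C') \<in> \<B>" "\<phi> x \<in> U'"
  shows "\<exists>U C V. (U, C) \<in> \<A> \<and> openin (zariski \<A> X) V \<and> x \<in> V \<and> V \<subseteq> U \<and> \<phi> ` V \<subseteq> U' \<and>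
           (\<forall>f\<in>C'. \<exists>p\<in>generated_algebra C. \<exists>q\<in>generated_algebra C.
              \<forall>y\<in>V. q y \<noteq> 0 \<and> f (\<phi> y) = p y / q y)"
proof -
  have "\<forall>(U', C')\<in>\<B>. \<phi> x \<in> U' \<longrightarrow>
        (\<exists>U C V. (U, C) \<in> \<A> \<and> openin (zariski \<A> X) V \<and> x \<in> V \<and> V \<subseteq> U \<and> \<phi> ` V \<subseteq> U' \<and>
           (\<forall>f\<in>C'. \<exists>p\<in>generated_algebra C. \<exists>q\<in>generated_algebra C.
              \<forall>y\<in>V. q y \<noteq> 0 \<and> f (\<phi> y) = p y / q y))"
    using assms(1,2) unfolding morph_def by (elim conjE) (rule bspec)
  from bspec[OF this assms(3)] assms(4) show ?thesis by simp
qed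

text \<open>Sums and products of fractions are brought to a common denominator, which is again
  nonvanishing on \<open>V\<close>.\<close>

lemma generated_algebra_pullback:
  assumes "g \<in> generated_algebra C'"
    and "\<forall>f\<in>C'. \<exists>p\<in>generated_algebra C. \<exists>q\<in>generated_algebra C.
              \<forall>y\<in>V. q y \<noteq> 0 \<and> f (\<phi> y) = p y / q y"
  shows "\<exists>p\<in>generated_algebra C. \<exists>q\<in>generated_algebra C. \<forall>y\<in>V. q y \<noteq> 0 \<and> g (\<phi> y) = p y / q y"
  using assms(1)
proof induction
  case (const c)
  show ?case by (intro bexI[of _ "\<lambda>_. c"] bexI[of _ "\<lambda>_. 1"]) (auto intro: generated_algebra.const)
next
  case (coord f)
  with assms(2) show ?case by (rule bspec)
next
  case (add f g)
  from add.IH obtain p q p' q' where h: "p \<in> generated_algebra C" "q \<in> generated_algebra C"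
    "p' \<in> generated_algebra C" "q' \<in> generated_algebra C"
    "\<forall>y\<in>V. q y \<noteq> 0 \<and> f (\<phi> y) = p y / q y" "\<forall>y\<in>V. q' y \<noteq> 0 \<and> g (\<phi> y) = p' y / q' y"
    by (elim bexE) (rule that)
  show ?case
    by (intro bexI[of _ "\<lambda>x. p x * q' x + p' x * q x"] bexI[of _ "\<lambda>x. q x * q' x"])
       (use h in \<open>auto intro!: generated_algebra.add generated_algebra.mult simp: field_simps\<close>)
next
  case (mult f g)
  from mult.IH obtain p q p' q' where h: "p \<in> generated_algebra C" "q \<in> generated_algebra C"
    "p' \<in> generated_algebra C" "q' \<in> generated_algebra C"
    "\<forall>y\<in>V. q y \<noteq> 0 \<and> f (\<phi> y) = p y / q y" "\<forall>y\<in>V. q' y \<noteq> 0 \<and> g (\<phi> y) = p' y / q' y"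
    by (elim bexE) (rule that)
  show ?case
    by (intro bexI[of _ "\<lambda>x. p x * p' x"] bexI[of _ "\<lambda>x. q x * q' x"])
       (use h in \<open>auto intro!: generated_algebra.mult\<close>)
qed

text \<open>The pullback of g is a fraction p / q near x, so near x the preimage of the set g
  \<noteq> 0 is the basic set p \<noteq> 0.\<close>

lemma morph_open_preimage:
  assumes m: "morph \<A> X \<B> Y \<phi>" and covX: "topspace (zariski \<A> X) = X" and "openin (zariski \<B> Y) W"
  shows "openin (zariski \<A> X) {x \<in> X. \<phi> x \<in> W}"
proof -
  have \<phi>: "\<phi> x \<in> Y" if "x \<in> X" for x using morph_image[OF m] that by auto
  have "generate_topology_on {{x \<in> Y \<inter> U. q x \<noteq> 0} | U C q. (U, C) \<in> \<B> \<and> q \<in> generated_algebra C} W"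
    using assms(3) by (simp add: zariski_def openin_topology_generated_by_iff)
  then show ?thesis
  proof induction
    case (Int A B)
    have "{x \<in> X. \<phi> x \<in> A \<inter> B} = {x \<in> X. \<phi> x \<in> A} \<inter> {x \<in> X. \<phi> x \<in> B}" by auto
    then show ?case using openin_Int[OF Int.IH] by simp
  next
    case (UN K)
    have "{x \<in> X. \<phi> x \<in> \<Union>K} = (\<Union>k\<in>K. {x \<in> X. \<phi> x \<in> k})" by auto
    then show ?case using openin_Union[of "(\<lambda>k. {x \<in> X. \<phi> x \<in> k}) ` K" "zariski \<A> X"] UN.IH by auto
  next
    case (Basis S)
    then obtain U' C' g where S: "S = {x \<in> Y \<inter> U'. g x \<noteq> 0}" "(U', C') \<in> \<B>" "g \<in> generated_algebra C'"
      by (elim CollectE exE conjE) (rule that)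
    show ?case
    proof (rule openin_zariskiI)
      fix x assume x: "x \<in> {x \<in> X. \<phi> x \<in> S}"
      then have "x \<in> X" "\<phi> x \<in> U'" using S by auto
      from morphD[OF m this(1) S(2) this(2)] obtain U C V where V: "(U, C) \<in> \<A>" "openin (zariski \<A> X) V" "x \<in> V" "V \<subseteq> U"
        "\<phi> ` V \<subseteq> U'" "\<forall>f\<in>C'. \<exists>p\<in>generated_algebra C. \<exists>q\<in>generated_algebra C.
              \<forall>y\<in>V. q y \<noteq> 0 \<and> f (\<phi> y) = p y / q y"
        by (elim exE conjE) (rule that)
      obtain p q where pq: "p \<in> generated_algebra C" "\<forall>y\<in>V. q y \<noteq> 0 \<and> g (\<phi> y) = p y / q y"
        using generated_algebra_pullback[OF S(3) V(6)] by (elim bexE) (rule that)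
      have VX: "V \<subseteq> X" using openin_subset[OF V(2)] covX by simp
      let ?V = "V \<inter> {x \<in> X \<inter> U. p x \<noteq> 0}"
      have "openin (zariski \<A> X) ?V"
        by (intro openin_Int V(2) openin_zariski_basic[OF V(1) pq(1)])
      moreover have "x \<in> ?V" using x pq V(3,4) S VX by auto
      moreover have "?V \<subseteq> {x \<in> X. \<phi> x \<in> S}"
        using S pq V(4,5) \<phi> VX by auto
      ultimately show "\<exists>V. openin (zariski \<A> X) V \<and> x \<in> V \<and> V \<subseteq> {x \<in> X. \<phi> x \<in> S}"
        by (intro exI[of _ ?V] conjI)
    qed
  qed simp
qed

lemma regular_onD:
  assumes "regular_on \<A> X W f" "x \<in> W"
  shows "\<exists>V U C p q. openin (zariski \<A> X) V \<and> x \<in> V \<and> V \<subseteq> W \<and> (U, C) \<in> \<A> \<and> V \<subseteq> U \<and>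
           p \<in> generated_algebra C \<and> q \<in> generated_algebra C \<and> (\<forall>y\<in>V. q y \<noteq> 0 \<and> f y = p y / q y)"
  using assms unfolding regular_on_def by (rule bspec)

lemma morph_regular:
  assumes m: "morph \<A> X \<B> Y \<phi>" and covX: "topspace (zariski \<A> X) = X"
    and covY: "topspace (zariski \<B> Y) = Y" and f: "regular_on \<B> Y W f" and "W \<subseteq> Y"
  shows "regular_on \<A> X {x \<in> X. \<phi> x \<in> W} (f \<circ> \<phi>)"
  unfolding regular_on_def
proof
  fix x assume x: "x \<in> {x \<in> X. \<phi> x \<in> W}"
  then have "\<phi> x \<in> W" by simp
  from regular_onD[OF f this] obtain V' U' C' p q where h: "openin (zariski \<B> Y) V'" "\<phi> x \<in> V'" "V' \<subseteq> W" "(U', C') \<in> \<B>"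
    "V' \<subseteq> U'" "p \<in> generated_algebra C'" "q \<in> generated_algebra C'"
    "\<forall>y\<in>V'. q y \<noteq> 0 \<and> f y = p y / q y"
    by (elim exE conjE) (rule that)
  have "x \<in> X" "\<phi> x \<in> U'" using x h by auto
  from morphD[OF m this(1) h(4) this(2)] obtain U C V where V: "(U, C) \<in> \<A>" "openin (zariski \<A> X) V" "x \<in> V" "V \<subseteq> U"
    "\<phi> ` V \<subseteq> U'" "\<forall>f\<in>C'. \<exists>p\<in>generated_algebra C. \<exists>q\<in>generated_algebra C.
          \<forall>y\<in>V. q y \<noteq> 0 \<and> f (\<phi> y) = p y / q y"
    by (elim exE conjE) (rule that)
  have VX: "V \<subseteq> X" using openin_subset[OF V(2)] covX by simp
  obtain p1 q1 where 1: "p1 \<in> generated_algebra C" "q1 \<in> generated_algebra C"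
    "\<forall>y\<in>V. q1 y \<noteq> 0 \<and> p (\<phi> y) = p1 y / q1 y"
    using generated_algebra_pullback[OF h(6) V(6)] by (elim bexE) (rule that)
  obtain p2 q2 where 2: "p2 \<in> generated_algebra C" "q2 \<in> generated_algebra C"
    "\<forall>y\<in>V. q2 y \<noteq> 0 \<and> q (\<phi> y) = p2 y / q2 y"
    using generated_algebra_pullback[OF h(7) V(6)] by (elim bexE) (rule that)
  let ?V = "V \<inter> {x \<in> X. \<phi> x \<in> V'}"
  show "\<exists>V U C p q. openin (zariski \<A> X) V \<and> x \<in> V \<and> V \<subseteq> {x \<in> X. \<phi> x \<in> W} \<and> (U, C) \<in> \<A> \<and> V \<subseteq> U \<and>
          p \<in> generated_algebra C \<and> q \<in> generated_algebra C \<and> (\<forall>y\<in>V. q y \<noteq> 0 \<and> (f \<circ> \<phi>) y = p y / q y)"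
  proof (intro exI conjI)
    show "openin (zariski \<A> X) ?V"
      using V(2) morph_open_preimage[OF m covX h(1)] by (rule openin_Int)
    show "(U, C) \<in> \<A>" by fact
    show "(\<lambda>y. p1 y * q2 y) \<in> generated_algebra C" "(\<lambda>y. q1 y * p2 y) \<in> generated_algebra C"
      using 1 2 by (auto intro: generated_algebra.mult)
    show "\<forall>y\<in>?V. q1 y * p2 y \<noteq> 0 \<and> (f \<circ> \<phi>) y = p1 y * q2 y / (q1 y * p2 y)"
    proof
      fix y assume y: "y \<in> ?V"
      then have a: "q1 y \<noteq> 0" "q2 y \<noteq> 0" "p (\<phi> y) = p1 y / q1 y" "q (\<phi> y) = p2 y / q2 y"
        "q (\<phi> y) \<noteq> 0" "f (\<phi> y) = p (\<phi> y) / q (\<phi> y)"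
        using 1(3) 2(3) h(8) by auto
      \<comment> \<open>The denominator at the image point equals \<open>p2 y / q2 y\<close> and is
        nonzero.\<close>
      then have "p2 y \<noteq> 0" by auto
      with a show "q1 y * p2 y \<noteq> 0 \<and> (f \<circ> \<phi>) y = p1 y * q2 y / (q1 y * p2 y)" by simp
    qed
  qed (use x V(1,3,4) h(2,3) VX in auto)
qed

lemma morph_inverse_iso:
  assumes m: "morph \<A> X \<B> Y \<phi>" and m': "morph \<B> Y \<A> X \<psi>"
    and inv: "\<And>x. x \<in> X \<Longrightarrow> \<psi> (\<phi> x) = x" "\<And>y. y \<in> Y \<Longrightarrow> \<phi> (\<psi> y) = y"
    and covX: "topspace (zariski \<A> X) = X" and covY: "topspace (zariski \<B> Y) = Y"
  shows "variety_iso \<A> X \<B> Y \<phi>"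
proof -
  have \<phi>: "\<phi> x \<in> Y" if "x \<in> X" for x using morph_image[OF m] that by auto
  have \<psi>: "\<psi> y \<in> X" if "y \<in> Y" for y using morph_image[OF m'] that by auto
  have "homeomorphic_maps (zariski \<A> X) (zariski \<B> Y) \<phi> \<psi>"
    unfolding homeomorphic_maps_def continuous_map_def covX covY
    using \<phi> \<psi> inv morph_open_preimage[OF m covX] morph_open_preimage[OF m' covY] by auto
  moreover have "regular_on \<B> Y W f \<longleftrightarrow> regular_on \<A> X {x \<in> X. \<phi> x \<in> W} (f \<circ> \<phi>)"
    if W: "openin (zariski \<B> Y) W" for W f
  proof
    have WY: "W \<subseteq> Y" using openin_subset[OF W] covY by simp
    assume "regular_on \<B> Y W f"
    then show "regular_on \<A> X {x \<in> X. \<phi> x \<in> W} (f \<circ> \<phi>)" by (rule morph_regular[OF m covX covY _ WY])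
  next
    have WY: "W \<subseteq> Y" using openin_subset[OF W] covY by simp
    assume "regular_on \<A> X {x \<in> X. \<phi> x \<in> W} (f \<circ> \<phi>)"
    \<comment> \<open>Pulling back along the inverse yields f only up to the composite of
      \<open>\<phi>\<close> and \<open>\<psi>\<close>, which is the identity on \<open>Y\<close> but
      not elsewhere; the local fractions are therefore compared on \<open>W\<close> only.\<close>
    from morph_regular[OF m' covY covX this]
    have "regular_on \<B> Y {y \<in> Y. \<psi> y \<in> {x \<in> X. \<phi> x \<in> W}} (f \<circ> \<phi> \<circ> \<psi>)" by blast
    moreover have "{y \<in> Y. \<psi> y \<in> {x \<in> X. \<phi> x \<in> W}} = W" using WY \<psi> inv by auto
    ultimately have r: "regular_on \<B> Y W (f \<circ> \<phi> \<circ> \<psi>)" by simp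
    show "regular_on \<B> Y W f"
      unfolding regular_on_def
    proof
      fix y assume "y \<in> W"
      from regular_onD[OF r this] obtain V U C p q where *: "openin (zariski \<B> Y) V" "y \<in> V" "V \<subseteq> W" "(U, C) \<in> \<B>" "V \<subseteq> U"
        "p \<in> generated_algebra C" "q \<in> generated_algebra C" "\<forall>y\<in>V. q y \<noteq> 0 \<and> (f \<circ> \<phi> \<circ> \<psi>) y = p y / q y"
        by (elim exE conjE) (rule that)
      moreover have "\<forall>y\<in>V. q y \<noteq> 0 \<and> f y = p y / q y" using *(3,8) WY inv by (auto simp: subset_iff)
      ultimately show "\<exists>V U C p q. openin (zariski \<B> Y) V \<and> y \<in> V \<and> V \<subseteq> W \<and> (U, C) \<in> \<B> \<and> V \<subseteq> U \<and>
          p \<in> generated_algebra C \<and> q \<in> generated_algebra C \<and> (\<forall>y\<in>V. q y \<noteq> 0 \<and> f y = p y / q y)"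
        by (intro exI[of _ V] exI[of _ U] exI[of _ C] exI[of _ p] exI[of _ q] conjI)
    qed
  qed
  ultimately show ?thesis
    unfolding variety_iso_def using homeomorphic_map_maps by blast
qed

section \<open>Dimensions of finitely spanned spaces\<close>

text \<open>\<open>cvs.dim\<close> is a cardinality and takes the value 0 on infinite-dimensional
  spaces. The finite spanning set \<open>W\<close> rules this out, here and in the next
  lemmas.\<close>

lemma subspace_finite_basis:
  assumes "cvs.subspace A" "A \<subseteq> cvs.span W" "finite W"
  obtains B where "B \<subseteq> A" "finite B" "cvs.independent B" "cvs.span B = A" "card B = cvs.dim A"
proof -
  obtain B where B: "B \<subseteq> A" "cvs.independent B" "A \<subseteq> cvs.span B" "card B = cvs.dim A"
    by (rule cvs.basis_exists)
  have "finite B"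
    using cvs.independent_span_bound[OF assms(3) B(2) order_trans[OF B(1) assms(2)]] by simp
  then show ?thesis
    using that[OF B(1) _ B(2) cvs.span_subspace[OF B(1,3) assms(1)] B(4)] by simp
qed

lemma independent_card_le_dim_fin:
  assumes "cvs.independent B" "B \<subseteq> A" "A \<subseteq> cvs.span W" "finite W"
  shows "finite B \<and> card B \<le> cvs.dim A"
proof -
  obtain C where C: "C \<subseteq> A" "cvs.independent C" "A \<subseteq> cvs.span C" "card C = cvs.dim A"
    by (rule cvs.basis_exists)
  have "finite C"
    using cvs.independent_span_bound[OF assms(4) C(2) order_trans[OF C(1) assms(3)]] by simp
  then show ?thesis
    using cvs.independent_span_bound[OF _ assms(1) order_trans[OF assms(2) C(3)]] C(4) by simp
qed

lemma dim_mono_fin: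
  assumes "A \<subseteq> V" "V \<subseteq> cvs.span W" "finite W"
  shows "cvs.dim A \<le> cvs.dim V"
proof -
  obtain B where B: "B \<subseteq> A" "cvs.independent B" "A \<subseteq> cvs.span B" "card B = cvs.dim A"
    by (rule cvs.basis_exists)
  show ?thesis
    using independent_card_le_dim_fin[OF B(2) order_trans[OF B(1) assms(1)] assms(2,3)] B(4) by simp
qed

lemma subspace_eq_of_dim:
  assumes "cvs.subspace A" "A \<subseteq> V" "V \<subseteq> cvs.span W" "finite W" "cvs.dim V \<le> cvs.dim A"
  shows "A = V"
proof (rule ccontr)
  assume "A \<noteq> V"
  then obtain v where v: "v \<in> V" "v \<notin> A" using assms by blast
  obtain B where B: "B \<subseteq> A" "finite B" "cvs.independent B" "cvs.span B = A" "card B = cvs.dim A"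
    by (rule subspace_finite_basis[OF assms(1) order_trans[OF assms(2,3)] assms(4)])
  have "cvs.independent (insert v B)" using B v by (simp add: cvs.independent_insert)
  moreover have "insert v B \<subseteq> V" using B assms v by auto
  ultimately have "card (insert v B) \<le> cvs.dim V"
    using independent_card_le_dim_fin[OF _ _ assms(3,4)] by blast
  moreover have "v \<notin> B" using B v by auto
  ultimately show False using B assms by simp
qed

lemma dim_le_add_card:
  assumes "cvs.subspace A" "A \<subseteq> cvs.span W" "finite W" "V \<subseteq> cvs.span (A \<union> T)" "finite T"
  shows "cvs.dim V \<le> cvs.dim A + card T"
proof -
  obtain B where B: "B \<subseteq> A" "finite B" "cvs.independent B" "cvs.span B = A" "card B = cvs.dim A"
    by (rule subspace_finite_basis[OF assms(1-3)])
  have "A \<union> T \<subseteq> cvs.span (B \<union> T)"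
    using B(4) cvs.span_mono[of B "B \<union> T"] cvs.span_superset[of "B \<union> T"] by blast
  then have "V \<subseteq> cvs.span (B \<union> T)"
    using assms(4) cvs.span_minimal[OF _ cvs.subspace_span] by blast
  then have "cvs.dim V \<le> card (B \<union> T)" using cvs.dim_le_card B assms by blast
  also have "\<dots> \<le> card B + card T" by (rule card_Un_le)
  finally show ?thesis using B by simp
qed

lemma independent_imageI:
  assumes "finite I" and "\<And>c. (\<Sum>i\<in>I. scale (c i) (w i)) = 0 \<Longrightarrow> \<forall>i\<in>I. c i = 0"
  shows "inj_on w I \<and> cvs.independent (w ` I)"
proof
  show inj: "inj_on w I"
  proof (rule inj_onI, rule ccontr)
    fix i j assume ij: "i \<in> I" "j \<in> I" "w i = w j" "i \<noteq> j"
    \<comment> \<open>Two equal members would satisfy the relation with coefficients 1 and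
      -1.\<close>
    let ?c = "\<lambda>k. if k = i then 1 else if k = j then -1 else 0"
    have "(\<Sum>k\<in>I. scale (?c k) (w k)) = (\<Sum>k\<in>{i,j}. scale (?c k) (w k))"
      using ij assms(1) by (intro sum.mono_neutral_right) auto
    also have "\<dots> = 0" using ij by simp
    finally show False using assms(2)[of ?c] ij by auto
  qed
  show "cvs.independent (w ` I)"
  proof (rule cvs.independent_if_scalars_zero)
    fix f x assume f: "(\<Sum>x\<in>w ` I. scale (f x) x) = 0" and x: "x \<in> w ` I"
    have "(\<Sum>i\<in>I. scale (f (w i)) (w i)) = 0" using f inj by (simp add: sum.reindex)
    from assms(2)[OF this] x show "f x = 0" by auto
  qed (use assms in auto)
qed

lemma independent_family_zero:
  assumes "inj_on w I" "cvs.independent (w ` I)" "finite I" "(\<Sum>i\<in>I. scale (c i) (w i)) = 0" "i \<in> I"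
  shows "c i = 0"
proof -
  have "(\<Sum>x\<in>w ` I. scale (c (the_inv_into I w x)) x) = 0"
    using assms by (simp add: sum.reindex the_inv_into_f_f)
  from cvs.independentD[OF assms(2) _ subset_refl this] assms(1,3,5)
  show ?thesis by (metis finite_imageI imageI the_inv_into_f_f)
qed

text \<open>Each linear functional lowers the dimension by at most one: if \<open>e j\<close> is
  nonzero at v, subtracting a multiple of v projects the kernel found so far into the kernel of
  \<open>e j\<close>.\<close>

lemma dim_kernel_ge:
  assumes "finite I" and V: "cvs.subspace V" "V \<subseteq> cvs.span W" "finite W"
    and add: "\<And>i x y. e i (x + y) = e i x + (e i y :: complex)" and scl: "\<And>i c x. e i (scale c x) = c * e i x"
  shows "cvs.dim V \<le> cvs.dim {x \<in> V. \<forall>i\<in>I. e i x = 0} + card I"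
  using assms(1)
proof induction
  case (insert j I)
  let ?K = "{x \<in> V. \<forall>i\<in>I. e i x = 0}" and ?L = "{x \<in> V. \<forall>i\<in>insert j I. e i x = 0}"
  have zero: "e i 0 = 0" for i using scl[of i 0 0] by simp
  have subL: "cvs.subspace ?L"
    using V(1) by (auto simp: cvs.subspace_def add scl zero)
  have subK: "cvs.subspace ?K"
    using V(1) by (auto simp: cvs.subspace_def add scl zero)
  have "\<exists>v. ?K \<subseteq> cvs.span (?L \<union> {v})"
  proof (cases "\<exists>v\<in>?K. e j v \<noteq> 0")
    case True
    then obtain v where v: "v \<in> ?K" "e j v \<noteq> 0" by blast
    have "x \<in> cvs.span (?L \<union> {v})" if "x \<in> ?K" for x
    proof -
      let ?y = "x + scale (- e j x / e j v) v"
      have "?y \<in> ?K" by (intro cvs.subspace_add[OF subK] cvs.subspace_scale[OF subK] v that)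
      moreover have "e j ?y = 0" unfolding add scl using v by simp
      ultimately have "?y \<in> cvs.span (?L \<union> {v})" by (auto intro: cvs.span_base)
      moreover have "v \<in> cvs.span (?L \<union> {v})" by (auto intro: cvs.span_base)
      ultimately have "?y - scale (- e j x / e j v) v \<in> cvs.span (?L \<union> {v})"
        by (intro cvs.span_diff cvs.span_scale)
      then show ?thesis by simp
    qed
    then have "?K \<subseteq> cvs.span (?L \<union> {v})" by (intro subsetI)
    then show ?thesis by (rule exI)
  next
    case False
    then have "?K \<subseteq> ?L" by auto
    also have "?L \<subseteq> cvs.span (?L \<union> {0})" by (rule subset_trans[OF Un_upper1 cvs.span_superset])
    finally show ?thesis by (rule exI)
  qed
  then obtain v where "?K \<subseteq> cvs.span (?L \<union> {v})" by (elim exE)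
  moreover have "?L \<subseteq> cvs.span W" using V(2) by auto
  ultimately have "cvs.dim ?K \<le> cvs.dim ?L + card {v}"
    by (intro dim_le_add_card[OF subL _ V(3)]) simp_all
  then show ?case using insert by simp
qed simp

section \<open>Algebraic families of bases\<close>

lemma det_in_fun_algebra:
  assumes R: "fun_algebra R" and "\<And>i j. i < n \<Longrightarrow> j < n \<Longrightarrow> a i j \<in> R"
  shows "(\<lambda>y. Determinant.det (Matrix.mat n n (\<lambda>(i, j). a i j y))) \<in> R"
proof -
  have "(\<lambda>y. Determinant.det (Matrix.mat n n (\<lambda>(i, j). a i j y))) =
        (\<lambda>y. \<Sum>p\<in>{p. p permutes {0..<n}}. signof p * (\<Prod>i = 0..<n. a i (p i) y))"
  proof
    fix y
    have "(\<Prod>i = 0..<n. Matrix.mat n n (\<lambda>(i, j). a i j y) $$ (i, p i)) = (\<Prod>i = 0..<n. a i (p i) y)"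
      if "p permutes {0..<n}" for p
      using permutes_in_image[OF that] by (intro prod.cong) auto
    then show "Determinant.det (Matrix.mat n n (\<lambda>(i, j). a i j y)) =
        (\<Sum>p\<in>{p. p permutes {0..<n}}. signof p * (\<Prod>i = 0..<n. a i (p i) y))"
      by (simp add: Determinant.det_def)
  qed
  also have "\<dots> \<in> R"
  proof (rule fun_algebra_sum[OF R])
    fix p assume "p \<in> {p. p permutes {0..<n}}"
    then have p: "p i < n" if "i < n" for i using permutes_in_image[of p "{0..<n}" i] that by auto
    have "(\<lambda>y. \<Prod>i = 0..<n. a i (p i) y) \<in> R"
      by (rule fun_algebra_prod[OF R]) (use assms(2) p in auto)
    then show "(\<lambda>y. signof p * (\<Prod>i = 0..<n. a i (p i) y)) \<in> R"
      by (rule fun_algebra_cmult[OF R])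
  qed
  finally show ?thesis .
qed

lemma adj_mat_in_fun_algebra:
  assumes R: "fun_algebra R" and a: "\<And>i j. i < n \<Longrightarrow> j < n \<Longrightarrow> a i j \<in> R" and ij: "i < n" "j < n"
  shows "(\<lambda>y. adj_mat (Matrix.mat n n (\<lambda>(i, j). a i j y)) $$ (i, j)) \<in> R"
proof -
  \<comment> \<open>The index shift deletes row j and column i; the two are exchanged because the
    adjugate is the transposed cofactor matrix.\<close>
  define b where "b = (\<lambda>r c. a (if r < j then r else Suc r) (if c < i then c else Suc c))"
  have "mat_delete (Matrix.mat n n (\<lambda>(i, j). a i j y)) j i = Matrix.mat (n - 1) (n - 1) (\<lambda>(r, c). b r c y)" for y
    unfolding mat_delete_def by (intro eq_matI) (auto simp: b_def)
  then have "(\<lambda>y. adj_mat (Matrix.mat n n (\<lambda>(i, j). a i j y)) $$ (i, j)) =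
      (\<lambda>y. (-1) ^ (j + i) * Determinant.det (Matrix.mat (n - 1) (n - 1) (\<lambda>(r, c). b r c y)))"
    using ij by (simp add: adj_mat_def cofactor_def)
  also have "\<dots> \<in> R"
  proof (rule fun_algebra_cmult[OF R], rule det_in_fun_algebra[OF R])
    show "b r c \<in> R" if "r < n - 1" "c < n - 1" for r c
      unfolding b_def using that by (intro a) auto
  qed
  finally show ?thesis .
qed

text \<open>Cramer's rule.\<close>

lemma family_basis:
  fixes w :: "nat \<Rightarrow> 'y \<Rightarrow> ('i \<Rightarrow>\<^sub>0 complex)"
  assumes R: "fun_algebra R" and M: "finite M" "card M = n"
    and w: "\<And>c m. c < n \<Longrightarrow> m \<in> M \<Longrightarrow> (\<lambda>y. Poly_Mapping.lookup (w c y) m) \<in> R"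
    and keys: "\<And>c y. c < n \<Longrightarrow> Poly_Mapping.keys (w c y) \<subseteq> M"
    and span: "\<And>m. m \<in> M \<Longrightarrow> Poly_Mapping.single m 1 \<in> cvs.span ((\<lambda>c. w c y0) ` {..<n})"
  shows "\<exists>D\<in>R. D y0 \<noteq> 0 \<and> (\<forall>m\<in>M. \<exists>X. (\<forall>c<n. X c \<in> R) \<and>
           (\<forall>y. D y \<noteq> 0 \<longrightarrow> Poly_Mapping.single m 1 = (\<Sum>c<n. scale (X c y / D y) (w c y))))"
proof -
  obtain ms where ms: "bij_betw ms {0..<n} M" using M ex_bij_betw_nat_finite by blast
  define a where "a = (\<lambda>i j y. Poly_Mapping.lookup (w j y) (ms i))"
  define A where "A = (\<lambda>y. Matrix.mat n n (\<lambda>(i, j). a i j y))"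
  have msM: "ms i \<in> M" if "i < n" for i using bij_betwE[OF ms] that by simp
  have aR: "a i j \<in> R" if "i < n" "j < n" for i j unfolding a_def using w msM that by simp
  have A [simp]: "A y \<in> carrier_mat n n" for y by (simp add: A_def)
  have ms_eq: "ms i = ms j \<longleftrightarrow> i = j" if "i < n" "j < n" for i j
    using bij_betw_imp_inj_on[OF ms] that by (simp add: inj_on_eq_iff)
  define D where "D = (\<lambda>y. Determinant.det (A y))"
  have D: "D \<in> R" unfolding D_def A_def by (rule det_in_fun_algebra[OF R aR])
  \<comment> \<open>At \<open>y0\<close> the spanning hypothesis provides a right inverse of the
    coefficient matrix, so the determinant is nonzero there.\<close>
  have "\<forall>i\<in>{0..<n}. \<exists>c. Poly_Mapping.single (ms i) 1 = (\<Sum>j<n. scale (c j) (w j y0))"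
  proof
    fix i assume "i \<in> {0..<n}"
    then have "Poly_Mapping.single (ms i) 1 \<in> cvs.span ((\<lambda>c. w c y0) ` {..<n})" using span msM by simp
    then show "\<exists>c. Poly_Mapping.single (ms i) 1 = (\<Sum>j<n. scale (c j) (w j y0))"
    proof (induction rule: cvs.span_induct_alt)
      case base
      show ?case by (rule exI[of _ "\<lambda>_. 0"]) simp
    next
      case (step c x y)
      then obtain k d where k: "k < n" "x = w k y0" "y = (\<Sum>j<n. scale (d j) (w j y0))" by blast
      have "scale c x + y = (\<Sum>j<n. scale (if j = k then c else 0) (w j y0)) + y"
      proof -
        have "(\<Sum>j<n. scale (if j = k then c else 0) (w j y0)) = (\<Sum>j<n. if j = k then scale c (w j y0) else 0)"
          by (intro sum.cong) auto
        then show ?thesis using k by simp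
      qed
      also have "\<dots> = (\<Sum>j<n. scale ((if j = k then c else 0) + d j) (w j y0))"
        by (simp add: k cvs.scale_left_distrib sum.distrib)
      finally show ?case by (rule exI[of _ "\<lambda>j. (if j = k then c else 0) + d j"])
    qed
  qed
  from bchoice[OF this] obtain c
    where "\<forall>i\<in>{0..<n}. Poly_Mapping.single (ms i) 1 = (\<Sum>j<n. scale (c i j) (w j y0))"
    by (elim exE) (rule that)
  then have c: "Poly_Mapping.single (ms i) 1 = (\<Sum>j<n. scale (c i j) (w j y0))" if "i < n" for i
    using that by simp
  define B where "B = Matrix.mat n n (\<lambda>(j, i). c i j)"
  have "A y0 * B = 1\<^sub>m n"
  proof (intro eq_matI)
    fix r i assume ri: "r < dim_row (1\<^sub>m n)" "i < dim_col (1\<^sub>m n)"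
    then have "(A y0 * B) $$ (r, i) = (\<Sum>j = 0..<n. a r j y0 * c i j)"
      by (simp add: A_def B_def scalar_prod_def)
    also have "\<dots> = Poly_Mapping.lookup (\<Sum>j<n. scale (c i j) (w j y0)) (ms r)"
      by (simp add: lookup_sum a_def mult.commute atLeast0LessThan)
    also have "\<dots> = (if r = i then 1 else 0)"
      using ri ms_eq[of i r] by (subst c[symmetric]) (simp_all add: lookup_single when_def)
    finally show "(A y0 * B) $$ (r, i) = 1\<^sub>m n $$ (r, i)" using ri by simp
  qed (simp_all add: A_def B_def)
  then have "Determinant.det (A y0) * Determinant.det B = 1"
    using det_mult[of "A y0" n B] by (simp add: B_def)
  then have D0: "D y0 \<noteq> 0" by (auto simp: D_def)
  have "\<exists>X. (\<forall>c<n. X c \<in> R) \<and>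
           (\<forall>y. D y \<noteq> 0 \<longrightarrow> Poly_Mapping.single m 1 = (\<Sum>c<n. scale (X c y / D y) (w c y)))" if "m \<in> M" for m
  proof -
    have "m \<in> ms ` {0..<n}" using ms that by (simp add: bij_betw_def)
    then obtain i where i: "i < n" "m = ms i" by auto
    define X where "X = (\<lambda>j y. adj_mat (A y) $$ (j, i))"
    have "X j \<in> R" if "j < n" for j
      unfolding X_def A_def using adj_mat_in_fun_algebra[OF R aR that i(1)] by simp
    moreover have "Poly_Mapping.single m 1 = (\<Sum>j<n. scale (X j y / D y) (w j y))" if "D y \<noteq> 0" for y
    proof (rule poly_mapping_eqI)
      fix k
      show "Poly_Mapping.lookup (Poly_Mapping.single m 1) k =
            Poly_Mapping.lookup (\<Sum>j<n. scale (X j y / D y) (w j y)) k"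
      proof (cases "k \<in> M")
        case True
        then have "k \<in> ms ` {0..<n}" using ms by (simp add: bij_betw_def)
        then obtain r where r: "r < n" "k = ms r" by auto
        \<comment> \<open>Column i of the adjugate, divided by the determinant, solves the system
          whose right-hand side is the unit vector at \<open>ms i\<close>. Coefficients outside
          \<open>M\<close> vanish by \<open>keys\<close>.\<close>
        have "(A y * adj_mat (A y)) $$ (r, i) = (\<Sum>j = 0..<n. a r j y * X j y)"
          using adj_mat(1)[OF A[of y]] r i by (simp add: A_def X_def scalar_prod_def)
        moreover have "(A y * adj_mat (A y)) $$ (r, i) = (if r = i then D y else 0)"
          using adj_mat(2)[OF A[of y]] r i by (simp add: D_def)
        ultimately have "(\<Sum>j = 0..<n. a r j y * X j y) = (if r = i then D y else 0)" by simp
        moreover have *: "(\<Sum>j<n. X j y / D y * a r j y) = (\<Sum>j = 0..<n. a r j y * X j y) / D y"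
          unfolding sum_divide_distrib atLeast0LessThan by (intro sum.cong) auto
        ultimately have "(\<Sum>j<n. X j y / D y * a r j y) = (if r = i then 1 else 0)"
          by (simp add: * that)
        then show ?thesis using r i ms_eq[of i r] by (auto simp: lookup_sum a_def lookup_single when_def)
      next
        case False
        then have "Poly_Mapping.lookup (w j y) k = 0" if "j < n" for j
          using keys[OF that] by (meson in_keys_iff subsetD)
        then show ?thesis using False \<open>m \<in> M\<close> by (auto simp: lookup_sum lookup_single when_def)
      qed
    qed
    ultimately show ?thesis by (intro exI[of _ X]) simp
  qed
  then show ?thesis using D D0 by (intro bexI[of _ D]) simp_all
qed

section \<open>Polynomials, derivations and dual bases\<close>

abbreviation cf :: "('i \<Rightarrow>\<^sub>0 'b::zero) \<Rightarrow> 'i \<Rightarrow> 'b" where "cf \<equiv> Poly_Mapping.lookup"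

text \<open>Arithmetic on the type \<open>3\<close> is modulo 3. Sums and enumerations over this
  type come with the indices 1, 2, 3, and the last of them is the index 0 used in the
  definitions.\<close>

lemma three_eq_zero: "(3::3) = 0"
  by simp

lemma UNIV3: "(UNIV :: 3 set) = {0, 1, 2}"
  unfolding UNIV_3 three_eq_zero by blast

lemma index3_neq [simp]: "(0::3) \<noteq> 2" "(1::3) \<noteq> 0" "(1::3) \<noteq> 2" "(2::3) \<noteq> 0" "(2::3) \<noteq> 1"
  by (simp_all add: eq_commute)

lemma sum3: "(\<Sum>i\<in>UNIV. f i) = f (0::3) + f 1 + (f 2 :: 'a::comm_monoid_add)"
  unfolding sum_3 three_eq_zero by (simp add: ac_simps)

lemma prod3: "(\<Prod>i\<in>UNIV. f i) = f (0::3) * f 1 * (f 2 :: 'a::comm_monoid_mult)"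
  unfolding UNIV3 by (simp del: numeral_3_eq_3 add: ac_simps)

lemma all3: "(\<forall>i::3. P i) \<longleftrightarrow> P 0 \<and> P 1 \<and> P 2"
proof -
  have "(\<forall>i::3. P i) \<longleftrightarrow> (\<forall>i\<in>{0,1,2}. P i)" by (simp flip: UNIV3)
  then show ?thesis by simp
qed

lemma pm_expand: "p = (\<Sum>m\<in>Poly_Mapping.keys p. Poly_Mapping.single m (cf p m))"
proof (rule poly_mapping_eqI)
  fix k
  have "cf (\<Sum>m\<in>Poly_Mapping.keys p. Poly_Mapping.single m (cf p m)) k =
        (\<Sum>m\<in>Poly_Mapping.keys p. if m = k then cf p m else 0)"
    by (auto simp: lookup_sum lookup_single when_def intro!: sum.cong)
  then show "cf p k = cf (\<Sum>m\<in>Poly_Mapping.keys p. Poly_Mapping.single m (cf p m)) k"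
    by (simp add: in_keys_iff)
qed

lemma pm_induct [case_names zero single add]:
  fixes P :: "('i \<Rightarrow>\<^sub>0 'b::comm_monoid_add) \<Rightarrow> bool"
  assumes "P 0" "\<And>m c. P (Poly_Mapping.single m c)" "\<And>p q. P p \<Longrightarrow> P q \<Longrightarrow> P (p + q)"
  shows "P p"
proof -
  have "P (\<Sum>m\<in>M. Poly_Mapping.single m (f m))" if "finite M" for M f
    using that by induction (auto intro: assms)
  from this[OF finite_keys, of "cf p" p] show ?thesis by (simp flip: pm_expand)
qed

text \<open>Scalars as constant polynomials: scaling becomes multiplication in the ring, so that
  ring identities apply.\<close>

definition const3 :: "complex \<Rightarrow> poly3" where "const3 c = Poly_Mapping.single 0 c"

lemma scale_const3: "scale c p = const3 c * p"
  unfolding scale_def const3_def by (rule mult_map_scale_conv_mult)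

lemma const3_add: "const3 (a + b) = const3 a + const3 b"
  and const3_mult: "const3 (a * b) = const3 a * const3 b"
  and const3_minus: "const3 (- a) = - const3 a"
  and const3_diff: "const3 (a - b) = const3 a - const3 b"
  by (simp_all add: const3_def single_add mult_single single_uminus single_diff)

lemma const3_simps [simp]: "const3 0 = 0" "const3 1 = 1" "const3 (numeral n) = numeral n"
  by (simp_all add: const3_def)

lemma const3_mult_single [simp]: "const3 c * Poly_Mapping.single m d = Poly_Mapping.single m (c * d)"
  by (simp add: const3_def mult_single)

lemma const3_power: "const3 (a ^ n) = const3 a ^ n"
  by (induction n) (simp_all add: const3_mult)

lemma cf_const3: "cf (const3 c) m = (if m = 0 then c else 0)"
  by (simp add: const3_def lookup_single when_def)

lemma cf_const3_0 [simp]: "cf (const3 c) 0 = c"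
  by (simp add: cf_const3)

lemma const3_eq_iff [simp]: "const3 a = const3 b \<longleftrightarrow> a = b"
  by (auto dest: arg_cong[where f = "\<lambda>p. cf p 0"])

lemma const3_eq_0_iff [simp]: "const3 a = 0 \<longleftrightarrow> a = 0"
  using const3_eq_iff[of a 0] by (simp del: const3_eq_iff)

lemma const3_inverse: "a \<noteq> 0 \<Longrightarrow> const3 a * const3 (1 / a) = 1"
  by (simp flip: const3_mult)

lemma cf_const_mult [simp]: "cf (const3 c * p) m = c * cf p m"
  by (simp flip: scale_const3)

lemma scale_mult_left: "scale c (p * q) = scale c p * (q :: poly3)"
  and scale_mult_right: "scale c (p * q) = p * (scale c q :: poly3)"
  by (simp_all add: scale_const3 mult_ac)

lemma mdeg_add: "mdeg (m + n) = mdeg m + mdeg n"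
  by (simp add: mdeg_def lookup_add sum.distrib)

lemma mdeg_zero [simp]: "mdeg 0 = 0"
  by (simp add: mdeg_def)

lemma mdeg_single [simp]: "mdeg (Poly_Mapping.single i k) = k"
  by (simp add: mdeg_def lookup_single when_def)

definition mk3 :: "nat \<Rightarrow> nat \<Rightarrow> nat \<Rightarrow> mon3" where
  "mk3 a b c = Poly_Mapping.single 0 a + Poly_Mapping.single 1 b + Poly_Mapping.single 2 c"

lemma cf_mk3 [simp]: "cf (mk3 a b c) 0 = a" "cf (mk3 a b c) 1 = b" "cf (mk3 a b c) 2 = c"
  by (simp_all add: mk3_def lookup_add lookup_single when_def)

lemma mk3_eta: "mk3 (cf m 0) (cf m 1) (cf m 2) = m"
  using all3[of "\<lambda>i. cf (mk3 (cf m 0) (cf m 1) (cf m 2)) i = cf m i"] by (intro poly_mapping_eqI) simp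

lemma mdeg_mk3 [simp]: "mdeg (mk3 a b c) = a + b + c"
  by (simp add: mk3_def mdeg_add)

definition mons :: "nat \<Rightarrow> mon3 set" where "mons k = {m. mdeg m = k}"

lemma mons_eq: "mons k = (\<lambda>(a, b). mk3 a b (k - a - b)) ` (SIGMA a:{..k}. {..k - a})"
proof
  show "mons k \<subseteq> (\<lambda>(a, b). mk3 a b (k - a - b)) ` (SIGMA a:{..k}. {..k - a})"
  proof
    fix m assume "m \<in> mons k"
    then have *: "cf m 0 + cf m 1 + cf m 2 = k" by (simp add: mons_def mdeg_def sum3)
    then have "k - cf m 0 - cf m 1 = cf m 2" by linarith
    then have "m = (\<lambda>(a, b). mk3 a b (k - a - b)) (cf m 0, cf m 1)" using mk3_eta[of m] by simp
    moreover have "(cf m 0, cf m 1) \<in> (SIGMA a:{..k}. {..k - a})" using * by auto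
    ultimately show "m \<in> (\<lambda>(a, b). mk3 a b (k - a - b)) ` (SIGMA a:{..k}. {..k - a})" by (rule image_eqI)
  qed
qed (auto simp: mons_def)

lemma finite_mons [simp]: "finite (mons k)"
  by (simp add: mons_eq)

lemma card_mons: "card (mons k) = (\<Sum>a\<le>k. Suc (k - a))"
proof -
  have "inj_on (\<lambda>(a, b). mk3 a b (k - a - b)) (SIGMA a:{..k}. {..k - a})"
  proof (rule inj_onI, clarify)
    fix a b a' b' assume e: "mk3 a b (k - a - b) = mk3 a' b' (k - a' - b')"
    show "a = a' \<and> b = b'" using arg_cong[OF e, of "\<lambda>m. cf m 0"] arg_cong[OF e, of "\<lambda>m. cf m 1"] by simp
  qed
  then show ?thesis by (simp add: mons_eq card_image)
qed

lemma forms_iff: "p \<in> forms k \<longleftrightarrow> Poly_Mapping.keys p \<subseteq> mons k"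
  by (auto simp: forms_def mons_def)

lemma forms_cf: "p \<in> forms k \<longleftrightarrow> (\<forall>m. cf p m \<noteq> 0 \<longrightarrow> mdeg m = k)"
  by (auto simp: forms_def in_keys_iff)

lemma subspace_forms: "cvs.subspace (forms k)"
  unfolding cvs.subspace_def
proof (intro conjI ballI allI)
  fix x y c assume "x \<in> forms k" "y \<in> forms k"
  then show "x + y \<in> forms k" "scale c x \<in> forms k"
    unfolding forms_cf lookup_add by (metis add_0, simp)
qed (simp add: forms_cf)

lemma single_in_forms: "mdeg m = k \<Longrightarrow> Poly_Mapping.single m c \<in> forms k"
  by (simp add: forms_def)

lemma const3_forms [simp]: "const3 c \<in> forms 0" "1 \<in> forms 0"
  using single_in_forms[of 0 0 c] single_in_forms[of 0 0 1] by (simp_all add: const3_def)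

lemma forms_0: "forms 0 = range const3"
proof
  show "forms 0 \<subseteq> range const3"
  proof
    fix p assume p: "p \<in> forms 0"
    have "p = const3 (cf p 0)"
    proof (rule poly_mapping_eqI)
      fix m
      show "cf p m = cf (const3 (cf p 0)) m"
      proof (cases "m = 0")
        case False
        have "m = 0" if "mdeg m = 0"
          using that mk3_eta[of m] by (simp add: mdeg_def sum3 mk3_def)
        then have "cf p m = 0" using p False by (auto simp: forms_cf)
        then show ?thesis using False by (simp add: cf_const3)
      qed simp
    qed
    then show "p \<in> range const3" by (rule range_eqI)
  qed
qed (auto simp: const3_forms)

lemma forms_span: "forms k = cvs.span (monom3 ` mons k)"
proof
  show "forms k \<subseteq> cvs.span (monom3 ` mons k)"
  proof
    fix p assume p: "p \<in> forms k"
    have "Poly_Mapping.single m (cf p m) \<in> cvs.span (monom3 ` mons k)" if "m \<in> Poly_Mapping.keys p" for m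
    proof -
      have "scale (cf p m) (monom3 m) \<in> cvs.span (monom3 ` mons k)"
        using p that by (intro cvs.span_scale cvs.span_base) (auto simp: forms_iff)
      moreover have "scale (cf p m) (monom3 m) = Poly_Mapping.single m (cf p m)"
        by (simp add: scale_const3 mult_single)
      ultimately show ?thesis by simp
    qed
    then have "(\<Sum>m\<in>Poly_Mapping.keys p. Poly_Mapping.single m (cf p m)) \<in> cvs.span (monom3 ` mons k)"
      by (rule cvs.span_sum)
    then show "p \<in> cvs.span (monom3 ` mons k)" by (simp flip: pm_expand)
  qed
  show "cvs.span (monom3 ` mons k) \<subseteq> forms k"
    by (rule cvs.span_minimal[OF _ subspace_forms]) (auto simp: mons_def intro: single_in_forms)
qed

lemma independent_mons: "inj_on monom3 M" "cvs.independent (monom3 ` M)" if "finite M"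
proof -
  have "inj_on monom3 M \<and> cvs.independent (monom3 ` M)"
  proof (rule independent_imageI[OF that])
    fix c assume "(\<Sum>m\<in>M. scale (c m) (monom3 m)) = 0"
    then have z: "cf (\<Sum>m\<in>M. scale (c m) (monom3 m)) k = 0" for k by simp
    show "\<forall>m\<in>M. c m = 0"
    proof
      fix k assume "k \<in> M"
      have "cf (\<Sum>m\<in>M. scale (c m) (monom3 m)) k = (\<Sum>m\<in>M. if m = k then c m else 0)"
        by (auto simp: lookup_sum lookup_single when_def intro!: sum.cong)
      with z[of k] \<open>k \<in> M\<close> that show "c k = 0" by simp
    qed
  qed
  then show "inj_on monom3 M" "cvs.independent (monom3 ` M)" by simp_all
qed

lemma dim_forms: "cvs.dim (forms k) = card (mons k)"
  using independent_mons[OF finite_mons, of k]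
  by (simp add: forms_span cvs.dim_eq_card_independent card_image)

lemma forms_fin: "forms k \<subseteq> cvs.span (monom3 ` mons k)" "finite (monom3 ` mons k)"
  by (simp_all add: forms_span)

lemma dim_forms_small: "cvs.dim (forms 0) = 1" "cvs.dim (forms 1) = 3" "cvs.dim (forms 2) = 6"
  by (simp_all add: dim_forms card_mons numeral_2_eq_2)

lemma forms_mult: assumes "p \<in> forms j" "q \<in> forms k" shows "p * q \<in> forms (j + k)"
  unfolding forms_def mem_Collect_eq
proof
  fix m assume "m \<in> Poly_Mapping.keys (p * q)"
  then obtain a b where "m = a + b" "a \<in> Poly_Mapping.keys p" "b \<in> Poly_Mapping.keys q"
    using keys_mult[of p q] by auto
  then show "mdeg m = j + k" using assms by (auto simp: forms_def mdeg_add)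
qed

lemma forms_power: "p \<in> forms j \<Longrightarrow> p ^ n \<in> forms (j * n)"
proof (induction n)
  case (Suc n)
  then show ?case using forms_mult[of p j "p ^ n" "j * n"] by simp
qed simp

lemma forms_const_mult: "p \<in> forms k \<Longrightarrow> const3 c * p \<in> forms k"
  using forms_mult[of "const3 c" 0 p k] by simp

lemma forms_add: "p \<in> forms k \<Longrightarrow> q \<in> forms k \<Longrightarrow> p + q \<in> forms k"
  and forms_diff: "p \<in> forms k \<Longrightarrow> q \<in> forms k \<Longrightarrow> p - q \<in> forms k"
  and forms_scale: "p \<in> forms k \<Longrightarrow> scale c p \<in> forms k"
  and forms_zero [simp]: "0 \<in> forms k"
  using cvs.subspace_add[OF subspace_forms] cvs.subspace_diff[OF subspace_forms]
    cvs.subspace_scale[OF subspace_forms] cvs.subspace_0[OF subspace_forms] by simp_all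

subsection \<open>Evaluation\<close>

definition mon_eval :: "mon3 \<Rightarrow> (3 \<Rightarrow>\<^sub>0 complex) \<Rightarrow> complex" where
  "mon_eval m v = (\<Prod>i\<in>UNIV. cf v i ^ cf m i)"

lemma eval3_superset:
  assumes "finite M" "Poly_Mapping.keys p \<subseteq> M"
  shows "eval3 p v = (\<Sum>m\<in>M. cf p m * mon_eval m v)"
  unfolding eval3_def mon_eval_def[symmetric]
  using assms by (intro sum.mono_neutral_left) (auto simp: in_keys_iff)

lemma eval3_single [simp]: "eval3 (Poly_Mapping.single m c) v = c * mon_eval m v"
  using eval3_superset[of "{m}" "Poly_Mapping.single m c" v] by (simp add: keys_single)

lemma eval3_zero [simp]: "eval3 0 v = 0"
  by (simp add: eval3_def)

lemma eval3_add [simp]: "eval3 (p + q) v = eval3 p v + eval3 q v"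
proof -
  let ?M = "Poly_Mapping.keys p \<union> Poly_Mapping.keys q"
  have "eval3 (p + q) v = (\<Sum>m\<in>?M. cf (p + q) m * mon_eval m v)"
    using Poly_Mapping.keys_add[of p q] by (intro eval3_superset) auto
  also have "\<dots> = (\<Sum>m\<in>?M. cf p m * mon_eval m v) + (\<Sum>m\<in>?M. cf q m * mon_eval m v)"
    by (simp add: lookup_add algebra_simps sum.distrib)
  also have "\<dots> = eval3 p v + eval3 q v"
    using eval3_superset[of ?M p v] eval3_superset[of ?M q v] by simp
  finally show ?thesis .
qed

lemma mon_eval_add: "mon_eval (m + n) v = mon_eval m v * mon_eval n v"
  by (simp add: mon_eval_def lookup_add power_add prod.distrib)

lemma mon_eval_zero [simp]: "mon_eval 0 v = 1"
  by (simp add: mon_eval_def)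

lemma eval3_mult [simp]: "eval3 (p * q) v = eval3 p v * eval3 q v"
proof (induction p rule: pm_induct)
  case (single m c)
  show ?case
    by (induction q rule: pm_induct) (simp_all add: mult_single mon_eval_add distrib_left)
qed (simp_all add: distrib_right)

lemma eval3_one [simp]: "eval3 1 v = 1"
  using eval3_single[of 0 1 v] by simp

lemma eval3_power [simp]: "eval3 (p ^ n) v = eval3 p v ^ n"
  by (induction n) simp_all

lemma eval3_const3 [simp]: "eval3 (const3 c) v = c"
  by (simp add: const3_def)

lemma eval3_scale [simp]: "eval3 (scale c p) v = c * eval3 p v"
  by (simp add: scale_const3)

lemma eval3_minus [simp]: "eval3 (- p) v = - eval3 p v"
  using eval3_add[of p "- p" v] by (simp add: eq_neg_iff_add_eq_0 add.commute)

lemma eval3_diff [simp]: "eval3 (p - q) v = eval3 p v - eval3 q v"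
  using eval3_add[of p "- q" v] by simp

lemma eval3_sum [simp]: "eval3 (\<Sum>i\<in>I. f i) v = (\<Sum>i\<in>I. eval3 (f i) v)"
  by (induction I rule: infinite_finite_induct) simp_all

lemma mon_eval_scale: "mon_eval m (scale c v) = c ^ mdeg m * mon_eval m v"
  by (simp add: mon_eval_def mdeg_def power_mult_distrib prod.distrib power_sum)

lemma eval3_homogeneous:
  assumes "p \<in> forms k" shows "eval3 p (scale c v) = c ^ k * eval3 p v"
proof -
  have "eval3 p (scale c v) = (\<Sum>m\<in>Poly_Mapping.keys p. cf p m * mon_eval m (scale c v))"
    by (rule eval3_superset) auto
  also have "\<dots> = (\<Sum>m\<in>Poly_Mapping.keys p. c ^ k * (cf p m * mon_eval m v))"
    using assms by (intro sum.cong) (auto simp: mon_eval_scale forms_def)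
  also have "\<dots> = c ^ k * (\<Sum>m\<in>Poly_Mapping.keys p. cf p m * mon_eval m v)"
    by (simp add: sum_distrib_left)
  also have "(\<Sum>m\<in>Poly_Mapping.keys p. cf p m * mon_eval m v) = eval3 p v"
    by (rule eval3_superset[symmetric]) auto
  finally show ?thesis .
qed

subsection \<open>Derivations\<close>

lemma cf_partial_deriv:
  "cf (partial_deriv i F) m = (of_nat (cf m i) + 1) * cf F (m + Poly_Mapping.single i 1)"
proof -
  have eq: "cf (Poly_Mapping.single (n - Poly_Mapping.single i 1) (of_nat (cf n i) * cf F n)) m =
        (if n = m + Poly_Mapping.single i 1 then (of_nat (cf m i) + 1) * cf F (m + Poly_Mapping.single i 1) else 0)" for n
  proof (cases "n = m + Poly_Mapping.single i 1")
    case True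
    then show ?thesis by (simp add: lookup_add add.commute)
  next
    case False
    \<comment> \<open>Subtraction of exponents is truncated, so a second monomial may also be sent
      to m; its exponent at i is then 0, and so is its contribution.\<close>
    have "cf n i = 0" if "n - Poly_Mapping.single i 1 = m"
    proof (rule ccontr)
      assume "cf n i \<noteq> 0"
      then have "n = m + Poly_Mapping.single i 1"
        unfolding that[symmetric]
        by (intro poly_mapping_eqI) (auto simp: lookup_add lookup_minus lookup_single when_def)
      with False show False by simp
    qed
    then show ?thesis using False by (auto simp: lookup_single when_def)
  qed
  show ?thesis
    unfolding partial_deriv_def lookup_sum eq by (simp add: in_keys_iff)
qed

lemma partial_deriv_add: "partial_deriv i (F + G) = partial_deriv i F + partial_deriv i G"
  by (rule poly_mapping_eqI) (simp add: cf_partial_deriv lookup_add algebra_simps)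

lemma partial_deriv_zero [simp]: "partial_deriv i 0 = 0"
  by (simp add: partial_deriv_def)

lemma partial_deriv_scale: "partial_deriv i (scale c F) = scale c (partial_deriv i F)"
  by (rule poly_mapping_eqI) (simp add: cf_partial_deriv)

lemma partial_deriv_commute: "partial_deriv i (partial_deriv j F) = partial_deriv j (partial_deriv i F)"
  by (rule poly_mapping_eqI) (auto simp: cf_partial_deriv lookup_add lookup_single when_def add_ac)

lemma partial_deriv_single:
  "partial_deriv i (Poly_Mapping.single m c) =
     Poly_Mapping.single (m - Poly_Mapping.single i 1) (of_nat (cf m i) * c)"
  by (cases "c = 0") (simp_all add: partial_deriv_def)

lemma mon_minus_add:
  fixes m n :: mon3
  assumes "cf m i \<noteq> 0"
  shows "m - Poly_Mapping.single i 1 + n = m + n - Poly_Mapping.single i 1"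
    "n + (m - Poly_Mapping.single i 1) = m + n - Poly_Mapping.single i 1"
  using assms by (auto intro!: poly_mapping_eqI simp: lookup_add lookup_minus lookup_single when_def)

lemma partial_deriv_mult:
  "partial_deriv i (F * G) = partial_deriv i F * G + F * partial_deriv i G"
proof (induction F rule: pm_induct)
  case (single m c)
  show ?case
  proof (induction G rule: pm_induct)
    case (single n d)
    show ?case
    proof (cases "cf m i = 0"; cases "cf n i = 0")
      assume "cf m i \<noteq> 0" "cf n i \<noteq> 0"
      then show ?thesis
        using mon_minus_add[of m i n] mon_minus_add[of n i m]
        by (simp add: mult_single partial_deriv_single lookup_add algebra_simps flip: single_add)
    next
      assume "cf m i \<noteq> 0" "cf n i = 0"
      then show ?thesis
        using mon_minus_add[of m i n]
        by (simp add: mult_single partial_deriv_single lookup_add algebra_simps)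
    next
      assume "cf m i = 0" "cf n i \<noteq> 0"
      then show ?thesis
        using mon_minus_add[of n i m]
        by (simp add: mult_single partial_deriv_single lookup_add algebra_simps)
    next
      assume "cf m i = 0" "cf n i = 0"
      then show ?thesis
        by (simp add: mult_single partial_deriv_single lookup_add)
    qed
  qed (simp_all add: partial_deriv_add distrib_left add_ac)
qed (simp_all add: partial_deriv_add distrib_right add_ac)

definition D :: "(3 \<Rightarrow>\<^sub>0 complex) \<Rightarrow> poly3 \<Rightarrow> poly3" where
  "D w F = (\<Sum>i\<in>UNIV. scale (cf w i) (partial_deriv i F))"

lemma D_add: "D w (F + G) = D w F + D w G"
  and D_scale: "D w (scale c F) = scale c (D w F)"
  and D_zero [simp]: "D w 0 = 0"
  by (simp_all add: D_def sum3 partial_deriv_add partial_deriv_scale cvs.scale_right_distrib mult.commute add_ac)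

lemma D_const_mult: "D w (const3 c * F) = const3 c * D w F"
  using D_scale[of w c F] by (simp add: scale_const3)

lemma D_minus: "D w (- F) = - D w F"
  using D_scale[of w "-1" F] by simp

lemma D_diff: "D w (F - G) = D w F - D w G"
  using D_add[of w F "- G"] by (simp add: D_minus)

lemma D_mult: "D w (F * G) = D w F * G + F * D w G"
  by (simp add: D_def sum3 partial_deriv_mult scale_const3 algebra_simps)

lemma D_const [simp]: "D w (const3 c) = 0"
  by (simp add: D_def partial_deriv_single const3_def)

lemma D_power: "D w (F ^ Suc n) = of_nat (Suc n) * F ^ n * D w F"
  by (induction n) (simp_all add: D_mult algebra_simps)

lemma D_power2: "D w (F ^ 2) = 2 * F * D w F"
  and D_power3: "D w (F ^ 3) = 3 * F ^ 2 * D w F"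
  using D_power[of w F 1] D_power[of w F 2] by (simp_all add: numeral_2_eq_2 numeral_3_eq_3)

lemma D_commute: "D v (D w F) = D w (D v F)"
  by (simp add: D_def sum3 partial_deriv_add partial_deriv_scale partial_deriv_commute[of 1 0]
      partial_deriv_commute[of 2 0] partial_deriv_commute[of 2 1] cvs.scale_right_distrib mult.commute add_ac)

lemma D_vec_add: "D (v + w) F = D v F + D w F"
  and D_vec_scale: "D (scale c v) F = scale c (D v F)"
  and D_vec_zero [simp]: "D 0 F = 0"
  by (simp_all add: D_def sum3 lookup_add cvs.scale_left_distrib cvs.scale_right_distrib add_ac)

lemma partial_deriv_forms: "F \<in> forms k \<Longrightarrow> partial_deriv i F \<in> forms (k - 1)"
  by (fastforce simp: forms_cf cf_partial_deriv mdeg_add)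

lemma D_forms: "F \<in> forms k \<Longrightarrow> D w F \<in> forms (k - 1)"
  unfolding D_def sum3 by (intro forms_add forms_scale partial_deriv_forms)

lemma linear_form_cf: "linear_form v = const3 (cf v 0) * monom3 (Poly_Mapping.single 0 1)
   + const3 (cf v 1) * monom3 (Poly_Mapping.single 1 1) + const3 (cf v 2) * monom3 (Poly_Mapping.single 2 1)"
  by (simp add: linear_form_def sum3 mult_single)

lemma linear_form_forms [simp]: "linear_form v \<in> forms 1" "linear_form v \<in> forms (Suc 0)"
  by (simp_all add: linear_form_def sum3 forms_add single_in_forms)

lemma linear_form_add: "linear_form (v + w) = linear_form v + linear_form w"
  and linear_form_scale: "linear_form (scale c v) = const3 c * linear_form v"
  and linear_form_zero [simp]: "linear_form 0 = 0"
  by (simp_all add: linear_form_cf lookup_add const3_add const3_mult algebra_simps)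

lemma linear_form_diff: "linear_form (v - w) = linear_form v - linear_form w"
  using linear_form_add[of "v - w" w] by simp

definition dot :: "(3 \<Rightarrow>\<^sub>0 complex) \<Rightarrow> (3 \<Rightarrow>\<^sub>0 complex) \<Rightarrow> complex" where
  "dot a u = cf a 0 * cf u 0 + cf a 1 * cf u 1 + cf a 2 * cf u 2"

lemma dot_commute: "dot a u = dot u a"
  by (simp add: dot_def mult.commute)

lemma dot_add: "dot a (u + v) = dot a u + dot a v" "dot (u + v) a = dot u a + dot v a"
  and dot_scale: "dot a (scale c u) = c * dot a u" "dot (scale c u) a = c * dot u a"
  and dot_zero [simp]: "dot a 0 = 0" "dot 0 a = 0"
  by (simp_all add: dot_def lookup_add algebra_simps)

lemma dot_diff: "dot a (u - v) = dot a u - dot a v" "dot (u - v) a = dot u a - dot v a"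
  by (simp_all add: dot_def lookup_minus algebra_simps)

lemma D_linear_form [simp]: "D a (linear_form u) = const3 (dot a u)"
proof -
  have "partial_deriv i (monom3 (Poly_Mapping.single j 1)) = (if i = j then 1 else 0)" for i j
    by (simp add: partial_deriv_single lookup_single when_def)
  then show ?thesis
    by (simp add: D_def sum3 linear_form_cf partial_deriv_add scale_const3[symmetric] partial_deriv_scale)
       (simp add: scale_const3 dot_def const3_add const3_mult)
qed

lemma eval3_linear_form [simp]: "eval3 (linear_form a) v = dot a v"
  by (simp add: linear_form_cf dot_def mon_eval_def prod3 lookup_single when_def)

text \<open>A monomial is an eigenvector of each summand, with its i-th exponent as eigenvalue, and
  the exponents add up to the degree.\<close>

lemma euler: assumes "F \<in> forms k"
  shows "(\<Sum>i\<in>UNIV. monom3 (Poly_Mapping.single i 1) * partial_deriv i F) = const3 (of_nat k) * F"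
proof -
  have *: "monom3 (Poly_Mapping.single i 1) * partial_deriv i (Poly_Mapping.single m c) =
      Poly_Mapping.single m (of_nat (cf m i) * c)" for i m c
  proof (cases "cf m i = 0")
    case False
    then have "Poly_Mapping.single i 1 + (m - Poly_Mapping.single i 1) = m"
      by (auto intro!: poly_mapping_eqI simp: lookup_add lookup_minus lookup_single when_def)
    then show ?thesis by (simp add: partial_deriv_single mult_single)
  qed (simp add: partial_deriv_single)
  have sum: "(\<Sum>i\<in>UNIV. monom3 (Poly_Mapping.single i 1) * partial_deriv i (Poly_Mapping.single m c)) =
      const3 (of_nat (mdeg m)) * Poly_Mapping.single m c" for m c
    unfolding * const3_mult_single by (simp add: sum3 mdeg_def algebra_simps flip: single_add)
  let ?E = "\<lambda>F. \<Sum>i\<in>UNIV. monom3 (Poly_Mapping.single i 1) * partial_deriv i F"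
  have lin: "?E (\<Sum>m\<in>M. f m) = (\<Sum>m\<in>M. ?E (f m))" if "finite M" for M and f :: "mon3 \<Rightarrow> poly3"
    using that by induction (simp_all add: partial_deriv_add distrib_left sum.distrib)
  have "?E F = ?E (\<Sum>m\<in>Poly_Mapping.keys F. Poly_Mapping.single m (cf F m))"
    by (simp flip: pm_expand)
  also have "\<dots> = (\<Sum>m\<in>Poly_Mapping.keys F. const3 (of_nat k) * Poly_Mapping.single m (cf F m))"
    unfolding lin[OF finite_keys] sum using assms by (intro sum.cong) (auto simp: forms_def)
  also have "\<dots> = const3 (of_nat k) * F"
    unfolding sum_distrib_left[symmetric] pm_expand[of F, symmetric] ..
  finally show ?thesis .
qed

subsection \<open>The differentiation action\<close>

lemma funpow_partial_deriv_commute: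
  "(partial_deriv i ^^ m) ((partial_deriv j ^^ n) F) = (partial_deriv j ^^ n) ((partial_deriv i ^^ m) F)"
proof -
  have 1: "partial_deriv i ((partial_deriv j ^^ n) F) = (partial_deriv j ^^ n) (partial_deriv i F)" for i j n F
    by (induction n arbitrary: F) (simp_all add: partial_deriv_commute[of i j])
  show ?thesis by (induction m) (simp_all add: 1)
qed

lemma mon_action_add: "mon_action (a + b) F = mon_action a (mon_action b F)"
proof -
  have c: "(partial_deriv 1 ^^ m) ((partial_deriv 0 ^^ n) F) = (partial_deriv 0 ^^ n) ((partial_deriv 1 ^^ m) F)"
    "(partial_deriv 2 ^^ m) ((partial_deriv 0 ^^ n) F) = (partial_deriv 0 ^^ n) ((partial_deriv 2 ^^ m) F)"
    "(partial_deriv 2 ^^ m) ((partial_deriv 1 ^^ n) F) = (partial_deriv 1 ^^ n) ((partial_deriv 2 ^^ m) F)"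
    for m n F by (rule funpow_partial_deriv_commute)+
  show ?thesis unfolding mon_action_def lookup_add funpow_add comp_apply c ..
qed

lemma funpow_partial_deriv_linear:
  "(partial_deriv i ^^ n) (F + G) = (partial_deriv i ^^ n) F + (partial_deriv i ^^ n) G"
  "(partial_deriv i ^^ n) (scale c F) = scale c ((partial_deriv i ^^ n) F)"
  by (induction n) (simp_all add: partial_deriv_add partial_deriv_scale)

lemma mon_action_linear:
  "mon_action a (F + G) = mon_action a F + mon_action a G"
  "mon_action a (scale c F) = scale c (mon_action a F)"
  by (simp_all add: mon_action_def funpow_partial_deriv_linear)

lemma mon_action_zero [simp]: "mon_action a 0 = 0"
  using mon_action_linear(2)[of a 0 0] by simp

lemma diff_action_superset:
  assumes "finite M" "Poly_Mapping.keys p \<subseteq> M"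
  shows "diff_action p F = (\<Sum>m\<in>M. scale (cf p m) (mon_action m F))"
  unfolding diff_action_def
  using assms by (intro sum.mono_neutral_left) (auto simp: in_keys_iff)

lemma diff_action_single [simp]: "diff_action (Poly_Mapping.single m c) F = scale c (mon_action m F)"
  using diff_action_superset[of "{m}" "Poly_Mapping.single m c" F] by (simp add: keys_single)

lemma diff_action_zero [simp]: "diff_action 0 F = 0"
  by (simp add: diff_action_def)

lemma diff_action_add: "diff_action (p + q) F = diff_action p F + diff_action q F"
proof -
  let ?M = "Poly_Mapping.keys p \<union> Poly_Mapping.keys q"
  have "diff_action (p + q) F = (\<Sum>m\<in>?M. scale (cf (p + q) m) (mon_action m F))"
    using Poly_Mapping.keys_add[of p q] by (intro diff_action_superset) auto
  also have "\<dots> = (\<Sum>m\<in>?M. scale (cf p m) (mon_action m F)) + (\<Sum>m\<in>?M. scale (cf q m) (mon_action m F))"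
    by (simp add: lookup_add cvs.scale_left_distrib sum.distrib)
  also have "\<dots> = diff_action p F + diff_action q F"
    using diff_action_superset[of ?M p F] diff_action_superset[of ?M q F] by simp
  finally show ?thesis .
qed

lemma diff_action_scale_right: "diff_action p (scale c F) = scale c (diff_action p F)"
  by (simp add: diff_action_def mon_action_linear cvs.scale_sum_right mult.commute)

lemma diff_action_mult: "diff_action (p * q) F = diff_action p (diff_action q F)"
proof (induction p rule: pm_induct)
  case (single m c)
  show ?case
    by (induction q rule: pm_induct)
       (simp_all add: mult_single mon_action_add mon_action_linear diff_action_add distrib_left cvs.scale_right_distrib)
qed (simp_all add: diff_action_add distrib_right)

lemma mon_action_0 [simp]: "mon_action 0 F = F"
  by (simp add: mon_action_def)

lemma diff_action_const [simp]: "diff_action (const3 c) F = const3 c * F"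
  using diff_action_single[of 0 c F] by (simp add: scale_const3 flip: const3_def)

lemma diff_action_linear_form [simp]: "diff_action (linear_form w) F = D w F"
proof -
  have "mon_action (Poly_Mapping.single i 1) F = partial_deriv i F" for i
    using all3[of "\<lambda>i. mon_action (Poly_Mapping.single i 1) F = partial_deriv i F"]
    by (simp add: mon_action_def lookup_single when_def)
  then show ?thesis
    by (simp add: linear_form_cf diff_action_add diff_action_mult D_def sum3 scale_const3)
qed

lemma cf_funpow_partial_deriv:
  "cf ((partial_deriv i ^^ n) F) m = pochhammer (of_nat (cf m i) + 1) n * cf F (m + Poly_Mapping.single i n)"
proof (induction n arbitrary: m)
  case (Suc n)
  have "cf ((partial_deriv i ^^ Suc n) F) m =
      (of_nat (cf m i) + 1) * (pochhammer (of_nat (cf m i) + 2) n * cf F (m + Poly_Mapping.single i 1 + Poly_Mapping.single i n))"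
    by (simp add: cf_partial_deriv Suc lookup_add add_ac)
  also have "m + Poly_Mapping.single i 1 + Poly_Mapping.single i n = m + Poly_Mapping.single i (Suc n)"
    by (simp add: add.assoc flip: single_add)
  finally show ?case by (simp add: pochhammer_rec add_ac)
qed simp

text \<open>\<open>pochhammer 1 n\<close> is n!, so the factor is the factorial of the multi-index.
  The point is that constant terms of iterated derivatives are linear in the coefficients of
  F.\<close>

lemma cf_mon_action_0:
  "cf (mon_action a F) 0 = pochhammer 1 (cf a 0) * pochhammer 1 (cf a 1) * pochhammer 1 (cf a 2) * cf F a"
  using mk3_eta[of a] by (simp add: mon_action_def cf_funpow_partial_deriv lookup_single when_def mk3_def lookup_add)

subsection \<open>Dual bases\<close>

text \<open>Dual bases. As a rule \<open>a\<close>, \<open>b\<close>, \<open>c\<close> are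
  directions of derivatives and linear forms in S, while \<open>u\<close>, \<open>v\<close>,
  \<open>w\<close> are linear forms in T and also the points of the plane at which forms in S are
  evaluated. S and T share one type, so the two triples may be exchanged.\<close>

definition frame :: "(3 \<Rightarrow>\<^sub>0 complex) \<Rightarrow> (3 \<Rightarrow>\<^sub>0 complex) \<Rightarrow> (3 \<Rightarrow>\<^sub>0 complex) \<Rightarrow>
    (3 \<Rightarrow>\<^sub>0 complex) \<Rightarrow> (3 \<Rightarrow>\<^sub>0 complex) \<Rightarrow> (3 \<Rightarrow>\<^sub>0 complex) \<Rightarrow> bool" where
  "frame a b c u v w \<longleftrightarrow> dot a u = 1 \<and> dot a v = 0 \<and> dot a w = 0 \<and>
     dot b u = 0 \<and> dot b v = 1 \<and> dot b w = 0 \<and> dot c u = 0 \<and> dot c v = 0 \<and> dot c w = 1"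

definition v3 :: "complex \<Rightarrow> complex \<Rightarrow> complex \<Rightarrow> (3 \<Rightarrow>\<^sub>0 complex)" where
  "v3 x y z = Poly_Mapping.single 0 x + Poly_Mapping.single 1 y + Poly_Mapping.single 2 z"

lemma cf_v3 [simp]: "cf (v3 x y z) 0 = x" "cf (v3 x y z) 1 = y" "cf (v3 x y z) 2 = z"
  by (simp_all add: v3_def lookup_add lookup_single when_def)

lemma vec3_eqI: "cf u 0 = cf v 0 \<Longrightarrow> cf u 1 = cf v 1 \<Longrightarrow> cf u 2 = cf v 2 \<Longrightarrow> u = (v :: 3 \<Rightarrow>\<^sub>0 'b::zero)"
  using all3[of "\<lambda>i. cf u i = cf v i"] by (intro poly_mapping_eqI) simp

definition cross :: "(3 \<Rightarrow>\<^sub>0 complex) \<Rightarrow> (3 \<Rightarrow>\<^sub>0 complex) \<Rightarrow> (3 \<Rightarrow>\<^sub>0 complex)" where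
  "cross v w = v3 (cf v 1 * cf w 2 - cf v 2 * cf w 1) (cf v 2 * cf w 0 - cf v 0 * cf w 2)
                  (cf v 0 * cf w 1 - cf v 1 * cf w 0)"

lemma dot_cross_self [simp]: "dot u (cross u v) = 0" "dot v (cross u v) = 0"
  "dot (cross u v) u = 0" "dot (cross u v) v = 0"
  by (simp_all add: dot_def cross_def algebra_simps)

lemma dot_cross_rotate: "dot v (cross w u) = dot u (cross v w)" "dot w (cross u v) = dot u (cross v w)"
  by (simp_all add: dot_def cross_def algebra_simps)

lemma frame_swap: "frame a b c u v w \<Longrightarrow> frame u v w a b c"
  by (simp add: frame_def dot_commute)

lemma frame_rotate: "frame a b c u v w \<Longrightarrow> frame b c a v w u"
  and frame_flip: "frame a b c u v w \<Longrightarrow> frame b a c v u w"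
  by (simp_all add: frame_def)

lemma frame_exists:
  assumes "dot u (cross v w) \<noteq> 0"
  shows "\<exists>a b c. frame a b c u v w"
proof -
  define d where "d = dot u (cross v w)"
  have "dot (cross v w) u = d" "dot (cross w u) v = d" "dot (cross u v) w = d"
    by (simp_all add: d_def dot_def cross_def algebra_simps)
  then have "frame (scale (1 / d) (cross v w)) (scale (1 / d) (cross w u)) (scale (1 / d) (cross u v)) u v w"
    using assms by (simp add: frame_def dot_scale d_def[symmetric])
  then show ?thesis by (intro exI)
qed

text \<open>The triple products are the determinants of the two bases, and their product is the
  determinant of the matrix of pairings, here the identity.\<close>

lemma frame_det: assumes "frame a b c u v w" shows "dot u (cross v w) \<noteq> 0"
proof
  assume 0: "dot u (cross v w) = 0"
  have "dot u (cross v w) * dot a (cross b c) =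
     dot a u * (dot b v * dot c w - dot b w * dot c v) - dot a v * (dot b u * dot c w - dot b w * dot c u)
     + dot a w * (dot b u * dot c v - dot b v * dot c u)"
    unfolding dot_def cross_def cf_v3 by (simp add: algebra_simps)
  also have "\<dots> = 1" using assms by (simp add: frame_def)
  finally show False using 0 by simp
qed

lemma vec_nonzero_iff: "u \<noteq> 0 \<longleftrightarrow> (\<exists>v. dot u v \<noteq> (0::complex))"
proof
  assume "u \<noteq> 0"
  then have "cf u 0 \<noteq> 0 \<or> cf u 1 \<noteq> 0 \<or> cf u 2 \<noteq> 0" using vec3_eqI[of u 0] by auto
  moreover have "dot u (v3 1 0 0) = cf u 0" "dot u (v3 0 1 0) = cf u 1" "dot u (v3 0 0 1) = cf u 2"
    by (simp_all add: dot_def)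
  ultimately have "dot u (v3 1 0 0) \<noteq> 0 \<or> dot u (v3 0 1 0) \<noteq> 0 \<or> dot u (v3 0 0 1) \<noteq> 0" by simp
  then show "\<exists>v. dot u v \<noteq> 0" by (elim disjE) (rule exI, assumption)+
qed auto

lemma frame_extend2:
  assumes "cross u v \<noteq> 0"
  shows "\<exists>a b c w. frame a b c u v w"
proof -
  obtain w where "dot (cross u v) w \<noteq> 0" using assms by (auto simp: vec_nonzero_iff)
  then have "dot u (cross v w) \<noteq> 0" by (simp add: dot_commute[of "cross u v"] dot_cross_rotate)
  from frame_exists[OF this] show ?thesis by (elim exE) (intro exI)
qed

lemma frame_extend1:
  assumes "u \<noteq> 0"
  shows "\<exists>a b c v w. frame a b c u v w"
proof -
  have "cf u 0 \<noteq> 0 \<or> cf u 1 \<noteq> 0 \<or> cf u 2 \<noteq> 0" using vec3_eqI[of u 0] assms by auto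
  moreover have "cf (cross u (v3 1 0 0)) 1 = cf u 2" "cf (cross u (v3 0 1 0)) 2 = cf u 0"
    "cf (cross u (v3 0 0 1)) 0 = cf u 1" by (simp_all add: cross_def)
  ultimately have "cross u (v3 1 0 0) \<noteq> 0 \<or> cross u (v3 0 1 0) \<noteq> 0 \<or> cross u (v3 0 0 1) \<noteq> 0" by auto
  then obtain v where "cross u v \<noteq> 0" by (elim disjE) (rule that, assumption)+
  from frame_extend2[OF this] show ?thesis by (elim exE) (intro exI)
qed

lemma frame_expand:
  assumes "frame a b c u v w"
  shows "s = scale (dot a s) u + scale (dot b s) v + scale (dot c s) w"
proof -
  define t where "t = s - (scale (dot a s) u + scale (dot b s) v + scale (dot c s) w)"
  have t: "dot a t = 0" "dot b t = 0" "dot c t = 0"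
    using assms by (simp_all add: t_def frame_def dot_diff dot_add dot_scale)
  have d: "dot a (cross b c) \<noteq> 0" using frame_det[OF frame_swap[OF assms]] .
  \<comment> \<open>Cramer's rule: a vector is recovered, up to the determinant of a, b, c, from its
    pairings with these three.\<close>
  have "cf t i * dot a (cross b c) =
      dot a t * cf (cross b c) i + dot b t * cf (cross c a) i + dot c t * cf (cross a b) i" for i
  proof -
    have "\<forall>i. cf t i * dot a (cross b c) =
        dot a t * cf (cross b c) i + dot b t * cf (cross c a) i + dot c t * cf (cross a b) i"
      unfolding all3 by (simp add: dot_def cross_def algebra_simps)
    then show ?thesis by (rule spec)
  qed
  then have "cf t i = 0" for i using t d by simp
  then have "t = 0" by (intro poly_mapping_eqI) simp
  then show ?thesis by (simp add: t_def)
qed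

text \<open>\<open>frame\<close> makes one matrix a right inverse of the other; for square matrices
  it is then a left inverse as well.\<close>

lemma frame_complete:
  assumes "frame a b c u v w"
  shows "cf a i * cf u j + cf b i * cf v j + cf c i * cf w j = (if i = j then 1 else 0)"
proof -
  have d: "\<forall>i. dot s (Poly_Mapping.single i 1) = cf s i" for s
    by (simp add: all3 dot_def lookup_single when_def)
  have "cf (Poly_Mapping.single i 1) j = cf a i * cf u j + cf b i * cf v j + cf c i * cf w j"
    by (subst frame_expand[OF assms, of "Poly_Mapping.single i 1"]) (simp add: lookup_add d[rule_format])
  then show ?thesis by (simp add: lookup_single when_def)
qed

lemma euler_frame_identity:
  fixes x0 x1 x2 d0 d1 d2 :: "'a::comm_ring_1"
  shows "(u0 * x0 + u1 * x1 + u2 * x2) * (a0 * d0 + a1 * d1 + a2 * d2) +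
     (v0 * x0 + v1 * x1 + v2 * x2) * (b0 * d0 + b1 * d1 + b2 * d2) +
     (w0 * x0 + w1 * x1 + w2 * x2) * (c0 * d0 + c1 * d1 + c2 * d2) =
     (a0 * u0 + b0 * v0 + c0 * w0) * x0 * d0 + (a0 * u1 + b0 * v1 + c0 * w1) * x1 * d0 + (a0 * u2 + b0 * v2 + c0 * w2) * x2 * d0 +
     (a1 * u0 + b1 * v0 + c1 * w0) * x0 * d1 + (a1 * u1 + b1 * v1 + c1 * w1) * x1 * d1 + (a1 * u2 + b1 * v2 + c1 * w2) * x2 * d1 +
     (a2 * u0 + b2 * v0 + c2 * w0) * x0 * d2 + (a2 * u1 + b2 * v1 + c2 * w1) * x1 * d2 + (a2 * u2 + b2 * v2 + c2 * w2) * x2 * d2"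
  by (simp add: algebra_simps)

text \<open>Euler's operator does not depend on the basis: summed over dual pairs of vectors it is
  the same for every frame.\<close>

lemma euler_frame:
  assumes "frame a b c u v w" "F \<in> forms k"
  shows "linear_form u * D a F + linear_form v * D b F + linear_form w * D c F = const3 (of_nat k) * F"
proof -
  let ?X = "\<lambda>i. monom3 (Poly_Mapping.single i 1)" and ?d = "\<lambda>i. partial_deriv i F"
  let ?s = "\<lambda>i j. cf a i * cf u j + cf b i * cf v j + cf c i * cf w j"
  have "linear_form u * D a F + linear_form v * D b F + linear_form w * D c F =
     const3 (?s 0 0) * ?X 0 * ?d 0 + const3 (?s 0 1) * ?X 1 * ?d 0 + const3 (?s 0 2) * ?X 2 * ?d 0 +
     const3 (?s 1 0) * ?X 0 * ?d 1 + const3 (?s 1 1) * ?X 1 * ?d 1 + const3 (?s 1 2) * ?X 2 * ?d 1 +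
     const3 (?s 2 0) * ?X 0 * ?d 2 + const3 (?s 2 1) * ?X 1 * ?d 2 + const3 (?s 2 2) * ?X 2 * ?d 2"
    unfolding linear_form_cf D_def sum3 scale_const3 const3_add const3_mult by (rule euler_frame_identity)
  also have "\<dots> = ?X 0 * ?d 0 + ?X 1 * ?d 1 + ?X 2 * ?d 2"
    unfolding frame_complete[OF assms(1)] by simp
  also have "\<dots> = const3 (of_nat k) * F" using euler[OF assms(2)] by (simp add: sum3)
  finally show ?thesis .
qed

section \<open>Homogeneous ideals in families\<close>

interpretation idl: Modules.module "(*) :: poly3 \<Rightarrow> poly3 \<Rightarrow> poly3"
  by unfold_locales (simp_all add: algebra_simps)

lemma cf_component: "cf (component k p) m = (if mdeg m = k then cf p m else 0)"
proof -
  have "cf (component k p) m = (\<Sum>n | n \<in> Poly_Mapping.keys p \<and> mdeg n = k. if n = m then cf p n else 0)"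
    by (auto simp: component_def lookup_sum lookup_single when_def intro!: sum.cong)
  then show ?thesis by (simp add: in_keys_iff)
qed

lemma component_forms: "component k p \<in> forms k"
  by (simp add: forms_cf cf_component)

lemma component_add: "component k (p + q) = component k p + component k q"
  by (rule poly_mapping_eqI) (simp add: cf_component lookup_add)

lemma component_zero [simp]: "component k 0 = 0"
  by (rule poly_mapping_eqI) (simp add: cf_component)

lemma component_of_form: "p \<in> forms j \<Longrightarrow> component k p = (if j = k then p else 0)"
  by (rule poly_mapping_eqI) (auto simp: cf_component forms_cf)

lemma component_sum: "p = (\<Sum>k\<in>mdeg ` Poly_Mapping.keys p. component k p)"
proof (rule poly_mapping_eqI)
  fix m
  have "cf (\<Sum>k\<in>mdeg ` Poly_Mapping.keys p. component k p) m =
      (\<Sum>k\<in>mdeg ` Poly_Mapping.keys p. if mdeg m = k then cf p m else 0)"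
    by (simp add: lookup_sum cf_component)
  also have "\<dots> = cf p m" by (auto simp: in_keys_iff)
  finally show "cf p m = cf (\<Sum>k\<in>mdeg ` Poly_Mapping.keys p. component k p) m" ..
qed

lemma component_mult:
  assumes "g \<in> forms e"
  shows "component k (p * g) = (if e \<le> k then component (k - e) p * g else 0)"
proof (induction p rule: pm_induct)
  case (single m c)
  have "Poly_Mapping.single m c * g \<in> forms (mdeg m + e)"
    using assms by (intro forms_mult single_in_forms) auto
  moreover have "Poly_Mapping.single m c \<in> forms (mdeg m)" by (rule single_in_forms) simp
  ultimately show ?case by (auto simp: component_of_form)
qed (simp_all add: component_add distrib_right)

lemma homogeneous_idealD:
  assumes "homogeneous_ideal I"
  shows "idl.subspace I" "p \<in> I \<Longrightarrow> component k p \<in> I"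
  using assms by (simp_all add: homogeneous_ideal_def)

lemma ideal_cvs_subspace: "idl.subspace I \<Longrightarrow> cvs.subspace I"
  unfolding cvs.subspace_def
  by (auto simp: scale_const3 intro: idl.subspace_0 idl.subspace_add idl.subspace_scale)

lemma subspace_piece: "idl.subspace I \<Longrightarrow> cvs.subspace (I \<inter> forms k)"
  by (intro cvs.subspace_inter ideal_cvs_subspace subspace_forms)

lemma homogeneous_subset:
  assumes "homogeneous_ideal I" "idl.subspace J" "\<And>k. I \<inter> forms k \<subseteq> J"
  shows "I \<subseteq> J"
proof
  fix p assume "p \<in> I"
  then have "component k p \<in> J" for k
    using homogeneous_idealD(2)[OF assms(1)] component_forms[of k p] assms(3)[of k] by blast
  then have "(\<Sum>k\<in>mdeg ` Poly_Mapping.keys p. component k p) \<in> J"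
    by (intro idl.subspace_sum[OF assms(2)])
  then show "p \<in> J" by (simp flip: component_sum)
qed

lemma dim_piece_le: "cvs.dim (I \<inter> forms k) \<le> cvs.dim (forms k)"
  by (rule dim_mono_fin[OF Int_lower2 forms_fin])

lemma Hilb_iff: "I \<in> Hilb r \<longleftrightarrow> homogeneous_ideal I \<and>
    (\<forall>k. cvs.dim (I \<inter> forms k) + min r (cvs.dim (forms k)) = cvs.dim (forms k))"
proof -
  have "cvs.dim (forms k) - cvs.dim (I \<inter> forms k) = min r (cvs.dim (forms k)) \<longleftrightarrow>
     cvs.dim (I \<inter> forms k) + min r (cvs.dim (forms k)) = cvs.dim (forms k)" for k
    using dim_piece_le[of I k] by linarith
  then show ?thesis by (simp add: Hilb_def hilbert_function_def generic_hf_def fun_eq_iff)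
qed

lemma Hilb_homogeneous: "I \<in> Hilb r \<Longrightarrow> homogeneous_ideal I"
  by (simp add: Hilb_iff)

lemma Hilb_dim_eq: "I \<in> Hilb r \<Longrightarrow> J \<in> Hilb r \<Longrightarrow> cvs.dim (I \<inter> forms k) = cvs.dim (J \<inter> forms k)"
  unfolding Hilb_iff by (metis add_right_cancel)

text \<open>An inclusion of ideals with equal Hilbert functions is an equality in each degree.
  Uniqueness of J thus reduces to finding one ideal with the right Hilbert function inside
  it.\<close>

lemma Hilb_eqI:
  assumes "I \<in> Hilb r" "J \<in> Hilb r" "I \<subseteq> J"
  shows "I = J"
proof
  show "J \<subseteq> I"
  proof (rule homogeneous_subset)
    fix k
    have "I \<inter> forms k = J \<inter> forms k"
      using homogeneous_idealD(1)[OF Hilb_homogeneous[OF assms(1)]] assms(3) Hilb_dim_eq[OF assms(2,1)]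
        forms_fin[of k]
      by (intro subspace_eq_of_dim[OF subspace_piece _ _ forms_fin(2)[of k]]) auto
    then show "J \<inter> forms k \<subseteq> I" by blast
  qed (use assms Hilb_homogeneous homogeneous_idealD in auto)
qed fact

text \<open>A family that is independent modulo \<open>A\<close> extends a basis of \<open>A\<close>
  to an independent family in \<open>V\<close>.\<close>

lemma vanishing_family_add_dim:
  assumes A: "cvs.subspace A" "A \<subseteq> V" and V: "V \<subseteq> cvs.span W" "finite W"
    and I: "finite I" "\<And>i. i \<in> I \<Longrightarrow> w i \<in> V"
    and ind: "\<And>c. (\<Sum>i\<in>I. scale (c i) (w i)) \<in> A \<Longrightarrow> \<forall>i\<in>I. c i = 0"
  shows "cvs.dim A + card I \<le> cvs.dim V"
proof -
  obtain B where B: "B \<subseteq> A" "finite B" "cvs.independent B" "cvs.span B = A" "card B = cvs.dim A"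
    by (rule subspace_finite_basis[OF A(1) order_trans[OF A(2) V(1)] V(2)])
  let ?w = "case_sum (\<lambda>b. b) w" and ?I = "B <+> I"
  have "inj_on ?w ?I \<and> cvs.independent (?w ` ?I)"
  proof (rule independent_imageI)
    fix c assume c: "(\<Sum>i\<in>?I. scale (c i) (?w i)) = 0"
    then have c': "(\<Sum>b\<in>B. scale (c (Inl b)) b) + (\<Sum>i\<in>I. scale (c (Inr i)) (w i)) = 0"
      using B I by (simp add: sum.Plus)
    have "(\<Sum>b\<in>B. scale (c (Inl b)) b) \<in> A"
      using B(1) by (intro cvs.subspace_sum[OF A(1)] cvs.subspace_scale[OF A(1)]) auto
    moreover have "(\<Sum>i\<in>I. scale (c (Inr i)) (w i)) = - (\<Sum>b\<in>B. scale (c (Inl b)) b)"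
      using c' by (simp add: eq_neg_iff_add_eq_0 add.commute)
    ultimately have "(\<Sum>i\<in>I. scale (c (Inr i)) (w i)) \<in> A" by (simp add: cvs.subspace_neg[OF A(1)])
    from ind[OF this] have r: "\<forall>i\<in>I. c (Inr i) = 0" .
    then have "(\<Sum>b\<in>B. scale (c (Inl b)) b) = 0" using c' by simp
    then have "\<forall>b\<in>B. c (Inl b) = 0"
      using cvs.independentD[OF B(3) B(2) subset_refl, of "\<lambda>b. c (Inl b)"] by blast
    with r show "\<forall>i\<in>?I. c i = 0" by auto
  qed (use B I in auto)
  moreover have "?w ` ?I \<subseteq> V" using B A I by auto
  ultimately have "card ?I \<le> cvs.dim V"
    using independent_card_le_dim_fin[of "?w ` ?I", OF _ _ V] card_image[of ?w ?I] by auto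
  then show ?thesis using B I by (simp add: card_Plus)
qed

lemma spanning_family_independent:
  assumes "finite C" "V \<subseteq> cvs.span (w ` C)" "card C \<le> cvs.dim V"
  shows "inj_on w C \<and> cvs.independent (w ` C)"
proof
  have le: "cvs.dim V \<le> card (w ` C)" using assms by (intro cvs.dim_le_card) auto
  then show "inj_on w C" using assms card_image_le[OF assms(1), of w] by (intro eq_card_imp_inj_on) auto
  show "cvs.independent (w ` C)"
  proof
    assume "cvs.dependent (w ` C)"
    then obtain a where a: "a \<in> w ` C" "a \<in> cvs.span (w ` C - {a})" unfolding cvs.dependent_def by blast
    have "w ` C \<subseteq> cvs.span (w ` C - {a})"
      using a(2) cvs.span_superset[of "w ` C - {a}"] by auto
    then have "cvs.span (w ` C) \<subseteq> cvs.span (w ` C - {a})" by (rule cvs.span_minimal) (rule cvs.subspace_span)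
    then have "cvs.dim V \<le> card (w ` C - {a})" using assms by (intro cvs.dim_le_card) auto
    also have "\<dots> < card (w ` C)" using a(1) assms(1) by (intro psubset_card_mono) auto
    finally show False using assms card_image_le[OF assms(1), of w] by simp
  qed
qed

lemma family_basis_indexed:
  fixes w :: "'c \<Rightarrow> 'y \<Rightarrow> ('i \<Rightarrow>\<^sub>0 complex)"
  assumes R: "fun_algebra R" and M: "finite M" and C: "finite C" "card C = card M"
    and w: "\<And>c m. c \<in> C \<Longrightarrow> m \<in> M \<Longrightarrow> (\<lambda>y. cf (w c y) m) \<in> R"
    and keys: "\<And>c y. c \<in> C \<Longrightarrow> Poly_Mapping.keys (w c y) \<subseteq> M"
    and span: "\<And>m. m \<in> M \<Longrightarrow> Poly_Mapping.single m 1 \<in> cvs.span ((\<lambda>c. w c y0) ` C)"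
  shows "\<exists>D\<in>R. D y0 \<noteq> 0 \<and> (\<forall>m\<in>M. \<exists>X. (\<forall>c\<in>C. X c \<in> R) \<and>
           (\<forall>y. D y \<noteq> 0 \<longrightarrow> Poly_Mapping.single m 1 = (\<Sum>c\<in>C. scale (X c y / D y) (w c y))))"
proof -
  define n where "n = card M"
  have "card C = n" using C(2) by (simp add: n_def)
  then obtain h where h: "bij_betw h {..<n} C"
    using ex_bij_betw_nat_finite[OF C(1)] by (auto simp: atLeast0LessThan)
  define w' where "w' = (\<lambda>c. w (h c))"
  have hC: "h c \<in> C" if "c < n" for c using bij_betwE[OF h] that by simp
  have im: "(\<lambda>c. w' c y0) ` {..<n} = (\<lambda>c. w c y0) ` C"
    using bij_betw_imp_surj_on[OF h] by (auto simp: w'_def)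
  have "\<exists>D\<in>R. D y0 \<noteq> 0 \<and> (\<forall>m\<in>M. \<exists>X. (\<forall>c<n. X c \<in> R) \<and>
           (\<forall>y. D y \<noteq> 0 \<longrightarrow> Poly_Mapping.single m 1 = (\<Sum>c<n. scale (X c y / D y) (w' c y))))"
  proof (rule family_basis[OF R M n_def[symmetric]])
    show "Poly_Mapping.single m 1 \<in> cvs.span ((\<lambda>c. w' c y0) ` {..<n})" if "m \<in> M" for m
      unfolding im using span[OF that] .
  qed (use w keys hC in \<open>auto simp: w'_def\<close>)
  then obtain D where D: "D \<in> R" "D y0 \<noteq> 0" and X: "\<forall>m\<in>M. \<exists>X. (\<forall>c<n. X c \<in> R) \<and>
           (\<forall>y. D y \<noteq> 0 \<longrightarrow> Poly_Mapping.single m 1 = (\<Sum>c<n. scale (X c y / D y) (w' c y)))"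
    by (elim bexE conjE) (rule that)
  have "\<exists>X. (\<forall>c\<in>C. X c \<in> R) \<and>
           (\<forall>y. D y \<noteq> 0 \<longrightarrow> Poly_Mapping.single m 1 = (\<Sum>c\<in>C. scale (X c y / D y) (w c y)))" if m: "m \<in> M" for m
  proof -
    from bspec[OF X m] obtain X where X: "\<forall>c<n. X c \<in> R"
      "\<forall>y. D y \<noteq> 0 \<longrightarrow> Poly_Mapping.single m 1 = (\<Sum>c<n. scale (X c y / D y) (w' c y))"
      by (elim exE conjE) (rule that)
    let ?X = "\<lambda>c. X (the_inv_into {..<n} h c)"
    have inv: "the_inv_into {..<n} h (h c) = c" if "c < n" for c
      using bij_betw_imp_inj_on[OF h] that by (simp add: the_inv_into_f_f)
    have "(\<Sum>c\<in>C. scale (?X c y / D y) (w c y)) = (\<Sum>c<n. scale (X c y / D y) (w' c y))" for y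
      unfolding w'_def sum.reindex_bij_betw[OF h, symmetric] by (intro sum.cong) (simp_all add: inv)
    moreover have "?X c \<in> R" if "c \<in> C" for c
    proof -
      from that obtain i where "i < n" "c = h i" using bij_betw_imp_surj_on[OF h] by auto
      then show ?thesis using X(1) inv by simp
    qed
    ultimately show ?thesis using X(2) by (intro exI[of _ ?X]) simp
  qed
  then show ?thesis using D by (intro bexI[of _ D] conjI ballI)
qed

lemma cf_monom_mult_add [simp]: "cf (monom3 a * q) (a + n) = cf q n"
  by (induction q rule: pm_induct) (simp_all add: mult_single distrib_left lookup_add lookup_single when_def)

lemma cf_monom_mult_other: "(\<And>n. m \<noteq> a + n) \<Longrightarrow> cf (monom3 a * q) m = 0"
  by (induction q rule: pm_induct) (simp_all add: mult_single distrib_left lookup_add lookup_single when_def, metis)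

text \<open>The set depends on the degrees of the generators only, not on their coefficients, so it
  indexes spanning sets of graded pieces uniformly in a family.\<close>

definition gen_index :: "'j set \<Rightarrow> ('j \<Rightarrow> nat) \<Rightarrow> nat \<Rightarrow> ('j \<times> mon3) set" where
  "gen_index I e k = {(j, m). j \<in> I \<and> e j + mdeg m = k}"

lemma finite_gen_index: "finite I \<Longrightarrow> finite (gen_index I e k)"
proof -
  assume I: "finite I"
  have "gen_index I e k \<subseteq> I \<times> (\<Union>i\<le>k. mons i)"
    by (auto simp: gen_index_def mons_def)
  then show ?thesis by (rule finite_subset) (simp add: I)
qed

lemma idl_span_pieces:
  assumes g: "\<And>j. j \<in> I \<Longrightarrow> g j \<in> forms (e j)"
  shows "idl.span (g ` I) \<inter> forms k = cvs.span ((\<lambda>(j, m). monom3 m * g j) ` gen_index I e k)"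
    and "homogeneous_ideal (idl.span (g ` I))"
proof -
  let ?G = "\<lambda>k. (\<lambda>(j, m). monom3 m * g j) ` gen_index I e k"
  have G: "cvs.span (?G k) \<subseteq> idl.span (g ` I) \<inter> forms k" for k
  proof (rule cvs.span_minimal[OF _ subspace_piece[OF idl.subspace_span]])
    show "?G k \<subseteq> idl.span (g ` I) \<inter> forms k"
    proof clarify
      fix j m assume "(j, m) \<in> gen_index I e k"
      then have j: "j \<in> I" "mdeg m + e j = k" by (auto simp: gen_index_def)
      have "monom3 m * g j \<in> idl.span (g ` I)" using j by (intro idl.span_scale idl.span_base) auto
      moreover have "monom3 m * g j \<in> forms k"
        using forms_mult[OF single_in_forms[of m "mdeg m" 1] g[OF j(1)]] j by simp
      ultimately show "monom3 m * g j \<in> idl.span (g ` I) \<inter> forms k" by simp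
    qed
  qed
  have mult: "x * g j \<in> cvs.span (?G k)" if "j \<in> I" "e j \<le> k" "x \<in> forms (k - e j)" for x j k
  proof -
    have "x \<in> cvs.span (monom3 ` mons (k - e j))" using that by (simp add: forms_span)
    then show ?thesis
    proof (induction rule: cvs.span_induct_alt)
      case base
      show ?case by (simp add: cvs.span_zero)
    next
      case (step c x y)
      then obtain m where "x = monom3 m" "mdeg m = k - e j" by (auto simp: mons_def)
      then have "x * g j \<in> ?G k"
        using that(1,2) by (intro image_eqI[of _ _ "(j, m)"]) (auto simp: gen_index_def)
      from cvs.span_add[OF cvs.span_scale[OF cvs.span_base[OF this], of c] step(2)]
      show ?case by (simp add: scale_mult_left distrib_right)
    qed
  qed
  have comp: "component k p \<in> cvs.span (?G k)" if "p \<in> idl.span (g ` I)" for p k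
    using that
  proof (induction rule: idl.span_induct_alt)
    case base
    show ?case by (simp add: cvs.span_zero)
  next
    case (step c x y)
    then obtain j where j: "j \<in> I" "x = g j" by blast
    \<comment> \<open>The degree k part of c g is the part of c in degree \<open>k - e j\<close>
      times g; for k below \<open>e j\<close> it is 0.\<close>
    have "component k (c * x) \<in> cvs.span (?G k)"
      using mult[OF j(1) _ component_forms, of k c] j component_mult[OF g[OF j(1)], of k c]
      by (auto simp: cvs.span_zero)
    then show ?case using step by (simp add: component_add cvs.span_add)
  qed
  show "idl.span (g ` I) \<inter> forms k = cvs.span (?G k)"
  proof
    show "idl.span (g ` I) \<inter> forms k \<subseteq> cvs.span (?G k)"
    proof
      fix p assume "p \<in> idl.span (g ` I) \<inter> forms k"
      with comp[of p k] component_of_form[of p k k] show "p \<in> cvs.span (?G k)" by simp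
    qed
  qed (rule G)
  show "homogeneous_ideal (idl.span (g ` I))"
    unfolding homogeneous_ideal_def using comp G by (auto intro: idl.subspace_span)
qed

text \<open>A basis of \<open>A\<close> is completed to a basis of the forms by monomials, the
  standard monomials of degree k.\<close>

lemma monomial_complement_exists:
  assumes A: "cvs.subspace A" "A \<subseteq> forms k"
  shows "\<exists>B\<subseteq>mons k. forms k \<subseteq> cvs.span (A \<union> monom3 ` B) \<and> card B + cvs.dim A = cvs.dim (forms k) \<and>
     (\<forall>c. (\<Sum>b\<in>B. scale (c b) (monom3 b)) \<in> A \<longrightarrow> (\<forall>b\<in>B. c b = 0))"
proof -
  obtain T where T: "T \<subseteq> A" "finite T" "cvs.independent T" "cvs.span T = A" "card T = cvs.dim A"
    by (rule subspace_finite_basis[OF A(1) order_trans[OF A(2) forms_fin(1)] forms_fin(2)])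
  obtain E where E: "T \<subseteq> E" "E \<subseteq> T \<union> monom3 ` mons k" "cvs.independent E" "T \<union> monom3 ` mons k \<subseteq> cvs.span E"
    by (rule cvs.maximal_independent_subset_extend[OF Un_upper1 T(3)])
  have "E - T \<subseteq> monom3 ` mons k" using E(2) by auto
  then obtain B where B: "B \<subseteq> mons k" "inj_on monom3 B" "E - T = monom3 ` B"
    unfolding subset_image_inj by (elim exE conjE) (rule that)
  have fB: "finite B" using B(1) by (rule finite_subset) simp
  have E': "E = T \<union> monom3 ` B" using E(1) B(3) by blast
  have fE: "finite E" using E' T(2) fB by simp
  have EF: "E \<subseteq> forms k" using E(2) T(1) A(2) by (auto simp: mons_def intro: single_in_forms)
  have "forms k \<subseteq> cvs.span E"
    unfolding forms_span using E(4) by (intro cvs.span_minimal) (auto intro: cvs.subspace_span)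
  then have dE: "card E = cvs.dim (forms k)" using cvs.basis_card_eq_dim[OF EF _ E(3)] by simp
  have cE: "card E = card T + card B"
  proof -
    have "E = T \<union> (E - T)" using E(1) by auto
    then have "card E = card T + card (E - T)" using card_Un_disjoint[of T "E - T"] fE T(2) by auto
    then show ?thesis using B by (simp add: card_image)
  qed
  have "cvs.span E \<subseteq> cvs.span (A \<union> monom3 ` B)"
    using T(1) by (intro cvs.span_mono) (auto simp: E')
  with \<open>forms k \<subseteq> cvs.span E\<close> have sp: "forms k \<subseteq> cvs.span (A \<union> monom3 ` B)" by (rule subset_trans)
  have ind: "\<forall>b\<in>B. c b = 0" if "(\<Sum>b\<in>B. scale (c b) (monom3 b)) \<in> A" for c
  proof -
    have "(\<Sum>b\<in>B. scale (c b) (monom3 b)) \<in> cvs.span T" using that T(4) by simp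
    then obtain d where d: "(\<Sum>b\<in>B. scale (c b) (monom3 b)) = (\<Sum>v\<in>T. scale (d v) v)"
      unfolding cvs.span_finite[OF T(2)] by (elim imageE)  (rule that)
    let ?f = "\<lambda>v. if v \<in> T then d v else - c (the_inv_into B monom3 v)"
    have "(\<Sum>v\<in>E. scale (?f v) v) = (\<Sum>v\<in>T. scale (?f v) v) + (\<Sum>v\<in>E - T. scale (?f v) v)"
      using sum.subset_diff[OF E(1) fE, of "\<lambda>v. scale (?f v) v"] by (simp only: add.commute)
    also have "(\<Sum>v\<in>T. scale (?f v) v) = (\<Sum>v\<in>T. scale (d v) v)" by (intro sum.cong) auto
    also have "(\<Sum>v\<in>E - T. scale (?f v) v) = (\<Sum>v\<in>E - T. scale (- c (the_inv_into B monom3 v)) v)"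
      by (intro sum.cong) auto
    also have "\<dots> = (\<Sum>b\<in>B. scale (- c b) (monom3 b))"
      unfolding B(3) sum.reindex[OF B(2)] by (intro sum.cong) (simp_all add: the_inv_into_f_f[OF B(2)])
    also have "\<dots> = - (\<Sum>b\<in>B. scale (c b) (monom3 b))" by (simp add: sum_negf)
    finally have "(\<Sum>v\<in>E. scale (?f v) v) = 0" using d by simp
    then have z: "?f v = 0" if "v \<in> E" for v
      using cvs.independentD[OF E(3) fE subset_refl _ that, of ?f] by simp
    show ?thesis
    proof
      fix b assume "b \<in> B"
      then have "monom3 b \<in> E - T" using B(3) by blast
      then show "c b = 0" using z[of "monom3 b"] \<open>b \<in> B\<close> by (simp add: the_inv_into_f_f[OF B(2)])
    qed
  qed
  show ?thesis using B(1) sp ind dE cE T(5) by (intro exI[of _ B]) simp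
qed

text \<open>Some products of generators with monomials form a basis of the degree k piece at
  \<open>y0\<close>; together with \<open>B\<close> they are a basis of all forms, and by Cramer's
  rule they remain one wherever \<open>D\<close> is nonzero. There the products are still
  independent, which is semicontinuity; dropping them gives the normal forms; and if the dimension
  has not grown, they span the piece, so that \<open>B\<close> is independent modulo the
  ideal.\<close>

lemma family_degree:
  fixes g :: "'j \<Rightarrow> 'y \<Rightarrow> poly3"
  assumes R: "fun_algebra R" and I: "finite I"
    and gens: "\<forall>j\<in>I. \<forall>y. g j y \<in> forms (e j)"
    and coefs: "\<forall>j\<in>I. \<forall>m. (\<lambda>y. cf (g j y) m) \<in> R"
    and B: "B \<subseteq> mons k" "forms k \<subseteq> cvs.span ((idl.span ((\<lambda>j. g j y0) ` I) \<inter> forms k) \<union> monom3 ` B)"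
      "card B + cvs.dim (idl.span ((\<lambda>j. g j y0) ` I) \<inter> forms k) = cvs.dim (forms k)"
  defines "J \<equiv> \<lambda>y. idl.span ((\<lambda>j. g j y) ` I)"
  shows "\<exists>D\<in>R. D y0 \<noteq> 0 \<and>
     (\<forall>y. D y \<noteq> 0 \<longrightarrow> cvs.dim (J y0 \<inter> forms k) \<le> cvs.dim (J y \<inter> forms k)) \<and>
     (\<forall>m\<in>mons k. \<exists>X. (\<forall>b\<in>B. X b \<in> R) \<and>
        (\<forall>y. D y \<noteq> 0 \<longrightarrow> monom3 m - (\<Sum>b\<in>B. scale (X b y / D y) (monom3 b)) \<in> J y)) \<and>
     (\<forall>y. D y \<noteq> 0 \<longrightarrow> cvs.dim (J y \<inter> forms k) = cvs.dim (J y0 \<inter> forms k) \<longrightarrow>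
        (\<forall>c. (\<Sum>b\<in>B. scale (c b) (monom3 b)) \<in> J y \<longrightarrow> (\<forall>b\<in>B. c b = 0)))"
proof -
  have g: "g j y \<in> forms (e j)" if "j \<in> I" for j y using gens that by simp
  have coef: "(\<lambda>y. cf (g j y) m) \<in> R" if "j \<in> I" for j m using coefs that by simp
  have fB: "finite B" using B(1) by (rule finite_subset) simp
  define P where "P = gen_index I e k"
  have fP: "finite P" unfolding P_def by (rule finite_gen_index[OF I])
  define u where "u = (\<lambda>(j, m) y. monom3 m * g j y)"
  have piece: "J y \<inter> forms k = cvs.span ((\<lambda>p. u p y) ` P)" for y
    unfolding J_def P_def u_def using idl_span_pieces(1)[of I "\<lambda>j. g j y" e k] g
    by (simp add: case_prod_beta')
  have subJ: "cvs.subspace (J y \<inter> forms k)" for y unfolding piece by (rule cvs.subspace_span)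
  obtain T where T: "T \<subseteq> (\<lambda>p. u p y0) ` P" "cvs.independent T" "(\<lambda>p. u p y0) ` P \<subseteq> cvs.span T"
    by (rule cvs.maximal_independent_subset)
  \<comment> \<open>The basis is remembered by its indices, since the same selection of products is
    used at every y.\<close>
  from T(1) obtain Q where Q: "Q \<subseteq> P" "inj_on (\<lambda>p. u p y0) Q" "T = (\<lambda>p. u p y0) ` Q"
    unfolding subset_image_inj by (elim exE conjE) (rule that)
  have fQ: "finite Q" using Q(1) fP by (rule finite_subset)
  have spT: "cvs.span T = J y0 \<inter> forms k"
  proof
    show "cvs.span T \<subseteq> J y0 \<inter> forms k" unfolding piece by (rule cvs.span_mono[OF T(1)])
    show "J y0 \<inter> forms k \<subseteq> cvs.span T" unfolding piece
      by (rule cvs.span_minimal[OF T(3) cvs.subspace_span])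
  qed
  have "cvs.dim (J y0 \<inter> forms k) = cvs.dim T"
    unfolding spT[symmetric] by (rule cvs.dim_span)
  then have cQ: "card Q = cvs.dim (J y0 \<inter> forms k)"
    using cvs.dim_eq_card_independent[OF T(2)] card_image[OF Q(2)] Q(3) by simp
  define C where "C = Q <+> B"
  define w where "w = (\<lambda>c y. case c of Inl p \<Rightarrow> u p y | Inr b \<Rightarrow> monom3 b)"
  have fC: "finite C" unfolding C_def using fQ fB by simp
  have cC: "card C = card (mons k)"
    unfolding C_def card_Plus[OF fQ fB] cQ using B(3) by (simp add: J_def dim_forms add.commute)
  have uforms: "u p y \<in> forms k" if "p \<in> P" for p y
    using that forms_mult[OF single_in_forms[of "snd p" "mdeg (snd p)" 1] g[of "fst p" y]]
    by (auto simp: u_def P_def gen_index_def add.commute)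
  have wforms: "w c y \<in> forms k" if "c \<in> C" for c y
    using that uforms Q(1) B(1) by (auto simp: C_def w_def mons_def intro!: single_in_forms)
  have wR: "(\<lambda>y. cf (w c y) m) \<in> R" if c: "c \<in> C" for c m
  proof (cases c)
    case (Inl p)
    then obtain j a where p: "p = (j, a)" "j \<in> I" using c Q(1) by (auto simp: C_def P_def gen_index_def)
    show ?thesis
    proof (cases "\<exists>n. m = a + n")
      case True
      then obtain n where n: "m = a + n" by (elim exE)
      have "(\<lambda>y. cf (w c y) m) = (\<lambda>y. cf (g j y) n)" by (simp add: Inl p n w_def u_def)
      with coef[OF p(2), of n] show ?thesis by simp
    next
      case False
      then have "(\<lambda>y. cf (w c y) m) = (\<lambda>y. 0)" using cf_monom_mult_other[of m a] by (simp add: Inl p w_def u_def)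
      then show ?thesis using fun_algebra_const[OF R, of 0] by simp
    qed
  next
    case (Inr b)
    then show ?thesis using fun_algebra_const[OF R] by (simp add: w_def)
  qed
  have imw: "(\<lambda>c. w c y) ` C = (\<lambda>p. u p y) ` Q \<union> monom3 ` B" for y
    by (force simp: C_def w_def image_iff)
  have sp0: "forms k \<subseteq> cvs.span ((\<lambda>c. w c y0) ` C)"
  proof -
    have "J y0 \<inter> forms k \<subseteq> cvs.span ((\<lambda>c. w c y0) ` C)"
      unfolding spT[symmetric] imw Q(3) by (rule cvs.span_mono) simp
    moreover have "monom3 ` B \<subseteq> cvs.span ((\<lambda>c. w c y0) ` C)"
      unfolding imw by (rule subset_trans[OF Un_upper2 cvs.span_superset])
    ultimately have "cvs.span ((J y0 \<inter> forms k) \<union> monom3 ` B) \<subseteq> cvs.span ((\<lambda>c. w c y0) ` C)"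
      by (intro cvs.span_minimal cvs.subspace_span Un_least)
    with B(2) show ?thesis unfolding J_def by (rule subset_trans)
  qed
  have "\<exists>D\<in>R. D y0 \<noteq> 0 \<and> (\<forall>m\<in>mons k. \<exists>X. (\<forall>c\<in>C. X c \<in> R) \<and>
           (\<forall>y. D y \<noteq> 0 \<longrightarrow> Poly_Mapping.single m 1 = (\<Sum>c\<in>C. scale (X c y / D y) (w c y))))"
  proof (rule family_basis_indexed[OF R finite_mons fC cC])
    show "monom3 m \<in> cvs.span ((\<lambda>c. w c y0) ` C)" if "m \<in> mons k" for m
      using that by (intro subsetD[OF sp0]) (auto simp: mons_def intro: single_in_forms)
    show "(\<lambda>y. cf (w c y) m) \<in> R" if "c \<in> C" for c m by (rule wR[OF that])
    show "Poly_Mapping.keys (w c y) \<subseteq> mons k" if "c \<in> C" for c y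
      using wforms[OF that] by (simp add: forms_iff)
  qed
  then obtain D where D: "D \<in> R" "D y0 \<noteq> 0" and X: "\<forall>m\<in>mons k. \<exists>X. (\<forall>c\<in>C. X c \<in> R) \<and>
           (\<forall>y. D y \<noteq> 0 \<longrightarrow> monom3 m = (\<Sum>c\<in>C. scale (X c y / D y) (w c y)))"
    by (elim bexE conjE) (rule that)
  have indep: "inj_on (\<lambda>c. w c y) C \<and> cvs.independent ((\<lambda>c. w c y) ` C)" if y: "D y \<noteq> 0" for y
  proof (rule spanning_family_independent[OF fC])
    show "forms k \<subseteq> cvs.span ((\<lambda>c. w c y) ` C)"
      unfolding forms_span
    proof (rule cvs.span_minimal[OF _ cvs.subspace_span], clarify)
      fix m assume "m \<in> mons k"
      from bspec[OF X this] obtain X where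
        "\<forall>y. D y \<noteq> 0 \<longrightarrow> monom3 m = (\<Sum>c\<in>C. scale (X c y / D y) (w c y))"
        by (elim exE conjE) (rule that)
      then have m: "monom3 m = (\<Sum>c\<in>C. scale (X c y / D y) (w c y))" using y by simp
      show "monom3 m \<in> cvs.span ((\<lambda>c. w c y) ` C)"
        unfolding m by (intro cvs.span_sum cvs.span_scale cvs.span_base) simp
    qed
    show "card C \<le> cvs.dim (forms k)" by (simp add: cC dim_forms)
  qed
  have uJ: "u p y \<in> J y \<inter> forms k" if "p \<in> Q" for p y
    unfolding piece using that Q(1) by (intro cvs.span_base) auto
  have zero: "(\<forall>q\<in>Q. d q = 0) \<and> (\<forall>b\<in>B. c b = 0)"
    if y: "D y \<noteq> 0" and s: "(\<Sum>q\<in>Q. scale (d q) (u q y)) + (\<Sum>b\<in>B. scale (c b) (monom3 b)) = 0" for y d c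
  proof -
    let ?c = "case_sum d c"
    have "(\<Sum>i\<in>C. scale (?c i) (w i y)) = 0"
      unfolding C_def using s fQ fB by (simp add: sum.Plus w_def)
    then have z: "?c i = 0" if "i \<in> C" for i
      using independent_family_zero[of "\<lambda>c. w c y" C ?c i] indep[OF y] fC that by simp
    have "d q = 0" if "q \<in> Q" for q using z[of "Inl q"] that by (simp add: C_def InlI)
    moreover have "c b = 0" if "b \<in> B" for b using z[of "Inr b"] that by (simp add: C_def InrI)
    ultimately show ?thesis by simp
  qed
  have indQ: "inj_on (\<lambda>q. u q y) Q \<and> cvs.independent ((\<lambda>q. u q y) ` Q)" if y: "D y \<noteq> 0" for y
  proof (rule independent_imageI[OF fQ])
    fix c assume "(\<Sum>q\<in>Q. scale (c q) (u q y)) = 0"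
    then show "\<forall>q\<in>Q. c q = 0" using zero[OF y, of c "\<lambda>_. 0"] by simp
  qed
  have le: "cvs.dim (J y0 \<inter> forms k) \<le> cvs.dim (J y \<inter> forms k)" if y: "D y \<noteq> 0" for y
  proof -
    have "card ((\<lambda>q. u q y) ` Q) \<le> cvs.dim (J y \<inter> forms k)"
      by (rule conjunct2[OF independent_card_le_dim_fin[OF conjunct2[OF indQ[OF y]] _ _ forms_fin(2)]])
         (use uJ forms_fin(1)[of k] in auto)
    then show ?thesis using card_image[of "\<lambda>q. u q y" Q] indQ[OF y] cQ by simp
  qed
  have normal: "\<exists>X. (\<forall>b\<in>B. X b \<in> R) \<and>
        (\<forall>y. D y \<noteq> 0 \<longrightarrow> monom3 m - (\<Sum>b\<in>B. scale (X b y / D y) (monom3 b)) \<in> J y)" if m: "m \<in> mons k" for m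
  proof -
    from bspec[OF X m] obtain X where X: "\<forall>c\<in>C. X c \<in> R"
      "\<forall>y. D y \<noteq> 0 \<longrightarrow> monom3 m = (\<Sum>c\<in>C. scale (X c y / D y) (w c y))"
      by (elim exE conjE) (rule that)
    have "monom3 m - (\<Sum>b\<in>B. scale (X (Inr b) y / D y) (monom3 b)) \<in> J y" if y: "D y \<noteq> 0" for y
    proof -
      have "monom3 m = (\<Sum>q\<in>Q. scale (X (Inl q) y / D y) (u q y)) + (\<Sum>b\<in>B. scale (X (Inr b) y / D y) (monom3 b))"
        using X(2) y fQ fB by (simp add: C_def sum.Plus w_def)
      then have "monom3 m - (\<Sum>b\<in>B. scale (X (Inr b) y / D y) (monom3 b)) = (\<Sum>q\<in>Q. scale (X (Inl q) y / D y) (u q y))"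
        by simp
      also have "\<dots> \<in> J y \<inter> forms k"
        by (intro cvs.subspace_sum[OF subJ] cvs.subspace_scale[OF subJ] uJ)
      finally show ?thesis by simp
    qed
    then show ?thesis using X(1) by (intro exI[of _ "\<lambda>b. X (Inr b)"]) (auto simp: C_def)
  qed
  have inB: "\<forall>b\<in>B. c b = 0" if y: "D y \<noteq> 0" and eq: "cvs.dim (J y \<inter> forms k) = cvs.dim (J y0 \<inter> forms k)"
    and s: "(\<Sum>b\<in>B. scale (c b) (monom3 b)) \<in> J y" for y c
  proof -
    have "cvs.span ((\<lambda>q. u q y) ` Q) = J y \<inter> forms k"
    proof (rule subspace_eq_of_dim[OF cvs.subspace_span _ _ forms_fin(2)[of k]])
      show "cvs.span ((\<lambda>q. u q y) ` Q) \<subseteq> J y \<inter> forms k" by (rule cvs.span_minimal[OF _ subJ]) (use uJ in auto)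
      show "J y \<inter> forms k \<subseteq> cvs.span (monom3 ` mons k)" using forms_fin(1) by auto
      show "cvs.dim (J y \<inter> forms k) \<le> cvs.dim (cvs.span ((\<lambda>q. u q y) ` Q))"
        using eq cvs.dim_span_eq_card_independent[OF conjunct2[OF indQ[OF y]]] card_image[OF conjunct1[OF indQ[OF y]]] cQ
        by simp
    qed
    moreover have "(\<Sum>b\<in>B. scale (c b) (monom3 b)) \<in> forms k"
      using B(1) by (intro cvs.subspace_sum[OF subspace_forms] forms_scale) (auto simp: mons_def intro: single_in_forms)
    ultimately have "(\<Sum>b\<in>B. scale (c b) (monom3 b)) \<in> cvs.span ((\<lambda>q. u q y) ` Q)" using s by simp
    then obtain f where f: "(\<Sum>b\<in>B. scale (c b) (monom3 b)) = (\<Sum>v\<in>(\<lambda>q. u q y) ` Q. scale (f v) v)"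
      unfolding cvs.span_finite[OF finite_imageI[OF fQ]] by (elim imageE) (rule that)
    have "(\<Sum>q\<in>Q. scale (- f (u q y)) (u q y)) + (\<Sum>b\<in>B. scale (c b) (monom3 b)) = 0"
      unfolding f sum.reindex[OF conjunct1[OF indQ[OF y]]] by (simp add: sum_negf)
    from zero[OF y this] show ?thesis by simp
  qed
  show ?thesis
    by (intro bexI[OF _ D(1)] conjI D(2) allI impI ballI le normal) (use inB in auto)
qed

section \<open>Normal forms modulo an ideal and the charts of the Hilbert scheme\<close>

lemma keys_sum_monom:
  assumes "finite B" shows "Poly_Mapping.keys (\<Sum>b\<in>B. scale (c b) (monom3 b)) \<subseteq> B"
proof
  fix m assume m: "m \<in> Poly_Mapping.keys (\<Sum>b\<in>B. scale (c b) (monom3 b))"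
  show "m \<in> B"
  proof (rule ccontr)
    assume "m \<notin> B"
    then have "cf (\<Sum>b\<in>B. scale (c b) (monom3 b)) m = 0"
      unfolding lookup_sum by (intro sum.neutral) (auto simp: lookup_single when_def)
    with m show False by (simp add: in_keys_iff)
  qed
qed

lemma cf_sum_monom:
  assumes "finite B" shows "cf (\<Sum>b\<in>B. scale (c b) (monom3 b)) m = (if m \<in> B then c m else 0)"
proof -
  have "cf (\<Sum>b\<in>B. scale (c b) (monom3 b)) m = (\<Sum>b\<in>B. if b = m then c b else 0)"
    unfolding lookup_sum by (intro sum.cong) (auto simp: lookup_single when_def)
  then show ?thesis using assms by simp
qed

lemma sum_monom_expand:
  assumes "finite B" "Poly_Mapping.keys p \<subseteq> B" shows "p = (\<Sum>b\<in>B. scale (cf p b) (monom3 b))"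
  by (rule poly_mapping_eqI) (use assms in \<open>auto simp: cf_sum_monom in_keys_iff\<close>)

definition deg_part :: "mon3 set \<Rightarrow> nat \<Rightarrow> mon3 set" where
  "deg_part B k = {b \<in> B. mdeg b = k}"

lemma deg_part_mons: "deg_part B k \<subseteq> mons k"
  by (auto simp: deg_part_def mons_def)

lemma finite_deg_part [simp]: "finite (deg_part B k)"
  by (rule finite_subset[OF deg_part_mons finite_mons])

lemma sum_deg_part_forms: "(\<Sum>b\<in>deg_part B k. scale (c b) (monom3 b)) \<in> forms k"
  by (intro cvs.subspace_sum[OF subspace_forms] forms_scale) (auto simp: deg_part_def intro: single_in_forms)

lemma normal_form_iff:
  assumes J: "idl.subspace J"
    and X: "monom3 m - (\<Sum>b\<in>deg_part B (mdeg m). scale (X b) (monom3 b)) \<in> J"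
    and ind: "\<And>c. (\<Sum>b\<in>deg_part B (mdeg m). scale (c b) (monom3 b)) \<in> J \<Longrightarrow> \<forall>b\<in>deg_part B (mdeg m). c b = 0"
  shows "is_normal_form B J m p \<longleftrightarrow> p = (\<Sum>b\<in>deg_part B (mdeg m). scale (X b) (monom3 b))"
proof
  let ?B = "deg_part B (mdeg m)"
  assume p: "is_normal_form B J m p"
  then have kp: "Poly_Mapping.keys p \<subseteq> ?B" and pJ: "monom3 m - p \<in> J"
    by (simp_all add: is_normal_form_def deg_part_def)
  have pe: "p = (\<Sum>b\<in>?B. scale (cf p b) (monom3 b))" by (rule sum_monom_expand[OF finite_deg_part kp])
  have "(monom3 m - p) - (monom3 m - (\<Sum>b\<in>?B. scale (X b) (monom3 b))) \<in> J"
    by (rule idl.subspace_diff[OF J pJ X])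
  also have "(monom3 m - p) - (monom3 m - (\<Sum>b\<in>?B. scale (X b) (monom3 b))) =
      (\<Sum>b\<in>?B. scale (X b) (monom3 b)) - (\<Sum>b\<in>?B. scale (cf p b) (monom3 b))"
    using pe by simp
  also have "\<dots> = (\<Sum>b\<in>?B. scale (X b - cf p b) (monom3 b))"
    by (simp add: cvs.scale_left_diff_distrib sum_subtractf)
  finally have "\<forall>b\<in>?B. X b - cf p b = 0" by (rule ind)
  then have "(\<Sum>b\<in>?B. scale (cf p b) (monom3 b)) = (\<Sum>b\<in>?B. scale (X b) (monom3 b))"
    by (intro sum.cong) auto
  with pe show "p = (\<Sum>b\<in>?B. scale (X b) (monom3 b))" by simp
next
  assume "p = (\<Sum>b\<in>deg_part B (mdeg m). scale (X b) (monom3 b))"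
  then show "is_normal_form B J m p"
    using X keys_sum_monom[OF finite_deg_part[of B "mdeg m"], of X] by (simp add: is_normal_form_def deg_part_def)
qed

lemma hilb_coord_eq:
  assumes J: "idl.subspace J"
    and X: "monom3 m - (\<Sum>b\<in>deg_part B (mdeg m). scale (X b) (monom3 b)) \<in> J"
    and ind: "\<And>c. (\<Sum>b\<in>deg_part B (mdeg m). scale (c b) (monom3 b)) \<in> J \<Longrightarrow> \<forall>b\<in>deg_part B (mdeg m). c b = 0"
  shows "\<exists>!p. is_normal_form B J m p"
    and "hilb_coord B m b J = (if b \<in> deg_part B (mdeg m) then X b else 0)"
  using normal_form_iff[OF assms] by (auto simp: hilb_coord_def cf_sum_monom)

lemma hilb_chartD:
  assumes J: "homogeneous_ideal J" and ch: "J \<in> hilb_chart d B" and "k \<le> d"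
  shows "forms k \<subseteq> cvs.span ((J \<inter> forms k) \<union> monom3 ` deg_part B k)"
    and "(\<Sum>b\<in>deg_part B k. scale (c b) (monom3 b)) \<in> J \<Longrightarrow> \<forall>b\<in>deg_part B k. c b = 0"
    and "card (deg_part B k) + cvs.dim (J \<inter> forms k) = cvs.dim (forms k)"
proof -
  note sub = homogeneous_idealD(1)[OF J]
  have ex1: "\<exists>!p. is_normal_form B J m p" if "mdeg m = k" for m
    using ch that \<open>k \<le> d\<close> by (auto simp: hilb_chart_def)
  show sp: "forms k \<subseteq> cvs.span ((J \<inter> forms k) \<union> monom3 ` deg_part B k)"
    unfolding forms_span[of k]
  proof (rule cvs.span_minimal[OF _ cvs.subspace_span], clarify)
    fix m assume "m \<in> mons k"
    then have mk: "mdeg m = k" by (simp add: mons_def)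
    from ex1[OF this] obtain p where p: "is_normal_form B J m p" by (elim ex1E) (rule that)
    then have kp: "Poly_Mapping.keys p \<subseteq> deg_part B k" and pJ: "monom3 m - p \<in> J"
      using mk by (simp_all add: is_normal_form_def deg_part_def)
    have pf: "p \<in> forms k" using kp deg_part_mons by (auto simp: forms_iff)
    have "monom3 m - p \<in> forms k" using pf mk by (intro forms_diff single_in_forms)
    then have 1: "monom3 m - p \<in> cvs.span ((J \<inter> forms k) \<union> monom3 ` deg_part B k)"
      using pJ by (intro cvs.span_base) simp
    have "(\<Sum>b\<in>deg_part B k. scale (cf p b) (monom3 b)) \<in> cvs.span ((J \<inter> forms k) \<union> monom3 ` deg_part B k)"
      by (intro cvs.span_sum cvs.span_scale cvs.span_base) simp
    then have "p \<in> cvs.span ((J \<inter> forms k) \<union> monom3 ` deg_part B k)"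
      by (simp flip: sum_monom_expand[OF finite_deg_part kp])
    from cvs.span_add[OF 1 this] show "monom3 m \<in> cvs.span ((J \<inter> cvs.span (monom3 ` mons k)) \<union> monom3 ` deg_part B k)"
      by (simp add: forms_span)
  qed
  show ind: "\<forall>b\<in>deg_part B k. c b = 0" if s: "(\<Sum>b\<in>deg_part B k. scale (c b) (monom3 b)) \<in> J" for c
  proof
    fix b assume b: "b \<in> deg_part B k"
    then have bk: "mdeg b = k" by (simp add: deg_part_def)
    let ?s = "\<Sum>b\<in>deg_part B k. scale (c b) (monom3 b)"
    \<comment> \<open>A combination of standard monomials lying in J could be added to the normal
      form of b, against its uniqueness.\<close>
    have "is_normal_form B J b (monom3 b)"
      using b idl.subspace_0[OF sub] by (simp add: is_normal_form_def deg_part_def)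
    moreover have "is_normal_form B J b (monom3 b + ?s)"
    proof -
      have "Poly_Mapping.keys (monom3 b + ?s) \<subseteq> deg_part B k"
        using Poly_Mapping.keys_add[of "monom3 b" ?s] keys_sum_monom[OF finite_deg_part[of B k], of c] b by auto
      moreover have "monom3 b - (monom3 b + ?s) \<in> J" using idl.subspace_neg[OF sub s] by simp
      ultimately show ?thesis using bk by (simp add: is_normal_form_def deg_part_def)
    qed
    ultimately have "monom3 b + ?s = monom3 b" using ex1[OF bk] by blast
    then have "?s = 0" by simp
    then have "cf ?s b = 0" by simp
    then show "c b = 0" using b by (simp add: cf_sum_monom)
  qed
  have "cvs.dim (forms k) \<le> cvs.dim (J \<inter> forms k) + card (monom3 ` deg_part B k)"
    by (rule dim_le_add_card[OF subspace_piece[OF sub] _ forms_fin(2)[of k] sp]) (use forms_fin(1) in auto)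
  moreover have "cvs.dim (J \<inter> forms k) + card (deg_part B k) \<le> cvs.dim (forms k)"
    by (rule vanishing_family_add_dim[OF subspace_piece[OF sub] Int_lower2 forms_fin finite_deg_part, where w = monom3])
       (use ind in \<open>simp_all add: deg_part_def single_in_forms\<close>)
  moreover have "card (monom3 ` deg_part B k) = card (deg_part B k)"
    by (rule card_image[OF independent_mons(1)[OF finite_deg_part]])
  ultimately show "card (deg_part B k) + cvs.dim (J \<inter> forms k) = cvs.dim (forms k)" by simp
qed

text \<open>Standard monomials chosen degree by degree are united into one set; degrees do not
  interact, so the same set serves every \<open>d\<close>.\<close>

lemma hilb_chart_exists:
  assumes J: "homogeneous_ideal J"
  shows "\<exists>B. J \<in> hilb_chart d B"
proof -
  note sub = homogeneous_idealD(1)[OF J]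
  have "\<forall>k. \<exists>B. B \<subseteq> mons k \<and> forms k \<subseteq> cvs.span ((J \<inter> forms k) \<union> monom3 ` B) \<and>
     (\<forall>c. (\<Sum>b\<in>B. scale (c b) (monom3 b)) \<in> J \<inter> forms k \<longrightarrow> (\<forall>b\<in>B. c b = 0))"
  proof
    fix k
    from monomial_complement_exists[OF subspace_piece[OF sub] Int_lower2, of k]
    show "\<exists>B. B \<subseteq> mons k \<and> forms k \<subseteq> cvs.span ((J \<inter> forms k) \<union> monom3 ` B) \<and>
     (\<forall>c. (\<Sum>b\<in>B. scale (c b) (monom3 b)) \<in> J \<inter> forms k \<longrightarrow> (\<forall>b\<in>B. c b = 0))"
      by (elim exE conjE) (intro exI conjI)
  qed
  from choice[OF this] obtain Bk where Bk: "\<forall>k. Bk k \<subseteq> mons k \<and>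
     forms k \<subseteq> cvs.span ((J \<inter> forms k) \<union> monom3 ` Bk k) \<and>
     (\<forall>c. (\<Sum>b\<in>Bk k. scale (c b) (monom3 b)) \<in> J \<inter> forms k \<longrightarrow> (\<forall>b\<in>Bk k. c b = 0))"
    by (elim exE) (rule that)
  define B where "B = (\<Union>k. Bk k)"
  have dB: "deg_part B k = Bk k" for k
  proof -
    have "Bk i \<subseteq> mons i" for i using Bk by simp
    then have "b \<in> Bk i \<Longrightarrow> mdeg b = i" for b i by (auto simp: mons_def)
    then show ?thesis by (auto simp: deg_part_def B_def)
  qed
  have "\<exists>!p. is_normal_form B J m p" for m
  proof -
    let ?k = "mdeg m"
    have "monom3 m \<in> cvs.span ((J \<inter> forms ?k) \<union> monom3 ` deg_part B ?k)"
      using Bk[rule_format, of ?k] single_in_forms[of m ?k 1] unfolding dB by auto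
    then obtain x y where xy: "monom3 m = x + y" "x \<in> cvs.span (J \<inter> forms ?k)" "y \<in> cvs.span (monom3 ` deg_part B ?k)"
      unfolding cvs.span_Un by (elim CollectE exE conjE) (rule that)
    have x: "x \<in> J" using xy(2) cvs.span_eq_iff[THEN iffD2, OF subspace_piece[OF sub, of ?k]] by simp
    obtain u where "y = (\<Sum>v\<in>monom3 ` deg_part B ?k. scale (u v) v)"
      using xy(3) unfolding cvs.span_finite[OF finite_imageI[OF finite_deg_part]] by (elim imageE) (rule that)
    then have y: "y = (\<Sum>b\<in>deg_part B ?k. scale (u (monom3 b)) (monom3 b))"
      by (simp add: sum.reindex[OF independent_mons(1)[OF finite_deg_part]])
    show ?thesis
    proof (rule hilb_coord_eq(1)[OF sub])
      show "monom3 m - (\<Sum>b\<in>deg_part B ?k. scale (u (monom3 b)) (monom3 b)) \<in> J"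
        using xy(1) x y by simp
      fix c assume "(\<Sum>b\<in>deg_part B ?k. scale (c b) (monom3 b)) \<in> J"
      with sum_deg_part_forms[of c B ?k] Bk[rule_format, of ?k]
      show "\<forall>b\<in>deg_part B ?k. c b = 0" unfolding dB by simp
    qed
  qed
  then show ?thesis by (intro exI[of _ B]) (simp add: hilb_chart_def)
qed

lemma topspace_hilb:
  assumes "\<And>J. J \<in> X \<Longrightarrow> homogeneous_ideal J"
  shows "topspace (zariski hilb_atlas X) = X"
proof (rule topspace_zariski)
  fix J assume "J \<in> X"
  from hilb_chart_exists[OF assms[OF this], of 0] obtain B where "J \<in> hilb_chart 0 B" by (elim exE)
  then show "\<exists>U C. (U, C) \<in> hilb_atlas \<and> J \<in> U" unfolding hilb_atlas_def by blast
qed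

text \<open>A chart involves only the degrees up to \<open>d\<close>, so the product of finitely
  many determinants can be used for all of them. On \<open>Y\<close>, where the dimensions are
  constant, the chart coordinates of \<open>J y\<close> are fractions of elements of
  \<open>R\<close>.\<close>

lemma family_chart:
  fixes g :: "'j \<Rightarrow> 'y \<Rightarrow> poly3"
  assumes R: "fun_algebra R" and I: "finite I"
    and gens: "\<forall>j\<in>I. \<forall>y. g j y \<in> forms (e j)"
    and coefs: "\<forall>j\<in>I. \<forall>m. (\<lambda>y. cf (g j y) m) \<in> R"
    and J: "\<forall>y. J y = idl.span ((\<lambda>j. g j y) ` I)"
    and ch: "J y0 \<in> hilb_chart d B"
    and dims: "\<forall>y\<in>Y. \<forall>k. cvs.dim (J y \<inter> forms k) = cvs.dim (J y0 \<inter> forms k)"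
  shows "\<exists>D\<in>R. D y0 \<noteq> 0 \<and> (\<forall>y\<in>Y. D y \<noteq> 0 \<longrightarrow> J y \<in> hilb_chart d B) \<and>
     (\<forall>m b. mdeg m \<le> d \<longrightarrow> (\<exists>N\<in>R. \<exists>Q\<in>R. \<forall>y. D y \<noteq> 0 \<longrightarrow> Q y \<noteq> 0 \<and>
        (y \<in> Y \<longrightarrow> hilb_coord B m b (J y) = N y / Q y)))"
proof -
  note J = J[rule_format]
  have hJ: "homogeneous_ideal (J y)" for y
    unfolding J by (rule idl_span_pieces(2)[where e = e]) (simp add: gens)
  note sub = homogeneous_idealD(1)[OF hJ]
  define G where "G = (\<lambda>k D. D \<in> R \<and> D y0 \<noteq> 0 \<and>
     (\<forall>m\<in>mons k. \<exists>X. (\<forall>b\<in>deg_part B k. X b \<in> R) \<and>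
        (\<forall>y. D y \<noteq> 0 \<longrightarrow> monom3 m - (\<Sum>b\<in>deg_part B k. scale (X b y / D y) (monom3 b)) \<in> J y)) \<and>
     (\<forall>y. D y \<noteq> 0 \<longrightarrow> cvs.dim (J y \<inter> forms k) = cvs.dim (J y0 \<inter> forms k) \<longrightarrow>
        (\<forall>c. (\<Sum>b\<in>deg_part B k. scale (c b) (monom3 b)) \<in> J y \<longrightarrow> (\<forall>b\<in>deg_part B k. c b = 0))))"
  have "\<forall>k\<in>{..d}. \<exists>D. G k D"
  proof
    fix k assume "k \<in> {..d}"
    then have k: "k \<le> d" by simp
    from family_degree[OF R I gens coefs deg_part_mons[of B k]
        hilb_chartD(1)[OF hJ ch k, unfolded J] hilb_chartD(3)[OF hJ ch k, unfolded J]]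
    show "\<exists>D. G k D" unfolding G_def J by (elim bexE conjE) (intro exI conjI)
  qed
  from bchoice[OF this] obtain Dk where Dk: "\<forall>k\<in>{..d}. G k (Dk k)" by (elim exE) (rule that)
  define D where "D = (\<lambda>y. \<Prod>k\<in>{..d}. Dk k y)"
  have D: "D \<in> R" unfolding D_def by (rule fun_algebra_prod[OF R]) (use Dk in \<open>simp add: G_def\<close>)
  have D0: "D y0 \<noteq> 0" using Dk by (simp add: D_def G_def)
  have Dk0: "Dk k y \<noteq> 0" if "D y \<noteq> 0" "k \<le> d" for k y using that by (auto simp: D_def)
  have nf: "\<exists>X. (\<forall>b\<in>deg_part B (mdeg m). X b \<in> R) \<and> (\<forall>y\<in>Y. D y \<noteq> 0 \<longrightarrow> (\<exists>!p. is_normal_form B (J y) m p) \<and>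
      (\<forall>b. hilb_coord B m b (J y) = (if b \<in> deg_part B (mdeg m) then X b y / Dk (mdeg m) y else 0)))"
    if m: "mdeg m \<le> d" for m
  proof -
    have Gm: "G (mdeg m) (Dk (mdeg m))" using Dk m by simp
    then have "\<exists>X. (\<forall>b\<in>deg_part B (mdeg m). X b \<in> R) \<and>
        (\<forall>y. Dk (mdeg m) y \<noteq> 0 \<longrightarrow> monom3 m - (\<Sum>b\<in>deg_part B (mdeg m). scale (X b y / Dk (mdeg m) y) (monom3 b)) \<in> J y)"
      unfolding G_def by (elim conjE) (erule bspec, simp add: mons_def)
    then obtain X where X: "\<forall>b\<in>deg_part B (mdeg m). X b \<in> R"
      "\<forall>y. Dk (mdeg m) y \<noteq> 0 \<longrightarrow> monom3 m - (\<Sum>b\<in>deg_part B (mdeg m). scale (X b y / Dk (mdeg m) y) (monom3 b)) \<in> J y"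
      by (elim exE conjE) (rule that)
    have "(\<exists>!p. is_normal_form B (J y) m p) \<and>
      (\<forall>b. hilb_coord B m b (J y) = (if b \<in> deg_part B (mdeg m) then X b y / Dk (mdeg m) y else 0))"
      if y: "y \<in> Y" "D y \<noteq> 0" for y
    proof -
      have d0: "Dk (mdeg m) y \<noteq> 0" by (rule Dk0[OF y(2) m])
      have x: "monom3 m - (\<Sum>b\<in>deg_part B (mdeg m). scale (X b y / Dk (mdeg m) y) (monom3 b)) \<in> J y"
        using X(2) d0 by simp
      have i: "\<forall>b\<in>deg_part B (mdeg m). c b = 0"
        if "(\<Sum>b\<in>deg_part B (mdeg m). scale (c b) (monom3 b)) \<in> J y" for c
        using Gm d0 dims y(1) that unfolding G_def by simp
      show ?thesis using hilb_coord_eq[OF sub x i] by simp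
    qed
    then show ?thesis using X(1) by (intro exI[of _ X]) simp
  qed
  have "\<forall>y\<in>Y. D y \<noteq> 0 \<longrightarrow> J y \<in> hilb_chart d B"
  proof (intro ballI impI)
    fix y assume y: "y \<in> Y" "D y \<noteq> 0"
    have "\<exists>!p. is_normal_form B (J y) m p" if "mdeg m \<le> d" for m
      using nf[OF that] y by (elim exE conjE) simp
    then show "J y \<in> hilb_chart d B" by (simp add: hilb_chart_def)
  qed
  moreover have "\<exists>N\<in>R. \<exists>Q\<in>R. \<forall>y. D y \<noteq> 0 \<longrightarrow> Q y \<noteq> 0 \<and>
        (y \<in> Y \<longrightarrow> hilb_coord B m b (J y) = N y / Q y)" if m: "mdeg m \<le> d" for m b
  proof -
    from nf[OF m] obtain X where X: "\<forall>b\<in>deg_part B (mdeg m). X b \<in> R"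
      "\<forall>y\<in>Y. D y \<noteq> 0 \<longrightarrow> (\<exists>!p. is_normal_form B (J y) m p) \<and>
      (\<forall>b. hilb_coord B m b (J y) = (if b \<in> deg_part B (mdeg m) then X b y / Dk (mdeg m) y else 0))"
      by (elim exE conjE) (rule that)
    let ?N = "\<lambda>y. if b \<in> deg_part B (mdeg m) then X b y else 0"
    have N: "?N \<in> R" using X(1) fun_algebra_const[OF R, of 0] by (cases "b \<in> deg_part B (mdeg m)") simp_all
    have Q: "Dk (mdeg m) \<in> R" using Dk m by (simp add: G_def)
    show ?thesis
      by (rule bexI[OF _ N], rule bexI[OF _ Q]) (use X(2) Dk0[OF _ m] in simp)
  qed
  ultimately show ?thesis using D0 by (intro bexI[OF _ D]) simp
qed

section \<open>Limits and reduced members of the smoothable component\<close>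

lemma Slip_subset_Hilb: "Slip r \<subseteq> Hilb r"
  unfolding Slip_def using closure_of_subset_topspace topspace_zariski_subset by (rule subset_trans)

lemma topspace_Hilb: "topspace (zariski hilb_atlas (Hilb r)) = Hilb r"
  by (rule topspace_hilb) (rule Hilb_homogeneous)

text \<open>By semicontinuity the graded pieces at 0 are not larger than those at small t, and
  \<open>upper\<close> says that they are not smaller, so the limit ideal has the right Hilbert
  function. Then the chart coordinates of the family are continuous at 0, and the limit lies in the
  closure of \<open>Slip r\<close>, which is \<open>Slip r\<close> itself.\<close>

lemma Slip_limit:
  fixes g :: "'j \<Rightarrow> complex \<Rightarrow> poly3"
  assumes I: "finite I"
    and gens: "\<forall>j\<in>I. \<forall>t. g j t \<in> forms (e j)"
    and coefs: "\<forall>j\<in>I. \<forall>m. isCont (\<lambda>t. cf (g j t) m) 0"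
    and mem: "\<forall>\<^sub>F t in at 0. idl.span ((\<lambda>j. g j t) ` I) \<in> Slip r"
    and upper: "\<And>k. cvs.dim (forms k) \<le> cvs.dim (idl.span ((\<lambda>j. g j 0) ` I) \<inter> forms k) + r"
  shows "idl.span ((\<lambda>j. g j 0) ` I) \<in> Slip r"
proof -
  define J where "J = (\<lambda>t. idl.span ((\<lambda>j. g j t) ` I))"
  let ?R = "{f :: complex \<Rightarrow> complex. isCont f 0}"
  note R = fun_algebra_continuous[of 0]
  have coefR: "\<forall>j\<in>I. \<forall>m. (\<lambda>t. cf (g j t) m) \<in> ?R" using coefs by simp
  have J: "\<forall>t. J t = idl.span ((\<lambda>j. g j t) ` I)" by (simp add: J_def)
  have hJ: "homogeneous_ideal (J t)" for t
    unfolding J_def by (rule idl_span_pieces(2)[where e = e]) (simp add: gens)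
  have ev0: "\<forall>\<^sub>F t in at 0. D t \<noteq> 0" if "D \<in> ?R" "D 0 \<noteq> 0" for D
  proof -
    have "(D \<longlongrightarrow> D 0) (at 0)" using that(1) by (simp add: isCont_def)
    from tendsto_imp_eventually_ne[OF this that(2)] show ?thesis .
  qed
  have "J 0 \<in> Hilb r"
    unfolding Hilb_iff
  proof (intro conjI allI hJ)
    fix k
    from monomial_complement_exists[OF subspace_piece[OF homogeneous_idealD(1)[OF hJ[of 0]]] Int_lower2, of k]
    obtain B where B: "B \<subseteq> mons k" "forms k \<subseteq> cvs.span (J 0 \<inter> forms k \<union> monom3 ` B)"
      "card B + cvs.dim (J 0 \<inter> forms k) = cvs.dim (forms k)" by (elim exE conjE) (rule that)
    from family_degree[OF R I gens coefR B(1) B(2)[unfolded J_def] B(3)[unfolded J_def], folded J[rule_format]]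
    obtain D where D: "D \<in> ?R" "D 0 \<noteq> 0"
      "\<forall>t. D t \<noteq> 0 \<longrightarrow> cvs.dim (J 0 \<inter> forms k) \<le> cvs.dim (J t \<inter> forms k)"
      by (elim bexE conjE) (rule that)
    have "\<forall>\<^sub>F t in at 0. J t \<in> Slip r \<and> D t \<noteq> 0"
      using mem ev0[OF D(1,2)] unfolding J_def by (rule eventually_conj)
    from eventually_happens'[OF _ this] obtain t where t: "J t \<in> Slip r" "D t \<noteq> 0" by auto
    have "cvs.dim (J t \<inter> forms k) + min r (cvs.dim (forms k)) = cvs.dim (forms k)"
      using subsetD[OF Slip_subset_Hilb t(1)] by (simp add: Hilb_iff)
    moreover have "cvs.dim (J 0 \<inter> forms k) \<le> cvs.dim (J t \<inter> forms k)" using D(3) t(2) by simp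
    moreover have "cvs.dim (forms k) \<le> cvs.dim (J 0 \<inter> forms k) + r" unfolding J_def by (rule upper)
    ultimately show "cvs.dim (J 0 \<inter> forms k) + min r (cvs.dim (forms k)) = cvs.dim (forms k)" by linarith
  qed
  let ?Y = "{t. J t \<in> Hilb r}"
  have dims: "\<forall>t\<in>?Y. \<forall>k. cvs.dim (J t \<inter> forms k) = cvs.dim (J 0 \<inter> forms k)"
    using \<open>J 0 \<in> Hilb r\<close> by (auto intro: Hilb_dim_eq)
  have evY: "\<forall>\<^sub>F t in at 0. t \<in> ?Y"
    using mem by (rule eventually_mono) (use Slip_subset_Hilb in \<open>auto simp: J_def\<close>)
  have "J 0 \<in> zariski hilb_atlas (Hilb r) closure_of (Slip r)"
  proof (rule in_zariski_closure[where x = J and G = "at 0"])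
    show "J 0 \<in> topspace (zariski hilb_atlas (Hilb r))" unfolding topspace_Hilb by fact
    show "\<forall>\<^sub>F t in at 0. J t \<in> Slip r" unfolding J_def by (rule mem)
    show "Slip r \<subseteq> Hilb r" by (rule Slip_subset_Hilb)
  next
    fix U C assume "(U, C) \<in> hilb_atlas" "J 0 \<in> U"
    then obtain d B where U: "U = hilb_chart d B" "J 0 \<in> hilb_chart d B" by (auto simp: hilb_atlas_def)
    from family_chart[OF R I gens coefR J U(2) dims]
    obtain D where D: "D \<in> ?R" "D 0 \<noteq> 0" "\<forall>t\<in>?Y. D t \<noteq> 0 \<longrightarrow> J t \<in> hilb_chart d B"
      by (elim bexE conjE) (rule that)
    show "\<forall>\<^sub>F t in at 0. J t \<in> U"
      using evY ev0[OF D(1,2)] by eventually_elim (use D(3) U(1) in simp)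
  next
    fix U C f assume "(U, C) \<in> hilb_atlas" "J 0 \<in> U" "f \<in> C"
    then obtain d B m b where U: "J 0 \<in> hilb_chart d B" "f = hilb_coord B m b" "mdeg m \<le> d"
      by (auto simp: hilb_atlas_def)
    from family_chart[OF R I gens coefR J U(1) dims]
    obtain D where D: "D \<in> ?R" "D 0 \<noteq> 0"
      "\<forall>m b. mdeg m \<le> d \<longrightarrow> (\<exists>N\<in>?R. \<exists>Q\<in>?R. \<forall>y. D y \<noteq> 0 \<longrightarrow> Q y \<noteq> 0 \<and>
        (y \<in> ?Y \<longrightarrow> hilb_coord B m b (J y) = N y / Q y))"
      by (elim bexE conjE) (rule that)
    from D(3)[rule_format, OF U(3), of b] obtain N Q where NQ: "N \<in> ?R" "Q \<in> ?R"
      "\<forall>y. D y \<noteq> 0 \<longrightarrow> Q y \<noteq> 0 \<and> (y \<in> ?Y \<longrightarrow> hilb_coord B m b (J y) = N y / Q y)"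
      by (elim bexE) (rule that)
    have Q0: "Q 0 \<noteq> 0" using NQ(3) D(2) by simp
    have f0: "f (J 0) = N 0 / Q 0" using NQ(3) D(2) \<open>J 0 \<in> Hilb r\<close> U(2) by simp
    have "((\<lambda>t. N t / Q t) \<longlongrightarrow> N 0 / Q 0) (at 0)"
      using NQ(1,2) Q0 by (intro tendsto_divide) (simp_all add: isCont_def)
    moreover have "\<forall>\<^sub>F t in at 0. N t / Q t = f (J t)"
      using evY ev0[OF D(1,2)] by eventually_elim (use NQ(3) U(2) in simp)
    ultimately show "((\<lambda>t. f (J t)) \<longlongrightarrow> f (J 0)) (at 0)"
      unfolding f0 by (rule Lim_transform_eventually)
  qed simp
  then show ?thesis by (simp add: Slip_def J_def)
qed

section \<open>Ideals of reduced points\<close>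

lemma P2_scale: "p \<in> P2 \<Longrightarrow> v \<in> p \<Longrightarrow> scale c v \<in> p"
  by (auto simp: P2_def proj_def intro: cvs.span_scale)

text \<open>Along the line through v, p becomes a polynomial in the scaling factor whose
  coefficients are the values of its components at v. Points are whole lines, so this polynomial
  vanishes identically.\<close>

lemma vanishing_ideal_homogeneous:
  assumes Z: "Z \<subseteq> P2" shows "homogeneous_ideal (vanishing_ideal Z)"
  unfolding homogeneous_ideal_def
proof (intro conjI ballI allI)
  show "idl.subspace (vanishing_ideal Z)"
    by (rule idl.subspaceI) (simp_all add: vanishing_ideal_def)
  fix p k assume p: "p \<in> vanishing_ideal Z"
  have "eval3 (component k p) v = 0" if "q \<in> Z" "v \<in> q" for q v
  proof (cases "k \<in> mdeg ` Poly_Mapping.keys p")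
    case True
    let ?K = "mdeg ` Poly_Mapping.keys p"
    define P where "P = (\<Sum>i\<in>?K. Polynomial.monom (eval3 (component i p) v) i)"
    have "poly P c = 0" for c
    proof -
      have "poly P c = (\<Sum>i\<in>?K. eval3 (component i p) (scale c v))"
        by (simp add: P_def poly_sum poly_monom eval3_homogeneous[OF component_forms] mult.commute)
      also have "\<dots> = eval3 (\<Sum>i\<in>?K. component i p) (scale c v)" by simp
      also have "\<dots> = eval3 p (scale c v)" by (simp flip: component_sum)
      also have "\<dots> = 0" using p that Z P2_scale[of q v c] by (auto simp: vanishing_ideal_def)
      finally show ?thesis .
    qed
    then have "P = 0" using poly_all_0_iff_0 by blast
    then have "poly.coeff P k = 0" by simp
    moreover have "poly.coeff P k = (\<Sum>i\<in>?K. if i = k then eval3 (component i p) v else 0)"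
      unfolding P_def coeff_sum by (intro sum.cong) simp_all
    ultimately show ?thesis using True by simp
  next
    case False
    then have "component k p = 0" by (intro poly_mapping_eqI) (auto simp: cf_component in_keys_iff)
    then show ?thesis by simp
  qed
  then show "component k p \<in> vanishing_ideal Z" by (simp add: vanishing_ideal_def)
qed

text \<open>The inclusion and the two estimates enclose the dimensions from both sides, so J
  coincides with the vanishing ideal of Z in every degree.\<close>

lemma Slip_reduced:
  assumes J: "homogeneous_ideal J" and Z: "Z \<subseteq> P2" "finite Z" "card Z = r"
    and JZ: "J \<subseteq> vanishing_ideal Z"
    and upper: "\<And>k. cvs.dim (forms k) \<le> cvs.dim (J \<inter> forms k) + r"
    and lower: "\<And>k. cvs.dim (vanishing_ideal Z \<inter> forms k) + min r (cvs.dim (forms k)) \<le> cvs.dim (forms k)"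
  shows "J \<in> Slip r"
proof -
  note hI = vanishing_ideal_homogeneous[OF Z(1)]
  have le: "cvs.dim (J \<inter> forms k) \<le> cvs.dim (vanishing_ideal Z \<inter> forms k)" for k
    by (rule dim_mono_fin[OF _ _ forms_fin(2)[of k]]) (use JZ forms_fin(1)[of k] in auto)
  have eq: "cvs.dim (J \<inter> forms k) + min r (cvs.dim (forms k)) = cvs.dim (forms k)"
    "cvs.dim (vanishing_ideal Z \<inter> forms k) \<le> cvs.dim (J \<inter> forms k)" for k
    using le[of k] upper[of k] lower[of k] by linarith+
  have "vanishing_ideal Z \<subseteq> J"
  proof (rule homogeneous_subset[OF hI homogeneous_idealD(1)[OF J]])
    fix k
    have "J \<inter> forms k = vanishing_ideal Z \<inter> forms k"
      by (rule subspace_eq_of_dim[OF subspace_piece[OF homogeneous_idealD(1)[OF J]] _ _ forms_fin(2)[of k] eq(2)])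
         (use JZ forms_fin(1)[of k] in auto)
    then show "vanishing_ideal Z \<inter> forms k \<subseteq> J" by auto
  qed
  with JZ have JI: "J = vanishing_ideal Z" by simp
  have JH: "J \<in> Hilb r" unfolding Hilb_iff using J eq(1) by simp
  let ?S = "{I \<in> Hilb r. \<exists>Z. Z \<subseteq> P2 \<and> finite Z \<and> card Z = r \<and> I = vanishing_ideal Z}"
  have "J \<in> ?S" using JH JI Z by auto
  moreover have "?S \<subseteq> zariski hilb_atlas (Hilb r) closure_of ?S"
    by (rule closure_of_subset) (auto simp: topspace_Hilb)
  ultimately show ?thesis unfolding Slip_def by (rule rev_subsetD)
qed

text \<open>Evaluation at one of the points isolates the coefficient of the form belonging to it, so
  the separating forms are independent modulo the vanishing ideal.\<close>

lemma separated_points_dim: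
  assumes "finite I" and Z: "Z = (\<lambda>i. cvs.span {v i}) ` I"
    and f: "\<And>i. i \<in> I \<Longrightarrow> f i \<in> forms k"
    and sep: "\<And>i j. i \<in> I \<Longrightarrow> j \<in> I \<Longrightarrow> (eval3 (f i) (v j) \<noteq> 0) \<longleftrightarrow> i = j"
    and sub: "Z \<subseteq> P2"
  shows "cvs.dim (vanishing_ideal Z \<inter> forms k) + card I \<le> cvs.dim (forms k)"
proof (rule vanishing_family_add_dim[OF subspace_piece Int_lower2 forms_fin assms(1) f])
  show "idl.subspace (vanishing_ideal Z)" by (rule homogeneous_idealD(1)[OF vanishing_ideal_homogeneous[OF sub]])
  fix c assume s: "(\<Sum>i\<in>I. scale (c i) (f i)) \<in> vanishing_ideal Z \<inter> forms k"
  show "\<forall>i\<in>I. c i = 0"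
  proof
    fix j assume j: "j \<in> I"
    have "eval3 (\<Sum>i\<in>I. scale (c i) (f i)) (v j) = 0"
      using s j cvs.span_base[of "v j" "{v j}"] by (auto simp: vanishing_ideal_def Z)
    also have "eval3 (\<Sum>i\<in>I. scale (c i) (f i)) (v j) = (\<Sum>i\<in>I. if i = j then c i * eval3 (f i) (v j) else 0)"
      unfolding eval3_sum by (intro sum.cong) (use sep j in auto)
    finally show "c j = 0" using assms(1) j sep[of j j] by simp
  qed
qed

section \<open>Border rank\<close>

lemma span_image_sum:
  assumes "x \<in> cvs.span (w ` I)" "finite I"
  shows "\<exists>c. x = (\<Sum>i\<in>I. scale (c i) (w i))"
  using assms(1)
proof (induction rule: cvs.span_induct_alt)
  case base
  show ?case by (rule exI[of _ "\<lambda>_. 0"]) simp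
next
  case (step c x y)
  then obtain k d where k: "k \<in> I" "x = w k" "y = (\<Sum>j\<in>I. scale (d j) (w j))" by blast
  have "(\<Sum>j\<in>I. scale (if j = k then c else 0) (w j)) = (\<Sum>j\<in>I. if j = k then scale c (w j) else 0)"
    by (intro sum.cong) auto
  then have "scale c x = (\<Sum>j\<in>I. scale (if j = k then c else 0) (w j))" using k assms(2) by simp
  then have "scale c x + y = (\<Sum>j\<in>I. scale ((if j = k then c else 0) + d j) (w j))"
    by (simp add: k(3) cvs.scale_left_distrib sum.distrib)
  then show ?case by (rule exI[of _ "\<lambda>j. (if j = k then c else 0) + d j"])
qed

lemma coord_ratio_span:
  assumes "cf v i \<noteq> 0" shows "coord_ratio i j (cvs.span {v}) = cf v j / cf v i"
  unfolding coord_ratio_def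
proof (rule the_equality)
  show "\<forall>u\<in>cvs.span {v}. cf u j = cf v j / cf v i * cf u i"
    using assms by (auto simp: cvs.span_singleton)
next
  fix c assume "\<forall>u\<in>cvs.span {v}. cf u j = c * cf u i"
  then have "cf v j = c * cf v i" using cvs.span_base[of v "{v}"] by simp
  then show "c = cf v j / cf v i" using assms by simp
qed

lemma chart_span_iff: "(\<exists>u\<in>cvs.span {v}. cf u i \<noteq> 0) \<longleftrightarrow> cf v i \<noteq> (0::complex)"
  by (auto simp: cvs.span_singleton intro: exI[of _ 1])

lemma topspace_proj: "topspace (zariski proj_atlas (proj V)) = proj V"
proof (rule topspace_zariski)
  fix p assume "p \<in> proj V"
  then obtain v where v: "p = cvs.span {v}" "v \<noteq> 0" by (auto simp: proj_def)
  from v(2) obtain i where "cf v i \<noteq> 0" by (metis lookup_zero poly_mapping_eqI)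
  then have "p \<in> {p. \<exists>v\<in>p. cf v i \<noteq> 0}" using v chart_span_iff[of v i] by simp
  moreover have "({p. \<exists>v\<in>p. cf v i \<noteq> 0}, range (\<lambda>j. coord_ratio i j)) \<in> proj_atlas"
    unfolding proj_atlas_def by blast
  ultimately show "\<exists>U C. (U, C) \<in> proj_atlas \<and> p \<in> U" by (intro exI conjI)
qed

text \<open>\<open>c = 0\<close> and \<open>l = 0\<close> are allowed, so r is an upper bound for
  the number of cubes. This is the affine cone over the points of the open part of the secant
  variety.\<close>

primrec sumcubes :: "nat \<Rightarrow> poly3 \<Rightarrow> bool" where
  "sumcubes 0 G \<longleftrightarrow> G = 0"
| "sumcubes (Suc r) G \<longleftrightarrow> (\<exists>H c l. sumcubes r H \<and> G = H + const3 c * linear_form l ^ 3)"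

lemma sumcubes_Suc: "sumcubes r G \<Longrightarrow> sumcubes (Suc r) G"
  unfolding sumcubes.simps(2) by (intro exI[of _ G] exI[of _ 0]) simp

lemma sumcubes_mono: assumes "r \<le> s" "sumcubes r G" shows "sumcubes s G"
  using assms by (induction s rule: dec_induct) (auto intro: sumcubes_Suc simp del: sumcubes.simps)

lemma sumcubes_add: assumes "sumcubes r F" "sumcubes s G" shows "sumcubes (r + s) (F + G)"
  using assms(2)
proof (induction s arbitrary: G)
  case (Suc s)
  then obtain H c l where "sumcubes s H" "G = H + const3 c * linear_form l ^ 3" by auto
  with Suc.IH[of H] have "sumcubes (r + s) (F + H)" "F + G = (F + H) + const3 c * linear_form l ^ 3"
    by (simp_all add: add.assoc)
  then show ?case unfolding add_Suc_right sumcubes.simps(2) by (intro exI conjI)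
qed (use assms(1) in simp)

lemma sumcubes_forms: "sumcubes r G \<Longrightarrow> G \<in> forms 3"
proof (induction r arbitrary: G)
  case (Suc r)
  then obtain H c l where "H \<in> forms 3" "G = H + const3 c * linear_form l ^ 3" by auto
  then show ?case using forms_power[OF linear_form_forms(1), of l 3] by (auto intro: forms_add forms_const_mult)
qed simp

lemma sumcubes_sum: "sumcubes r (\<Sum>i<r. const3 (c i) * linear_form (l i) ^ 3)"
  by (induction r) auto

lemma veronese3_span: "veronese3 (cvs.span {u}) = cvs.span {linear_form u ^ 3}"
proof
  have "linear_form v ^ 3 \<in> cvs.span {linear_form u ^ 3}" if "v \<in> cvs.span {u}" for v
  proof -
    from that obtain c where "v = scale c u" by (auto simp: cvs.span_singleton)
    then have "linear_form v ^ 3 = scale (c ^ 3) (linear_form u ^ 3)"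
      by (simp add: linear_form_scale scale_const3 power_mult_distrib const3_power)
    then show ?thesis by (simp add: cvs.span_base cvs.span_scale)
  qed
  then show "veronese3 (cvs.span {u}) \<subseteq> cvs.span {linear_form u ^ 3}"
    unfolding veronese3_def by (intro cvs.span_minimal cvs.subspace_span) auto
  show "cvs.span {linear_form u ^ 3} \<subseteq> veronese3 (cvs.span {u})"
    unfolding veronese3_def by (intro cvs.span_mono) (auto intro: cvs.span_base)
qed

definition secant_points :: "nat \<Rightarrow> poly3 set set" where
  "secant_points r = {q \<in> proj (forms 3). \<exists>p :: nat \<Rightarrow> poly3 set.
        (\<forall>i<r. p i \<in> veronese3 ` P2) \<and> q \<subseteq> cvs.span (\<Union>i<r. p i)}"

lemma secant_points_iff:
  assumes "G \<noteq> 0" shows "cvs.span {G} \<in> secant_points r \<longleftrightarrow> sumcubes r G"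
proof
  assume "cvs.span {G} \<in> secant_points r"
  then obtain p where p: "\<forall>i<r. p i \<in> veronese3 ` P2" "cvs.span {G} \<subseteq> cvs.span (\<Union>i<r. p i)"
    unfolding secant_points_def by blast
  have "\<forall>i\<in>{..<r}. \<exists>u. p i = cvs.span {linear_form u ^ 3}"
  proof
    fix i assume "i \<in> {..<r}"
    with p(1) obtain q where "q \<in> P2" "p i = veronese3 q" by auto
    then show "\<exists>u. p i = cvs.span {linear_form u ^ 3}" by (auto simp: P2_def proj_def veronese3_span)
  qed
  from bchoice[OF this] obtain u where u: "\<forall>i\<in>{..<r}. p i = cvs.span {linear_form (u i) ^ 3}"
    by (elim exE) (rule that)
  have "(\<Union>i<r. p i) \<subseteq> cvs.span ((\<lambda>i. linear_form (u i) ^ 3) ` {..<r})"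
  proof (rule UN_least)
    fix i assume i: "i \<in> {..<r}"
    show "p i \<subseteq> cvs.span ((\<lambda>i. linear_form (u i) ^ 3) ` {..<r})"
      using bspec[OF u i] i by (auto intro!: cvs.span_mono)
  qed
  then have "cvs.span (\<Union>i<r. p i) \<subseteq> cvs.span ((\<lambda>i. linear_form (u i) ^ 3) ` {..<r})"
    by (rule cvs.span_minimal) (rule cvs.subspace_span)
  then have "G \<in> cvs.span ((\<lambda>i. linear_form (u i) ^ 3) ` {..<r})"
    using p(2) cvs.span_base[of G "{G}"] by auto
  from span_image_sum[OF this] obtain c where "G = (\<Sum>i<r. scale (c i) (linear_form (u i) ^ 3))" by auto
  then show "sumcubes r G" using sumcubes_sum[of r c u] by (simp add: scale_const3)
next
  assume G: "sumcubes r G"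
  have "\<exists>p :: nat \<Rightarrow> poly3 set. (\<forall>i<r. p i \<in> veronese3 ` P2) \<and> G \<in> cvs.span (\<Union>i<r. p i)"
    using G
  proof (induction r arbitrary: G)
    case 0
    then show ?case by (simp add: cvs.span_zero)
  next
    case (Suc r)
    then obtain H c l where H: "sumcubes r H" "G = H + const3 c * linear_form l ^ 3" by auto
    obtain p where p: "\<forall>i<r. p i \<in> veronese3 ` P2" "H \<in> cvs.span (\<Union>i<r. p i)"
      using Suc.IH[OF H(1)] by blast
    \<comment> \<open>The zero vector is not a point of the plane; its cube is 0 and lies in the
      span of any other cube.\<close>
    define l' where "l' = (if l = 0 then v3 1 0 0 else l)"
    have "v3 1 0 0 \<noteq> 0" using cf_v3(1)[of 1 0 0] by (metis lookup_zero zero_neq_one)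
    then have "l' \<noteq> 0" by (simp add: l'_def)
    then have P: "cvs.span {l'} \<in> P2" by (auto simp: P2_def proj_def)
    let ?p = "p(r := veronese3 (cvs.span {l'}))"
    have "linear_form l ^ 3 \<in> ?p r"
    proof (cases "l = 0")
      case True
      then show ?thesis by (simp add: veronese3_span cvs.span_zero)
    next
      case False
      then show ?thesis by (simp add: veronese3_span l'_def cvs.span_base)
    qed
    then have "linear_form l ^ 3 \<in> cvs.span (\<Union>i<Suc r. ?p i)" by (intro cvs.span_base) auto
    from cvs.span_scale[OF this, of c]
    have "const3 c * linear_form l ^ 3 \<in> cvs.span (\<Union>i<Suc r. ?p i)" by (simp add: scale_const3)
    moreover have "(\<Union>i<r. p i) \<subseteq> (\<Union>i<Suc r. ?p i)" by (auto intro!: bexI less_SucI)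
    then have "H \<in> cvs.span (\<Union>i<Suc r. ?p i)" using p(2) cvs.span_mono by blast
    ultimately have "G \<in> cvs.span (\<Union>i<Suc r. ?p i)" unfolding H(2) by (intro cvs.span_add)
    moreover have "\<forall>i<Suc r. ?p i \<in> veronese3 ` P2" using p(1) P by (auto simp: less_Suc_eq)
    ultimately show ?case by (intro exI[of _ ?p] conjI)
  qed
  then obtain p :: "nat \<Rightarrow> poly3 set" where p: "\<forall>i<r. p i \<in> veronese3 ` P2" "G \<in> cvs.span (\<Union>i<r. p i)" by blast
  have "cvs.span {G} \<subseteq> cvs.span (\<Union>i<r. p i)" using p(2) by (intro cvs.span_minimal cvs.subspace_span) simp
  moreover have "cvs.span {G} \<in> proj (forms 3)"
    using assms sumcubes_forms[OF G] by (auto simp: proj_def)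
  ultimately show "cvs.span {G} \<in> secant_points r" unfolding secant_points_def using p(1) by blast
qed

lemma secant_variety_eq: "secant_variety r = zariski proj_atlas (proj (forms 3)) closure_of (secant_points r)"
  by (simp add: secant_variety_def secant_points_def)

text \<open>The filter \<open>at 0\<close> leaves out t = 0, so \<open>F\<close> itself may require
  more than r cubes.\<close>

definition limcubes :: "nat \<Rightarrow> poly3 \<Rightarrow> bool" where
  "limcubes r F \<longleftrightarrow> (\<exists>G :: complex \<Rightarrow> poly3. (\<forall>m. isCont (\<lambda>t. cf (G t) m) 0) \<and> G 0 = F \<and>
     (\<forall>\<^sub>F t in at 0. sumcubes r (G t)))"

lemma limcubes_secant:
  assumes "limcubes r F" "F \<in> forms 3" "F \<noteq> 0"
  shows "cvs.span {F} \<in> secant_variety r"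
proof -
  from assms(1) obtain G :: "complex \<Rightarrow> poly3" where G: "\<forall>m. isCont (\<lambda>t. cf (G t) m) 0" "G 0 = F"
    "\<forall>\<^sub>F t in at 0. sumcubes r (G t)" unfolding limcubes_def by blast
  have lim: "((\<lambda>t. cf (G t) m) \<longlongrightarrow> cf F m) (at 0)" for m using G(1,2) by (auto simp: isCont_def)
  have ev: "\<forall>\<^sub>F t in at 0. cf (G t) m \<noteq> 0" if "cf F m \<noteq> 0" for m
    by (rule tendsto_imp_eventually_ne[OF lim that])
  from assms(3) obtain i where i: "cf F i \<noteq> 0" by (metis lookup_zero poly_mapping_eqI)
  show ?thesis
    unfolding secant_variety_eq
  proof (rule in_zariski_closure[where x = "\<lambda>t. cvs.span {G t}" and G = "at 0"])
    show "cvs.span {F} \<in> topspace (zariski proj_atlas (proj (forms 3)))"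
      unfolding topspace_proj using assms by (auto simp: proj_def)
    show "\<forall>\<^sub>F t in at 0. cvs.span {G t} \<in> secant_points r"
      using G(3) ev[OF i]
    proof eventually_elim
      case (elim t)
      then have "G t \<noteq> 0" by auto
      then show ?case using elim(1) by (simp add: secant_points_iff)
    qed
    show "secant_points r \<subseteq> proj (forms 3)" by (auto simp: secant_points_def)
  next
    fix U C assume "(U, C) \<in> proj_atlas" "cvs.span {F} \<in> U"
    then obtain j where U: "U = {p. \<exists>v\<in>p. cf v j \<noteq> 0}" and "cf F j \<noteq> 0"
      unfolding proj_atlas_def using chart_span_iff[of F] by blast
    from ev[OF this(2)] show "\<forall>\<^sub>F t in at 0. cvs.span {G t} \<in> U"
      by (rule eventually_mono) (simp add: U chart_span_iff)
  next
    fix U C f assume "(U, C) \<in> proj_atlas" "cvs.span {F} \<in> U" "f \<in> C"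
    then obtain j k where f: "f = coord_ratio j k" and j: "cf F j \<noteq> 0"
      unfolding proj_atlas_def using chart_span_iff[of F] by blast
    have "((\<lambda>t. cf (G t) k / cf (G t) j) \<longlongrightarrow> cf F k / cf F j) (at 0)"
      by (intro tendsto_divide lim j)
    moreover have "\<forall>\<^sub>F t in at 0. cf (G t) k / cf (G t) j = f (cvs.span {G t})"
      using ev[OF j] by eventually_elim (simp add: f coord_ratio_span)
    ultimately show "((\<lambda>t. f (cvs.span {G t})) \<longlongrightarrow> f (cvs.span {F})) (at 0)"
      unfolding f coord_ratio_span[OF j] by (rule Lim_transform_eventually)
  qed simp
qed

abbreviation coef_poly :: "(poly3 \<Rightarrow> complex) \<Rightarrow> bool" where
  "coef_poly \<phi> \<equiv> \<phi> \<in> generated_algebra (range (\<lambda>m G. cf G m))"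

text \<open>On the i-th chart each line has a representative whose i-th coefficient is 1, and the
  coefficients of this representative are the chart coordinates.\<close>

lemma coef_poly_dehomogenize:
  assumes "coef_poly \<phi>"
  shows "\<exists>\<phi>'\<in>generated_algebra (range (\<lambda>j. coord_ratio i j)).
     \<forall>G. cf G i \<noteq> 0 \<longrightarrow> \<phi>' (cvs.span {G}) = \<phi> (scale (1 / cf G i) G)"
  using assms
proof induction
  case (const c)
  show ?case by (rule bexI[OF _ generated_algebra.const[of c]]) simp
next
  case (coord f)
  then obtain m where f: "f = (\<lambda>G. cf G m)" by auto
  have c: "coord_ratio i m \<in> generated_algebra (range (\<lambda>j. coord_ratio i j))"
    by (rule generated_algebra.coord) simp
  show ?case by (rule bexI[OF _ c]) (simp add: f coord_ratio_span)
next
  case (add f g)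
  from add.IH obtain f' g' where
    h: "f' \<in> generated_algebra (range (\<lambda>j. coord_ratio i j))"
       "\<forall>G. cf G i \<noteq> 0 \<longrightarrow> f' (cvs.span {G}) = f (scale (1 / cf G i) G)"
       "g' \<in> generated_algebra (range (\<lambda>j. coord_ratio i j))"
       "\<forall>G. cf G i \<noteq> 0 \<longrightarrow> g' (cvs.span {G}) = g (scale (1 / cf G i) G)"
    by (elim bexE) (rule that)
  show ?case by (rule bexI[OF _ generated_algebra.add[OF h(1,3)]]) (use h in simp)
next
  case (mult f g)
  from mult.IH obtain f' g' where
    h: "f' \<in> generated_algebra (range (\<lambda>j. coord_ratio i j))"
       "\<forall>G. cf G i \<noteq> 0 \<longrightarrow> f' (cvs.span {G}) = f (scale (1 / cf G i) G)"
       "g' \<in> generated_algebra (range (\<lambda>j. coord_ratio i j))"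
       "\<forall>G. cf G i \<noteq> 0 \<longrightarrow> g' (cvs.span {G}) = g (scale (1 / cf G i) G)"
    by (elim bexE) (rule that)
  show ?case by (rule bexI[OF _ generated_algebra.mult[OF h(1,3)]]) (use h in simp)
qed

text \<open>By homogeneity the nonvanishing of the polynomial makes sense on lines. It defines an
  open neighbourhood of \<open>F\<close> that contains no point spanned by r cubes.\<close>

lemma not_in_secant:
  assumes \<phi>: "coef_poly \<phi>" and hom: "\<And>c G. \<phi> (scale c G) = c ^ n * \<phi> G"
    and van: "\<And>G. sumcubes r G \<Longrightarrow> \<phi> G = 0" and F: "\<phi> F \<noteq> 0" "F \<noteq> 0"
  shows "cvs.span {F} \<notin> secant_variety r"
proof
  assume cl: "cvs.span {F} \<in> secant_variety r"
  from F(2) obtain i where i: "cf F i \<noteq> 0" by (metis lookup_zero poly_mapping_eqI)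
  from coef_poly_dehomogenize[OF \<phi>, of i] obtain \<phi>' where
    \<phi>': "\<phi>' \<in> generated_algebra (range (\<lambda>j. coord_ratio i j))"
        "\<forall>G. cf G i \<noteq> 0 \<longrightarrow> \<phi>' (cvs.span {G}) = \<phi> (scale (1 / cf G i) G)"
    by (elim bexE) (rule that)
  have val: "\<phi>' (cvs.span {G}) = (1 / cf G i) ^ n * \<phi> G" if "cf G i \<noteq> 0" for G
    using \<phi>'(2) that hom by simp
  let ?U = "{p. \<exists>v\<in>p. cf v i \<noteq> 0}"
  let ?W = "{p \<in> proj (forms 3) \<inter> ?U. \<phi>' p \<noteq> 0}"
  have "openin (zariski proj_atlas (proj (forms 3))) ?W"
    by (rule openin_zariski_basic[OF _ \<phi>'(1)]) (auto simp: proj_atlas_def)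
  moreover have "cvs.span {F} \<in> ?W"
  proof -
    have "cvs.span {F} \<in> proj (forms 3)"
      using subsetD[OF closure_of_subset_topspace cl[unfolded secant_variety_eq]] by (simp add: topspace_proj)
    then show ?thesis using F i val[OF i] by (simp add: chart_span_iff)
  qed
  ultimately have W: "cvs.span {F} \<in> ?W \<and> openin (zariski proj_atlas (proj (forms 3))) ?W" by (intro conjI)
  from cl have "\<forall>T. cvs.span {F} \<in> T \<and> openin (zariski proj_atlas (proj (forms 3))) T \<longrightarrow>
      (\<exists>y. y \<in> secant_points r \<and> y \<in> T)"
    unfolding secant_variety_eq in_closure_of by (rule conjunct2)
  from spec[OF this, of ?W, THEN mp, OF W] obtain q where q: "q \<in> secant_points r" "q \<in> ?W" by (elim exE conjE)
  then obtain G where G: "q = cvs.span {G}" "G \<noteq> 0" by (auto simp: proj_def)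
  then have "sumcubes r G" using q(1) by (simp add: secant_points_iff)
  then have "\<phi> G = 0" by (rule van)
  moreover have "cf G i \<noteq> 0" using q(2) by (simp add: G chart_span_iff)
  ultimately have "\<phi>' q = 0" using val by (simp add: G)
  with q(2) show False by simp
qed

lemma border_rankI:
  assumes \<phi>: "coef_poly \<phi>" "\<And>c G. \<phi> (scale c G) = c ^ n * \<phi> G"
    "\<And>G. sumcubes r G \<Longrightarrow> \<phi> G = 0" "\<phi> F \<noteq> 0"
    and F: "F \<in> forms 3" "F \<noteq> 0" "limcubes (Suc r) F"
  shows "border_rank F = Suc r"
  unfolding border_rank_def
proof (rule Least_equality)
  show "cvs.span {F} \<in> secant_variety (Suc r)" by (rule limcubes_secant[OF F(3,1,2)])
  fix s assume s: "cvs.span {F} \<in> secant_variety s"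
  show "Suc r \<le> s"
  proof (rule ccontr)
    assume "\<not> Suc r \<le> s"
    then have "s \<le> r" by simp
    have "cvs.span {F} \<notin> secant_variety s"
      by (rule not_in_secant[OF \<phi>(1,2) _ \<phi>(4) F(2)]) (rule \<phi>(3)[OF sumcubes_mono[OF \<open>s \<le> r\<close>]])
    with s show False by simp
  qed
qed

subsection \<open>Limits of sums of cubes\<close>

lemma limcubes_sumcubes: "sumcubes r F \<Longrightarrow> limcubes r F"
  unfolding limcubes_def by (rule exI[of _ "\<lambda>_. F"]) simp

lemma limcubes_add:
  assumes "limcubes r F" "limcubes s G" shows "limcubes (r + s) (F + G)"
proof -
  from assms(1) obtain A :: "complex \<Rightarrow> poly3" where A: "\<forall>m. isCont (\<lambda>t. cf (A t) m) 0" "A 0 = F"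
    "\<forall>\<^sub>F t in at 0. sumcubes r (A t)" unfolding limcubes_def by blast
  from assms(2) obtain B :: "complex \<Rightarrow> poly3" where B: "\<forall>m. isCont (\<lambda>t. cf (B t) m) 0" "B 0 = G"
    "\<forall>\<^sub>F t in at 0. sumcubes s (B t)" unfolding limcubes_def by blast
  have "\<forall>\<^sub>F t in at 0. sumcubes (r + s) (A t + B t)"
    using A(3) B(3) by eventually_elim (rule sumcubes_add)
  then show ?thesis
    unfolding limcubes_def using A(1,2) B(1,2) by (intro exI[of _ "\<lambda>t. A t + B t"]) (simp add: lookup_add)
qed

lemma eventually_at_0_neq: "\<forall>\<^sub>F t in at 0. t \<noteq> (0::complex)"
  by (simp add: eventually_at_filter)

lemma cube_sumcubes: "sumcubes 1 (const3 c * linear_form u ^ 3)"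
  by (simp, rule exI[of _ c], rule exI[of _ u], simp)

lemma cube_difference:
  fixes x y C E :: "'a::comm_ring_1"
  shows "E * (x + C * y) ^ 3 - E * x ^ 3 = (3 * E * C) * (x ^ 2 * y) + (3 * E * C ^ 2) * (x * y ^ 2) + (E * C ^ 3) * y ^ 3"
  by (simp add: power2_eq_square power3_eq_cube algebra_simps)

text \<open>With x, y the forms of \<open>u\<close>, \<open>v\<close>: x^2 y is tangent to the cone
  of cubes, the limit of ((x + t y)^3 - x^3) / (3 t).\<close>

lemma limcubes_square_times:
  "limcubes 2 (linear_form u ^ 2 * linear_form v)"
proof -
  let ?x = "linear_form u" and ?y = "linear_form v"
  let ?G = "\<lambda>t. ?x ^ 2 * ?y + const3 t * (?x * ?y ^ 2) + const3 (t ^ 2 / 3) * ?y ^ 3"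
  have "sumcubes 2 (?G t)" if t: "t \<noteq> 0" for t
  proof -
    let ?e = "1 / (3 * t)"
    have e: "3 * const3 ?e * const3 t = 1" "3 * const3 ?e * const3 t ^ 2 = const3 t"
      "const3 ?e * const3 t ^ 3 = const3 (t ^ 2 / 3)"
      unfolding const3_simps(3)[symmetric] const3_power[symmetric] const3_mult[symmetric]
      using t by (simp_all add: power2_eq_square power3_eq_cube)
    have "?G t = const3 ?e * linear_form (u + scale t v) ^ 3 + const3 (- ?e) * ?x ^ 3"
      using cube_difference[of "const3 ?e" ?x "const3 t" ?y] unfolding e
      by (simp add: linear_form_add linear_form_scale const3_minus)
    then show ?thesis
      using sumcubes_add[OF cube_sumcubes[of ?e "u + scale t v"] cube_sumcubes[of "- ?e" u]]
      by (simp only: one_add_one)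
  qed
  then have "\<forall>\<^sub>F t in at 0. sumcubes 2 (?G t)" using eventually_at_0_neq by (rule eventually_mono[rotated])
  moreover have "isCont (\<lambda>t. cf (?G t) m) 0" for m
    unfolding lookup_add cf_const_mult by (intro continuous_intros) simp
  ultimately show ?thesis unfolding limcubes_def by (intro exI[of _ ?G]) simp
qed

lemma cube_second_difference:
  fixes x y z C E :: "'a::comm_ring_1"
  shows "E * (x + C * y + C ^ 2 * z) ^ 3 + E * (x - C * y + C ^ 2 * z) ^ 3 - 2 * E * x ^ 3 =
     (6 * E * C ^ 2) * (x ^ 2 * z + x * y ^ 2) + (6 * E * C ^ 4) * (x * z ^ 2 + z * y ^ 2) + (2 * E * C ^ 6) * z ^ 3"
  by (simp add: eval_nat_numeral algebra_simps)

text \<open>The cubes are taken at the parameters t, -t, 0 of the conic x + t y + t^2 z; their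
  second difference divided by 6 t^2 tends to x^2 z + x y^2.\<close>

lemma limcubes_conic_tangent:
  "limcubes 3 (linear_form u ^ 2 * linear_form w + linear_form u * linear_form v ^ 2)"
proof -
  let ?x = "linear_form u" and ?y = "linear_form v" and ?z = "linear_form w"
  let ?G = "\<lambda>t. ?x ^ 2 * ?z + ?x * ?y ^ 2 + const3 (t ^ 2) * (?x * ?z ^ 2 + ?z * ?y ^ 2) + const3 (t ^ 4 / 3) * ?z ^ 3"
  have "sumcubes 3 (?G t)" if t: "t \<noteq> 0" for t
  proof -
    let ?e = "1 / (6 * t ^ 2)"
    let ?p = "u + scale t v + scale (t ^ 2) w" and ?q = "u + scale (- t) v + scale (t ^ 2) w"
    have e: "6 * const3 ?e * const3 t ^ 2 = 1" "6 * const3 ?e * const3 t ^ 4 = const3 (t ^ 2)"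
      "2 * const3 ?e * const3 t ^ 6 = const3 (t ^ 4 / 3)"
      unfolding const3_simps(3)[symmetric] const3_power[symmetric] const3_mult[symmetric]
      using t by (simp_all add: eval_nat_numeral)
    have m: "const3 (- 2 * ?e) = - (2 * const3 ?e)"
      unfolding const3_simps(3)[symmetric] const3_mult[symmetric] const3_minus[symmetric] by simp
    have "?G t = const3 ?e * linear_form ?p ^ 3 + const3 ?e * linear_form ?q ^ 3 + const3 (- 2 * ?e) * ?x ^ 3"
      using cube_second_difference[of "const3 ?e" ?x "const3 t" ?y ?z] unfolding e m
      by (simp add: linear_form_add linear_form_diff linear_form_scale const3_minus const3_power)
    then show ?thesis
      using sumcubes_add[OF sumcubes_add[OF cube_sumcubes[of ?e ?p] cube_sumcubes[of ?e ?q]] cube_sumcubes[of "- 2 * ?e" u]]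
      by (simp only: one_add_one numeral_plus_one semiring_norm)
  qed
  then have "\<forall>\<^sub>F t in at 0. sumcubes 3 (?G t)" using eventually_at_0_neq by (rule eventually_mono[rotated])
  moreover have "isCont (\<lambda>t. cf (?G t) m) 0" for m
    unfolding lookup_add cf_const_mult by (intro continuous_intros) simp_all
  ultimately show ?thesis unfolding limcubes_def by (intro exI[of _ ?G]) simp
qed

subsection \<open>Polynomials vanishing on sums of few cubes\<close>

text \<open>For a cubic this is six times its polarization, a symmetric trilinear form. Its values
  on a frame are, up to factorials, the coefficients of the cubic in the dual coordinates.\<close>

definition val3 :: "(3 \<Rightarrow>\<^sub>0 complex) \<Rightarrow> (3 \<Rightarrow>\<^sub>0 complex) \<Rightarrow> (3 \<Rightarrow>\<^sub>0 complex) \<Rightarrow> poly3 \<Rightarrow> complex" where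
  "val3 a b c G = cf (D a (D b (D c G))) 0"

lemma val3_linear: "val3 a b c (F + G) = val3 a b c F + val3 a b c G"
  "val3 a b c (scale k G) = k * val3 a b c G" "val3 a b c (const3 k * G) = k * val3 a b c G"
  "val3 a b c 0 = 0"
  by (simp_all add: val3_def D_add D_scale D_const_mult lookup_add)

lemma D_cube: "D a (D b (D c (linear_form l ^ 3))) = const3 (6 * dot a l * dot b l * dot c l)"
proof -
  have 1: "D c (linear_form l ^ 3) = const3 (3 * dot c l) * linear_form l ^ 2"
    unfolding D_power3 D_linear_form const3_mult const3_simps by (simp only: mult.assoc mult.commute[of "const3 (dot c l)"])
  have 2: "D b (const3 k * linear_form l ^ 2) = const3 (k * 2 * dot b l) * linear_form l" for k
    unfolding D_const_mult D_power2 D_linear_form const3_mult const3_simps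
    by (simp only: mult.assoc mult.commute[of "const3 (dot b l)"])
  have 3: "D a (const3 k * linear_form l) = const3 (k * dot a l)" for k
    unfolding D_const_mult D_linear_form const3_mult ..
  show ?thesis unfolding 1 2 3 by (simp add: mult_ac)
qed

lemma val3_cube [simp]: "val3 a b c (linear_form l ^ 3) = 6 * dot a l * dot b l * dot c l"
  by (simp add: val3_def D_cube)

lemma coef_poly_val3: "coef_poly (val3 a b c)"
proof -
  let ?\<psi> = "linear_form a * linear_form b * linear_form c"
  let ?K = "\<lambda>m. pochhammer 1 (cf m 0) * pochhammer 1 (cf m 1) * pochhammer 1 (cf m 2) :: complex"
  have "val3 a b c = (\<lambda>G. \<Sum>m\<in>Poly_Mapping.keys ?\<psi>. (cf ?\<psi> m * ?K m) * cf G m)"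
  proof
    fix G
    have "val3 a b c G = cf (diff_action ?\<psi> G) 0" by (simp add: val3_def diff_action_mult)
    also have "\<dots> = (\<Sum>m\<in>Poly_Mapping.keys ?\<psi>. (cf ?\<psi> m * ?K m) * cf G m)"
      unfolding diff_action_def lookup_sum lookup_scale cf_mon_action_0 by (intro sum.cong refl) (simp only: mult.assoc)
    finally show "val3 a b c G = (\<Sum>m\<in>Poly_Mapping.keys ?\<psi>. (cf ?\<psi> m * ?K m) * cf G m)" .
  qed
  also have "coef_poly \<dots>"
    by (intro fun_algebra_sum[OF fun_algebra_generated] fun_algebra_cmult[OF fun_algebra_generated] generated_algebra.coord) simp
  finally show ?thesis .
qed

lemma border_rank_eq_1:
  assumes "frame a b c u v w" "F = linear_form u ^ 3"
  shows "border_rank F = 1"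
proof -
  have "border_rank F = Suc 0"
  proof (rule border_rankI[where \<phi> = "val3 a a a" and n = 1])
    show F3: "val3 a a a F \<noteq> 0" using assms by (simp add: frame_def)
    then show "F \<noteq> 0" by (auto simp: val3_linear)
    have "sumcubes 1 F" using cube_sumcubes[of 1 u] assms by simp
    then show "F \<in> forms 3" "limcubes (Suc 0) F" by (auto intro: sumcubes_forms limcubes_sumcubes simp del: sumcubes.simps)
  qed (simp_all add: coef_poly_val3 val3_linear)
  then show ?thesis by simp
qed

text \<open>The polynomial is a 2 by 2 minor of the catalecticant from conics to linear forms: the
  rows belong to derivatives along \<open>p\<close> and \<open>q\<close>, the columns to the
  products of \<open>a\<close>, \<open>a'\<close> and of \<open>b\<close>, \<open>b'\<close>. On a
  single cube this matrix has rank one.\<close>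

lemma border_rank_eq_2:
  assumes lim: "limcubes 2 F" and F: "F \<in> forms 3"
    and val: "val3 p a a' F * val3 q b b' F - val3 p b b' F * val3 q a a' F \<noteq> 0"
  shows "border_rank F = 2"
proof -
  let ?\<phi> = "\<lambda>G. val3 p a a' G * val3 q b b' G - val3 p b b' G * val3 q a a' G"
  have "border_rank F = Suc 1"
  proof (rule border_rankI[where \<phi> = ?\<phi> and n = 2])
    show "coef_poly ?\<phi>"
      by (intro fun_algebra_diff[OF fun_algebra_generated] generated_algebra.mult coef_poly_val3)
    show "?\<phi> (scale c G) = c ^ 2 * ?\<phi> G" for c G
      unfolding val3_linear by (simp add: power2_eq_square algebra_simps)
    show "?\<phi> G = 0" if "sumcubes 1 G" for G
      using that by (auto simp: val3_linear)
    show "F \<noteq> 0" using val by (auto simp: val3_linear)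
    show "limcubes (Suc 1) F" using lim by (simp only: Suc_1)
  qed fact+
  then show ?thesis by simp
qed

text \<open>The matrix is a sum of two matrices of rank one, so its 3 by 3 determinant is 0. This is
  the catalecticant of a sum of two cubes.\<close>

lemma det3_rank_two:
  fixes s t :: complex
  defines "m \<equiv> \<lambda>x y x' y'. s * x * y + t * x' * y'"
  shows "m a1 x1 b1 y1 * (m a2 x2 b2 y2 * m a3 x3 b3 y3 - m a2 x3 b2 y3 * m a3 x2 b3 y2)
       - m a1 x2 b1 y2 * (m a2 x1 b2 y1 * m a3 x3 b3 y3 - m a2 x3 b2 y3 * m a3 x1 b3 y1)
       + m a1 x3 b1 y3 * (m a2 x1 b2 y1 * m a3 x2 b3 y2 - m a2 x2 b2 y2 * m a3 x1 b3 y1) = 0"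
  unfolding m_def by (simp add: algebra_simps)

lemma border_rank_eq_3:
  assumes lim: "limcubes 3 F" and F: "F \<in> forms 3"
    and val: "val3 p1 a1 a1' F * (val3 p2 a2 a2' F * val3 p3 a3 a3' F - val3 p2 a3 a3' F * val3 p3 a2 a2' F)
       - val3 p1 a2 a2' F * (val3 p2 a1 a1' F * val3 p3 a3 a3' F - val3 p2 a3 a3' F * val3 p3 a1 a1' F)
       + val3 p1 a3 a3' F * (val3 p2 a1 a1' F * val3 p3 a2 a2' F - val3 p2 a2 a2' F * val3 p3 a1 a1' F) \<noteq> 0"
  shows "border_rank F = 3"
proof -
  let ?\<phi> = "\<lambda>G. val3 p1 a1 a1' G * (val3 p2 a2 a2' G * val3 p3 a3 a3' G - val3 p2 a3 a3' G * val3 p3 a2 a2' G)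
       - val3 p1 a2 a2' G * (val3 p2 a1 a1' G * val3 p3 a3 a3' G - val3 p2 a3 a3' G * val3 p3 a1 a1' G)
       + val3 p1 a3 a3' G * (val3 p2 a1 a1' G * val3 p3 a2 a2' G - val3 p2 a2 a2' G * val3 p3 a1 a1' G)"
  have "border_rank F = Suc 2"
  proof (rule border_rankI[where \<phi> = ?\<phi> and n = 3])
    show "coef_poly ?\<phi>"
      by (intro fun_algebra_diff[OF fun_algebra_generated] generated_algebra.add generated_algebra.mult coef_poly_val3)
    show "?\<phi> (scale c G) = c ^ 3 * ?\<phi> G" for c G
      unfolding val3_linear by (simp add: power3_eq_cube algebra_simps)
    show "?\<phi> G = 0" if G: "sumcubes 2 G" for G
    proof -
      have "\<exists>s l t k. G = const3 s * linear_form l ^ 3 + const3 t * linear_form k ^ 3"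
        using G by (auto simp: numeral_2_eq_2)
      then obtain s l t k where "G = const3 s * linear_form l ^ 3 + const3 t * linear_form k ^ 3"
        by (elim exE)
      then have e: "val3 x y z G = 6 * s * dot x l * (dot y l * dot z l) + 6 * t * dot x k * (dot y k * dot z k)" for x y z
        by (simp add: val3_linear mult_ac)
      show ?thesis unfolding e by (rule det3_rank_two)
    qed
    show "F \<noteq> 0" using val by (auto simp: val3_linear)
    show "limcubes (Suc 2) F" using lim by (simp add: numeral_3_eq_3 numeral_2_eq_2)
  qed fact+
  then show ?thesis by simp
qed

section \<open>Normal forms of ternary cubics\<close>

lemma const3_mult_assoc: "const3 a * (const3 b * p) = const3 (a * b) * p"
  unfolding const3_mult mult.assoc ..

lemma const3_cancel:
  assumes "k \<noteq> 0" "const3 k * p = const3 k * q" shows "p = q"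
proof -
  have "const3 (1 / k) * (const3 k * p) = const3 (1 / k) * (const3 k * q)" using assms(2) by simp
  then show ?thesis using assms(1) by (simp add: const3_mult_assoc)
qed

lemma form0_const: assumes "p \<in> forms 0" shows "p = const3 (cf p 0)"
proof -
  from assms obtain c where "p = const3 c" by (auto simp: forms_0)
  then show ?thesis by (simp only: cf_const3_0)
qed

lemma form1_expand:
  assumes "frame a b c u v w" "L \<in> forms 1"
  shows "L = const3 (cf (D a L) 0) * linear_form u + const3 (cf (D b L) 0) * linear_form v
           + const3 (cf (D c L) 0) * linear_form w"
proof -
  have dc: "D s L = const3 (cf (D s L) 0)" for s using D_forms[OF assms(2), of s] by (intro form0_const) simp
  have d: "linear_form x * D s L = const3 (cf (D s L) 0) * linear_form x" for s x
    by (rule trans[OF arg_cong[OF dc] mult.commute])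
  from euler_frame[OF assms] have "const3 (cf (D a L) 0) * linear_form u + const3 (cf (D b L) 0) * linear_form v
           + const3 (cf (D c L) 0) * linear_form w = L"
    by (simp only: d of_nat_1 const3_simps mult_1)
  then show ?thesis by (rule sym)
qed

definition val2 :: "(3 \<Rightarrow>\<^sub>0 complex) \<Rightarrow> (3 \<Rightarrow>\<^sub>0 complex) \<Rightarrow> poly3 \<Rightarrow> complex" where
  "val2 a b Q = cf (D a (D b Q)) 0"

lemma val2_swap: "val2 x y Q = val2 y x Q"
  unfolding val2_def by (subst D_commute) (rule refl)

lemma val3_12: "val3 x y z F = val3 y x z F"
  unfolding val3_def by (subst D_commute) (rule refl)

lemma val3_23: "val3 x y z F = val3 x z y F"
  unfolding val3_def D_commute[of y z] ..

text \<open>Ring identities are stated abstractly because normalization is slow on type \<open>poly3\<close>.\<close>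

lemma euler_quad_identity:
  fixes X Y Z :: "'a::comm_ring_1"
  shows "X * (p * X + q * Y + r * Z) + Y * (q * X + s * Y + t * Z) + Z * (r * X + t * Y + k * Z) =
    p * X ^ 2 + (2 * q) * (X * Y) + s * Y ^ 2 + (2 * r) * (X * Z) + (2 * t) * (Y * Z) + k * Z ^ 2"
  by (simp add: power2_eq_square algebra_simps)

lemma euler_cubic_identity:
  fixes X Y Z :: "'a::comm_ring_1"
  shows "X * (A * X ^ 2 + 2 * AAB * (X * Y) + ABB * Y ^ 2 + 2 * AAC * (X * Z) + ABC * (Y * Z) + ACC * Z ^ 2)
    + Y * (AAB * X ^ 2 + 2 * ABB * (X * Y) + B * Y ^ 2 + ABC * (X * Z) + 2 * BBC * (Y * Z) + BCC * Z ^ 2)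
    + Z * (AAC * X ^ 2 + ABC * (X * Y) + BBC * Y ^ 2 + 2 * ACC * (X * Z) + 2 * BCC * (Y * Z) + C * Z ^ 2) =
    A * X ^ 3 + B * Y ^ 3 + C * Z ^ 3 + 3 * AAB * (X ^ 2 * Y) + 3 * AAC * (X ^ 2 * Z)
     + 3 * ABB * (X * Y ^ 2) + 3 * ACC * (X * Z ^ 2) + 3 * BBC * (Y ^ 2 * Z) + 3 * BCC * (Y * Z ^ 2)
     + 3 * ABC * (X * Y * Z)"
  by (simp add: power2_eq_square power3_eq_cube algebra_simps)

text \<open>Euler's relation with the derivatives of Q expanded as linear forms. The left side is 2
  Q, mixed terms are met twice and squares once, whence the halves at the squares.\<close>

lemma quad_expand:
  assumes "frame a b c u v w" "Q \<in> forms 2"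
  shows "Q = const3 (val2 a a Q / 2) * linear_form u ^ 2 + const3 (val2 a b Q) * (linear_form u * linear_form v)
    + const3 (val2 b b Q / 2) * linear_form v ^ 2 + const3 (val2 a c Q) * (linear_form u * linear_form w)
    + const3 (val2 b c Q) * (linear_form v * linear_form w) + const3 (val2 c c Q / 2) * linear_form w ^ 2"
    (is "Q = ?R")
proof -
  let ?X = "linear_form u" and ?Y = "linear_form v" and ?Z = "linear_form w"
  have e: "D s Q = const3 (val2 a s Q) * ?X + const3 (val2 b s Q) * ?Y + const3 (val2 c s Q) * ?Z" for s
    unfolding val2_def using D_forms[OF assms(2), of s] by (intro form1_expand[OF assms(1)]) simp
  have "const3 2 * Q = ?X * D a Q + ?Y * D b Q + ?Z * D c Q" using euler_frame[OF assms] by simp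
  also have "\<dots> = const3 (val2 a a Q) * ?X ^ 2 + const3 (2 * val2 a b Q) * (?X * ?Y) + const3 (val2 b b Q) * ?Y ^ 2
     + const3 (2 * val2 a c Q) * (?X * ?Z) + const3 (2 * val2 b c Q) * (?Y * ?Z) + const3 (val2 c c Q) * ?Z ^ 2"
    unfolding e val2_swap[of b a] val2_swap[of c a] val2_swap[of c b] const3_mult const3_simps
    by (rule euler_quad_identity)
  also have "\<dots> = const3 2 * ?R" by (simp only: distrib_left const3_mult_assoc) simp
  finally show ?thesis by (rule const3_cancel[rotated]) simp
qed

lemma cubic_expand:
  assumes "frame a b c u v w" "F \<in> forms 3"
  shows "F = const3 (val3 a a a F / 6) * linear_form u ^ 3 + const3 (val3 b b b F / 6) * linear_form v ^ 3
    + const3 (val3 c c c F / 6) * linear_form w ^ 3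
    + const3 (val3 a a b F / 2) * (linear_form u ^ 2 * linear_form v) + const3 (val3 a a c F / 2) * (linear_form u ^ 2 * linear_form w)
    + const3 (val3 a b b F / 2) * (linear_form u * linear_form v ^ 2) + const3 (val3 a c c F / 2) * (linear_form u * linear_form w ^ 2)
    + const3 (val3 b b c F / 2) * (linear_form v ^ 2 * linear_form w) + const3 (val3 b c c F / 2) * (linear_form v * linear_form w ^ 2)
    + const3 (val3 a b c F) * (linear_form u * linear_form v * linear_form w)"
    (is "F = ?R")
proof -
  let ?X = "linear_form u" and ?Y = "linear_form v" and ?Z = "linear_form w"
  have v: "val2 p q (D s F) = val3 p q s F" for p q s by (simp add: val2_def val3_def)
  have sw: "val3 a b a F = val3 a a b F" "val3 a c a F = val3 a a c F" "val3 a c b F = val3 a b c F" "val3 b c b F = val3 b b c F"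
    by (rule val3_23)+
  have sw': "val3 b b a F = val3 a b b F" "val3 c c a F = val3 a c c F" "val3 c c b F = val3 b c c F" "val3 b c a F = val3 a b c F"
    by (rule trans[OF val3_23 val3_12])+
  define A B C AAB AAC ABB ACC BBC BCC ABC where d: "A = const3 (val3 a a a F / 2)" "B = const3 (val3 b b b F / 2)"
    "C = const3 (val3 c c c F / 2)" "AAB = const3 (val3 a a b F / 2)" "AAC = const3 (val3 a a c F / 2)"
    "ABB = const3 (val3 a b b F / 2)" "ACC = const3 (val3 a c c F / 2)" "BBC = const3 (val3 b b c F / 2)"
    "BCC = const3 (val3 b c c F / 2)" "ABC = const3 (val3 a b c F)"
  have two: "const3 k = 2 * const3 (k / 2)" for k using const3_mult[of 2 "k / 2"] by simp
  have three: "3 * (k / 6) = k / 2" "const3 (3 * (k / 2)) = 3 * const3 (k / 2)"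
    "const3 (3 * val3 x y z F) = 3 * const3 (val3 x y z F)" for k :: complex and x y z
    by (simp, simp only: const3_mult const3_simps, simp only: const3_mult const3_simps)
  have q: "D s F = const3 (val3 a a s F / 2) * ?X ^ 2 + const3 (val3 a b s F) * (?X * ?Y)
    + const3 (val3 b b s F / 2) * ?Y ^ 2 + const3 (val3 a c s F) * (?X * ?Z)
    + const3 (val3 b c s F) * (?Y * ?Z) + const3 (val3 c c s F / 2) * ?Z ^ 2" for s
    unfolding v[symmetric] using D_forms[OF assms(2), of s] by (intro quad_expand[OF assms(1)]) simp
  have qa: "D a F = A * ?X ^ 2 + 2 * AAB * (?X * ?Y) + ABB * ?Y ^ 2 + 2 * AAC * (?X * ?Z) + ABC * (?Y * ?Z) + ACC * ?Z ^ 2"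
    by (simp only: q[of a] d sw sw' two[of "val3 a a b F"] two[of "val3 a a c F"])
  have qb: "D b F = AAB * ?X ^ 2 + 2 * ABB * (?X * ?Y) + B * ?Y ^ 2 + ABC * (?X * ?Z) + 2 * BBC * (?Y * ?Z) + BCC * ?Z ^ 2"
    by (simp only: q[of b] d sw sw' two[of "val3 a b b F"] two[of "val3 b b c F"])
  have qc: "D c F = AAC * ?X ^ 2 + ABC * (?X * ?Y) + BBC * ?Y ^ 2 + 2 * ACC * (?X * ?Z) + 2 * BCC * (?Y * ?Z) + C * ?Z ^ 2"
    by (simp only: q[of c] d two[of "val3 a c c F"] two[of "val3 b c c F"])
  have "const3 3 * F = ?X * D a F + ?Y * D b F + ?Z * D c F" using euler_frame[OF assms] by simp
  also have "\<dots> = A * ?X ^ 3 + B * ?Y ^ 3 + C * ?Z ^ 3 + 3 * AAB * (?X ^ 2 * ?Y) + 3 * AAC * (?X ^ 2 * ?Z)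
     + 3 * ABB * (?X * ?Y ^ 2) + 3 * ACC * (?X * ?Z ^ 2) + 3 * BBC * (?Y ^ 2 * ?Z) + 3 * BCC * (?Y * ?Z ^ 2)
     + 3 * ABC * (?X * ?Y * ?Z)"
    unfolding qa qb qc by (rule euler_cubic_identity)
  also have "\<dots> = const3 3 * ?R"
    unfolding d by (simp only: distrib_left const3_mult_assoc three)
  finally show ?thesis by (rule const3_cancel[rotated]) simp
qed

lemma val3_killed:
  assumes "D c F = 0"
  shows "val3 c x y F = 0" "val3 x c y F = 0" "val3 x y c F = 0"
proof -
  show 1: "val3 x y c F = 0" for x y using assms by (simp add: val3_def)
  show 2: "val3 x c y F = 0" using 1[of x y] val3_23[of x c y F] by simp
  show "val3 c x y F = 0" using 2 val3_12[of c x y F] by simp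
qed

lemma val3_killed2:
  assumes "D a (D b F) = 0"
  shows "val3 x a b F = 0" "val3 a x b F = 0" "val3 a b x F = 0" "val3 x b a F = 0" "val3 b x a F = 0" "val3 b a x F = 0"
proof -
  show 1: "val3 x a b F = 0" using assms by (simp add: val3_def)
  show 2: "val3 a x b F = 0" using 1 val3_12[of a x b F] by simp
  show "val3 a b x F = 0" using 2 val3_23[of a b x F] by simp
  show 4: "val3 x b a F = 0" using 1 val3_23[of x b a F] by simp
  show 5: "val3 b x a F = 0" using 4 val3_12[of b x a F] by simp
  show "val3 b a x F = 0" using 5 val3_23[of b a x F] by simp
qed

section \<open>Binary cubics by Sylvester's method\<close>

lemma cube_root_exists: "\<exists>k::complex. k ^ 3 = p"
proof (cases "p = 0")
  case False
  have "exp (Ln p / 3) ^ 3 = exp (of_nat 3 * (Ln p / 3))" by (rule exp_of_nat_mult[symmetric])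
  also have "\<dots> = p" using False by simp
  finally show ?thesis by (rule exI)
qed (auto intro: exI[of _ 0])

lemma binary_quadratic_factor:
  fixes r s t :: complex
  shows "\<exists>p1 p2 q1 q2. r = p1 * q1 \<and> s = p1 * q2 + p2 * q1 \<and> t = p2 * q2"
proof (cases "r = 0")
  case True
  then show ?thesis by (intro exI[of _ 0] exI[of _ 1] exI[of _ s] exI[of _ t]) simp
next
  case False
  let ?d = "csqrt (s ^ 2 - 4 * r * t)"
  have "((s - ?d) / 2) * ((s + ?d) / (2 * r)) = (s ^ 2 - ?d ^ 2) / (4 * r)"
    by (simp add: power2_eq_square algebra_simps)
  also have "\<dots> = t" using False by (simp add: power2_csqrt)
  finally have "t = ((s - ?d) / 2) * ((s + ?d) / (2 * r))" ..
  moreover have "s = r * ((s + ?d) / (2 * r)) + (s - ?d) / 2 * 1" using False by (simp add: field_simps)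
  ultimately show ?thesis
    by (intro exI[of _ r] exI[of _ "(s - ?d) / 2"] exI[of _ 1] exI[of _ "(s + ?d) / (2 * r)"]) simp
qed

lemma common_orthogonal: "\<exists>n. n \<noteq> 0 \<and> dot n R = 0 \<and> dot n S = (0::complex)"
proof (cases "cross R S = 0")
  case False
  then show ?thesis by (intro exI[of _ "cross R S"]) simp
next
  case True
  have *: "\<exists>n. n \<noteq> 0 \<and> dot n P = 0 \<and> dot n Q = 0" if "P \<noteq> 0" "cross P Q = 0" for P Q
  proof -
    from frame_extend1[OF that(1)] obtain a b c v w where "frame a b c P v w" by (elim exE)
    from frame_det[OF this] have "dot (cross P v) w \<noteq> 0"
      by (simp add: dot_commute[of "cross P v"] dot_cross_rotate)
    then have "cross P v \<noteq> 0" by auto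
    moreover have "dot (cross P v) Q = - dot v (cross P Q)"
      by (simp add: dot_def cross_def algebra_simps)
    ultimately show ?thesis using that(2) by (intro exI[of _ "cross P v"]) simp
  qed
  have "cross S R = - cross R S" by (rule vec3_eqI) (simp_all add: cross_def)
  then have sym: "cross S R = 0" using True by simp
  show ?thesis
  proof (cases "R = 0")
    case False
    from *[OF False True] show ?thesis .
  next
    case R: True
    show ?thesis
    proof (cases "S = 0")
      case False
      from *[OF False sym] show ?thesis by blast
    next
      case True
      have "v3 1 0 0 \<noteq> 0" using cf_v3(1)[of 1 0 0] by (metis lookup_zero zero_neq_one)
      then show ?thesis using R True by (intro exI[of _ "v3 1 0 0"]) simp
    qed
  qed
qed

lemma frame_mix:
  assumes "frame a b c u v w" "p1 * q2 - p2 * q1 \<noteq> 0"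
  shows "\<exists>u' v'. frame (scale p1 a + scale p2 b) (scale q1 a + scale q2 b) c u' v' w"
proof -
  define d where "d = p1 * q2 - p2 * q1"
  have "d \<noteq> 0" using assms by (simp add: d_def)
  have "frame (scale p1 a + scale p2 b) (scale q1 a + scale q2 b) c
     (scale (q2 / d) u + scale (- q1 / d) v) (scale (- p2 / d) u + scale (p1 / d) v) w"
    using assms(1) \<open>d \<noteq> 0\<close> unfolding frame_def dot_add dot_scale
    by (simp add: divide_simps) (simp add: d_def algebra_simps)
  then show ?thesis by (intro exI)
qed

lemma product_of_combinations:
  fixes x y z :: "'a::comm_ring_1"
  shows "q1 * (p1 * x + p2 * y) + q2 * (p1 * y + p2 * z) = p1 * q1 * x + (p1 * q2 + p2 * q1) * y + p2 * q2 * z"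
  by (simp add: algebra_simps)

text \<open>A binary quadric has three coefficients, and annihilating \<open>F\<close> imposes two
  linear equations on them. A nonzero solution exists and splits into linear factors over the
  complex numbers.\<close>

lemma binary_cubic_apolar:
  assumes fr: "frame a b c u v w" and F: "F \<in> forms 3" and c: "D c F = 0"
  shows "\<exists>p1 p2 q1 q2. (p1 \<noteq> 0 \<or> p2 \<noteq> 0) \<and> (q1 \<noteq> 0 \<or> q2 \<noteq> 0) \<and>
     D (scale p1 a + scale p2 b) (D (scale q1 a + scale q2 b) F) = 0"
proof -
  from common_orthogonal[of "v3 (val3 a a a F) (val3 a a b F) (val3 a b b F)" "v3 (val3 a a b F) (val3 a b b F) (val3 b b b F)"]
  obtain n :: "3 \<Rightarrow>\<^sub>0 complex" where n: "n \<noteq> 0" "cf n 0 * val3 a a a F + cf n 1 * val3 a a b F + cf n 2 * val3 a b b F = 0"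
    "cf n 0 * val3 a a b F + cf n 1 * val3 a b b F + cf n 2 * val3 b b b F = 0"
    by (auto simp: dot_def)
  from binary_quadratic_factor[of "cf n 0" "cf n 1" "cf n 2"] obtain p1 p2 q1 q2 where
    f: "cf n 0 = p1 * q1" "cf n 1 = p1 * q2 + p2 * q1" "cf n 2 = p2 * q2" by (elim exE conjE) (rule that)
  let ?G = "D (scale p1 a + scale p2 b) (D (scale q1 a + scale q2 b) F)"
  have G: "?G \<in> forms 1" using D_forms[OF D_forms[OF F], of "scale p1 a + scale p2 b" "scale q1 a + scale q2 b"] by (simp add: numeral_3_eq_3)
  have e: "?G = const3 (p1 * q1) * D a (D a F) + const3 (p1 * q2 + p2 * q1) * D a (D b F) + const3 (p2 * q2) * D b (D b F)"
    unfolding D_vec_add D_vec_scale scale_const3 D_add D_const_mult D_commute[of b a] const3_mult const3_add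
    by (rule product_of_combinations)
  have k: "cf (D s ?G) 0 = cf n 0 * val3 s a a F + cf n 1 * val3 s a b F + cf n 2 * val3 s b b F" for s
    unfolding e D_add D_const_mult lookup_add cf_const_mult f val3_def ..
  have "cf (D a ?G) 0 = 0" "cf (D b ?G) 0 = 0" "cf (D c ?G) 0 = 0"
    unfolding k using n(2,3) val3_killed(1)[OF c] val3_12[of b a a F] val3_12[of b a b F] val3_23[of a b a F] by simp_all
  then have "?G = 0" using form1_expand[OF fr G] by simp
  moreover have "cf n 0 \<noteq> 0 \<or> cf n 1 \<noteq> 0 \<or> cf n 2 \<noteq> 0" using n(1) vec3_eqI[of n 0] by auto
  then have "(p1 \<noteq> 0 \<or> p2 \<noteq> 0) \<and> (q1 \<noteq> 0 \<or> q2 \<noteq> 0)" unfolding f by auto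
  ultimately show ?thesis by (intro exI conjI) simp_all
qed

text \<open>The factors of the apolar quadric decide. Independent factors, taken as new basis
  vectors, kill the mixed terms and leave two cubes; if they are proportional, one repeated
  derivative kills \<open>F\<close>, and only terms divisible by the square of the other coordinate
  remain.\<close>

lemma binary_cubic_cases:
  assumes fr: "frame a b c u v w" and F: "F \<in> forms 3" and c: "D c F = 0"
  shows "\<exists>a' b' u' v' p q. frame a' b' c u' v' w \<and>
    (F = const3 p * linear_form u' ^ 3 + const3 q * linear_form v' ^ 3 \<or>
     F = const3 p * linear_form u' ^ 3 + const3 q * (linear_form u' ^ 2 * linear_form v'))"
proof -
  from binary_cubic_apolar[OF assms] obtain p1 p2 q1 q2 where
    p: "p1 \<noteq> 0 \<or> p2 \<noteq> 0" "q1 \<noteq> 0 \<or> q2 \<noteq> 0" and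
    k: "D (scale p1 a + scale p2 b) (D (scale q1 a + scale q2 b) F) = 0" by (elim exE conjE) (rule that)
  show ?thesis
  proof (cases "p1 * q2 - p2 * q1 = 0")
    case False
    from frame_mix[OF fr False] obtain u' v' where
      fr': "frame (scale p1 a + scale p2 b) (scale q1 a + scale q2 b) c u' v' w" by (elim exE)
    from cubic_expand[OF fr' F] have "F = const3 (val3 (scale p1 a + scale p2 b) (scale p1 a + scale p2 b) (scale p1 a + scale p2 b) F / 6) * linear_form u' ^ 3 +
      const3 (val3 (scale q1 a + scale q2 b) (scale q1 a + scale q2 b) (scale q1 a + scale q2 b) F / 6) * linear_form v' ^ 3"
      unfolding val3_killed2[OF k] val3_killed[OF c] by simp
    with fr' show ?thesis by (intro exI conjI disjI1)
  next
    case True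
    have "\<exists>l. l \<noteq> 0 \<and> q1 = l * p1 \<and> q2 = l * p2"
    proof (cases "p1 = 0")
      case False
      then show ?thesis using True p(2) by (intro exI[of _ "q1 / p1"]) (auto simp: field_simps)
    next
      case p1: True
      then have "p2 \<noteq> 0" "q1 = 0" using p True by auto
      then show ?thesis using p(2) p1 by (intro exI[of _ "q2 / p2"]) auto
    qed
    then obtain l where l: "l \<noteq> 0" "q1 = l * p1" "q2 = l * p2" by (elim exE conjE)
    let ?b = "scale p1 a + scale p2 b"
    have "scale q1 a + scale q2 b = scale l ?b" by (simp add: l(2,3) cvs.scale_right_distrib)
    then have "const3 l * D ?b (D ?b F) = const3 l * 0"
      using k by (simp only: D_vec_scale scale_const3 D_const_mult) simp
    then have kk: "D ?b (D ?b F) = 0" by (rule const3_cancel[OF l(1)])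
    have "\<exists>r1 r2. r1 * p2 - r2 * p1 \<noteq> 0"
    proof (cases "p2 = 0")
      case True
      then show ?thesis using p(1) by (intro exI[of _ 0] exI[of _ 1]) simp
    next
      case False
      then show ?thesis by (intro exI[of _ 1] exI[of _ 0]) simp
    qed
    then obtain r1 r2 where r: "r1 * p2 - r2 * p1 \<noteq> 0" by (elim exE)
    from frame_mix[OF fr r] obtain u' v' where fr': "frame (scale r1 a + scale r2 b) ?b c u' v' w" by (elim exE)
    from cubic_expand[OF fr' F] have "F = const3 (val3 (scale r1 a + scale r2 b) (scale r1 a + scale r2 b) (scale r1 a + scale r2 b) F / 6) * linear_form u' ^ 3 +
      const3 (val3 (scale r1 a + scale r2 b) (scale r1 a + scale r2 b) ?b F / 2) * (linear_form u' ^ 2 * linear_form v')"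
      unfolding val3_killed2[OF kk] val3_killed[OF c] by simp
    with fr' show ?thesis by (intro exI conjI disjI2)
  qed
qed

lemma frame_scale:
  assumes "frame a b c u v w" "k \<noteq> 0"
  shows "frame (scale (1 / k) a) b c (scale k u) v w"
  using assms by (simp add: frame_def dot_scale)

lemma frame_shear:
  assumes "frame a b c u v w"
  shows "frame (a - scale s c) (b - scale t c) c u v (w + scale s u + scale t v)"
  using assms by (simp add: frame_def dot_scale dot_add dot_diff)

lemma linear_form_scale_cube: "linear_form (scale k u) ^ 3 = const3 (k ^ 3) * linear_form u ^ 3"
  by (simp add: linear_form_scale power_mult_distrib const3_power)

lemma square_times_combination:
  fixes x y :: "'a::comm_ring_1"
  shows "p * x ^ 3 + q * (x ^ 2 * y) = x ^ 2 * (p * x + q * y)"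
  by (simp add: power2_eq_square power3_eq_cube algebra_simps)

lemma absorb_square_multiples:
  fixes x y z :: "'a::comm_ring_1"
  shows "x ^ 2 * z + (k1 * x ^ 3 + k4 * y ^ 3 + k2 * (x ^ 2 * y) + k3 * (x * y ^ 2)) =
    x ^ 2 * (z + k1 * x + k2 * y) + k3 * (x * y ^ 2) + k4 * y ^ 3"
  by (simp add: power2_eq_square power3_eq_cube algebra_simps)

text \<open>Completing the cube in y absorbs the term x y^2; what is left over is divisible by
  x^2.\<close>

lemma complete_cube:
  fixes x y z :: "'a::comm_ring_1"
  shows "x ^ 2 * z + (3 * k * t) * (x * y ^ 2) + k * y ^ 3 =
    x ^ 2 * (z - k * t ^ 3 * x - 3 * k * t ^ 2 * y) + k * (y + t * x) ^ 3"
  by (simp add: power2_eq_square power3_eq_cube algebra_simps)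

lemma binary_cubic_normal:
  assumes fr: "frame a b c u v w" and F: "F \<in> forms 3" and c: "D c F = 0"
  shows "\<exists>a' b' u' v'. frame a' b' c u' v' w \<and>
    (F = 0 \<or> F = linear_form u' ^ 3 \<or> F = linear_form u' ^ 3 + linear_form v' ^ 3 \<or>
     F = linear_form u' ^ 2 * linear_form v')"
proof -
  from binary_cubic_cases[OF assms] obtain a b u v p q where fr: "frame a b c u v w" and
    F: "F = const3 p * linear_form u ^ 3 + const3 q * linear_form v ^ 3 \<or>
     F = const3 p * linear_form u ^ 3 + const3 q * (linear_form u ^ 2 * linear_form v)"
    by (elim exE conjE) (rule that)
  obtain k l where kl: "k ^ 3 = p" "l ^ 3 = q" using cube_root_exists[of p] cube_root_exists[of q] by auto
  have k0: "p \<noteq> 0 \<Longrightarrow> k \<noteq> 0" and l0: "q \<noteq> 0 \<Longrightarrow> l \<noteq> 0" using kl by auto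
  show ?thesis
    using F
  proof
    assume F: "F = const3 p * linear_form u ^ 3 + const3 q * linear_form v ^ 3"
    show ?thesis
    proof (cases "p = 0"; cases "q = 0")
      assume "p = 0" "q = 0"
      then show ?thesis using fr F by (intro exI conjI disjI1) simp_all
    next
      assume pq: "p = 0" "q \<noteq> 0"
      have "frame (scale (1 / l) b) a c (scale l v) u w" by (rule frame_scale[OF frame_flip[OF fr] l0[OF pq(2)]])
      moreover have "F = linear_form (scale l v) ^ 3" using F pq by (simp add: linear_form_scale_cube kl)
      ultimately show ?thesis by (intro exI conjI disjI2 disjI1)
    next
      assume pq: "p \<noteq> 0" "q = 0"
      have "frame (scale (1 / k) a) b c (scale k u) v w" by (rule frame_scale[OF fr k0[OF pq(1)]])
      moreover have "F = linear_form (scale k u) ^ 3" using F pq by (simp add: linear_form_scale_cube kl)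
      ultimately show ?thesis by (intro exI conjI disjI2 disjI1)
    next
      assume pq: "p \<noteq> 0" "q \<noteq> 0"
      have "frame (scale (1 / l) b) (scale (1 / k) a) c (scale l v) (scale k u) w"
        by (rule frame_scale[OF frame_flip[OF frame_scale[OF fr k0[OF pq(1)]]] l0[OF pq(2)]])
      moreover have "F = linear_form (scale l v) ^ 3 + linear_form (scale k u) ^ 3"
        using F by (simp add: linear_form_scale_cube kl add.commute)
      then have "F = 0 \<or> F = linear_form (scale l v) ^ 3 \<or> F = linear_form (scale l v) ^ 3 + linear_form (scale k u) ^ 3 \<or>
        F = linear_form (scale l v) ^ 2 * linear_form (scale k u)" by simp
      ultimately show ?thesis by (intro exI conjI)
    qed
  next
    assume F: "F = const3 p * linear_form u ^ 3 + const3 q * (linear_form u ^ 2 * linear_form v)"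
    show ?thesis
    proof (cases "q = 0")
      case False
      \<comment> \<open>The linear factor p u + q v becomes the second coordinate while u is
        kept.\<close>
      have "frame (a - scale (p / q) b) (scale (1 / q) b) c u (scale p u + scale q v) w"
        using fr False by (simp add: frame_def dot_add dot_scale dot_diff)
      moreover have "F = linear_form u ^ 2 * linear_form (scale p u + scale q v)"
        unfolding F linear_form_add linear_form_scale by (rule square_times_combination)
      then have "F = 0 \<or> F = linear_form u ^ 3 \<or> F = linear_form u ^ 3 + linear_form (scale p u + scale q v) ^ 3 \<or>
        F = linear_form u ^ 2 * linear_form (scale p u + scale q v)" by simp
      ultimately show ?thesis by (intro exI conjI)
    next
      case q: True
      show ?thesis
      proof (cases "p = 0")
        case True
        then show ?thesis using fr F q by (intro exI conjI disjI1) simp_all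
      next
        case False
        have "frame (scale (1 / k) a) b c (scale k u) v w" by (rule frame_scale[OF fr k0[OF False]])
        moreover have "F = linear_form (scale k u) ^ 3" using F q by (simp add: linear_form_scale_cube kl)
        ultimately show ?thesis by (intro exI conjI disjI2 disjI1)
      qed
    qed
  qed
qed

definition special_cubic :: "(3 \<Rightarrow>\<^sub>0 complex) \<Rightarrow> (3 \<Rightarrow>\<^sub>0 complex) \<Rightarrow> (3 \<Rightarrow>\<^sub>0 complex) \<Rightarrow> poly3 \<Rightarrow> bool" where
  "special_cubic u v w F \<longleftrightarrow> F = linear_form u ^ 3 \<or> F = linear_form u ^ 3 + linear_form v ^ 3 \<or>
     F = linear_form u ^ 2 * linear_form v \<or> F = linear_form w ^ 3 + (linear_form u ^ 3 + linear_form v ^ 3) \<or>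
     F = linear_form w ^ 3 + linear_form u ^ 2 * linear_form v \<or>
     F = linear_form u ^ 2 * linear_form w + linear_form u * linear_form v ^ 2"

text \<open>\<open>s\<close> is kept as a direction of derivatives, while \<open>y\<close>, which it
  kills, becomes a coordinate dual to another direction.\<close>

lemma frame_completing_vector:
  assumes "s \<noteq> 0" "y \<noteq> 0" "dot s y = 0"
  shows "\<exists>a b v w. frame a b s y v w"
proof -
  from frame_extend1[OF assms(1)] obtain u0 v0 w0 b0 c0 where "frame u0 v0 w0 s b0 c0" by (elim exE)
  from frame_rotate[OF frame_swap[OF this]] have fr: "frame b0 c0 s v0 w0 u0" .
  define k m where km: "k = dot b0 y" "m = dot c0 y"
  have y: "y = scale k v0 + scale m w0" using frame_expand[OF fr, of y] assms(3) by (simp add: km)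
  have "k \<noteq> 0 \<or> m \<noteq> 0" using assms(2) y by auto
  then show ?thesis
  proof
    assume k: "k \<noteq> 0"
    have "frame (scale (1 / k) b0) (c0 - scale (m / k) b0) s y w0 u0"
      unfolding y using fr k by (simp add: frame_def dot_add dot_scale dot_diff)
    then show ?thesis by (intro exI)
  next
    assume m: "m \<noteq> 0"
    have "frame (scale (1 / m) c0) (b0 - scale (k / m) c0) s y v0 u0"
      unfolding y using fr m by (simp add: frame_def dot_add dot_scale dot_diff)
    then show ?thesis by (intro exI)
  qed
qed

lemma D_square_mult: "D s (linear_form u ^ 2 * linear_form w) = const3 (2 * dot s u) * (linear_form u * linear_form w) + const3 (dot s w) * linear_form u ^ 2"
  unfolding D_mult D_power2 D_linear_form const3_mult const3_simps by (simp only: mult_ac)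

text \<open>The equation D s F = y^2 is integrated. If \<open>s\<close> does not kill y, a multiple
  of y^3 is a particular solution and a binary cubic remains. If it does and y is not 0, then y^2 z
  with z dual to \<open>s\<close> is a particular solution; a cubic in y and v remains, whose terms
  divisible by y^2 are absorbed into z, and its two other coefficients separate the remaining
  types.\<close>

lemma special_cubic_exists:
  assumes F: "F \<in> forms 3" "F \<noteq> 0" and s: "s \<noteq> 0" "D s F = linear_form y ^ 2"
  shows "\<exists>a b c u v w. frame a b c u v w \<and> special_cubic u v w F"
proof (cases "dot s y = 0")
  case False
  define k where "k = dot s y"
  have k: "k \<noteq> 0" using False by (simp add: k_def)
  from frame_extend1[OF s(1)] obtain u0 v0 w0 b0 c0 where "frame u0 v0 w0 s b0 c0" by (elim exE)
  from frame_swap[OF this] have fr: "frame s b0 c0 u0 v0 w0" .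
  have fr': "frame (scale (1 / k) s) (b0 - scale (dot b0 y / k) s) (c0 - scale (dot c0 y / k) s) y v0 w0"
    using fr k by (simp add: frame_def dot_add dot_scale dot_diff k_def)
  \<comment> \<open>The derivative of y^3 along s is 3 k y^2.\<close>
  let ?p = "1 / (3 * k)"
  define G where "G = F - const3 ?p * linear_form y ^ 3"
  have G: "G \<in> forms 3"
    unfolding G_def using forms_power[OF linear_form_forms(1), of y 3] by (intro forms_diff F forms_const_mult) simp
  have "D s G = linear_form y ^ 2 - const3 ?p * (3 * linear_form y ^ 2 * const3 k)"
    unfolding G_def D_diff D_const_mult D_power3 s(2) D_linear_form k_def ..
  also have "const3 ?p * (3 * linear_form y ^ 2 * const3 k) = const3 (?p * 3 * k) * linear_form y ^ 2"
    unfolding const3_mult const3_simps by (simp only: mult_ac)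
  also have "\<dots> = linear_form y ^ 2" using k by simp
  finally have "D (scale (1 / k) s) G = 0" by (simp add: D_vec_scale)
  from binary_cubic_normal[OF frame_rotate[OF fr'] G this] obtain a b u v where
    fr2: "frame a b (scale (1 / k) s) u v y" and
    G2: "G = 0 \<or> G = linear_form u ^ 3 \<or> G = linear_form u ^ 3 + linear_form v ^ 3 \<or> G = linear_form u ^ 2 * linear_form v"
    by (elim exE conjE) (rule that)
  obtain l where l: "l ^ 3 = ?p" using cube_root_exists by blast
  have l0: "l \<noteq> 0" using l k by auto
  have fr3: "frame (scale (1 / l) (scale (1 / k) s)) a b (scale l y) u v"
    by (rule frame_scale[OF frame_rotate[OF frame_rotate[OF fr2]] l0])
  have F2: "F = linear_form (scale l y) ^ 3 + G" unfolding G_def linear_form_scale_cube l by simp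
  show ?thesis
    using G2
  proof (elim disjE)
    assume "G = 0"
    then have "special_cubic (scale l y) u v F" using F2 by (simp add: special_cubic_def)
    with fr3 show ?thesis by (intro exI conjI)
  next
    assume "G = linear_form u ^ 3"
    then have "special_cubic (scale l y) u v F" using F2 by (simp add: special_cubic_def)
    with fr3 show ?thesis by (intro exI conjI)
  next
    assume "G = linear_form u ^ 3 + linear_form v ^ 3"
    then have "special_cubic u v (scale l y) F" using F2 by (simp add: special_cubic_def)
    with frame_rotate[OF fr3] show ?thesis by (intro exI conjI)
  next
    assume "G = linear_form u ^ 2 * linear_form v"
    then have "special_cubic u v (scale l y) F" using F2 by (simp add: special_cubic_def)
    with frame_rotate[OF fr3] show ?thesis by (intro exI conjI)
  qed
next
  case dy: True
  show ?thesis
  proof (cases "y = 0")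
    case True
    then have c: "D s F = 0" using s(2) by simp
    from frame_extend1[OF s(1)] obtain u0 v0 w0 b0 c0 where "frame u0 v0 w0 s b0 c0" by (elim exE)
    from binary_cubic_normal[OF frame_rotate[OF frame_swap[OF this]] F(1) c] F(2)
    obtain a b u v where fr: "frame a b s u v u0" and
      "F = linear_form u ^ 3 \<or> F = linear_form u ^ 3 + linear_form v ^ 3 \<or> F = linear_form u ^ 2 * linear_form v"
      by (elim exE conjE) (rule that, auto)
    then have "special_cubic u v u0 F" by (auto simp: special_cubic_def)
    with fr show ?thesis by (intro exI conjI)
  next
    case False
    from frame_completing_vector[OF s(1) False dy] obtain a b v w where fr: "frame a b s y v w" by (elim exE)
    let ?X = "linear_form y" and ?Y = "linear_form v" and ?Z = "linear_form w"
    define G where "G = F - ?X ^ 2 * ?Z"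
    have "?X ^ 2 * ?Z \<in> forms 3"
      using forms_mult[OF forms_power[OF linear_form_forms(1), of y 2] linear_form_forms(1), of w] by simp
    then have G: "G \<in> forms 3" unfolding G_def by (intro forms_diff F)
    have "D s G = 0" unfolding G_def D_diff s(2) D_square_mult using fr by (simp add: frame_def)
    note z = val3_killed[OF this]
    define k1 k2 k3 k4 where k: "k1 = val3 a a a G / 6" "k2 = val3 a a b G / 2" "k3 = val3 a b b G / 2" "k4 = val3 b b b G / 6"
    have Ge: "G = const3 k1 * ?X ^ 3 + const3 k4 * ?Y ^ 3 + const3 k2 * (?X ^ 2 * ?Y) + const3 k3 * (?X * ?Y ^ 2)"
      using cubic_expand[OF fr G] unfolding z k by simp
    have Fe: "F = ?X ^ 2 * linear_form (w + scale k1 y + scale k2 v) + const3 k3 * (?X * ?Y ^ 2) + const3 k4 * ?Y ^ 3"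
    proof -
      have "F = ?X ^ 2 * ?Z + G" by (simp add: G_def)
      then show ?thesis unfolding Ge linear_form_add linear_form_scale absorb_square_multiples .
    qed
    have fr2: "frame (a - scale k1 s) (b - scale k2 s) s y v (w + scale k1 y + scale k2 v)" by (rule frame_shear[OF fr])
    define w' where "w' = w + scale k1 y + scale k2 v"
    note fr2 = fr2[folded w'_def] and Fe = Fe[folded w'_def]
    show ?thesis
    proof (cases "k4 = 0")
      case True
      show ?thesis
      proof (cases "k3 = 0")
        case k30: True
        have "special_cubic y w' v F" unfolding Fe special_cubic_def using True k30 by simp
        moreover have "frame (a - scale k1 s) s (b - scale k2 s) y w' v" using fr2 by (simp add: frame_def)
        ultimately show ?thesis by (intro exI conjI)
      next
        case False
        define r where "r = csqrt k3"
        have r: "r \<noteq> 0" "r ^ 2 = k3" using False by (simp_all add: r_def)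
        have "frame (a - scale k1 s) (scale (1 / r) (b - scale k2 s)) s y (scale r v) w'"
          using fr2 r(1) by (simp add: frame_def dot_scale)
        moreover have "special_cubic y (scale r v) w' F"
          unfolding Fe special_cubic_def linear_form_scale power_mult_distrib const3_power[symmetric] r(2)
          using True by (simp add: mult.left_commute)
        ultimately show ?thesis by (intro exI conjI)
      qed
    next
      case False
      obtain r where r: "r ^ 3 = k4" using cube_root_exists by blast
      have r0: "r \<noteq> 0" using r False by auto
      \<comment> \<open>The coefficient of x y^2 in k (y + t x)^3 is 3 k t and has to equal
        \<open>k3\<close> for k = \<open>k4\<close>.\<close>
      define t where "t = k3 / (3 * k4)"
      define v' where "v' = scale r (v + scale t y)"
      define w2 where "w2 = w' + scale (- k4 * t ^ 3) y + scale (- 3 * k4 * t ^ 2) v"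
      have F2: "F = ?X ^ 2 * linear_form w2 + linear_form v' ^ 3"
      proof -
        have k3: "const3 k3 = 3 * const3 k4 * const3 t"
          unfolding const3_simps(3)[symmetric] const3_mult[symmetric] t_def using False by simp
        have "linear_form v' ^ 3 = const3 k4 * (?Y + const3 t * ?X) ^ 3"
          unfolding v'_def linear_form_scale_cube r by (simp add: linear_form_add linear_form_scale)
        moreover have "linear_form w2 = linear_form w' - const3 k4 * const3 t ^ 3 * ?X - 3 * const3 k4 * const3 t ^ 2 * ?Y"
          unfolding w2_def linear_form_add linear_form_scale const3_mult const3_power const3_minus
          by (simp add: const3_minus)
        ultimately show ?thesis unfolding Fe k3 complete_cube by simp
      qed
      \<comment> \<open>The changes by multiples of y and v do not affect the triple product, which
        only acquires the factor r of v'.\<close>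
      have "dot y (cross v' w2) = r * dot y (cross v w')"
        unfolding v'_def w2_def by (simp add: dot_def cross_def lookup_add lookup_minus algebra_simps)
      then have "dot y (cross v' w2) \<noteq> 0" using frame_det[OF fr2] r0 by simp
      from frame_exists[OF this] obtain a' b' c' where fr3: "frame a' b' c' y v' w2" by (elim exE)
      have "frame a' c' b' y w2 v'" using fr3 by (simp add: frame_def)
      moreover have "special_cubic y w2 v' F" unfolding special_cubic_def F2 by (simp add: add.commute)
      ultimately show ?thesis by (intro exI conjI)
    qed
  qed
qed

lemma limcubes_0: "limcubes r 0"
proof -
  have "sumcubes r 0" by (rule sumcubes_mono[of 0]) simp_all
  then show ?thesis by (rule limcubes_sumcubes)
qed

lemma limcubes_cube: "limcubes 1 (linear_form u ^ 3)"
  using limcubes_sumcubes[OF cube_sumcubes[of 1 u]] by simp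

lemma limcubes_two_cubes: "limcubes 2 (linear_form u ^ 3 + linear_form v ^ 3)"
  using limcubes_add[OF limcubes_cube limcubes_cube] by (simp only: one_add_one)

lemma limcubes_binary:
  assumes "frame a b c u v w" "F \<in> forms 3" "D c F = 0"
  shows "limcubes 2 F"
proof -
  from binary_cubic_normal[OF assms] obtain u v where
    "F = 0 \<or> F = linear_form u ^ 3 \<or> F = linear_form u ^ 3 + linear_form v ^ 3 \<or> F = linear_form u ^ 2 * linear_form v"
    by (elim exE conjE) (rule that)
  moreover have "limcubes 2 (linear_form u ^ 3)"
    using limcubes_add[OF limcubes_cube[of u] limcubes_0[of 1]] by (simp only: one_add_one add_0_right)
  ultimately show ?thesis
    using limcubes_0 limcubes_two_cubes limcubes_square_times by auto
qed

section \<open>Ideals of small colength\<close>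

text \<open>Codimension at most r, phrased by a spanning set instead of a dimension: representatives
  can be multiplied by linear forms and carried from one degree to the next.\<close>

definition cod_le :: "poly3 set \<Rightarrow> nat \<Rightarrow> nat \<Rightarrow> bool" where
  "cod_le J k r \<longleftrightarrow> (\<exists>W. finite W \<and> card W \<le> r \<and> forms k \<subseteq> cvs.span ((J \<inter> forms k) \<union> W))"

lemma cod_le_dim:
  assumes "cod_le J k r" "idl.subspace J"
  shows "cvs.dim (forms k) \<le> cvs.dim (J \<inter> forms k) + r"
proof -
  from assms(1) obtain W where W: "finite W" "card W \<le> r" "forms k \<subseteq> cvs.span ((J \<inter> forms k) \<union> W)"
    unfolding cod_le_def by (elim exE conjE)
  have "cvs.dim (forms k) \<le> cvs.dim (J \<inter> forms k) + card W"
    by (rule dim_le_add_card[OF subspace_piece[OF assms(2)] _ forms_fin(2)[of k] W(3,1)]) (use forms_fin(1)[of k] in auto)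
  then show ?thesis using W(2) by simp
qed

lemma cod_le_trivial:
  assumes "cvs.dim (forms k) \<le> r" shows "cod_le J k r"
  unfolding cod_le_def
proof (intro exI[of _ "monom3 ` mons k"] conjI)
  show "card (monom3 ` mons k) \<le> r"
    using assms card_image_le[OF finite_mons, of monom3 k] by (simp add: dim_forms)
  show "forms k \<subseteq> cvs.span (J \<inter> forms k \<union> monom3 ` mons k)"
    unfolding forms_span[of k] by (intro cvs.span_mono) simp
qed simp

lemma cod_le_0: "r \<ge> 1 \<Longrightarrow> cod_le J 0 r"
  by (rule cod_le_trivial) (simp add: dim_forms_small)

lemma forms_Suc_decompose:
  assumes "frame a b c u v w" "f \<in> forms (Suc k)"
  shows "\<exists>f1\<in>forms k. \<exists>f2\<in>forms k. \<exists>f3\<in>forms k. f = linear_form a * f1 + linear_form b * f2 + linear_form c * f3"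
proof -
  let ?c = "of_nat (Suc k) :: complex"
  have c: "?c \<noteq> 0" by (simp only: of_nat_eq_0_iff)
  have d: "const3 (1 / ?c) * D s f \<in> forms k" for s
    using D_forms[OF assms(2), of s] by (intro forms_const_mult) simp
  have "const3 ?c * f = linear_form a * D u f + linear_form b * D v f + linear_form c * D w f"
    using euler_frame[OF frame_swap[OF assms(1)] assms(2)] by simp
  then have "const3 (1 / ?c) * (const3 ?c * f) = const3 (1 / ?c) * (linear_form a * D u f + linear_form b * D v f + linear_form c * D w f)"
    by simp
  then have "f = linear_form a * (const3 (1 / ?c) * D u f) + linear_form b * (const3 (1 / ?c) * D v f) + linear_form c * (const3 (1 / ?c) * D w f)"
    unfolding const3_mult_assoc using c by (simp only: distrib_left mult.left_commute[of "const3 (1 / ?c)"]) simp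
  then show ?thesis using d by blast
qed

lemma span_mult_left:
  assumes "x \<in> cvs.span S" "\<And>y. y \<in> S \<Longrightarrow> l * y \<in> cvs.span (T :: poly3 set)"
  shows "l * x \<in> cvs.span T"
  using assms(1)
proof (induction rule: cvs.span_induct_alt)
  case base
  show ?case by (simp add: cvs.span_zero)
next
  case (step c x y)
  have "scale c (l * x) + l * y \<in> cvs.span T"
    by (rule cvs.span_add[OF cvs.span_scale[OF assms(2)[OF step(1)]] step(2)])
  then show ?case by (simp only: scale_mult_right distrib_left)
qed

text \<open>Every form of positive degree lies in the ideal of the three coordinates. Hence only the
  products of the old representatives with the coordinates have to be expressed by the new
  ones.\<close>

lemma forms_Suc_spanned:
  assumes fr: "frame a b c u v w" and J: "idl.subspace J"
    and W: "forms k \<subseteq> cvs.span ((J \<inter> forms k) \<union> W)"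
    and step: "\<And>x s. x \<in> W \<Longrightarrow> s \<in> {a, b, c} \<Longrightarrow> linear_form s * x \<in> cvs.span ((J \<inter> forms (Suc k)) \<union> W')"
  shows "forms (Suc k) \<subseteq> cvs.span ((J \<inter> forms (Suc k)) \<union> W')"
proof
  fix f assume "f \<in> forms (Suc k)"
  from forms_Suc_decompose[OF fr this] obtain f1 f2 f3 where
    f: "f1 \<in> forms k" "f2 \<in> forms k" "f3 \<in> forms k" "f = linear_form a * f1 + linear_form b * f2 + linear_form c * f3"
    by (elim bexE)
  have "linear_form s * g \<in> cvs.span ((J \<inter> forms (Suc k)) \<union> W')" if "g \<in> forms k" "s \<in> {a, b, c}" for g s
  proof (rule span_mult_left[OF subsetD[OF W that(1)]])
    fix y assume "y \<in> J \<inter> forms k \<union> W"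
    then show "linear_form s * y \<in> cvs.span ((J \<inter> forms (Suc k)) \<union> W')"
    proof
      assume y: "y \<in> J \<inter> forms k"
      then have "linear_form s * y \<in> J \<inter> forms (Suc k)"
        using idl.subspace_scale[OF J] forms_mult[OF linear_form_forms(1), of y k s] by simp
      then show ?thesis by (intro cvs.span_base) simp
    qed (rule step[OF _ that(2)])
  qed
  then show "f \<in> cvs.span ((J \<inter> forms (Suc k)) \<union> W')" unfolding f(4) using f(1-3) by (intro cvs.span_add) auto
qed

lemma frame_forms1_span:
  assumes fr: "frame a b c u v w"
  shows "forms 1 \<subseteq> cvs.span {linear_form a, linear_form b, linear_form c}"
proof
  fix f :: poly3 assume "f \<in> forms 1"
  from form1_expand[OF frame_swap[OF fr] this]
  have f: "f = scale (cf (D u f) 0) (linear_form a) + scale (cf (D v f) 0) (linear_form b) + scale (cf (D w f) 0) (linear_form c)"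
    by (simp only: scale_const3)
  show "f \<in> cvs.span {linear_form a, linear_form b, linear_form c}"
    by (subst f) (intro cvs.span_add cvs.span_scale cvs.span_base; simp)
qed

lemma cod_le_point:
  assumes fr: "frame a b c u v w" and J: "idl.subspace J" "linear_form b \<in> J" "linear_form c \<in> J"
  shows "forms k \<subseteq> cvs.span ((J \<inter> forms k) \<union> {linear_form a ^ k})"
proof (induction k)
  case 0
  have "forms 0 \<subseteq> cvs.span {1}"
  proof
    fix p :: poly3 assume "p \<in> forms 0"
    then obtain k where "p = const3 k" by (auto simp: forms_0)
    then have "p = scale k 1" by (simp add: scale_const3)
    then show "p \<in> cvs.span {1}" by (simp add: cvs.span_base cvs.span_scale)
  qed
  also have "\<dots> \<subseteq> cvs.span ((J \<inter> forms 0) \<union> {linear_form a ^ 0})" by (intro cvs.span_mono) simp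
  finally show ?case .
next
  case (Suc k)
  show ?case
  proof (rule forms_Suc_spanned[OF fr J(1) Suc.IH])
    fix x s assume x: "x \<in> {linear_form a ^ k}" and s: "s \<in> {a, b, c}"
    have xf: "x \<in> forms k" using x forms_power[OF linear_form_forms(1), of a k] by simp
    have "linear_form s * x \<in> J \<inter> forms (Suc k)" if "s = b \<or> s = c"
    proof -
      have "linear_form s \<in> J" using that J by auto
      from idl.subspace_scale[OF J(1) this, of x] forms_mult[OF linear_form_forms(1) xf, of s]
      show ?thesis by (simp add: mult.commute[of x])
    qed
    then show "linear_form s * x \<in> cvs.span ((J \<inter> forms (Suc k)) \<union> {linear_form a ^ Suc k})"
      using s x by (intro cvs.span_base) auto
  qed
qed

text \<open>If y^2 occurs in q with an invertible coefficient, multiples of y^2 are rewritten modulo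
  q and x with lower powers of y.\<close>

lemma quad_mod_identity:
  fixes g :: "'a::comm_ring_1"
  assumes "p * p' = 1" "q = A * x ^ 2 + B * (x * y) + p * y ^ 2 + C * (x * z) + S * (y * z) + T * z ^ 2"
  shows "y * (y * g) = (p' * g) * q + (- (p' * g * (A * x + B * y + C * z))) * x - (p' * S) * (y * (z * g)) - (p' * T) * (z * (z * g))"
proof -
  have "y * (y * g) = (p * p') * (y * (y * g))" using assms(1) by simp
  also have "\<dots> = (p' * g) * q + (- (p' * g * (A * x + B * y + C * z))) * x - (p' * S) * (y * (z * g)) - (p' * T) * (z * (z * g))"
    unfolding assms(2) by (simp add: power2_eq_square algebra_simps)
  finally show ?thesis .
qed

text \<open>On the line a = 0 the conic restricts to a binary form containing b^2, so two monomials
  survive in each positive degree.\<close>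

lemma cod_le_line_aux:
  assumes fr: "frame a b c u v w" and q: "q \<in> forms 2" "val2 v v q \<noteq> 0"
    and J: "idl.subspace J" "linear_form a \<in> J" "q \<in> J"
  shows "forms (Suc k) \<subseteq> cvs.span ((J \<inter> forms (Suc k)) \<union> {linear_form c ^ Suc k, linear_form b * linear_form c ^ k})"
proof (induction k)
  case 0
  have "forms 1 \<subseteq> cvs.span {linear_form a, linear_form b, linear_form c}" by (rule frame_forms1_span[OF fr])
  also have "\<dots> \<subseteq> cvs.span ((J \<inter> forms 1) \<union> {linear_form c ^ Suc 0, linear_form b * linear_form c ^ 0})"
    using J(2) by (intro cvs.span_mono) simp
  finally show ?case by simp
next
  case (Suc k)
  let ?S = "(J \<inter> forms (Suc (Suc k))) \<union> {linear_form c ^ Suc (Suc k), linear_form b * linear_form c ^ Suc k}"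
  show ?case
  proof (rule forms_Suc_spanned[OF fr J(1) Suc.IH])
    fix x s assume x: "x \<in> {linear_form c ^ Suc k, linear_form b * linear_form c ^ k}" and s: "s \<in> {a, b, c}"
    have ck: "linear_form c ^ i \<in> forms i" for i using forms_power[OF linear_form_forms(1), of c i] by simp
    have xf: "x \<in> forms (Suc k)"
      using x ck[of "Suc k"] forms_mult[OF linear_form_forms(1) ck, of b k] by auto
    have bc: "linear_form c ^ Suc (Suc k) \<in> cvs.span ?S" "linear_form b * linear_form c ^ Suc k \<in> cvs.span ?S"
      by (intro cvs.span_base; simp)+
    from s x consider "s = a" | "s = c" "x = linear_form c ^ Suc k" | "s = c" "x = linear_form b * linear_form c ^ k" | "s = b" "x = linear_form c ^ Suc k" | "s = b" "x = linear_form b * linear_form c ^ k"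
      by blast
    then show "linear_form s * x \<in> cvs.span ?S"
    proof cases
      case 1
      have "linear_form s * x \<in> J \<inter> forms (Suc (Suc k))"
        using 1 idl.subspace_scale[OF J(1,2), of x] forms_mult[OF linear_form_forms(1) xf, of s] by (simp add: mult.commute)
      then show ?thesis by (intro cvs.span_base) simp
    next
      case 2
      then show ?thesis using bc(1) by (simp only: power_Suc)
    next
      case 3
      have "linear_form s * x = linear_form b * linear_form c ^ Suc k"
        unfolding 3 power_Suc by (rule mult.left_commute)
      then show ?thesis using bc(2) by (simp only:)
    next
      case 4
      then show ?thesis using bc by simp
    next
      case 5
      let ?g = "linear_form c ^ k" and ?p = "val2 v v q / 2"
      let ?m = "const3 (val2 u u q / 2) * linear_form a + const3 (val2 u v q) * linear_form b + const3 (val2 u w q) * linear_form c"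
      have pp: "const3 ?p * const3 (1 / ?p) = 1" by (rule const3_inverse) (use q(2) in simp)
      note e = quad_mod_identity[OF pp quad_expand[OF frame_swap[OF fr] q(1)], of ?g]
      have gf: "const3 (1 / ?p) * ?g \<in> forms k" by (intro forms_const_mult ck)
      have 1: "(const3 (1 / ?p) * ?g) * q \<in> J \<inter> forms (Suc (Suc k))"
        using idl.subspace_scale[OF J(1,3)] forms_mult[OF gf q(1)] by simp
      have mf: "?m \<in> forms 1" by (intro forms_add forms_const_mult linear_form_forms)
      have "- (const3 (1 / ?p) * ?g * ?m) = const3 (-1) * ((const3 (1 / ?p) * ?g) * ?m)" by (simp add: const3_minus)
      then have "- (const3 (1 / ?p) * ?g * ?m) \<in> forms (Suc k)"
        using forms_const_mult[OF forms_mult[OF gf mf], of "-1"] by simp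
      then have 2: "(- (const3 (1 / ?p) * ?g * ?m)) * linear_form a \<in> J \<inter> forms (Suc (Suc k))"
        using idl.subspace_scale[OF J(1,2)] forms_mult[OF _ linear_form_forms(1)[of a]] by fastforce
      have 3: "(const3 (1 / ?p) * const3 (val2 v w q)) * (linear_form b * (linear_form c * ?g)) \<in> cvs.span ?S"
        using cvs.span_scale[OF bc(2), of "1 / ?p * val2 v w q"] unfolding scale_const3 const3_mult[of "1 / ?p"] power_Suc .
      have 4: "(const3 (1 / ?p) * const3 (val2 w w q / 2)) * (linear_form c * (linear_form c * ?g)) \<in> cvs.span ?S"
        using cvs.span_scale[OF bc(1), of "1 / ?p * (val2 w w q / 2)"] unfolding scale_const3 const3_mult[of "1 / ?p"] power_Suc .
      have s12: "x \<in> cvs.span ?S" if "x \<in> J \<inter> forms (Suc (Suc k))" for x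
        using that by (intro cvs.span_base) simp
      show ?thesis
        unfolding \<open>s = b\<close> \<open>x = _\<close> e by (intro cvs.span_diff cvs.span_add s12 1 2 3 4)
    qed
  qed
qed

lemma cod_le_line:
  assumes fr: "frame a b c u v w" and q: "q \<in> forms 2" "val2 v v q \<noteq> 0 \<or> val2 v w q \<noteq> 0 \<or> val2 w w q \<noteq> 0"
    and J: "idl.subspace J" "linear_form a \<in> J" "q \<in> J"
  shows "cod_le J k 2"
proof -
  have "\<exists>b c v w. frame a b c u v w \<and> val2 v v q \<noteq> 0"
  proof (cases "val2 v v q \<noteq> 0")
    case True
    then show ?thesis using fr by blast
  next
    case vv: False
    show ?thesis
    proof (cases "val2 w w q \<noteq> 0")
      case True
      moreover have "frame a c b u w v" using fr by (simp add: frame_def)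
      ultimately show ?thesis by blast
    next
      case False
      \<comment> \<open>When neither square occurs on the line, the mixed term makes q nonzero at v
        + w, and a basis containing this vector is used.\<close>
      have "frame a b (c - b) u (v + w) w" using fr by (simp add: frame_def dot_add dot_diff)
      moreover have "val2 (v + w) (v + w) q = val2 v v q + val2 v w q + val2 w v q + val2 w w q"
        by (simp add: val2_def D_vec_add D_add lookup_add)
      then have "val2 (v + w) (v + w) q \<noteq> 0" using vv False q(2) val2_swap[of w v q] by simp
      ultimately show ?thesis by blast
    qed
  qed
  then obtain b c v w where fr: "frame a b c u v w" "val2 v v q \<noteq> 0" by blast
  show ?thesis
  proof (cases k)
    case 0
    then show ?thesis by (simp add: cod_le_0)
  next
    case (Suc i)
    show ?thesis unfolding Suc cod_le_def
      using cod_le_line_aux[OF fr(1) q(1) fr(2) J, of i]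
      by (intro exI[of _ "{linear_form c ^ Suc i, linear_form b * linear_form c ^ i}"] conjI)
         (simp_all add: card_insert_if)
  qed
qed

lemma pair_ideal_decompose:
  assumes "x \<in> idl.span {l, q}" "x \<in> forms (Suc k)" "l \<in> forms 1" "q \<in> forms 2"
  shows "\<exists>A\<in>forms k. \<exists>B. x = A * l + B * q"
proof -
  from assms(1) obtain A where "x - A * l \<in> idl.span {q}" unfolding idl.span_insert by blast
  then obtain B where "x - A * l = B * q" unfolding idl.span_singleton by blast
  then have x: "x = A * l + B * q" by (simp add: algebra_simps)
  have "x = component (Suc k) x" using assms(2) component_of_form[of x "Suc k" "Suc k"] by simp
  also have "\<dots> = component (Suc k) (A * l) + component (Suc k) (B * q)" by (subst x) (rule component_add)
  also have "component (Suc k) (A * l) = component k A * l" using component_mult[OF assms(3), of "Suc k" A] by simp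
  also have "component (Suc k) (B * q) = (if 2 \<le> Suc k then component (Suc k - 2) B else 0) * q"
    using component_mult[OF assms(4), of "Suc k" B] by simp
  finally show ?thesis using component_forms[of k A] by blast
qed

text \<open>The exact sequence relating the residual ideal \<open>I\<close> with respect to the line \<open>l = 0\<close> and the trace on that line.\<close>

lemma cod_le_residual:
  assumes line: "cod_le (idl.span {l, q}) (Suc k) r" and l: "l \<in> forms 1" "q \<in> forms 2"
    and res: "cod_le I k s" and J: "idl.subspace J" "q \<in> J" and lI: "\<And>x. x \<in> I \<Longrightarrow> x * l \<in> J"
  shows "cod_le J (Suc k) (r + s)"
proof -
  from line obtain W where W: "finite W" "card W \<le> r"
    "forms (Suc k) \<subseteq> cvs.span ((idl.span {l, q} \<inter> forms (Suc k)) \<union> W)"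
    unfolding cod_le_def by (elim exE conjE)
  from res obtain W' where W': "finite W'" "card W' \<le> s" "forms k \<subseteq> cvs.span ((I \<inter> forms k) \<union> W')"
    unfolding cod_le_def by (elim exE conjE)
  let ?U = "W \<union> (\<lambda>x. x * l) ` W'" and ?S = "J \<inter> forms (Suc k)"
  have "idl.span {l, q} \<inter> forms (Suc k) \<subseteq> cvs.span (?S \<union> ?U)"
  proof
    fix x assume x: "x \<in> idl.span {l, q} \<inter> forms (Suc k)"
    then obtain A B where AB: "A \<in> forms k" "x = A * l + B * q"
      using pair_ideal_decompose[OF _ _ l, of x k] by blast
    have "l * A \<in> cvs.span (?S \<union> ?U)"
    proof (rule span_mult_left[OF subsetD[OF W'(3) AB(1)]])
      fix y assume "y \<in> I \<inter> forms k \<union> W'"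
      then show "l * y \<in> cvs.span (?S \<union> ?U)"
      proof
        assume y: "y \<in> I \<inter> forms k"
        then have "y * l \<in> ?S" using lI forms_mult[OF _ l(1), of y k] by simp
        then show ?thesis by (intro cvs.span_base) (simp add: mult.commute)
      next
        assume "y \<in> W'"
        then show ?thesis
          by (intro cvs.span_base UnI2 image_eqI[of _ _ y]) (simp_all add: mult.commute)
      qed
    qed
    moreover have "B * q \<in> ?S"
    proof -
      have "A * l \<in> forms (Suc k)" using forms_mult[OF AB(1) l(1)] by simp
      then have "x - A * l \<in> forms (Suc k)" using x by (intro forms_diff) simp_all
      then show ?thesis using AB(2) idl.subspace_scale[OF J] by simp
    qed
    then have "B * q \<in> cvs.span (?S \<union> ?U)" by (intro cvs.span_base) simp
    ultimately show "x \<in> cvs.span (?S \<union> ?U)" unfolding AB(2) mult.commute[of A l] by (intro cvs.span_add)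
  qed
  moreover have "W \<subseteq> cvs.span (?S \<union> ?U)" by (rule subset_trans[OF _ cvs.span_superset]) auto
  ultimately have "cvs.span ((idl.span {l, q} \<inter> forms (Suc k)) \<union> W) \<subseteq> cvs.span (?S \<union> ?U)"
    by (intro cvs.span_minimal cvs.subspace_span Un_least)
  with W(3) have "forms (Suc k) \<subseteq> cvs.span (?S \<union> ?U)" by (rule subset_trans)
  moreover have "card ?U \<le> r + s"
    using card_Un_le[of W "(\<lambda>x. x * l) ` W'"] card_image_le[OF W'(1), of "\<lambda>x. x * l"] W(2) W'(2) by linarith
  ultimately show ?thesis unfolding cod_le_def using W(1) W'(1) by (intro exI[of _ ?U]) simp
qed

section \<open>Smoothable ideals\<close>

lemma homogeneous_span2:
  assumes "p \<in> forms i" "q \<in> forms j" shows "homogeneous_ideal (idl.span {p, q})"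
proof -
  have "homogeneous_ideal (idl.span ((\<lambda>x. if x = (0::nat) then p else q) ` {0, 1}))"
    by (rule idl_span_pieces(2)[where e = "\<lambda>x. if x = 0 then i else j"]) (use assms in auto)
  then show ?thesis by (simp add: insert_commute)
qed

lemma homogeneous_span3:
  assumes "p \<in> forms 2" "q \<in> forms 2" "r \<in> forms 2" shows "homogeneous_ideal (idl.span {p, q, r})"
proof -
  have "homogeneous_ideal (idl.span ((\<lambda>x. x) ` {p, q, r}))"
    by (rule idl_span_pieces(2)[where e = "\<lambda>_. 2"]) (use assms in auto)
  then show ?thesis by simp
qed

lemma lower_bound_0:
  assumes "Z \<subseteq> P2" "Z \<noteq> {}"
  shows "cvs.dim (vanishing_ideal Z \<inter> forms 0) + min r (cvs.dim (forms 0)) \<le> cvs.dim (forms 0)"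
proof -
  have "vanishing_ideal Z \<inter> forms 0 \<subseteq> cvs.span {}"
  proof
    fix p assume p: "p \<in> vanishing_ideal Z \<inter> forms 0"
    then obtain k where k: "p = const3 k" by (auto simp: forms_0)
    from assms obtain z v where "z \<in> Z" "v \<in> z" by (auto simp: P2_def proj_def intro: cvs.span_zero)
    then have "k = 0" using p k by (auto simp: vanishing_ideal_def)
    then show "p \<in> cvs.span {}" using k by simp
  qed
  then have "cvs.dim (vanishing_ideal Z \<inter> forms 0) \<le> card ({} :: poly3 set)" by (rule cvs.dim_le_card) simp
  then show ?thesis by simp
qed

lemma span_in_P2: "v \<noteq> 0 \<Longrightarrow> cvs.span {v} \<in> P2"
  by (auto simp: P2_def proj_def)

lemma span_separated:
  assumes "f \<in> forms k" "eval3 f u \<noteq> 0" "eval3 f v = 0"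
  shows "cvs.span {u} \<noteq> cvs.span {v}"
proof
  assume "cvs.span {u} = cvs.span {v}"
  then have "u \<in> cvs.span {v}" using cvs.span_base[of u "{u}"] by simp
  then obtain c where "u = scale c v" by (auto simp: cvs.span_singleton)
  then show False using assms(2,3) eval3_homogeneous[OF assms(1), of c v] by simp
qed

lemma vanishing_ideal_spanI:
  assumes "\<And>p. p \<in> G \<Longrightarrow> \<exists>k. p \<in> forms k" "\<And>p i. p \<in> G \<Longrightarrow> i \<in> I \<Longrightarrow> eval3 p (v i) = 0"
    and Z: "(\<lambda>i. cvs.span {v i}) ` I \<subseteq> P2"
  shows "idl.span G \<subseteq> vanishing_ideal ((\<lambda>i. cvs.span {v i}) ` I)"
proof (rule idl.span_minimal)
  show "G \<subseteq> vanishing_ideal ((\<lambda>i. cvs.span {v i}) ` I)"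
  proof
    fix p assume p: "p \<in> G"
    then obtain k where k: "p \<in> forms k" using assms(1) by blast
    have "eval3 p x = 0" if "i \<in> I" "x \<in> cvs.span {v i}" for i x
    proof -
      from that(2) obtain c where "x = scale c (v i)" by (auto simp: cvs.span_singleton)
      then show ?thesis using eval3_homogeneous[OF k, of c "v i"] assms(2)[OF p that(1)] by simp
    qed
    then show "p \<in> vanishing_ideal ((\<lambda>i. cvs.span {v i}) ` I)" by (auto simp: vanishing_ideal_def)
  qed
qed (rule homogeneous_idealD(1)[OF vanishing_ideal_homogeneous[OF Z]])

text \<open>The lower bounds come in three ranges: nonzero constants do not vanish, below
  \<open>d\<close> no nonzero form of positive degree vanishes at all points, and from
  \<open>d\<close> on the forms \<open>f\<close> separate the points. With \<open>cod\<close> this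
  fixes the Hilbert function.\<close>

lemma Slip_pointsI:
  fixes v :: "'i \<Rightarrow> (3 \<Rightarrow>\<^sub>0 complex)"
  assumes J: "J = idl.span G" "homogeneous_ideal J" "\<And>p. p \<in> G \<Longrightarrow> \<exists>k. p \<in> forms k"
    and I: "finite I" "card I = r" "I \<noteq> {}"
    and van: "\<And>p i. p \<in> G \<Longrightarrow> i \<in> I \<Longrightarrow> eval3 p (v i) = 0"
    and cod: "\<And>k. cod_le J k r"
    and d: "d > 0" and small: "\<And>k. 0 < k \<Longrightarrow> k < d \<Longrightarrow>
        (\<And>p. p \<in> forms k \<Longrightarrow> (\<And>i. i \<in> I \<Longrightarrow> eval3 p (v i) = 0) \<Longrightarrow> p = 0)"
    and f: "\<And>i k. i \<in> I \<Longrightarrow> d \<le> k \<Longrightarrow> f i k \<in> forms k"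
    and sep: "\<And>i j k. i \<in> I \<Longrightarrow> j \<in> I \<Longrightarrow> d \<le> k \<Longrightarrow> (eval3 (f i k) (v j) \<noteq> 0) \<longleftrightarrow> i = j"
  shows "J \<in> Slip r"
proof -
  let ?Z = "(\<lambda>i. cvs.span {v i}) ` I"
  have nz: "v i \<noteq> 0" if "i \<in> I" for i
  proof
    \<comment> \<open>A form of positive degree vanishes at the origin, but \<open>f i d\<close>
      does not vanish at \<open>v i\<close>.\<close>
    assume "v i = 0"
    then have "v i = scale 0 (v i)" by simp
    then have "eval3 (f i d) (v i) = 0 ^ d * eval3 (f i d) (v i)"
      using eval3_homogeneous[OF f[OF that order_refl], of 0 "v i"] by simp
    then show False using sep[OF that that order_refl] zero_power[OF d, where 'a = complex] by simp
  qed
  have ZP: "?Z \<subseteq> P2" using nz span_in_P2 by auto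
  have inj: "inj_on (\<lambda>i. cvs.span {v i}) I"
  proof (rule inj_onI, rule ccontr)
    fix i j assume ij: "i \<in> I" "j \<in> I" "cvs.span {v i} = cvs.span {v j}" "i \<noteq> j"
    have "eval3 (f i d) (v i) \<noteq> 0" "eval3 (f i d) (v j) = 0" using sep[OF ij(1)] ij by auto
    from span_separated[OF f[OF ij(1) order_refl] this] ij(3) show False by simp
  qed
  show ?thesis
  proof (rule Slip_reduced[OF J(2) ZP])
    show "finite ?Z" "card ?Z = r" using I inj by (simp_all add: card_image)
    show "J \<subseteq> vanishing_ideal ?Z" unfolding J(1) by (rule vanishing_ideal_spanI[OF J(3) van ZP])
    show "cvs.dim (forms k) \<le> cvs.dim (J \<inter> forms k) + r" for k
      by (rule cod_le_dim[OF cod homogeneous_idealD(1)[OF J(2)]])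
    show "cvs.dim (vanishing_ideal ?Z \<inter> forms k) + min r (cvs.dim (forms k)) \<le> cvs.dim (forms k)" for k
    proof (cases "d \<le> k")
      case True
      have "cvs.dim (vanishing_ideal ?Z \<inter> forms k) + card I \<le> cvs.dim (forms k)"
        by (rule separated_points_dim[OF I(1) refl f[OF _ True] sep[OF _ _ True] ZP])
      then show ?thesis using I(2) by simp
    next
      case False
      show ?thesis
      proof (cases "k = 0")
        case True
        then show ?thesis using lower_bound_0[OF ZP] I(3) by simp
      next
        case k: False
        have "vanishing_ideal ?Z \<inter> forms k \<subseteq> cvs.span {}"
        proof
          fix p assume p: "p \<in> vanishing_ideal ?Z \<inter> forms k"
          have "eval3 p (v i) = 0" if "i \<in> I" for i
            using p that cvs.span_base[of "v i" "{v i}"] by (auto simp: vanishing_ideal_def)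
          then have "p = 0" using small[of k p] k False p by simp
          then show "p \<in> cvs.span {}" by simp
        qed
        then have "cvs.dim (vanishing_ideal ?Z \<inter> forms k) \<le> card ({} :: poly3 set)" by (rule cvs.dim_le_card) simp
        then show ?thesis by simp
      qed
    qed
  qed
qed

lemma power_forms: "linear_form a ^ k \<in> forms k"
  using forms_power[OF linear_form_forms(1), of a k] by simp

lemma product_forms: "linear_form a * linear_form b \<in> forms 2"
  using forms_mult[OF linear_form_forms(1) linear_form_forms(1), of a b] by (simp add: numeral_2_eq_2)

lemma square_forms: "linear_form a ^ 2 \<in> forms 2"
  by (rule power_forms)

lemma D2_product: "D x (D y (linear_form a * linear_form b)) = const3 (dot a x * dot b y + dot a y * dot b x)"
  by (simp add: D_mult D_add const3_add const3_mult dot_commute[of x] dot_commute[of y] mult.commute add.commute)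

lemma val2_product [simp]: "val2 x y (linear_form a * linear_form b) = dot a x * dot b y + dot a y * dot b x"
  by (simp add: val2_def D2_product)

lemma val2_square [simp]: "val2 x y (linear_form a ^ 2) = 2 * dot a x * dot a y"
  by (simp add: power2_eq_square)

lemma val2_linear [simp]: "val2 x y (p + q) = val2 x y p + val2 x y q" "val2 x y (p - q) = val2 x y p - val2 x y q"
  "val2 x y (const3 k * p) = k * val2 x y p" "val2 x y 0 = 0"
  by (simp_all add: val2_def D_add D_diff D_const_mult lookup_add lookup_minus)

section \<open>Ideals of one, two and three points and their degenerations\<close>

lemma Slip_1_point:
  assumes fr: "frame a b c u v w"
  shows "idl.span {linear_form b, linear_form c} \<in> Slip 1"
proof (rule Slip_pointsI[where I = "{0::nat}" and v = "\<lambda>_. u" and d = 1 and f = "\<lambda>_ k. linear_form a ^ k"])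
  let ?J = "idl.span {linear_form b, linear_form c}"
  show h: "homogeneous_ideal ?J" by (rule homogeneous_span2[OF linear_form_forms(1) linear_form_forms(1)])
  show "cod_le ?J k 1" for k
    unfolding cod_le_def using cod_le_point[OF fr idl.subspace_span, of "{linear_form b, linear_form c}" k]
    by (intro exI[of _ "{linear_form a ^ k}"]) (simp add: idl.span_base)
qed (use fr in \<open>auto simp: frame_def power_forms intro: linear_form_forms\<close>)

lemma Slip_2_points:
  assumes fr: "frame a b c u v w"
  shows "idl.span {linear_form c, linear_form a * linear_form b} \<in> Slip 2"
proof (rule Slip_pointsI[where I = "{0::nat, 1}" and v = "\<lambda>i. if i = 0 then u else v" and d = 1
      and f = "\<lambda>i k. linear_form (if i = 0 then a else b) ^ k"])
  let ?J = "idl.span {linear_form c, linear_form a * linear_form b}"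
  show "homogeneous_ideal ?J" by (rule homogeneous_span2[OF linear_form_forms(1) product_forms])
  show "cod_le ?J k 2" for k
    by (rule cod_le_line[OF frame_rotate[OF frame_rotate[OF fr]] product_forms[of a b]])
       (use fr in \<open>simp_all add: frame_def idl.span_base\<close>)
qed (use fr in \<open>auto simp: frame_def power_forms intro: linear_form_forms product_forms\<close>)

lemma frame_cod_le_point:
  assumes fr: "frame a b c u v w"
  shows "cod_le (idl.span {linear_form b, linear_form c}) k 1"
  unfolding cod_le_def using cod_le_point[OF fr idl.subspace_span, of "{linear_form b, linear_form c}" k]
  by (intro exI[of _ "{linear_form a ^ k}"]) (simp add: idl.span_base)

text \<open>The trace on the line a = 0 is the pair of points cut out by q, and the residual scheme
  is the point b = c = 0; the lengths 2 and 1 add up.\<close>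

lemma cod_le_point_and_pair:
  assumes fr: "frame a b c u v w" and q: "q \<in> forms 2" "val2 v v q \<noteq> 0 \<or> val2 v w q \<noteq> 0 \<or> val2 w w q \<noteq> 0"
  shows "cod_le (idl.span {linear_form a * linear_form b, linear_form a * linear_form c, q}) k 3"
proof (cases k)
  case 0
  then show ?thesis by (simp add: cod_le_0)
next
  case (Suc i)
  let ?J = "idl.span {linear_form a * linear_form b, linear_form a * linear_form c, q}"
  have "cod_le ?J (Suc i) (2 + 1)"
  proof (rule cod_le_residual[OF _ linear_form_forms(1)[of a] q(1) frame_cod_le_point[OF fr]])
    show "cod_le (idl.span {linear_form a, q}) (Suc i) 2"
      by (rule cod_le_line[OF fr q idl.subspace_span]) (simp_all add: idl.span_base)
    show "q \<in> ?J" by (rule idl.span_base) simp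
    fix x assume "x \<in> idl.span {linear_form b, linear_form c}"
    then show "x * linear_form a \<in> ?J"
    proof (induction rule: idl.span_induct_alt)
      case (step r y z)
      have "y * linear_form a \<in> ?J" using step(1) by (intro idl.span_base) (auto simp: mult.commute)
      from idl.span_add[OF idl.span_scale[OF this, of r] step(2)]
      show ?case by (simp only: distrib_right mult.assoc)
    qed (simp add: idl.span_zero)
  qed (rule idl.subspace_span)
  then show ?thesis by (simp add: Suc)
qed

lemma Slip_3_points:
  assumes fr: "frame a b c u v w"
  shows "idl.span {linear_form a * linear_form b, linear_form a * linear_form c, linear_form b * linear_form c} \<in> Slip 3"
proof (rule Slip_pointsI[where I = "{0::nat, 1, 2}" and v = "\<lambda>i. if i = 0 then u else if i = 1 then v else w" and d = 1
      and f = "\<lambda>i k. linear_form (if i = 0 then a else if i = 1 then b else c) ^ k"])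
  let ?J = "idl.span {linear_form a * linear_form b, linear_form a * linear_form c, linear_form b * linear_form c}"
  show "homogeneous_ideal ?J" by (intro homogeneous_span3 product_forms)
  show "cod_le ?J k 3" for k
    by (rule cod_le_point_and_pair[OF fr product_forms]) (use fr in \<open>simp add: frame_def\<close>)
qed (use fr in \<open>auto simp: frame_def power_forms intro: product_forms\<close>)

lemma Slip_limit2:
  fixes p :: "complex \<Rightarrow> poly3"
  assumes g: "g0 \<in> forms i" "\<And>t. p t \<in> forms j"
    and cont: "\<And>m. isCont (\<lambda>t. cf (p t) m) 0"
    and mem: "\<forall>\<^sub>F t in at 0. idl.span {g0, p t} \<in> Slip r"
    and cod: "\<And>k. cod_le (idl.span {g0, p 0}) k r"
  shows "idl.span {g0, p 0} \<in> Slip r"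
proof -
  let ?g = "\<lambda>x t. if x = (0::nat) then g0 else p t"
  have im: "(\<lambda>x. ?g x t) ` {0, 1} = {g0, p t}" for t by auto
  have "idl.span ((\<lambda>x. ?g x 0) ` {0, 1}) \<in> Slip r"
  proof (rule Slip_limit[where e = "\<lambda>x. if x = 0 then i else j" and g = ?g])
    show "\<forall>\<^sub>F t in at 0. idl.span ((\<lambda>x. ?g x t) ` {0, 1}) \<in> Slip r" unfolding im by (rule mem)
    show "cvs.dim (forms k) \<le> cvs.dim (idl.span ((\<lambda>x. ?g x 0) ` {0, 1}) \<inter> forms k) + r" for k
      unfolding im by (rule cod_le_dim[OF cod idl.subspace_span])
  qed (use g cont in auto)
  then show ?thesis unfolding im .
qed

lemma Slip_limit3:
  fixes gx gy gz :: "complex \<Rightarrow> poly3"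
  assumes g: "\<And>t. gx t \<in> forms 2" "\<And>t. gy t \<in> forms 2" "\<And>t. gz t \<in> forms 2"
    and cont: "\<And>m. isCont (\<lambda>t. cf (gx t) m) 0" "\<And>m. isCont (\<lambda>t. cf (gy t) m) 0" "\<And>m. isCont (\<lambda>t. cf (gz t) m) 0"
    and mem: "\<forall>\<^sub>F t in at 0. idl.span {gx t, gy t, gz t} \<in> Slip r"
    and cod: "\<And>k. cod_le (idl.span {gx 0, gy 0, gz 0}) k r"
  shows "idl.span {gx 0, gy 0, gz 0} \<in> Slip r"
proof -
  let ?g = "\<lambda>x t. if x = (0::nat) then gx t else if x = 1 then gy t else gz t"
  have im: "(\<lambda>x. ?g x t) ` {0, 1, 2} = {gx t, gy t, gz t}" for t by auto
  have "idl.span ((\<lambda>x. ?g x 0) ` {0, 1, 2}) \<in> Slip r"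
  proof (rule Slip_limit[where e = "\<lambda>x. 2" and g = ?g])
    show "\<forall>\<^sub>F t in at 0. idl.span ((\<lambda>x. ?g x t) ` {0, 1, 2}) \<in> Slip r" unfolding im by (rule mem)
    show "cvs.dim (forms k) \<le> cvs.dim (idl.span ((\<lambda>x. ?g x 0) ` {0, 1, 2}) \<inter> forms k) + r" for k
      unfolding im by (rule cod_le_dim[OF cod idl.subspace_span])
  qed (use g cont in auto)
  then show ?thesis unfolding im .
qed

lemma frame_tilt:
  assumes fr: "frame a b c u v w" and t: "t \<noteq> 0"
  shows "\<exists>u' v'. frame b (b - scale t a) c u' v' w"
proof -
  have "\<exists>u' v'. frame (scale 0 a + scale 1 b) (scale (- t) a + scale 1 b) c u' v' w"
    by (rule frame_mix[OF fr]) (use t in simp)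
  then show ?thesis by simp
qed

lemma tilted_product: "linear_form b * linear_form (b - scale t a) = linear_form b ^ 2 - const3 t * (linear_form b * linear_form a)"
  unfolding linear_form_diff linear_form_scale by (simp only: power2_eq_square right_diff_distrib mult.left_commute[of "linear_form b" "const3 t"])

text \<open>Two points on the line c = 0, cut out there by b and by b - t a, collide as t tends to
  0.\<close>

lemma Slip_2_double:
  assumes fr: "frame a b c u v w"
  shows "idl.span {linear_form c, linear_form b ^ 2} \<in> Slip 2"
proof -
  let ?p = "\<lambda>t. linear_form b ^ 2 - const3 t * (linear_form b * linear_form a)"
  have "idl.span {linear_form c, ?p 0} \<in> Slip 2"
  proof (rule Slip_limit2[where i = 1 and j = 2])
    have "idl.span {linear_form c, ?p t} \<in> Slip 2" if t: "t \<noteq> 0" for t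
    proof -
      from frame_tilt[OF fr t] obtain u' v' where "frame b (b - scale t a) c u' v' w" by (elim exE)
      from Slip_2_points[OF this] show ?thesis unfolding tilted_product .
    qed
    then show "\<forall>\<^sub>F t in at 0. idl.span {linear_form c, ?p t} \<in> Slip 2"
      using eventually_at_0_neq by (rule eventually_mono[rotated])
    show "cod_le (idl.span {linear_form c, ?p 0}) k 2" for k
      by (rule cod_le_line[OF frame_rotate[OF frame_rotate[OF fr]] square_forms[of b]])
         (use fr in \<open>simp_all add: frame_def idl.span_base\<close>)
    show "?p t \<in> forms 2" for t by (intro forms_diff square_forms forms_const_mult product_forms)
    show "isCont (\<lambda>t. cf (?p t) m) 0" for m unfolding lookup_minus cf_const_mult by (intro continuous_intros)
  qed (rule linear_form_forms)
  then show ?thesis by simp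
qed

text \<open>The collision of two points on the line c = 0, with a third point \<open>w\<close> off
  this line kept fixed.\<close>

lemma Slip_3_double:
  assumes fr: "frame a b c u v w"
  shows "idl.span {linear_form c * linear_form a, linear_form c * linear_form b, linear_form b ^ 2} \<in> Slip 3"
proof -
  let ?p = "\<lambda>t. linear_form b ^ 2 - const3 t * (linear_form b * linear_form a)"
  let ?x = "linear_form a" and ?y = "linear_form b" and ?z = "linear_form c"
  have "idl.span {?z * ?x, ?z * ?y, ?p 0} \<in> Slip 3"
  proof (rule Slip_limit3)
    have "idl.span {?z * ?x, ?z * ?y, ?p t} \<in> Slip 3" if t: "t \<noteq> 0" for t
    proof -
      from frame_tilt[OF fr t] obtain u' v' where "frame b (b - scale t a) c u' v' w" by (elim exE)
      from Slip_3_points[OF frame_rotate[OF frame_rotate[OF this]]]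
      have S: "idl.span {?z * ?y, ?z * linear_form (b - scale t a), ?p t} \<in> Slip 3" unfolding tilted_product .
      let ?I = "idl.span {?z * ?y, ?z * linear_form (b - scale t a), ?p t}" and ?J = "idl.span {?z * ?x, ?z * ?y, ?p t}"
      \<comment> \<open>For t \<noteq> 0 the conics c b and c (b - t a) span the same pencil as c b
        and c a. The first pair coincides at t = 0, the second still generates an ideal of the right
        size together with the limit of the third conic.\<close>
      have l: "?z * linear_form (b - scale t a) = ?z * ?y - const3 t * (?z * ?x)"
        unfolding linear_form_diff linear_form_scale by (simp only: right_diff_distrib mult.left_commute[of ?z "const3 t"])
      have I: "?z * ?y \<in> ?I" "?z * ?y - const3 t * (?z * ?x) \<in> ?I" "?p t \<in> ?I"
        unfolding l[symmetric] by (simp_all add: idl.span_base)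
      have "const3 (1 / t) * (?z * ?y - (?z * ?y - const3 t * (?z * ?x))) \<in> ?I"
        by (intro idl.span_scale idl.span_diff I)
      also have "const3 (1 / t) * (?z * ?y - (?z * ?y - const3 t * (?z * ?x))) = ?z * ?x"
        by (simp only: diff_diff_eq2 add_diff_cancel_left' const3_mult_assoc) (simp add: t)
      finally have "?J \<subseteq> ?I" using I by (intro idl.span_minimal idl.subspace_span) auto
      moreover have "?I \<subseteq> ?J"
      proof (rule idl.span_minimal[OF _ idl.subspace_span])
        have J: "?z * ?y \<in> ?J" "?z * ?x \<in> ?J" "?p t \<in> ?J" by (simp_all add: idl.span_base)
        then have "?z * linear_form (b - scale t a) \<in> ?J" unfolding l by (intro idl.span_diff[OF _ idl.span_scale])
        with J show "{?z * ?y, ?z * linear_form (b - scale t a), ?p t} \<subseteq> ?J" by simp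
      qed
      ultimately show ?thesis using S by simp
    qed
    then show "\<forall>\<^sub>F t in at 0. idl.span {?z * ?x, ?z * ?y, ?p t} \<in> Slip 3"
      using eventually_at_0_neq by (rule eventually_mono[rotated])
    show "cod_le (idl.span {?z * ?x, ?z * ?y, ?p 0}) k 3" for k
      using cod_le_point_and_pair[OF frame_rotate[OF frame_rotate[OF fr]] square_forms[of b], of k] fr
      by (simp add: frame_def)
    show "?p t \<in> forms 2" for t by (intro forms_diff square_forms forms_const_mult product_forms)
    show "isCont (\<lambda>t. cf (?p t) m) 0" for m unfolding lookup_minus cf_const_mult by (intro continuous_intros)
  qed (simp_all add: product_forms)
  then show ?thesis by simp
qed

text \<open>Three points on the conic \<open>b\<^sup>2 = a c\<close>, with parameters \<open>0\<close>, \<open>t\<close> and \<open>- t\<close>.\<close>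

lemma cod_le_conic:
  fixes s :: complex
  assumes fr: "frame a b c u v w"
  shows "cod_le (idl.span {linear_form c ^ 2 - const3 s * (linear_form a * linear_form c),
     linear_form b * linear_form c - const3 s * (linear_form a * linear_form b),
     linear_form b ^ 2 - linear_form a * linear_form c}) k 3"
proof (cases k)
  case 0
  then show ?thesis by (simp add: cod_le_0)
next
  case (Suc i)
  let ?x = "linear_form a" and ?y = "linear_form b" and ?z = "linear_form c"
  let ?G = "{?z ^ 2 - const3 s * (?x * ?z), ?y * ?z - const3 s * (?x * ?y), ?y ^ 2 - ?x * ?z}"
  let ?J = "idl.span ?G"
  let ?W = "\<lambda>i. {?x ^ Suc i, ?x ^ i * ?y, ?x ^ i * ?z}"
  have G2: "g \<in> forms 2" if "g \<in> ?G" for g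
  proof -
    have "?z ^ 2 - const3 s * (?x * ?z) \<in> forms 2" "?y * ?z - const3 s * (?x * ?y) \<in> forms 2" "?y ^ 2 - ?x * ?z \<in> forms 2"
      by (intro forms_diff forms_const_mult square_forms product_forms)+
    with that show ?thesis by blast
  qed
  have "forms (Suc i) \<subseteq> cvs.span ((?J \<inter> forms (Suc i)) \<union> ?W i)" for i
  proof (induction i)
    case 0
    have "forms 1 \<subseteq> cvs.span {?x, ?y, ?z}" by (rule frame_forms1_span[OF fr])
    also have "\<dots> \<subseteq> cvs.span ((?J \<inter> forms 1) \<union> ?W 0)" by (intro cvs.span_mono) simp
    finally show ?case by simp
  next
    case (Suc i)
    let ?S = "(?J \<inter> forms (Suc (Suc i))) \<union> ?W (Suc i)"
    show ?case
    proof (rule forms_Suc_spanned[OF fr idl.subspace_span Suc.IH])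
      have gen: "?x ^ i * g \<in> cvs.span ?S" if "g \<in> ?G" for g
      proof (rule cvs.span_base, rule UnI1, rule IntI)
        show "?x ^ i * g \<in> ?J" by (rule idl.span_scale[OF idl.span_base[OF that]])
        show "?x ^ i * g \<in> forms (Suc (Suc i))" using forms_mult[OF power_forms G2[OF that], of a i] by simp
      qed
      have b1: "?x ^ Suc (Suc i) \<in> cvs.span ?S" by (rule cvs.span_base) simp
      have b2: "?x ^ Suc i * ?y \<in> cvs.span ?S" by (rule cvs.span_base) simp
      have b3: "?x ^ Suc i * ?z \<in> cvs.span ?S" by (rule cvs.span_base) simp
      have zz: "?x ^ i * ?z * ?z \<in> cvs.span ?S"
      proof -
        have "?x ^ i * (?z ^ 2 - const3 s * (?x * ?z)) + scale s (?x ^ Suc i * ?z) \<in> cvs.span ?S"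
          by (rule cvs.span_add[OF gen cvs.span_scale[OF b3]]) simp
        also have "?x ^ i * (?z ^ 2 - const3 s * (?x * ?z)) + scale s (?x ^ Suc i * ?z) = ?x ^ i * ?z * ?z"
          unfolding scale_const3 by (simp only: right_diff_distrib power2_eq_square power_Suc mult_ac diff_add_cancel)
        finally show ?thesis .
      qed
      have yz: "?x ^ i * ?y * ?z \<in> cvs.span ?S"
      proof -
        have "?x ^ i * (?y * ?z - const3 s * (?x * ?y)) + scale s (?x ^ Suc i * ?y) \<in> cvs.span ?S"
          by (rule cvs.span_add[OF gen cvs.span_scale[OF b2]]) simp
        also have "?x ^ i * (?y * ?z - const3 s * (?x * ?y)) + scale s (?x ^ Suc i * ?y) = ?x ^ i * ?y * ?z"
          unfolding scale_const3 by (simp only: right_diff_distrib power_Suc mult_ac diff_add_cancel)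
        finally show ?thesis .
      qed
      have yy: "?x ^ i * ?y * ?y \<in> cvs.span ?S"
      proof -
        have "?x ^ i * (?y ^ 2 - ?x * ?z) + ?x ^ Suc i * ?z \<in> cvs.span ?S"
          by (rule cvs.span_add[OF gen b3]) simp
        also have "?x ^ i * (?y ^ 2 - ?x * ?z) + ?x ^ Suc i * ?z = ?x ^ i * ?y * ?y"
          by (simp only: right_diff_distrib power2_eq_square power_Suc mult_ac diff_add_cancel)
        finally show ?thesis .
      qed
      fix f r assume f: "f \<in> ?W i" and r: "r \<in> {a, b, c}"
      have "linear_form r * f = ?x ^ Suc (Suc i) \<or> linear_form r * f = ?x ^ Suc i * ?y \<or> linear_form r * f = ?x ^ Suc i * ?z
         \<or> linear_form r * f = ?x ^ i * ?y * ?y \<or> linear_form r * f = ?x ^ i * ?y * ?z \<or> linear_form r * f = ?x ^ i * ?z * ?z"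
        using f r by (elim insertE emptyE) (simp_all only: power_Suc mult_ac simp_thms)
      then show "linear_form r * f \<in> cvs.span ?S"
        by (elim disjE) (simp_all only: b1 b2 b3 yy yz zz)
    qed
  qed
  then show ?thesis unfolding Suc cod_le_def
    by (intro exI[of _ "?W i"] conjI) (simp_all add: card_insert_if)
qed

text \<open>As t tends to 0 the three points of the conic come together in the curvilinear scheme of
  length three at the point \<open>u\<close>.\<close>

lemma Slip_3_conic:
  assumes fr: "frame a b c u v w"
  shows "idl.span {linear_form c ^ 2, linear_form b * linear_form c, linear_form b ^ 2 - linear_form a * linear_form c} \<in> Slip 3"
proof -
  let ?x = "linear_form a" and ?y = "linear_form b" and ?z = "linear_form c"
  let ?g1 = "\<lambda>t. ?z ^ 2 - const3 (t ^ 2) * (?x * ?z)" and ?g2 = "\<lambda>t. ?y * ?z - const3 (t ^ 2) * (?x * ?y)"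
  have f2: "?z ^ 2 - const3 k * (?x * ?z) \<in> forms 2" "?y * ?z - const3 k * (?x * ?y) \<in> forms 2" "?y ^ 2 - ?x * ?z \<in> forms 2" for k
    by (intro forms_diff forms_const_mult square_forms product_forms)+
  have "idl.span {?g1 0, ?g2 0, ?y ^ 2 - ?x * ?z} \<in> Slip 3"
  proof (rule Slip_limit3[where gz = "\<lambda>_. ?y ^ 2 - ?x * ?z"])
    have "idl.span {?g1 t, ?g2 t, ?y ^ 2 - ?x * ?z} \<in> Slip 3" if t: "t \<noteq> 0" for t
    \<comment> \<open>The lines c = t^2 a, c = - t b and c = t b join the points in pairs, and each
      misses exactly one of the three.\<close>
    proof (rule Slip_pointsI[OF refl, where I = "{0::nat, 1, 2}" and d = 1
        and v = "\<lambda>i. if i = 0 then u else if i = 1 then u + scale t v + scale (t ^ 2) w else u + scale (- t) v + scale (t ^ 2) w"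
        and f = "\<lambda>i k. linear_form (if i = 0 then c - scale (t ^ 2) a else if i = 1 then c + scale t b else c - scale t b) ^ k"])
      show "homogeneous_ideal (idl.span {?g1 t, ?g2 t, ?y ^ 2 - ?x * ?z})" by (intro homogeneous_span3 f2)
      show "cod_le (idl.span {?g1 t, ?g2 t, ?y ^ 2 - ?x * ?z}) k 3" for k by (rule cod_le_conic[OF fr])
      show "\<exists>k. p \<in> forms k" if "p \<in> {?g1 t, ?g2 t, ?y ^ 2 - ?x * ?z}" for p using that f2 by blast
      show "eval3 p (if i = 0 then u else if i = 1 then u + scale t v + scale (t ^ 2) w else u + scale (- t) v + scale (t ^ 2) w) = 0"
        if "p \<in> {?g1 t, ?g2 t, ?y ^ 2 - ?x * ?z}" "i \<in> {0::nat, 1, 2}" for p i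
        using that fr by (auto simp: frame_def dot_add dot_diff dot_scale power2_eq_square)
      show "(eval3 (linear_form (if i = 0 then c - scale (t ^ 2) a else if i = 1 then c + scale t b else c - scale t b) ^ k)
          (if j = 0 then u else if j = 1 then u + scale t v + scale (t ^ 2) w else u + scale (- t) v + scale (t ^ 2) w) \<noteq> 0) \<longleftrightarrow> i = j"
        if "i \<in> {0::nat, 1, 2}" "j \<in> {0::nat, 1, 2}" "1 \<le> k" for i j k
        using that fr t by (auto simp: frame_def dot_add dot_diff dot_scale power2_eq_square)
    qed (auto simp: power_forms)
    then show "\<forall>\<^sub>F t in at 0. idl.span {?g1 t, ?g2 t, ?y ^ 2 - ?x * ?z} \<in> Slip 3"
      using eventually_at_0_neq by (rule eventually_mono[rotated])
    show "cod_le (idl.span {?g1 0, ?g2 0, ?y ^ 2 - ?x * ?z}) k 3" for k by (rule cod_le_conic[OF fr])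
    show "isCont (\<lambda>t. cf (?g1 t) m) 0" "isCont (\<lambda>t. cf (?g2 t) m) 0" for m
      unfolding lookup_minus cf_const_mult by (intro continuous_intros)+
  qed (simp_all only: f2 continuous_const)
  then show ?thesis by simp
qed

section \<open>Special cubics\<close>

lemma val3_square_times [simp]: "val3 a b c (linear_form u ^ 2 * linear_form v) =
    2 * (dot a u * dot b u * dot c v + dot a u * dot b v * dot c u + dot a v * dot b u * dot c u)"
proof -
  have "D c (linear_form u ^ 2 * linear_form v) = const3 (2 * dot c u) * (linear_form u * linear_form v) + const3 (dot c v) * linear_form u ^ 2"
    by (rule D_square_mult)
  then have "val3 a b c (linear_form u ^ 2 * linear_form v) =
      2 * dot c u * val2 a b (linear_form u * linear_form v) + dot c v * val2 a b (linear_form u ^ 2)"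
    unfolding val3_def val2_def by (simp only: D_add D_const_mult lookup_add cf_const_mult)
  then show ?thesis by (simp add: dot_commute[of u] dot_commute[of v] algebra_simps)
qed

lemma val3_times_square [simp]: "val3 a b c (linear_form u * linear_form v ^ 2) =
    2 * (dot a v * dot b v * dot c u + dot a v * dot b u * dot c v + dot a u * dot b v * dot c v)"
  using val3_square_times[of a b c v u] by (simp only: mult.commute[of "linear_form u"])

lemma quad_action:
  assumes fr: "frame a b c u v w" and q: "q \<in> forms 2"
  shows "cf (D s (diff_action q F)) 0 = val2 u u q / 2 * val3 s a a F + val2 u v q * val3 s a b F + val2 v v q / 2 * val3 s b b F
     + val2 u w q * val3 s a c F + val2 v w q * val3 s b c F + val2 w w q / 2 * val3 s c c F"
proof -
  have "diff_action q F = diff_action (const3 (val2 u u q / 2) * linear_form a ^ 2 + const3 (val2 u v q) * (linear_form a * linear_form b)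
    + const3 (val2 v v q / 2) * linear_form b ^ 2 + const3 (val2 u w q) * (linear_form a * linear_form c)
    + const3 (val2 v w q) * (linear_form b * linear_form c) + const3 (val2 w w q / 2) * linear_form c ^ 2) F"
    using quad_expand[OF frame_swap[OF fr] q] by (rule arg_cong)
  also have "\<dots> = const3 (val2 u u q / 2) * D a (D a F) + const3 (val2 u v q) * D a (D b F)
    + const3 (val2 v v q / 2) * D b (D b F) + const3 (val2 u w q) * D a (D c F)
    + const3 (val2 v w q) * D b (D c F) + const3 (val2 w w q / 2) * D c (D c F)"
    by (simp only: diff_action_add diff_action_mult diff_action_const diff_action_linear_form power2_eq_square)
  finally show ?thesis by (simp only: D_add D_const_mult lookup_add cf_const_mult val3_def)
qed

lemma quad_action_form:
  assumes fr: "frame a b c u v w" and q: "q \<in> forms 2" and F: "F \<in> forms 3"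
  shows "diff_action q F \<in> forms 1"
proof -
  have DD: "D s (D t F) \<in> forms 1" for s t using D_forms[OF D_forms[OF F], of s t] by (simp add: numeral_3_eq_3)
  have "diff_action q F = diff_action (const3 (val2 u u q / 2) * linear_form a ^ 2 + const3 (val2 u v q) * (linear_form a * linear_form b)
    + const3 (val2 v v q / 2) * linear_form b ^ 2 + const3 (val2 u w q) * (linear_form a * linear_form c)
    + const3 (val2 v w q) * (linear_form b * linear_form c) + const3 (val2 w w q / 2) * linear_form c ^ 2) F"
    using quad_expand[OF frame_swap[OF fr] q] by (rule arg_cong)
  also have "\<dots> \<in> forms 1"
    unfolding diff_action_add diff_action_mult diff_action_const diff_action_linear_form power2_eq_square
    by (intro forms_add forms_const_mult DD)
  finally show ?thesis .
qed

text \<open>A conic sends F to a linear form, which is zero as soon as its derivatives along a basis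
  are. Annihilation becomes three linear equations on the six coefficients of q.\<close>

lemma Ann_quad_iff:
  assumes fr: "frame a b c u v w" and q: "q \<in> forms 2" and F: "F \<in> forms 3"
  shows "q \<in> Ann F \<longleftrightarrow> (\<forall>s\<in>{a, b, c}. val2 u u q / 2 * val3 s a a F + val2 u v q * val3 s a b F + val2 v v q / 2 * val3 s b b F
     + val2 u w q * val3 s a c F + val2 v w q * val3 s b c F + val2 w w q / 2 * val3 s c c F = 0)"
  unfolding quad_action[OF fr q, symmetric]
proof
  assume "q \<in> Ann F"
  then show "\<forall>s\<in>{a, b, c}. cf (D s (diff_action q F)) 0 = 0" by (simp add: Ann_def)
next
  assume "\<forall>s\<in>{a, b, c}. cf (D s (diff_action q F)) 0 = 0"
  then have "diff_action q F = 0" using form1_expand[OF fr quad_action_form[OF fr q F]] by simp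
  then show "q \<in> Ann F" by (simp add: Ann_def)
qed

lemma Ann_subspace: "idl.subspace (Ann F)"
proof (rule idl.subspaceI)
  have 0: "diff_action x 0 = 0" for x using diff_action_scale_right[of x 0 0] by simp
  show "c * x \<in> Ann F" if "x \<in> Ann F" for c x using that 0 by (simp add: Ann_def diff_action_mult)
qed (simp_all add: Ann_def diff_action_add)

lemma Ann_linear:
  assumes fr: "frame a b c u v w" and L: "L \<in> forms 1" "L \<in> Ann F"
  shows "cf (D u L) 0 * val3 s t a F + cf (D v L) 0 * val3 s t b F + cf (D w L) 0 * val3 s t c F = 0"
proof -
  have "0 = diff_action (const3 (cf (D u L) 0) * linear_form a + const3 (cf (D v L) 0) * linear_form b + const3 (cf (D w L) 0) * linear_form c) F"
    using L(2) form1_expand[OF frame_swap[OF fr] L(1)] by (simp add: Ann_def)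
  also have "\<dots> = const3 (cf (D u L) 0) * D a F + const3 (cf (D v L) 0) * D b F + const3 (cf (D w L) 0) * D c F"
    by (simp only: diff_action_add diff_action_mult diff_action_const diff_action_linear_form)
  finally have e: "const3 (cf (D u L) 0) * D a F + const3 (cf (D v L) 0) * D b F + const3 (cf (D w L) 0) * D c F = 0" ..
  have "cf (D s (D t (const3 (cf (D u L) 0) * D a F + const3 (cf (D v L) 0) * D b F + const3 (cf (D w L) 0) * D c F))) 0 = 0"
    unfolding e by simp
  then show ?thesis by (simp only: D_add D_const_mult lookup_add cf_const_mult val3_def)
qed

text \<open>Where \<open>Ann F\<close> is spanned in degree k by no more elements than the dimension
  that J has there, the two pieces agree.\<close>

lemma piece_contains:
  assumes J: "idl.subspace J" "J \<subseteq> Ann F" and T: "finite T" "Ann F \<inter> forms k \<subseteq> cvs.span T"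
    and dim: "card T \<le> cvs.dim (J \<inter> forms k)"
  shows "Ann F \<inter> forms k \<subseteq> J"
proof -
  have "cvs.dim (Ann F \<inter> forms k) \<le> cvs.dim (J \<inter> forms k)" using cvs.dim_le_card[OF T(2,1)] dim by simp
  from subspace_eq_of_dim[OF subspace_piece[OF J(1)] _ T(2,1) this] J(2) show ?thesis by auto
qed

lemma Hilb_dims:
  assumes "J \<in> Hilb r"
  shows "cvs.dim (J \<inter> forms 1) = 3 - min r 3" "cvs.dim (J \<inter> forms 2) = 6 - min r 6"
proof -
  have "cvs.dim (J \<inter> forms k) + min r (cvs.dim (forms k)) = cvs.dim (forms k)" for k
    using assms by (simp add: Hilb_iff)
  from this[of 1] this[of 2] show "cvs.dim (J \<inter> forms 1) = 3 - min r 3" "cvs.dim (J \<inter> forms 2) = 6 - min r 6"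
    unfolding dim_forms_small by linarith+
qed

text \<open>If the generators of one member are forced into every J, then that member lies below
  every J, and equal Hilbert functions leave no room.\<close>

lemma border_VSP_singleton:
  assumes "border_rank F = r" "idl.span S \<in> Slip r" "S \<subseteq> Ann F"
    and "\<And>J. J \<in> Hilb r \<Longrightarrow> J \<subseteq> Ann F \<Longrightarrow> idl.subspace J \<Longrightarrow> S \<subseteq> J"
  shows "border_VSP F (border_rank F) = {idl.span S}"
proof
  have "idl.span S \<subseteq> Ann F" by (rule idl.span_minimal[OF assms(3) Ann_subspace])
  then show "{idl.span S} \<subseteq> border_VSP F (border_rank F)" using assms by (simp add: border_VSP_def)
  show "border_VSP F (border_rank F) \<subseteq> {idl.span S}"
  proof
    fix J assume "J \<in> border_VSP F (border_rank F)"
    then have J: "J \<in> Hilb r" "J \<subseteq> Ann F"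
      using Slip_subset_Hilb[of r] by (auto simp: border_VSP_def assms(1))
    note sub = homogeneous_idealD(1)[OF Hilb_homogeneous[OF J(1)]]
    have "idl.span S \<subseteq> J" by (rule idl.span_minimal[OF assms(4)[OF J sub] sub])
    with Hilb_eqI[OF subsetD[OF Slip_subset_Hilb assms(2)] J(1)] show "J \<in> {idl.span S}" by simp
  qed
qed

lemma VSP_conics:
  assumes "border_rank F = 3" "idl.span {f, g, h} \<in> Slip 3" and sub: "{f, g, h} \<subseteq> Ann F" "{f, g, h} \<subseteq> forms 2"
    and T: "Ann F \<inter> forms 2 \<subseteq> cvs.span {f, g, h}"
  shows "\<exists>J. border_VSP F (border_rank F) = {J}"
proof (rule exI, rule border_VSP_singleton[OF assms(1,2) sub(1)])
  fix J assume J: "J \<in> Hilb 3" "J \<subseteq> Ann F" "idl.subspace J"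
  have "card {f, g, h} \<le> cvs.dim (J \<inter> forms 2)"
    unfolding Hilb_dims(2)[OF J(1)] by (simp add: card_insert_if)
  from piece_contains[OF J(3,2) _ T this] sub show "{f, g, h} \<subseteq> J" by blast
qed

text \<open>For r = 2 the Hilbert function forces dimension 1 in degree 1 and 4 in degree 2. In the
  applications \<open>f\<close>, \<open>g\<close>, \<open>h\<close> are the products of z with the
  coordinates.\<close>

lemma VSP_line_conic:
  assumes "border_rank F = 2" "idl.span {z, q} \<in> Slip 2" and sub: "z \<in> Ann F" "q \<in> Ann F" "z \<in> forms 1" "q \<in> forms 2"
    and T: "Ann F \<inter> forms 1 \<subseteq> cvs.span {z}" "Ann F \<inter> forms 2 \<subseteq> cvs.span {f, g, h, q}"
  shows "\<exists>J. border_VSP F (border_rank F) = {J}"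
proof (rule exI, rule border_VSP_singleton[OF assms(1,2)])
  show "{z, q} \<subseteq> Ann F" using sub by simp
  fix J assume J: "J \<in> Hilb 2" "J \<subseteq> Ann F" "idl.subspace J"
  have "card {z} \<le> cvs.dim (J \<inter> forms 1)" "card {f, g, h, q} \<le> cvs.dim (J \<inter> forms 2)"
    unfolding Hilb_dims[OF J(1)] by (simp_all add: card_insert_if)
  from piece_contains[OF J(3,2) _ T(1) this(1)] piece_contains[OF J(3,2) _ T(2) this(2)] sub
  show "{z, q} \<subseteq> J" by blast
qed

lemma span_scale_const3: "x \<in> cvs.span S \<Longrightarrow> const3 k * x \<in> cvs.span S"
  unfolding scale_const3[symmetric] by (rule cvs.span_scale)

section \<open>The six types of cubics for which a single ideal remains\<close>

lemma VSP_fermat1: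
  assumes fr: "frame a b c u v w" and F: "F = linear_form u ^ 3"
  shows "\<exists>J. border_VSP F (border_rank F) = {J}"
proof (rule exI, rule border_VSP_singleton[OF border_rank_eq_1[OF fr F] Slip_1_point[OF fr]])
  show A: "{linear_form b, linear_form c} \<subseteq> Ann F"
    using fr by (simp add: F Ann_def D_power3 frame_def)
  fix J assume J: "J \<in> Hilb 1" "J \<subseteq> Ann F" "idl.subspace J"
  have c: "card {linear_form b, linear_form c} \<le> cvs.dim (J \<inter> forms 1)"
    unfolding Hilb_dims[OF J(1)] by (simp add: card_insert_if)
  have "Ann F \<inter> forms 1 \<subseteq> cvs.span {linear_form b, linear_form c}"
  proof
    fix L assume L: "L \<in> Ann F \<inter> forms 1"
    have "cf (D u L) 0 = 0"
      using Ann_linear[OF fr, of L F a a] L fr by (simp add: F frame_def)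
    then have "L = const3 (cf (D v L) 0) * linear_form b + const3 (cf (D w L) 0) * linear_form c"
      using form1_expand[OF frame_swap[OF fr], of L] L by simp
    also have "\<dots> \<in> cvs.span {linear_form b, linear_form c}"
      by (intro cvs.span_add span_scale_const3 cvs.span_base) simp_all
    finally show "L \<in> cvs.span {linear_form b, linear_form c}" .
  qed
  from piece_contains[OF J(3,2) _ this c] A linear_form_forms(1) show "{linear_form b, linear_form c} \<subseteq> J" by blast
qed

lemma VSP_fermat2:
  assumes fr: "frame a b c u v w" and F: "F = linear_form u ^ 3 + linear_form v ^ 3"
  shows "\<exists>J. border_VSP F (border_rank F) = {J}"
proof (rule VSP_line_conic[OF _ Slip_2_points[OF fr]])
  have F3: "F \<in> forms 3" unfolding F by (intro forms_add power_forms)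
  show "border_rank F = 2"
    by (rule border_rank_eq_2[where p = a and q = b and a = a and a' = a and b = b and b' = b])
       (use F3 fr in \<open>simp_all add: F limcubes_two_cubes val3_linear frame_def\<close>)
  show "linear_form c \<in> Ann F" using fr by (simp add: F Ann_def D_power3 D_add frame_def)
  show "linear_form a * linear_form b \<in> Ann F"
    using fr by (simp add: F Ann_quad_iff[OF fr product_forms F3[unfolded F]] val3_linear frame_def)
  show "Ann F \<inter> forms 1 \<subseteq> cvs.span {linear_form c}"
  proof
    fix L assume L: "L \<in> Ann F \<inter> forms 1"
    have "cf (D u L) 0 = 0" "cf (D v L) 0 = 0"
      using Ann_linear[OF fr, of L F a a] Ann_linear[OF fr, of L F b b] L fr by (simp_all add: F val3_linear frame_def)
    then have "L = const3 (cf (D w L) 0) * linear_form c"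
      using form1_expand[OF frame_swap[OF fr], of L] L by simp
    also have "\<dots> \<in> cvs.span {linear_form c}"
      by (intro span_scale_const3 cvs.span_base) simp
    finally show "L \<in> cvs.span {linear_form c}" .
  qed
  show "Ann F \<inter> forms 2 \<subseteq> cvs.span {linear_form a * linear_form c, linear_form b * linear_form c, linear_form c ^ 2, linear_form a * linear_form b}"
  proof
    fix q assume q: "q \<in> Ann F \<inter> forms 2"
    then have "val2 u u q = 0" "val2 v v q = 0"
      using fr Ann_quad_iff[OF fr _ F3, of q] by (simp_all add: F val3_linear frame_def)
    with quad_expand[OF frame_swap[OF fr], of q] q
    have "q = const3 (val2 u v q) * (linear_form a * linear_form b) + const3 (val2 u w q) * (linear_form a * linear_form c)
       + const3 (val2 v w q) * (linear_form b * linear_form c) + const3 (val2 w w q / 2) * linear_form c ^ 2" by simp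
    also have "\<dots> \<in> cvs.span {linear_form a * linear_form c, linear_form b * linear_form c, linear_form c ^ 2, linear_form a * linear_form b}"
      by (intro cvs.span_add span_scale_const3 cvs.span_base) simp_all
    finally show "q \<in> cvs.span {linear_form a * linear_form c, linear_form b * linear_form c, linear_form c ^ 2, linear_form a * linear_form b}" .
  qed
qed (rule linear_form_forms product_forms)+

lemma VSP_square_times:
  assumes fr: "frame a b c u v w" and F: "F = linear_form u ^ 2 * linear_form v"
  shows "\<exists>J. border_VSP F (border_rank F) = {J}"
proof (rule VSP_line_conic[OF _ Slip_2_double[OF fr]])
  have F3: "F \<in> forms 3" unfolding F using forms_mult[OF square_forms[of u] linear_form_forms(1)[of v]] by simp
  \<comment> \<open>The columns a b and a^2 are taken in this order against the rows a and b, which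
    makes the minor diagonal.\<close>
  show "border_rank F = 2"
    by (rule border_rank_eq_2[where p = a and q = b and a = a and a' = b and b = a and b' = a])
       (use F3 fr in \<open>simp_all add: F limcubes_square_times val3_linear frame_def\<close>)
  show "linear_form c \<in> Ann F" using fr by (simp add: F Ann_def D_square_mult frame_def)
  show "linear_form b ^ 2 \<in> Ann F"
    using fr by (simp add: F Ann_quad_iff[OF fr square_forms F3[unfolded F]] val3_linear frame_def)
  show "Ann F \<inter> forms 1 \<subseteq> cvs.span {linear_form c}"
  proof
    fix L assume L: "L \<in> Ann F \<inter> forms 1"
    have "cf (D u L) 0 = 0" "cf (D v L) 0 = 0"
      using Ann_linear[OF fr, of L F a b] Ann_linear[OF fr, of L F a a] L fr by (simp_all add: F val3_linear frame_def)
    then have "L = const3 (cf (D w L) 0) * linear_form c"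
      using form1_expand[OF frame_swap[OF fr], of L] L by simp
    also have "\<dots> \<in> cvs.span {linear_form c}"
      by (intro span_scale_const3 cvs.span_base) simp
    finally show "L \<in> cvs.span {linear_form c}" .
  qed
  show "Ann F \<inter> forms 2 \<subseteq> cvs.span {linear_form a * linear_form c, linear_form b * linear_form c, linear_form c ^ 2, linear_form b ^ 2}"
  proof
    fix q assume q: "q \<in> Ann F \<inter> forms 2"
    then have "val2 u u q = 0" "val2 u v q = 0"
      using fr Ann_quad_iff[OF fr _ F3, of q] by (simp_all add: F val3_linear frame_def)
    with quad_expand[OF frame_swap[OF fr], of q] q
    have "q = const3 (val2 v v q / 2) * linear_form b ^ 2 + const3 (val2 u w q) * (linear_form a * linear_form c)
       + const3 (val2 v w q) * (linear_form b * linear_form c) + const3 (val2 w w q / 2) * linear_form c ^ 2" by simp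
    also have "\<dots> \<in> cvs.span {linear_form a * linear_form c, linear_form b * linear_form c, linear_form c ^ 2, linear_form b ^ 2}"
      by (intro cvs.span_add span_scale_const3 cvs.span_base) simp_all
    finally show "q \<in> cvs.span {linear_form a * linear_form c, linear_form b * linear_form c, linear_form c ^ 2, linear_form b ^ 2}" .
  qed
qed (rule linear_form_forms square_forms)+

lemma VSP_fermat3:
  assumes fr: "frame a b c u v w" and F: "F = linear_form w ^ 3 + (linear_form u ^ 3 + linear_form v ^ 3)"
  shows "\<exists>J. border_VSP F (border_rank F) = {J}"
proof (rule VSP_conics[OF _ Slip_3_points[OF fr]])
  have F3: "F \<in> forms 3" unfolding F by (intro forms_add power_forms)
  have lim: "limcubes 3 F" unfolding F using limcubes_add[OF limcubes_cube[of w] limcubes_two_cubes[of u v]] by (simp add: numeral_3_eq_3)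
  show "border_rank F = 3"
    by (rule border_rank_eq_3[where ?p1.0 = a and ?p2.0 = b and ?p3.0 = c and ?a1.0 = a and a1' = a and ?a2.0 = b and a2' = b and ?a3.0 = c and a3' = c])
       (use F3 lim fr in \<open>simp_all add: F val3_linear frame_def\<close>)
  show "{linear_form a * linear_form b, linear_form a * linear_form c, linear_form b * linear_form c} \<subseteq> Ann F"
    using fr by (simp add: F Ann_quad_iff[OF fr product_forms F3[unfolded F]] val3_linear frame_def)
  show "Ann F \<inter> forms 2 \<subseteq> cvs.span {linear_form a * linear_form b, linear_form a * linear_form c, linear_form b * linear_form c}"
  proof
    fix q assume q: "q \<in> Ann F \<inter> forms 2"
    then have "val2 u u q = 0" "val2 v v q = 0" "val2 w w q = 0"
      using fr Ann_quad_iff[OF fr _ F3, of q] by (simp_all add: F val3_linear frame_def)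
    with quad_expand[OF frame_swap[OF fr], of q] q
    have "q = const3 (val2 u v q) * (linear_form a * linear_form b) + const3 (val2 u w q) * (linear_form a * linear_form c)
       + const3 (val2 v w q) * (linear_form b * linear_form c)" by simp
    also have "\<dots> \<in> cvs.span {linear_form a * linear_form b, linear_form a * linear_form c, linear_form b * linear_form c}"
      by (intro cvs.span_add span_scale_const3 cvs.span_base) simp_all
    finally show "q \<in> cvs.span {linear_form a * linear_form b, linear_form a * linear_form c, linear_form b * linear_form c}" .
  qed
qed (simp add: product_forms)

lemma VSP_cuspidal_cone:
  assumes fr: "frame a b c u v w" and F: "F = linear_form w ^ 3 + linear_form u ^ 2 * linear_form v"
  shows "\<exists>J. border_VSP F (border_rank F) = {J}"
proof (rule VSP_conics[OF _ Slip_3_double[OF fr]])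
  have F3: "F \<in> forms 3" unfolding F
    using forms_mult[OF square_forms[of u] linear_form_forms(1)[of v]] by (intro forms_add power_forms) simp
  have lim: "limcubes 3 F" unfolding F using limcubes_add[OF limcubes_cube[of w] limcubes_square_times[of u v]] by (simp add: numeral_3_eq_3)
  show "border_rank F = 3"
    by (rule border_rank_eq_3[where ?p1.0 = a and ?p2.0 = b and ?p3.0 = c and ?a1.0 = a and a1' = b and ?a2.0 = a and a2' = a and ?a3.0 = c and a3' = c])
       (use F3 lim fr in \<open>simp_all add: F val3_linear frame_def\<close>)
  show "{linear_form c * linear_form a, linear_form c * linear_form b, linear_form b ^ 2} \<subseteq> Ann F"
    using fr by (simp add: F Ann_quad_iff[OF fr product_forms F3[unfolded F]] Ann_quad_iff[OF fr square_forms F3[unfolded F]] val3_linear frame_def)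
  show "Ann F \<inter> forms 2 \<subseteq> cvs.span {linear_form c * linear_form a, linear_form c * linear_form b, linear_form b ^ 2}"
  proof
    fix q assume q: "q \<in> Ann F \<inter> forms 2"
    then have "val2 u u q = 0" "val2 u v q = 0" "val2 w w q = 0"
      using fr Ann_quad_iff[OF fr _ F3, of q] by (simp_all add: F val3_linear frame_def)
    with quad_expand[OF frame_swap[OF fr], of q] q
    have "q = const3 (val2 v v q / 2) * linear_form b ^ 2 + const3 (val2 u w q) * (linear_form c * linear_form a)
       + const3 (val2 v w q) * (linear_form c * linear_form b)"
      unfolding mult.commute[of "linear_form c"] by simp
    also have "\<dots> \<in> cvs.span {linear_form c * linear_form a, linear_form c * linear_form b, linear_form b ^ 2}"
      by (intro cvs.span_add span_scale_const3 cvs.span_base) simp_all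
    finally show "q \<in> cvs.span {linear_form c * linear_form a, linear_form c * linear_form b, linear_form b ^ 2}" .
  qed
qed (simp add: product_forms square_forms)

lemma VSP_conic_tangent:
  assumes fr: "frame a b c u v w" and F: "F = linear_form u ^ 2 * linear_form w + linear_form u * linear_form v ^ 2"
  shows "\<exists>J. border_VSP F (border_rank F) = {J}"
proof (rule VSP_conics[OF _ Slip_3_conic[OF fr]])
  have F3: "F \<in> forms 3" unfolding F
    using forms_mult[OF square_forms[of u] linear_form_forms(1)[of w]] forms_mult[OF linear_form_forms(1)[of u] square_forms[of v]]
    by (intro forms_add) (simp_all add: numeral_3_eq_3)
  have lim: "limcubes 3 F" unfolding F by (rule limcubes_conic_tangent)
  \<comment> \<open>Against the rows a, b, c the columns a c, a b, a^2 give a diagonal minor with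
    entries 2.\<close>
  show "border_rank F = 3"
    by (rule border_rank_eq_3[where ?p1.0 = a and ?p2.0 = b and ?p3.0 = c and ?a1.0 = a and a1' = c and ?a2.0 = a and a2' = b and ?a3.0 = a and a3' = a])
       (use F3 lim fr in \<open>simp_all add: F val3_linear frame_def\<close>)
  have f: "linear_form b ^ 2 - linear_form a * linear_form c \<in> forms 2" by (intro forms_diff square_forms product_forms)
  then show "{linear_form c ^ 2, linear_form b * linear_form c, linear_form b ^ 2 - linear_form a * linear_form c} \<subseteq> forms 2"
    by (simp add: product_forms square_forms)
  show "{linear_form c ^ 2, linear_form b * linear_form c, linear_form b ^ 2 - linear_form a * linear_form c} \<subseteq> Ann F"
    using fr by (simp add: F Ann_quad_iff[OF fr product_forms F3[unfolded F]] Ann_quad_iff[OF fr square_forms F3[unfolded F]]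
       Ann_quad_iff[OF fr f F3[unfolded F]] val3_linear frame_def)
  show "Ann F \<inter> forms 2 \<subseteq> cvs.span {linear_form c ^ 2, linear_form b * linear_form c, linear_form b ^ 2 - linear_form a * linear_form c}"
  proof
    fix q assume q: "q \<in> Ann F \<inter> forms 2"
    then have 0: "val2 u u q = 0" "val2 u v q = 0" and e: "val2 v v q + 2 * val2 u w q = 0"
      using fr Ann_quad_iff[OF fr _ F3, of q] by (simp_all add: F val3_linear frame_def algebra_simps)
    from e have k: "val2 u w q = - (val2 v v q / 2)" by (simp add: field_simps eq_neg_iff_add_eq_0 add.commute)
    have "q = const3 (val2 v v q / 2) * linear_form b ^ 2 + const3 (- (val2 v v q / 2)) * (linear_form a * linear_form c)
       + const3 (val2 v w q) * (linear_form b * linear_form c) + const3 (val2 w w q / 2) * linear_form c ^ 2"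
      using quad_expand[OF frame_swap[OF fr], of q] q unfolding 0 k by simp
    also have "\<dots> = const3 (val2 v v q / 2) * (linear_form b ^ 2 - linear_form a * linear_form c)
       + const3 (val2 v w q) * (linear_form b * linear_form c) + const3 (val2 w w q / 2) * linear_form c ^ 2"
      unfolding const3_minus by (simp only: mult_minus_left diff_conv_add_uminus distrib_left mult_minus_right)
    also have "\<dots> \<in> cvs.span {linear_form c ^ 2, linear_form b * linear_form c, linear_form b ^ 2 - linear_form a * linear_form c}"
      by (intro cvs.span_add span_scale_const3 cvs.span_base) simp_all
    finally show "q \<in> cvs.span {linear_form c ^ 2, linear_form b * linear_form c, linear_form b ^ 2 - linear_form a * linear_form c}" .
  qed
qed

lemma VSP_special_cubic:
  assumes "frame a b c u v w" "special_cubic u v w F"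
  shows "\<exists>J. border_VSP F (border_rank F) = {J}"
  using assms(2) unfolding special_cubic_def
  by (elim disjE) (rule VSP_fermat1[OF assms(1)] VSP_fermat2[OF assms(1)] VSP_square_times[OF assms(1)]
      VSP_fermat3[OF assms(1)] VSP_cuspidal_cone[OF assms(1)] VSP_conic_tangent[OF assms(1)], assumption)+

section \<open>Pencils of conics\<close>

definition indep2 :: "('i \<Rightarrow>\<^sub>0 complex) \<Rightarrow> ('i \<Rightarrow>\<^sub>0 complex) \<Rightarrow> bool" where
  "indep2 g h \<longleftrightarrow> (\<forall>s t. scale s g + scale t h = 0 \<longrightarrow> s = 0 \<and> t = 0)"

lemma indep2_card: "indep2 g h \<longleftrightarrow> g \<noteq> h \<and> cvs.independent {g, h}"
proof
  assume "indep2 g h"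
  then have i: "scale s g + scale t h = 0 \<Longrightarrow> s = 0 \<and> t = 0" for s t by (simp add: indep2_def)
  let ?w = "\<lambda>i. if i = (0::nat) then g else h"
  have "inj_on ?w {0, 1} \<and> cvs.independent (?w ` {0, 1})"
  proof (rule independent_imageI)
    fix c assume "(\<Sum>j\<in>{0, 1}. scale (c j) (?w j)) = 0"
    then show "\<forall>j\<in>{0, 1}. c j = 0" using i[of "c 0" "c 1"] by simp
  qed simp
  moreover have "?w ` {0, 1} = {g, h}" by auto
  ultimately show "g \<noteq> h \<and> cvs.independent {g, h}" by (auto simp: inj_on_def)
next
  assume gh: "g \<noteq> h \<and> cvs.independent {g, h}"
  let ?w = "\<lambda>i. if i = (0::nat) then g else h"
  have w: "?w ` {0, 1} = {g, h}" "inj_on ?w {0, 1}" using gh by (auto simp: inj_on_def)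
  show "indep2 g h" unfolding indep2_def
  proof (intro allI impI)
    fix s t assume "scale s g + scale t h = 0"
    then have "(\<Sum>i\<in>{0, 1}. scale (if i = 0 then s else t) (?w i)) = 0" by simp
    from independent_family_zero[OF w(2) _ _ this, of 0] independent_family_zero[OF w(2) _ _ this, of 1] gh w(1)
    show "s = 0 \<and> t = 0" by simp
  qed
qed

lemma indep2_exists:
  assumes "cvs.subspace A" "A \<subseteq> cvs.span W" "finite W" "2 \<le> cvs.dim A"
  shows "\<exists>g\<in>A. \<exists>h\<in>A. indep2 g h"
proof -
  obtain B where B: "B \<subseteq> A" "finite B" "cvs.independent B" "cvs.span B = A" "card B = cvs.dim A"
    by (rule subspace_finite_basis[OF assms(1-3)])
  then obtain C where C: "C \<subseteq> B" "card C = 2" using assms(4) obtain_subset_with_card_n[of 2 B] by metis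
  then obtain g h where gh: "C = {g, h}" "g \<noteq> h" by (auto simp: card_2_iff)
  have "cvs.independent {g, h}" using cvs.independent_mono[OF B(3) C(1)] gh(1) by simp
  then have "indep2 g h" using gh(2) by (simp add: indep2_card)
  then show ?thesis using B(1) C(1) gh(1) by blast
qed

lemma cross_0_multiple:
  assumes "cross l m = 0" "l \<noteq> 0" shows "\<exists>k. m = scale k l"
proof -
  have c: "cf l 1 * cf m 2 = cf l 2 * cf m 1" "cf l 2 * cf m 0 = cf l 0 * cf m 2" "cf l 0 * cf m 1 = cf l 1 * cf m 0"
    using arg_cong[OF assms(1), of "\<lambda>v. cf v 0"] arg_cong[OF assms(1), of "\<lambda>v. cf v 1"] arg_cong[OF assms(1), of "\<lambda>v. cf v 2"]
    by (simp_all add: cross_def)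
  have "cf l 0 \<noteq> 0 \<or> cf l 1 \<noteq> 0 \<or> cf l 2 \<noteq> 0" using vec3_eqI[of l 0] assms(2) by auto
  then show ?thesis
  proof (elim disjE)
    assume "cf l 0 \<noteq> 0"
    then show ?thesis using c by (intro exI[of _ "cf m 0 / cf l 0"] vec3_eqI) (simp_all add: field_simps)
  next
    assume "cf l 1 \<noteq> 0"
    then show ?thesis using c by (intro exI[of _ "cf m 1 / cf l 1"] vec3_eqI) (simp_all add: field_simps)
  next
    assume "cf l 2 \<noteq> 0"
    then show ?thesis using c by (intro exI[of _ "cf m 2 / cf l 2"] vec3_eqI) (simp_all add: field_simps)
  qed
qed

lemma common_orthogonal3:
  assumes "dot R (cross S T) = 0"
  shows "\<exists>n. n \<noteq> 0 \<and> dot n R = 0 \<and> dot n S = 0 \<and> dot n T = 0"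
proof (cases "cross S T = 0")
  case False
  then show ?thesis using assms by (intro exI[of _ "cross S T"]) (simp add: dot_commute)
next
  case True
  show ?thesis
  proof (cases "S = 0")
    case S: True
    from common_orthogonal[of R T] show ?thesis using S by auto
  next
    case False
    from cross_0_multiple[OF True False] obtain k where "T = scale k S" ..
    with common_orthogonal[of R S] show ?thesis by (auto simp: dot_scale)
  qed
qed

text \<open>The determinant of the symmetric 3 by 3 matrix with diagonal x, y, z and entries p, q, r
  above the diagonal.\<close>

definition sdet :: "'a::comm_ring_1 \<Rightarrow> 'a \<Rightarrow> 'a \<Rightarrow> 'a \<Rightarrow> 'a \<Rightarrow> 'a \<Rightarrow> 'a" where
  "sdet x y z p q r = x * y * z + 2 * p * q * r - x * r ^ 2 - y * q ^ 2 - z * p ^ 2"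

text \<open>With s = 1 the determinant is a cubic in t whose leading coefficient is the determinant
  of the second member. If the latter is 0, this member itself is singular; otherwise the cubic has
  a root.\<close>

lemma sdet_pencil_root:
  fixes x y z p q r x' y' z' p' q' r' :: complex
  shows "\<exists>s t. (s \<noteq> 0 \<or> t \<noteq> 0) \<and> sdet (s * x + t * x') (s * y + t * y') (s * z + t * z') (s * p + t * p') (s * q + t * q') (s * r + t * r') = 0"
proof (cases "sdet x' y' z' p' q' r' = 0")
  case True
  then show ?thesis by (intro exI[of _ 0] exI[of _ 1]) simp
next
  case False
  let ?P = "[:sdet x y z p q r,
     x' * y * z + x * y' * z + x * y * z' + 2 * (p' * q * r + p * q' * r + p * q * r')
       - x' * r ^ 2 - 2 * x * r * r' - y' * q ^ 2 - 2 * y * q * q' - z' * p ^ 2 - 2 * z * p * p',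
     x * y' * z' + x' * y * z' + x' * y' * z + 2 * (p * q' * r' + p' * q * r' + p' * q' * r)
       - x * r' ^ 2 - 2 * x' * r' * r - y * q' ^ 2 - 2 * y' * q' * q - z * p' ^ 2 - 2 * z' * p' * p,
     sdet x' y' z' p' q' r':]"
  have "\<exists>t. poly ?P t = 0"
    by (rule fundamental_theorem_of_algebra_alt) (use False in auto)
  then obtain t where "poly ?P t = 0" ..
  moreover have "poly ?P t = sdet (1 * x + t * x') (1 * y + t * y') (1 * z + t * z') (1 * p + t * p') (1 * q + t * q') (1 * r + t * r')"
    unfolding poly_pCons poly_0 sdet_def by Groebner_Basis.algebra
  ultimately show ?thesis by (intro exI[of _ 1] exI[of _ t]) simp
qed

lemma val2_vec: "val2 (x + y) z Q = val2 x z Q + val2 y z Q" "val2 (scale k x) z Q = k * val2 x z Q"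
  by (simp_all add: val2_def D_vec_add D_vec_scale lookup_add)

lemma product_of_linear_forms2:
  fixes x y :: "'a::comm_ring_1"
  shows "(p1 * x + p2 * y) * (q1 * x + q2 * y) = p1 * q1 * x ^ 2 + (p1 * q2 + p2 * q1) * (x * y) + p2 * q2 * y ^ 2"
  by (simp add: algebra_simps power2_eq_square)

text \<open>The second equation says that the discriminant is the square of the determinant of the
  two factors, so a nonzero discriminant means independent factors.\<close>

lemma binary_form_product:
  assumes fr: "frame a b c u v w" and Q: "Q \<in> forms 2" "D c Q = 0"
  obtains p1 p2 q1 q2 where "Q = linear_form (scale p1 u + scale p2 v) * linear_form (scale q1 u + scale q2 v)"
    "val2 a b Q ^ 2 - val2 a a Q * val2 b b Q = (p1 * q2 - p2 * q1) ^ 2"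
proof -
  from binary_quadratic_factor[of "val2 a a Q / 2" "val2 a b Q" "val2 b b Q / 2"]
  obtain p1 p2 q1 q2 where e: "val2 a a Q / 2 = p1 * q1" "val2 a b Q = p1 * q2 + p2 * q1" "val2 b b Q / 2 = p2 * q2"
    by (elim exE conjE)
  have c: "val2 x c Q = 0" for x using Q(2) by (simp add: val2_def)
  have "Q = const3 (val2 a a Q / 2) * linear_form u ^ 2 + const3 (val2 a b Q) * (linear_form u * linear_form v)
    + const3 (val2 b b Q / 2) * linear_form v ^ 2" using quad_expand[OF fr Q(1)] unfolding c by simp
  also have "\<dots> = linear_form (scale p1 u + scale p2 v) * linear_form (scale q1 u + scale q2 v)"
    unfolding e linear_form_add linear_form_scale product_of_linear_forms2 const3_mult const3_add ..
  finally have 1: "Q = linear_form (scale p1 u + scale p2 v) * linear_form (scale q1 u + scale q2 v)" .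
  have f: "val2 a a Q = 2 * (p1 * q1)" "val2 b b Q = 2 * (p2 * q2)" using e by (simp_all add: field_simps)
  have "val2 a b Q ^ 2 - val2 a a Q * val2 b b Q = (p1 * q2 - p2 * q1) ^ 2" unfolding f e(2) by Groebner_Basis.algebra
  with 1 show ?thesis by (rule that)
qed

lemma binary_form_square:
  assumes fr: "frame a b c u v w" and Q: "Q \<in> forms 2" "D c Q = 0" and d: "val2 a b Q ^ 2 = val2 a a Q * val2 b b Q"
  shows "\<exists>y. Q = linear_form y ^ 2"
proof -
  from binary_form_product[OF fr Q] obtain p1 p2 q1 q2
    where e: "Q = linear_form (scale p1 u + scale p2 v) * linear_form (scale q1 u + scale q2 v)"
      "val2 a b Q ^ 2 - val2 a a Q * val2 b b Q = (p1 * q2 - p2 * q1) ^ 2" by blast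
  let ?P = "scale p1 u + scale p2 v" and ?Q = "scale q1 u + scale q2 v"
  from e(2) d have k: "p1 * q2 = p2 * q1" by simp
  have "\<exists>r s t. ?P = scale s r \<and> ?Q = scale t r"
  proof (cases "p1 = 0 \<and> p2 = 0")
    case True
    then show ?thesis by (intro exI[of _ ?Q] exI[of _ 0] exI[of _ 1]) simp
  next
    case False
    then consider "p1 \<noteq> 0" | "p2 \<noteq> 0" by blast
    then have "\<exists>t. q1 = t * p1 \<and> q2 = t * p2"
    proof cases
      case 1 then show ?thesis using k by (intro exI[of _ "q1 / p1"]) (simp add: field_simps)
    next
      case 2 then show ?thesis using k by (intro exI[of _ "q2 / p2"]) (simp add: field_simps)
    qed
    then obtain t where "q1 = t * p1" "q2 = t * p2" by blast
    then have "?Q = scale t ?P" by (simp add: cvs.scale_right_distrib)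
    then show ?thesis by (intro exI[of _ ?P] exI[of _ 1] exI[of _ t]) simp
  qed
  then obtain r s t where r: "?P = scale s r" "?Q = scale t r" by blast
  have "Q = linear_form (scale (csqrt (s * t)) r) ^ 2"
  proof -
    have "Q = const3 (s * t) * linear_form r ^ 2"
      unfolding e(1) r linear_form_scale const3_mult power2_eq_square by (simp only: mult_ac)
    also have "s * t = csqrt (s * t) ^ 2" by simp
    finally show ?thesis unfolding linear_form_scale power_mult_distrib const3_power .
  qed
  then show ?thesis ..
qed

text \<open>A root of the discriminant gives a singular member of the pencil, which is killed by the derivative along its vertex.\<close>

lemma pencil_product:
  assumes "g \<in> forms 2" "h \<in> forms 2"
  shows "\<exists>s t l m. (s \<noteq> 0 \<or> t \<noteq> 0) \<and> scale s g + scale t h = linear_form l * linear_form m"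
proof -
  have "v3 1 0 0 \<noteq> 0" using cf_v3(1)[of 1 0 0] by (metis lookup_zero zero_neq_one)
  then obtain a b c u v w where fr: "frame a b c u v w" using frame_extend1 by meson
  from sdet_pencil_root[of "val2 u u g" "val2 u u h" "val2 v v g" "val2 v v h" "val2 w w g" "val2 w w h"
      "val2 u v g" "val2 u v h" "val2 u w g" "val2 u w h" "val2 v w g" "val2 v w h"]
  obtain s t where st: "s \<noteq> 0 \<or> t \<noteq> 0" and det: "sdet (s * val2 u u g + t * val2 u u h) (s * val2 v v g + t * val2 v v h)
     (s * val2 w w g + t * val2 w w h) (s * val2 u v g + t * val2 u v h) (s * val2 u w g + t * val2 u w h) (s * val2 v w g + t * val2 v w h) = 0"
    by (elim exE conjE)
  define Q where "Q = scale s g + scale t h"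
  have Q: "Q \<in> forms 2" unfolding Q_def by (intro forms_add forms_scale assms)
  have v: "val2 x y Q = s * val2 x y g + t * val2 x y h" for x y unfolding Q_def by (simp add: scale_const3)
  let ?R = "\<lambda>x. v3 (val2 u x Q) (val2 v x Q) (val2 w x Q)"
  have "dot (?R u) (cross (?R v) (?R w)) = sdet (val2 u u Q) (val2 v v Q) (val2 w w Q) (val2 u v Q) (val2 u w Q) (val2 v w Q)"
    unfolding dot_def cross_def cf_v3 sdet_def val2_swap[of v u] val2_swap[of w u] val2_swap[of w v] by Groebner_Basis.algebra
  then have "dot (?R u) (cross (?R v) (?R w)) = 0" using det unfolding v by simp
  from common_orthogonal3[OF this] obtain n where n: "n \<noteq> 0" "dot n (?R u) = 0" "dot n (?R v) = 0" "dot n (?R w) = 0" by blast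
  \<comment> \<open>\<open>n\<close> lies in the kernel of the symmetric matrix of Q; the
    corresponding vector is a vertex of the singular conic.\<close>
  let ?x = "scale (cf n 0) u + scale (cf n 1) v + scale (cf n 2) w"
  have 0: "val2 ?x u Q = 0" "val2 ?x v Q = 0" "val2 ?x w Q = 0" using n(2-) by (simp_all add: val2_vec dot_def)
  have "D ?x Q \<in> forms 1" using D_forms[OF Q] by simp
  from form1_expand[OF frame_swap[OF fr] this] have DQ: "D ?x Q = 0"
    using 0 by (simp add: val2_def D_commute[of _ ?x])
  have "?x \<noteq> 0"
  proof
    assume "?x = 0"
    then have "dot a ?x = 0" "dot b ?x = 0" "dot c ?x = 0" by simp_all
    then have "cf n 0 = 0" "cf n 1 = 0" "cf n 2 = 0" using fr by (simp_all add: dot_add dot_scale frame_def)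
    with n(1) show False using vec3_eqI[of n 0] by simp
  qed
  from frame_extend1[OF this] obtain a' b' c' v' w' where "frame a' b' c' ?x v' w'" by (elim exE)
  from binary_form_product[OF frame_rotate[OF frame_swap[OF this]] Q DQ]
  obtain l m where "Q = linear_form l * linear_form m" by metis
  then show ?thesis using st unfolding Q_def by blast
qed

section \<open>Cubics without square polars\<close>

text \<open>Six coefficients of a conic against the three equations of
  \<open>Ann_quad_iff\<close>.\<close>

lemma dim_Ann_quad_ge:
  assumes F: "F \<in> forms 3"
  shows "3 \<le> cvs.dim (Ann F \<inter> forms 2)"
proof -
  have "v3 1 0 0 \<noteq> 0" using cf_v3(1)[of 1 0 0] by (metis lookup_zero zero_neq_one)
  then obtain a b c u v w where fr: "frame a b c u v w" using frame_extend1 by meson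
  let ?e = "\<lambda>s q. cf (D s (diff_action q F)) 0"
  have "Ann F \<inter> forms 2 = {q \<in> forms 2. \<forall>s\<in>{a, b, c}. ?e s q = 0}"
    using Ann_quad_iff[OF fr _ F] quad_action[OF fr, of _ _ F] by auto
  moreover have "cvs.dim (forms 2) \<le> cvs.dim {q \<in> forms 2. \<forall>s\<in>{a, b, c}. ?e s q = 0} + card {a, b, c}"
  proof (rule dim_kernel_ge[OF _ subspace_forms forms_fin])
    show "?e i (scale k x) = k * ?e i x" for i k x
      by (simp add: scale_const3 diff_action_mult D_const_mult cf_const_mult)
  qed (simp_all add: diff_action_add D_add lookup_add)
  moreover have "card {a, b, c} \<le> 3" by (simp add: card_insert_if)
  ultimately show ?thesis unfolding dim_forms_small by simp
qed

text \<open>The case y = 0 is included, so such an F is in particular not a cubic in fewer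
  variables.\<close>

definition no_square_polar :: "poly3 \<Rightarrow> bool" where
  "no_square_polar F \<longleftrightarrow> (\<forall>s y. s \<noteq> 0 \<longrightarrow> D s F \<noteq> linear_form y ^ 2)"

lemma frame_nonzero: "frame a b c u v w \<Longrightarrow> a \<noteq> 0 \<and> b \<noteq> 0 \<and> c \<noteq> 0 \<and> u \<noteq> 0 \<and> v \<noteq> 0 \<and> w \<noteq> 0"
  by (auto simp: frame_def)

text \<open>The polar D a F is killed by b, hence a binary form in the coordinates dual to a and c.
  It is not a square, so its discriminant is nonzero, which is the inequality.\<close>

lemma no_square_polar_val:
  assumes nsq: "no_square_polar F" and F: "F \<in> forms 3" and fr: "frame a b c u v w" and 0: "D b (D a F) = 0"
  shows "val3 a c a F ^ 2 \<noteq> val3 a a a F * val3 c c a F"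
proof
  assume e: "val3 a c a F ^ 2 = val3 a a a F * val3 c c a F"
  have "D a F \<in> forms 2" using D_forms[OF F] by simp
  from binary_form_square[OF frame_flip[OF frame_rotate[OF frame_rotate[OF fr]]] this 0]
  have "\<exists>y. D a F = linear_form y ^ 2" using e by (simp add: val3_def val2_def)
  with nsq frame_nonzero[OF fr] show False by (auto simp: no_square_polar_def)
qed

text \<open>The derivatives of D l F along x and y are Q and P, and x^2 - y^2 sends F to a
  combination of these two. So multiples of x l and y l correct x^2 - y^2 to a conic that
  annihilates F and, up to a multiple of l^2, still splits into independent factors.\<close>

lemma product_annihilator_aux:
  assumes fr: "frame x y l P Q a" and F: "F \<in> forms 3" and e: "D l F = linear_form P * linear_form Q"
  shows "\<exists>a b c u v w. frame a b c u v w \<and> D a (D b F) = 0"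
proof -
  have vl: "val3 r s l F = dot r P * dot s Q + dot r Q * dot s P" for r s
    unfolding val3_def e D2_product by (simp add: dot_commute[of r] dot_commute[of s] mult.commute)
  have vals: "val3 x x l F = 0" "val3 x y l F = 1" "val3 y y l F = 0" "val3 x l l F = 0" "val3 y l l F = 0" "val3 l l l F = 0"
    unfolding vl using fr by (simp_all add: frame_def)
  note perm = val3_12[of y x] val3_12[of l x] val3_12[of l y] val3_23[of _ l x] val3_23[of _ l y] val3_23[of _ y x]
  \<comment> \<open>Chosen such that x^2 - y^2 + 2 r1 x l - 2 r2 y l annihilates F. Adding a
    multiple of l^2, which annihilates F too, turns this into a product.\<close>
  define r1 r2 where "r1 = (val3 y y y F - val3 x x y F) / 2" and "r2 = (val3 x x x F - val3 x y y F) / 2"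
  have "1 * 1 - (- 1) * (1::complex) \<noteq> 0" by simp
  from frame_mix[OF fr this] obtain u' v' where "frame (scale 1 x + scale (- 1) y) (scale 1 x + scale 1 y) l u' v' a"
    by (elim exE)
  from frame_shear[OF this, of "r2 - r1" "- (r1 + r2)"] obtain w'
    where fr3: "frame (scale 1 x + scale (- 1) y - scale (r2 - r1) l) (scale 1 x + scale 1 y - scale (- (r1 + r2)) l) l u' v' w'" by blast
  let ?L = "scale 1 x + scale (- 1) y - scale (r2 - r1) l" and ?M = "scale 1 x + scale 1 y - scale (- (r1 + r2)) l"
  have dots: "dot ?L P = 1" "dot ?L Q = - 1" "dot ?L a = r1 - r2" "dot ?M P = 1" "dot ?M Q = 1" "dot ?M a = r1 + r2"
    using fr by (simp_all add: dot_add dot_diff dot_scale frame_def)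
  have "linear_form ?L * linear_form ?M \<in> Ann F"
    unfolding Ann_quad_iff[OF fr product_forms F] val2_product dots ball_simps perm vals
    by (simp add: r1_def r2_def field_simps)
  then have "D ?L (D ?M F) = 0" by (simp add: Ann_def diff_action_mult)
  with fr3 show ?thesis by blast
qed

text \<open>A pencil in \<open>Ann F\<close> has a singular member l m. If its factors are
  dependent, l^2 annihilates F; then D l F is a binary form, and not being a square it is a product
  of independent factors, from which \<open>product_annihilator_aux\<close> builds another
  conic.\<close>

lemma product_annihilator:
  assumes nsq: "no_square_polar F" and F: "F \<in> forms 3"
  shows "\<exists>a b c u v w. frame a b c u v w \<and> D a (D b F) = 0"
proof -
  have "2 \<le> cvs.dim (Ann F \<inter> forms 2)" using dim_Ann_quad_ge[OF F] by simp
  from indep2_exists[OF subspace_piece[OF Ann_subspace] order_trans[OF Int_lower2 forms_fin(1)] forms_fin(2) this]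
  obtain g h where gh: "g \<in> Ann F" "g \<in> forms 2" "h \<in> Ann F" "h \<in> forms 2" "indep2 g h" by blast
  from pencil_product[OF gh(2,4)] obtain s t l m where
    p: "s \<noteq> 0 \<or> t \<noteq> 0" "scale s g + scale t h = linear_form l * linear_form m" by (elim exE conjE)
  have "scale s g + scale t h \<in> Ann F"
    by (intro cvs.subspace_add[OF ideal_cvs_subspace[OF Ann_subspace]] cvs.subspace_scale[OF ideal_cvs_subspace[OF Ann_subspace]] gh)
  then have lm: "D l (D m F) = 0" by (simp add: p(2) Ann_def diff_action_mult)
  have "linear_form l * linear_form m \<noteq> 0" using gh(5) p unfolding indep2_def by metis
  then have nz: "l \<noteq> 0" "m \<noteq> 0" using linear_form_scale[of 0 0] by auto
  show ?thesis
  proof (cases "cross l m = 0")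
    case False
    from frame_extend2[OF this] obtain a b c w where "frame a b c l m w" by (elim exE)
    from frame_swap[OF this] lm show ?thesis by blast
  next
    case True
    from cross_0_multiple[OF True nz(1)] obtain k where k: "m = scale k l" ..
    with nz have "k \<noteq> 0" by auto
    with lm have ll: "D l (D l F) = 0" by (simp add: k D_vec_scale D_scale)
    from frame_extend1[OF nz(1)] obtain a b c v w where "frame a b c l v w" by (elim exE)
    note fr = frame_rotate[OF frame_swap[OF this]]
    have Q: "D l F \<in> forms 2" using D_forms[OF F] by simp
    from binary_form_product[OF fr Q ll] obtain p1 p2 q1 q2
      where e: "D l F = linear_form (scale p1 b + scale p2 c) * linear_form (scale q1 b + scale q2 c)"
        "val2 v w (D l F) ^ 2 - val2 v v (D l F) * val2 w w (D l F) = (p1 * q2 - p2 * q1) ^ 2" by metis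
    have "\<nexists>y. D l F = linear_form y ^ 2" using nsq nz(1) by (auto simp: no_square_polar_def)
    then have "val2 v w (D l F) ^ 2 \<noteq> val2 v v (D l F) * val2 w w (D l F)"
      using binary_form_square[OF fr Q ll] by blast
    with e(2) have "p1 * q2 - p2 * q1 \<noteq> 0" by auto
    from frame_mix[OF frame_swap[OF fr] this] obtain x y
      where "frame (scale p1 b + scale p2 c) (scale q1 b + scale q2 c) a x y l" by (elim exE)
    from product_annihilator_aux[OF frame_swap[OF this] F e(1)] show ?thesis .
  qed
qed

text \<open>This is x adj(C) y - z adj(C) z, with C the symmetric matrix of the entries c. If x and
  z are the first two rows of A, and z and y those of B, all symmetric, it is the difference of the
  entries (1,2) and (2,1) of A adj(C) B.\<close>

definition aronf :: "'a::comm_ring_1 \<Rightarrow> 'a \<Rightarrow> 'a \<Rightarrow> 'a \<Rightarrow> 'a \<Rightarrow> 'a \<Rightarrow> 'a \<Rightarrow> 'a \<Rightarrow> 'a \<Rightarrow> 'a \<Rightarrow> 'a \<Rightarrow> 'a \<Rightarrow> 'a \<Rightarrow> 'a \<Rightarrow> 'a \<Rightarrow> 'a" where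
  "aronf x0 x1 x2 y0 y1 y2 z0 z1 z2 c00 c01 c02 c11 c12 c22 =
    (c11*c22-c12^2)*(x0*y0-z0^2) + (c00*c22-c02^2)*(x1*y1-z1^2) + (c00*c11-c01^2)*(x2*y2-z2^2)
  + (c02*c12-c01*c22)*(x0*y1+x1*y0-2*z0*z1) + (c01*c12-c02*c11)*(x0*y2+x2*y0-2*z0*z2)
  + (c01*c02-c00*c12)*(x1*y2+x2*y1-2*z1*z2)"

text \<open>A polynomial identity in the weights s of three cubes and the values p, q, r of their
  linear forms on three vectors; the numerical factor 6 of the derivatives is later absorbed into
  the weights.\<close>

lemma aronf_cubes:
  fixes p1 p2 p3 q1 q2 q3 r1 r2 r3 s1 s2 s3 :: complex
  defines "M \<equiv> \<lambda>e1 e2 e3. s1*e1+s2*e2+s3*e3"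
  shows "aronf (M (p1^3) (p2^3) (p3^3)) (M (p1^2*q1) (p2^2*q2) (p3^2*q3)) (M (p1^2*r1) (p2^2*r2) (p3^2*r3))
   (M (p1*q1^2) (p2*q2^2) (p3*q3^2)) (M (q1^3) (q2^3) (q3^3)) (M (q1^2*r1) (q2^2*r2) (q3^2*r3))
   (M (p1^2*q1) (p2^2*q2) (p3^2*q3)) (M (p1*q1^2) (p2*q2^2) (p3*q3^2)) (M (p1*q1*r1) (p2*q2*r2) (p3*q3*r3))
   (M (p1^2*r1) (p2^2*r2) (p3^2*r3)) (M (p1*q1*r1) (p2*q2*r2) (p3*q3*r3)) (M (p1*r1^2) (p2*r2^2) (p3*r3^2))
   (M (q1^2*r1) (q2^2*r2) (q3^2*r3)) (M (q1*r1^2) (q2*r2^2) (q3*r3^2)) (M (r1^3) (r2^3) (r3^3)) = 0"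
  unfolding M_def aronf_def by Groebner_Basis.algebra

text \<open>Strassen's equation: for a sum of three cubes the Hessians \<open>A\<close>, \<open>B\<close>, \<open>C\<close> of the three partial
  derivatives are simultaneously diagonalised by a congruence, so that \<open>A adj(C) B\<close> is symmetric.
  Up to a constant this is the Aronhold invariant.\<close>

definition aronhold :: "(3 \<Rightarrow>\<^sub>0 complex) \<Rightarrow> (3 \<Rightarrow>\<^sub>0 complex) \<Rightarrow> (3 \<Rightarrow>\<^sub>0 complex) \<Rightarrow> poly3 \<Rightarrow> complex" where
  "aronhold a b c G = aronf (val3 a a a G) (val3 a a b G) (val3 a a c G) (val3 a b b G) (val3 b b b G) (val3 b b c G)
     (val3 a a b G) (val3 a b b G) (val3 a b c G)
     (val3 a a c G) (val3 a b c G) (val3 a c c G) (val3 b b c G) (val3 b c c G) (val3 c c c G)"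

lemma aronhold_three_cubes:
  assumes "sumcubes 3 G" shows "aronhold a b c G = 0"
proof -
  have "sumcubes (Suc (Suc (Suc 0))) G" using assms by (simp add: numeral_3_eq_3)
  then obtain H r j where H: "sumcubes (Suc (Suc 0)) H" "G = H + const3 r * linear_form j ^ 3"
    unfolding sumcubes.simps(2)[of "Suc (Suc 0)"] by (elim exE conjE)
  from H(1) obtain s l t k where "H = const3 s * linear_form l ^ 3 + const3 t * linear_form k ^ 3"
    unfolding sumcubes.simps by (elim exE conjE) simp
  with H(2) have "G = const3 s * linear_form l ^ 3 + const3 t * linear_form k ^ 3 + const3 r * linear_form j ^ 3" by (simp only:)
  then have e: "val3 x y z G = (6 * s) * (dot x l * dot y l * dot z l) + (6 * t) * (dot x k * dot y k * dot z k)
      + (6 * r) * (dot x j * dot y j * dot z j)" for x y z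
    by (simp add: val3_linear mult_ac)
  show ?thesis unfolding e aronhold_def
    using aronf_cubes[of "6 * s" "dot a l" "6 * t" "dot a k" "6 * r" "dot a j" "dot b l" "dot b k" "dot b j" "dot c l" "dot c k" "dot c j"]
    unfolding power3_eq_cube power2_eq_square mult.assoc[symmetric] .
qed

lemma coef_poly_aronhold: "coef_poly (aronhold a b c)"
  unfolding aronhold_def[abs_def] aronf_def power2_eq_square
  by (intro generated_algebra.add generated_algebra.mult fun_algebra_diff[OF fun_algebra_generated] generated_algebra.const coef_poly_val3)

lemma aronhold_scale: "aronhold a b c (scale k G) = k ^ 4 * aronhold a b c G"
  unfolding aronhold_def aronf_def val3_linear by Groebner_Basis.algebra

lemma border_rank_eq_4:
  assumes nsq: "no_square_polar F" and F: "F \<in> forms 3" and fr: "frame a b c u v w" and 0: "D a (D b F) = 0"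
  shows "border_rank F = 4"
proof -
  have ab: "val3 a b x F = 0" "val3 a a b F = 0" "val3 a b b F = 0" for x
    using val3_killed2[OF 0] by simp_all
  have ba: "D b (D a F) = 0" using 0 by (simp add: D_commute)
  have A: "val3 a a c F ^ 2 \<noteq> val3 a a a F * val3 a c c F"
    using no_square_polar_val[OF nsq F fr ba] by (simp add: val3_23[of a c a] val3_12[of c a] val3_23[of c c a])
  have B: "val3 b b c F ^ 2 \<noteq> val3 b b b F * val3 b c c F"
    using no_square_polar_val[OF nsq F frame_flip[OF fr] 0] by (simp add: val3_23[of b c b] val3_12[of c b] val3_23[of c c b])
  have ar: "aronhold a b c F = (val3 a a a F * val3 a c c F - val3 a a c F ^ 2) * (val3 b b b F * val3 b c c F - val3 b b c F ^ 2)"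
    unfolding aronhold_def ab aronf_def by (simp add: power2_eq_square algebra_simps)
  have nz: "aronhold a b c F \<noteq> 0" unfolding ar using A B by simp
  \<comment> \<open>No term couples u and v, so the cubic splits into two binary ones. The term w^3
    would fit into either part and is put into the first.\<close>
  let ?G = "const3 (val3 a a a F / 6) * linear_form u ^ 3 + const3 (val3 a a c F / 2) * (linear_form u ^ 2 * linear_form w)
      + const3 (val3 a c c F / 2) * (linear_form u * linear_form w ^ 2) + const3 (val3 c c c F / 6) * linear_form w ^ 3"
  let ?H = "const3 (val3 b b b F / 6) * linear_form v ^ 3
      + const3 (val3 b b c F / 2) * (linear_form v ^ 2 * linear_form w) + const3 (val3 b c c F / 2) * (linear_form v * linear_form w ^ 2)"
  have e: "F = ?G + ?H"
    using cubic_expand[OF fr F] unfolding ab by (simp only: add_ac) simp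
  have s: "linear_form x ^ 2 * linear_form y \<in> forms 3" "linear_form y * linear_form x ^ 2 \<in> forms 3" for x y
    using forms_mult[OF square_forms[of x] linear_form_forms(1)[of y]] by (simp_all add: mult.commute)
  have GH: "?G \<in> forms 3" "?H \<in> forms 3" by (intro forms_add forms_const_mult power_forms s)+
  have DG: "D b ?G = 0" "D a ?H = 0"
    using fr by (simp_all add: D_add D_const_mult D_power3 D_mult D_power2 frame_def)
  have lim: "limcubes (2 + 2) (?G + ?H)"
    by (rule limcubes_add[OF limcubes_binary[OF frame_rotate[OF frame_rotate[OF fr]] GH(1) DG(1)] limcubes_binary[OF frame_rotate[OF fr] GH(2) DG(2)]])
  have "border_rank F = Suc 3"
  proof (rule border_rankI[OF coef_poly_aronhold aronhold_scale aronhold_three_cubes nz F])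
    show "F \<noteq> 0" using nz by (auto simp: aronhold_def aronf_def val3_linear)
    show "limcubes (Suc 3) F" using lim unfolding e[symmetric] by simp
  qed
  then show ?thesis by simp
qed

text \<open>For the upper bound three conics independent modulo \<open>Ann F\<close> are exhibited.
  They are built from the second derivatives so as to send F to multiples of u, v and w; the
  multipliers are, up to sign, the two discriminants that do not vanish.\<close>

lemma dim_Ann_quad:
  assumes nsq: "no_square_polar F" and F: "F \<in> forms 3"
  shows "cvs.dim (Ann F \<inter> forms 2) = 3"
proof -
  from product_annihilator[OF nsq F] obtain a b c u v w where fr: "frame a b c u v w" and 0: "D a (D b F) = 0" by (elim exE conjE)
  have ab: "val3 x a b F = 0" "val3 a x b F = 0" "val3 a b x F = 0" "val3 x b a F = 0" "val3 b x a F = 0" "val3 b a x F = 0" for x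
    using val3_killed2[OF 0] by simp_all
  have ba: "D b (D a F) = 0" using 0 by (simp add: D_commute)
  have A: "val3 a a c F ^ 2 \<noteq> val3 a a a F * val3 a c c F"
    using no_square_polar_val[OF nsq F fr ba] by (simp add: val3_23[of a c a] val3_12[of c a] val3_23[of c c a])
  have B: "val3 b b c F ^ 2 \<noteq> val3 b b b F * val3 b c c F"
    using no_square_polar_val[OF nsq F frame_flip[OF fr] 0] by (simp add: val3_23[of b c b] val3_12[of c b] val3_23[of c c b])
  let ?x = "linear_form a" and ?y = "linear_form b" and ?z = "linear_form c"
  let ?w = "\<lambda>i. if i = (0::nat) then const3 (val3 a c c F) * ?x ^ 2 - const3 (val3 a a c F) * (?x * ?z)
     else if i = 1 then const3 (val3 b c c F) * ?y ^ 2 - const3 (val3 b b c F) * (?y * ?z)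
     else const3 (val3 a a c F) * ?x ^ 2 - const3 (val3 a a a F) * (?x * ?z)"
  have "const3 s * linear_form x ^ 2 - const3 t * (linear_form x * linear_form y) \<in> forms 2" for s t x y
    by (intro forms_diff forms_const_mult square_forms product_forms)
  then have w2: "?w i \<in> forms 2" for i by (simp only: split: if_split) (simp only: simp_thms)
  have "cvs.dim (Ann F \<inter> forms 2) + card {0::nat, 1, 2} \<le> cvs.dim (forms 2)"
  proof (rule vanishing_family_add_dim[OF subspace_piece[OF Ann_subspace] Int_lower2 forms_fin])
    show "?w i \<in> forms 2" for i by (rule w2)
    fix k assume k: "(\<Sum>i\<in>{0::nat, 1, 2}. scale (k i) (?w i)) \<in> Ann F \<inter> forms 2"
    have e: "(\<Sum>i\<in>{0::nat, 1, 2}. scale (k i) (?w i)) =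
         const3 (k 0) * (const3 (val3 a c c F) * ?x ^ 2 - const3 (val3 a a c F) * (?x * ?z))
       + const3 (k 1) * (const3 (val3 b c c F) * ?y ^ 2 - const3 (val3 b b c F) * (?y * ?z))
       + const3 (k 2) * (const3 (val3 a a c F) * ?x ^ 2 - const3 (val3 a a a F) * (?x * ?z))"
      by (simp add: scale_const3 add_ac)
    have v: "val2 x y (\<Sum>i\<in>{0::nat, 1, 2}. scale (k i) (?w i)) = k 0 * (val3 a c c F * (2 * dot a x * dot a y) - val3 a a c F * (dot a x * dot c y + dot a y * dot c x))
        + k 1 * (val3 b c c F * (2 * dot b x * dot b y) - val3 b b c F * (dot b x * dot c y + dot b y * dot c x))
        + k 2 * (val3 a a c F * (2 * dot a x * dot a y) - val3 a a a F * (dot a x * dot c y + dot a y * dot c x))" for x y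
      unfolding e by (simp only: val2_linear val2_square val2_product)
    from k have q: "(\<Sum>i\<in>{0::nat, 1, 2}. scale (k i) (?w i)) \<in> Ann F" "(\<Sum>i\<in>{0::nat, 1, 2}. scale (k i) (?w i)) \<in> forms 2" by auto
    note eq = q(1)[unfolded Ann_quad_iff[OF fr q(2) F] v]
    have "k 0 * (val3 a a a F * val3 a c c F - val3 a a c F ^ 2) = 0"
      using eq fr by (simp add: frame_def ab power2_eq_square algebra_simps)
    with A have k0: "k 0 = 0" by simp
    have "k 1 * (val3 b b b F * val3 b c c F - val3 b b c F ^ 2) = 0"
      using eq fr by (simp add: frame_def ab power2_eq_square algebra_simps)
    with B have k1: "k 1 = 0" by simp
    have "k 2 * (val3 a a a F * val3 a c c F - val3 a a c F ^ 2) = 0"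
      using eq fr k0 k1 by (auto simp: frame_def ab power2_eq_square val3_12[of c a] val3_23[of a c a] algebra_simps)
    with A have "k 2 = 0" by simp
    with k0 k1 show "\<forall>i\<in>{0::nat, 1, 2}. k i = 0" by simp
  qed simp
  then have "cvs.dim (Ann F \<inter> forms 2) \<le> 3" unfolding dim_forms_small by (simp add: card_insert_if)
  with dim_Ann_quad_ge[OF F] show ?thesis by simp
qed

section \<open>Pencils of conics in the component of reduced ideals\<close>

text \<open>The three values are the coefficients of q on the line a = 0 up to factors; if all of
  them vanish, a divides q.\<close>

lemma conic_restriction_nonzero:
  assumes fr: "frame a b c u v w" and q: "q \<in> forms 2" "\<nexists>n. q = linear_form a * linear_form n"
  shows "val2 v v q \<noteq> 0 \<or> val2 v w q \<noteq> 0 \<or> val2 w w q \<noteq> 0"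
proof (rule ccontr)
  assume "\<not> ?thesis"
  then have "q = const3 (val2 u u q / 2) * linear_form a ^ 2 + const3 (val2 u v q) * (linear_form a * linear_form b)
       + const3 (val2 u w q) * (linear_form a * linear_form c)"
    using quad_expand[OF frame_swap[OF fr] q(1)] by simp
  also have "\<dots> = linear_form a * linear_form (scale (val2 u u q / 2) a + scale (val2 u v q) b + scale (val2 u w q) c)"
    unfolding linear_form_add linear_form_scale by (simp only: distrib_left power2_eq_square mult.left_commute)
  finally show False using q(2) by blast
qed

lemma cod_le_line_conic:
  assumes l: "l \<noteq> 0" and q: "q \<in> forms 2" "\<nexists>n. q = linear_form l * linear_form n"
  shows "cod_le (idl.span {linear_form l, q}) k 2"
proof -
  from frame_extend1[OF l] obtain a b c v w where "frame a b c l v w" by (elim exE)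
  note fr = frame_swap[OF this]
  show ?thesis
    by (rule cod_le_line[OF fr q(1) conic_restriction_nonzero[OF fr q] idl.subspace_span]) (simp_all add: idl.span_base)
qed

text \<open>Residuation with respect to the line l: the trace is the ideal of l and q, the residual
  that of m and q, each of length at most 2. The two lines may coincide.\<close>

lemma cod_le_two_conics:
  assumes lm: "l \<noteq> 0" "m \<noteq> 0" and q: "q \<in> forms 2" "\<nexists>n. q = linear_form l * linear_form n" "\<nexists>n. q = linear_form m * linear_form n"
  shows "cod_le (idl.span {linear_form l * linear_form m, q}) k 4"
proof (cases k)
  case 0
  then show ?thesis by (simp add: cod_le_0)
next
  case (Suc i)
  let ?J = "idl.span {linear_form l * linear_form m, q}"
  have "cod_le ?J (Suc i) (2 + 2)"
  proof (rule cod_le_residual[OF cod_le_line_conic[OF lm(1) q(1,2)] linear_form_forms(1) q(1) cod_le_line_conic[OF lm(2) q(1,3)] idl.subspace_span])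
    show "q \<in> ?J" by (simp add: idl.span_base)
    fix x assume "x \<in> idl.span {linear_form m, q}"
    then have "linear_form l * x \<in> ?J"
    proof (induction rule: idl.span_induct_alt)
      case base
      show ?case using idl.span_zero by simp
    next
      case (step c x y)
      have "linear_form l * x \<in> ?J"
        using step(1) by (elim insertE emptyE) (simp_all add: idl.span_base idl.span_scale)
      then have "c * (linear_form l * x) + linear_form l * y \<in> ?J"
        using step(2) by (rule idl.span_add[OF idl.span_scale])
      also have "c * (linear_form l * x) + linear_form l * y = linear_form l * (c * x + y)"
        by (simp only: distrib_left mult.left_commute)
      finally show ?case .
    qed
    then show "x * linear_form l \<in> ?J" by (simp only: mult.commute)
  qed
  then show ?thesis using Suc by simp
qed

lemma quadratic_two_roots:
  fixes A B C :: complex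
  assumes "C \<noteq> 0" "B ^ 2 \<noteq> A * C"
  shows "\<exists>x y. x \<noteq> y \<and> A / 2 + x * B + x ^ 2 * (C / 2) = 0 \<and> A / 2 + y * B + y ^ 2 * (C / 2) = 0"
proof -
  let ?d = "csqrt (B ^ 2 - A * C)"
  have d: "?d ^ 2 = B ^ 2 - A * C" by simp
  have r: "A / 2 + ((e - B) / C) * B + ((e - B) / C) ^ 2 * (C / 2) = 0" if "e ^ 2 = B ^ 2 - A * C" for e
  proof -
    have "A / 2 + ((e - B) / C) * B + ((e - B) / C) ^ 2 * (C / 2) = (A * C + 2 * (e - B) * B + (e - B) ^ 2) / (2 * C)"
      using assms(1) by (simp add: field_simps power2_eq_square)
    also have "A * C + 2 * (e - B) * B + (e - B) ^ 2 = e ^ 2 - (B ^ 2 - A * C)" by Groebner_Basis.algebra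
    finally show ?thesis using that by simp
  qed
  have "?d \<noteq> 0" using assms(2) by simp
  then have "(?d - B) / C \<noteq> (- ?d - B) / C" using assms(1) by simp
  with r[OF d] r[of "- ?d"] d show ?thesis
    by (intro exI[of _ "(?d - B) / C"] exI[of _ "(- ?d - B) / C"]) simp
qed

text \<open>Each of the lines a = 0 and b = 0 meets q in two points, distinct because the
  discriminants are nonzero. Since q does not pass through the common point \<open>w\<close> of the
  lines, the four points are distinct and can be normalized as v + x w and u + y w.\<close>

lemma Slip_4_points:
  assumes fr: "frame a b c u v w" and q: "q \<in> forms 2" and ww: "val2 w w q \<noteq> 0"
    and dv: "val2 v w q ^ 2 \<noteq> val2 v v q * val2 w w q" and du: "val2 u w q ^ 2 \<noteq> val2 u u q * val2 w w q"
  shows "idl.span {linear_form a * linear_form b, q} \<in> Slip 4"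
proof -
  from quadratic_two_roots[OF ww dv] obtain x1 x2 where x: "x1 \<noteq> x2"
    "val2 v v q / 2 + x1 * val2 v w q + x1 ^ 2 * (val2 w w q / 2) = 0" "val2 v v q / 2 + x2 * val2 v w q + x2 ^ 2 * (val2 w w q / 2) = 0" by blast
  from quadratic_two_roots[OF ww du] obtain y1 y2 where y: "y1 \<noteq> y2"
    "val2 u u q / 2 + y1 * val2 u w q + y1 ^ 2 * (val2 w w q / 2) = 0" "val2 u u q / 2 + y2 * val2 u w q + y2 ^ 2 * (val2 w w q / 2) = 0" by blast
  have ev: "eval3 q z = val2 u u q / 2 * dot a z ^ 2 + val2 u v q * (dot a z * dot b z) + val2 v v q / 2 * dot b z ^ 2
      + val2 u w q * (dot a z * dot c z) + val2 v w q * (dot b z * dot c z) + val2 w w q / 2 * dot c z ^ 2" for z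
    using arg_cong[OF quad_expand[OF frame_swap[OF fr] q], of "\<lambda>p. eval3 p z"]
    by (simp only: eval3_add eval3_mult eval3_const3 eval3_linear_form eval3_power)
  let ?G = "{linear_form a * linear_form b, q}"
  let ?p = "\<lambda>i. if i = (0::nat) then v + scale x1 w else if i = 1 then v + scale x2 w else if i = 2 then u + scale y1 w else u + scale y2 w"
  \<comment> \<open>The power of b vanishes on both points of the line b = 0, and the linear factor
    removes the other point of the line a = 0; the last two forms are analogous. The power is
    nontrivial only from degree 2 on, whence d = 2.\<close>
  let ?f = "\<lambda>i k. if i = (0::nat) then linear_form b ^ (k - 1) * linear_form (c - scale x2 b)
     else if i = 1 then linear_form b ^ (k - 1) * linear_form (c - scale x1 b)
     else if i = 2 then linear_form a ^ (k - 1) * linear_form (c - scale y2 a)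
     else linear_form a ^ (k - 1) * linear_form (c - scale y1 a)"
  have q0: "p = q \<or> p = linear_form a * linear_form b" if "p \<in> ?G" for p using that by auto
  have nd: "\<nexists>n. q = linear_form a * linear_form n" "\<nexists>n. q = linear_form b * linear_form n"
    using dv du fr by (auto simp: val2_product frame_def)
  show ?thesis
  proof (rule Slip_pointsI[OF refl, where I = "{0::nat, 1, 2, 3}" and d = 2 and v = ?p and f = ?f])
    show "homogeneous_ideal (idl.span ?G)" by (rule homogeneous_span2[OF product_forms q])
    show "\<exists>k. p \<in> forms k" if "p \<in> ?G" for p using q0[OF that] q product_forms by blast
    show "cod_le (idl.span ?G) k 4" for k
      using frame_nonzero[OF fr] by (intro cod_le_two_conics q nd) simp_all
    show "eval3 p (?p i) = 0" if "p \<in> ?G" "i \<in> {0::nat, 1, 2, 3}" for p i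
      using q0[OF that(1)] that(2) fr x(2,3) y(2,3)
      by (auto simp: ev frame_def dot_add dot_scale mult_ac)
    show "?f i k \<in> forms k" if "i \<in> {0::nat, 1, 2, 3}" "2 \<le> k" for i k
    proof -
      have "linear_form s ^ (k - 1) * linear_form t \<in> forms k" for s t
        using forms_mult[OF power_forms[of s "k - 1"] linear_form_forms(1)[of t]] that(2) by simp
      then show ?thesis by simp
    qed
    show "(eval3 (?f i k) (?p j) \<noteq> 0) \<longleftrightarrow> i = j" if "i \<in> {0::nat, 1, 2, 3}" "j \<in> {0::nat, 1, 2, 3}" "2 \<le> k" for i j k
    proof -
      have "k - Suc 0 \<noteq> 0" using that(3) by simp
      then show ?thesis
        using that(1,2) fr x(1) y(1) by (auto simp: frame_def dot_add dot_diff dot_scale)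
    qed
    \<comment> \<open>A linear form vanishing at both points of the line a = 0 is a multiple of a,
      which is nonzero at the points of the other line.\<close>
    show "p = 0" if k: "0 < k" "k < 2" and p: "p \<in> forms k" "\<And>i. i \<in> {0::nat, 1, 2, 3} \<Longrightarrow> eval3 p (?p i) = 0" for p k
    proof -
      have "p \<in> forms 1" using k p(1) by (metis One_nat_def Suc_1 Suc_leI le_less_Suc_eq)
      note e = form1_expand[OF frame_swap[OF fr] this]
      have ev: "eval3 p z = cf (D u p) 0 * dot a z + cf (D v p) 0 * dot b z + cf (D w p) 0 * dot c z" for z
        using arg_cong[OF e, of "\<lambda>p. eval3 p z"] by (simp only: eval3_add eval3_mult eval3_const3 eval3_linear_form)
      have "cf (D v p) 0 + cf (D w p) 0 * x1 = 0" "cf (D v p) 0 + cf (D w p) 0 * x2 = 0" "cf (D u p) 0 + cf (D w p) 0 * y1 = 0"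
        using p(2)[of 0] p(2)[of 1] p(2)[of 2] fr by (simp_all add: ev frame_def dot_add dot_scale)
      moreover from this(1,2) have "cf (D w p) 0 * (x1 - x2) = 0" unfolding right_diff_distrib by Groebner_Basis.algebra
      ultimately have "cf (D w p) 0 = 0" "cf (D v p) 0 = 0" "cf (D u p) 0 = 0" using x(1) by simp_all
      with e show ?thesis by simp
    qed
  qed auto
qed

lemma eventually_poly_neq_0:
  fixes p :: "complex poly"
  assumes "p \<noteq> 0" shows "\<forall>\<^sub>F t in at 0. poly p t \<noteq> 0"
proof -
  let ?S = "{t. poly p t = 0} - {0}"
  have "finite ?S" using poly_roots_finite[OF assms] by simp
  then have "open (- ?S)" by (intro open_Compl finite_imp_closed)
  then have "\<forall>\<^sub>F t in at 0. t \<in> - ?S" by (intro eventually_at_in_open') simp_all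
  with eventually_at_0_neq show ?thesis by eventually_elim simp
qed

text \<open>Along q + t (c^2 - a^2 - b^2) the genericity conditions of \<open>Slip_4_points\<close>
  become nonvanishing of polynomials in t with leading coefficients 2 and 4. They hold for all small
  t \<noteq> 0, whatever q is.\<close>

lemma Slip_4_two_lines:
  assumes fr: "frame a b c u v w" and q: "q \<in> forms 2" "\<nexists>n. q = linear_form a * linear_form n" "\<nexists>n. q = linear_form b * linear_form n"
  shows "idl.span {linear_form a * linear_form b, q} \<in> Slip 4"
proof -
  let ?p = "\<lambda>t. q + const3 t * (linear_form c ^ 2 - linear_form a ^ 2 - linear_form b ^ 2)"
  have vals: "val2 w w (?p t) = val2 w w q + 2 * t" "val2 v v (?p t) = val2 v v q - 2 * t" "val2 u u (?p t) = val2 u u q - 2 * t"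
    "val2 v w (?p t) = val2 v w q" "val2 u w (?p t) = val2 u w q" for t
    using fr by (simp_all add: frame_def)
  have p2: "?p t \<in> forms 2" for t by (intro forms_add q forms_const_mult forms_diff square_forms)
  have "idl.span {linear_form a * linear_form b, ?p 0} \<in> Slip 4"
  proof (rule Slip_limit2)
    have "\<forall>\<^sub>F t in at 0. poly [:val2 w w q, 2:] t \<noteq> 0"
      "\<forall>\<^sub>F t in at 0. poly [:val2 v w q ^ 2 - val2 v v q * val2 w w q, 2 * val2 w w q - 2 * val2 v v q, 4:] t \<noteq> 0"
      "\<forall>\<^sub>F t in at 0. poly [:val2 u w q ^ 2 - val2 u u q * val2 w w q, 2 * val2 w w q - 2 * val2 u u q, 4:] t \<noteq> 0"
      by (rule eventually_poly_neq_0, simp)+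
    then show "\<forall>\<^sub>F t in at 0. idl.span {linear_form a * linear_form b, ?p t} \<in> Slip 4"
    proof eventually_elim
      case (elim t)
      have "val2 w w (?p t) \<noteq> 0" using elim(1) unfolding vals by (simp add: mult.commute)
      moreover have "val2 v w (?p t) ^ 2 \<noteq> val2 v v (?p t) * val2 w w (?p t)" "val2 u w (?p t) ^ 2 \<noteq> val2 u u (?p t) * val2 w w (?p t)"
        using elim(2,3) unfolding vals by (auto simp: algebra_simps)
      ultimately show ?case by (rule Slip_4_points[OF fr p2])
    qed
    show "cod_le (idl.span {linear_form a * linear_form b, ?p 0}) k 4" for k
      using frame_nonzero[OF fr] q by (simp add: cod_le_two_conics)
    show "isCont (\<lambda>t. cf (?p t) m) 0" for m unfolding lookup_add cf_const_mult by (intro continuous_intros)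
  qed (rule product_forms p2)+
  then show ?thesis by simp
qed

text \<open>The double line is the limit of the pairs of lines l and l + t b. That q does not
  contain the second line is an open condition on t which holds at t = 0.\<close>

lemma Slip_4_double_line:
  assumes l: "l \<noteq> 0" and q: "q \<in> forms 2" "\<nexists>n. q = linear_form l * linear_form n"
  shows "idl.span {linear_form l * linear_form l, q} \<in> Slip 4"
proof -
  from frame_extend1[OF l] obtain u v w b c where "frame u v w l b c" by (elim exE)
  note fr = frame_swap[OF this]
  let ?p = "\<lambda>t. linear_form l * linear_form l + const3 t * (linear_form l * linear_form b)"
  have pt: "?p t = linear_form l * linear_form (l + scale t b)" for t
    unfolding linear_form_add linear_form_scale by (simp only: distrib_left mult.left_commute)
  have p2: "?p t \<in> forms 2" for t unfolding pt by (rule product_forms)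
  have "idl.span {q, ?p 0} \<in> Slip 4"
  proof (rule Slip_limit2[OF q(1) p2])
    have v1: "val2 (v - scale t u) (v - scale t u) q = poly [:val2 v v q, - 2 * val2 u v q, val2 u u q:] t"
      and v2: "val2 (v - scale t u) w q = poly [:val2 v w q, - val2 u w q:] t" for t
    proof -
      have e: "v - scale t u = v + scale (- t) u" by simp
      have r: "val2 x (y + scale k z) Q = val2 x y Q + k * val2 x z Q" for x y z k Q
        unfolding val2_swap[of x] val2_vec ..
      show "val2 (v - scale t u) (v - scale t u) q = poly [:val2 v v q, - 2 * val2 u v q, val2 u u q:] t"
        "val2 (v - scale t u) w q = poly [:val2 v w q, - val2 u w q:] t"
        unfolding e r val2_vec val2_swap[of v u] by (simp_all add: algebra_simps)
    qed
    have "\<forall>\<^sub>F t in at 0. val2 (v - scale t u) (v - scale t u) q \<noteq> 0 \<or> val2 (v - scale t u) w q \<noteq> 0 \<or> val2 w w q \<noteq> 0"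
      using conic_restriction_nonzero[OF fr q]
    proof (elim disjE)
      assume "val2 v v q \<noteq> 0"
      then have "\<forall>\<^sub>F t in at 0. poly [:val2 v v q, - 2 * val2 u v q, val2 u u q:] t \<noteq> 0" by (intro eventually_poly_neq_0) simp
      then show ?thesis unfolding v1 by (rule eventually_mono) blast
    next
      assume "val2 v w q \<noteq> 0"
      then have "\<forall>\<^sub>F t in at 0. poly [:val2 v w q, - val2 u w q:] t \<noteq> 0" by (intro eventually_poly_neq_0) simp
      then show ?thesis unfolding v2 by (rule eventually_mono) blast
    qed simp
    with eventually_at_0_neq show "\<forall>\<^sub>F t in at 0. idl.span {q, ?p t} \<in> Slip 4"
    proof eventually_elim
      case (elim t)
      \<comment> \<open>The tilted line is spanned by v - t u and w, so the values considered above
        are the coefficients of q on it.\<close>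
      have fr': "frame (l + scale t b) b c u (v - scale t u) w"
        using fr by (simp add: frame_def dot_add dot_diff dot_scale)
      have nd: "\<nexists>n. q = linear_form (l + scale t b) * linear_form n"
        using elim(2) fr' by (auto simp: val2_product frame_def)
      have "1 * t - 0 * (1::complex) \<noteq> 0" using elim(1) by simp
      from frame_mix[OF fr this] obtain u' v' where "frame (scale 1 l + scale 0 b) (scale 1 l + scale t b) c u' v' w" by (elim exE)
      then have "frame l (l + scale t b) c u' v' w" by simp
      from Slip_4_two_lines[OF this q nd] show ?case unfolding pt by (simp only: insert_commute)
    qed
    show "cod_le (idl.span {q, ?p 0}) k 4" for k
      using cod_le_two_conics[OF l l q q(2), of k] by (simp add: insert_commute)
    show "isCont (\<lambda>t. cf (?p t) m) 0" for m unfolding lookup_add cf_const_mult by (intro continuous_intros)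
  qed
  then show ?thesis by (simp add: insert_commute)
qed

lemma idl_span_pencil:
  assumes "s \<noteq> 0" shows "idl.span {scale s g + scale t h, h} = idl.span {g, h}"
proof (rule antisym; rule idl.span_minimal[OF _ idl.subspace_span])
  show "{scale s g + scale t h, h} \<subseteq> idl.span {g, h}"
    unfolding scale_const3 by (simp add: idl.span_base idl.span_add idl.span_scale)
  let ?I = "idl.span {scale s g + scale t h, h}"
  have "const3 (1 / s) * ((scale s g + scale t h) - const3 t * h) \<in> ?I"
    by (intro idl.span_scale idl.span_diff idl.span_base) simp_all
  also have "const3 (1 / s) * ((scale s g + scale t h) - const3 t * h) = g"
    unfolding scale_const3 by (simp only: add_diff_cancel_right' const3_mult_assoc) (simp add: assms)
  finally show "{g, h} \<subseteq> ?I" by (simp add: idl.span_base)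
qed

lemma Slip_4_product:
  assumes lm: "l \<noteq> 0" "m \<noteq> 0" and q: "q \<in> forms 2" "\<nexists>n. q = linear_form l * linear_form n" "\<nexists>n. q = linear_form m * linear_form n"
  shows "idl.span {linear_form l * linear_form m, q} \<in> Slip 4"
proof (cases "cross l m = 0")
  case False
  from frame_extend2[OF this] obtain a b c w where "frame a b c l m w" by (elim exE)
  from Slip_4_two_lines[OF frame_swap[OF this] q] show ?thesis .
next
  case True
  from cross_0_multiple[OF True lm(1)] obtain k where k: "m = scale k l" ..
  with lm have "k \<noteq> 0" by auto
  have "linear_form l * linear_form m = scale k (linear_form l * linear_form l) + scale 0 q"
    unfolding k linear_form_scale by (simp only: scale_const3 mult.left_commute) simp
  then have "idl.span {linear_form l * linear_form m, q} = idl.span {linear_form l * linear_form l, q}"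
    by (simp only: idl_span_pencil[OF \<open>k \<noteq> 0\<close>])
  with Slip_4_double_line[OF lm(1) q(1,2)] show ?thesis by simp
qed

text \<open>Otherwise D l F would be killed by two independent vectors and hence be a multiple of
  the square of one linear form, that is, a square.\<close>

lemma no_common_factor:
  assumes nsq: "no_square_polar F" and F: "F \<in> forms 3" and l: "l \<noteq> 0"
    and lm: "linear_form l * linear_form m \<in> Ann F" "linear_form l * linear_form n \<in> Ann F"
  shows "cross m n = 0"
proof (rule ccontr)
  assume "cross m n \<noteq> 0"
  from frame_extend2[OF this] obtain a b c w where "frame a b c m n w" by (elim exE)
  note fr = frame_swap[OF this]
  have 0: "D m (D l F) = 0" "D n (D l F) = 0"
    using lm by (simp_all add: Ann_def diff_action_mult D_commute[of l])
  have Q: "D l F \<in> forms 2" using D_forms[OF F] by simp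
  have "val2 x m (D l F) = 0" "val2 x n (D l F) = 0" for x using 0 by (simp_all add: val2_def)
  then have "val2 m m (D l F) = 0" "val2 m n (D l F) = 0" "val2 n n (D l F) = 0" "val2 m w (D l F) = 0" "val2 n w (D l F) = 0"
    by (simp_all add: val2_swap[of _ w])
  with quad_expand[OF fr Q] have "D l F = const3 (val2 w w (D l F) / 2) * linear_form c ^ 2" by simp
  also have "val2 w w (D l F) / 2 = csqrt (val2 w w (D l F) / 2) ^ 2" by simp
  finally have "D l F = linear_form (scale (csqrt (val2 w w (D l F) / 2)) c) ^ 2"
    unfolding linear_form_scale power_mult_distrib const3_power .
  with nsq l show False by (auto simp: no_square_polar_def)
qed

text \<open>The pencil contains a product l m. If the other generator were divisible by l or by m,
  \<open>no_common_factor\<close> would make it a multiple of l m, against independence.\<close>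

lemma pencil_Slip_4:
  assumes nsq: "no_square_polar F" and F: "F \<in> forms 3" and gh: "g \<in> Ann F" "g \<in> forms 2" "h \<in> Ann F" "h \<in> forms 2" "indep2 g h"
  shows "idl.span {g, h} \<in> Slip 4"
proof -
  have *: "idl.span {g, h} \<in> Slip 4" if gh: "g \<in> Ann F" "g \<in> forms 2" "h \<in> Ann F" "h \<in> forms 2" "indep2 g h"
    and p: "s \<noteq> 0" "scale s g + scale t h = linear_form l * linear_form m" for g h s t l m
  proof -
    have A: "linear_form l * linear_form m \<in> Ann F" unfolding p(2)[symmetric]
      by (intro cvs.subspace_add[OF ideal_cvs_subspace[OF Ann_subspace]] cvs.subspace_scale[OF ideal_cvs_subspace[OF Ann_subspace]] gh)
    have "linear_form l * linear_form m \<noteq> 0" using gh(5) p unfolding indep2_def by metis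
    then have nz: "l \<noteq> 0" "m \<noteq> 0" using linear_form_scale[of 0 0] by auto
    have dep: False if "h = const3 k * (linear_form l * linear_form m)" for k
    proof -
      have "scale (- (k * s)) g + scale (1 - k * t) h = h - scale k (scale s g + scale t h)"
        by (rule poly_mapping_eqI) (simp add: lookup_add lookup_minus algebra_simps)
      also have "\<dots> = 0" unfolding p(2) using that by (simp add: scale_const3)
      finally have "- (k * s) = 0" "1 - k * t = 0" using gh(5) unfolding indep2_def by blast+
      with p(1) show False by auto
    qed
    have nd1: "\<nexists>n. h = linear_form l * linear_form n"
    proof
      assume "\<exists>n. h = linear_form l * linear_form n"
      then obtain n where n: "h = linear_form l * linear_form n" ..
      from cross_0_multiple[OF no_common_factor[OF nsq F nz(1) A gh(3)[unfolded n]] nz(2)]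
      obtain k where "n = scale k m" ..
      with n have "h = const3 k * (linear_form l * linear_form m)" by (simp only: linear_form_scale mult.left_commute)
      then show False by (rule dep)
    qed
    have nd2: "\<nexists>n. h = linear_form m * linear_form n"
    proof
      assume "\<exists>n. h = linear_form m * linear_form n"
      then obtain n where n: "h = linear_form m * linear_form n" ..
      from cross_0_multiple[OF no_common_factor[OF nsq F nz(2) A[unfolded mult.commute[of "linear_form l"]] gh(3)[unfolded n]] nz(1)]
      obtain k where "n = scale k l" ..
      with n have "h = const3 k * (linear_form l * linear_form m)" by (simp only: linear_form_scale mult.left_commute mult.commute)
      then show False by (rule dep)
    qed
    from Slip_4_product[OF nz gh(4) nd1 nd2] show ?thesis unfolding p(2)[symmetric] idl_span_pencil[OF p(1)] .
  qed
  from pencil_product[OF gh(2,4)] obtain s t l m where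
    p: "s \<noteq> 0 \<or> t \<noteq> 0" "scale s g + scale t h = linear_form l * linear_form m" by (elim exE conjE)
  show ?thesis
  proof (cases "s = 0")
    case False
    from *[OF gh False p(2)] show ?thesis .
  next
    case True
    with p(1) have "t \<noteq> 0" by simp
    have "indep2 h g" using gh(5) unfolding indep2_def by (metis add.commute)
    from *[OF gh(3,4,1,2) this \<open>t \<noteq> 0\<close> p(2)[unfolded add.commute[of "scale s g"]]] show ?thesis by (simp only: insert_commute)
  qed
qed

section \<open>The plane of pencils of annihilating conics\<close>

lemma hilb_coord_spec:
  assumes "J \<in> hilb_chart d B" "mdeg m \<le> d"
  shows "monom3 m - (\<Sum>b\<in>deg_part B (mdeg m). scale (hilb_coord B m b J) (monom3 b)) \<in> J"
proof -
  from assms have "\<exists>!p. is_normal_form B J m p" by (simp add: hilb_chart_def)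
  from theI'[OF this] have n: "is_normal_form B J m (THE p. is_normal_form B J m p)" .
  then have k: "Poly_Mapping.keys (THE p. is_normal_form B J m p) \<subseteq> deg_part B (mdeg m)"
    by (simp add: is_normal_form_def deg_part_def)
  from n sum_monom_expand[OF finite_deg_part k] show ?thesis by (simp add: is_normal_form_def hilb_coord_def)
qed

text \<open>On a chart this is the coefficient at b of the normal form of the conic p modulo J. It
  is linear in p and, for fixed p, a polynomial in the chart coordinates of J.\<close>

definition normal_coeff :: "mon3 set \<Rightarrow> mon3 \<Rightarrow> poly3 \<Rightarrow> poly3 set \<Rightarrow> complex" where
  "normal_coeff B b p J = (\<Sum>m\<in>mons 2. cf p m * hilb_coord B m b J)"

lemma normal_coeff_add: "normal_coeff B b (p + p') J = normal_coeff B b p J + normal_coeff B b p' J"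
  and normal_coeff_scale: "normal_coeff B b (scale c p) J = c * normal_coeff B b p J"
  by (simp_all add: normal_coeff_def lookup_add sum.distrib sum_distrib_left algebra_simps)

lemma normal_coeff_spec:
  assumes J: "homogeneous_ideal J" "J \<in> hilb_chart 2 B" and p: "p \<in> forms 2"
  shows "p - (\<Sum>b\<in>deg_part B 2. scale (normal_coeff B b p J) (monom3 b)) \<in> J"
proof -
  have "monom3 m - (\<Sum>b\<in>deg_part B 2. scale (hilb_coord B m b J) (monom3 b)) \<in> J" if "m \<in> mons 2" for m
    using hilb_coord_spec[OF J(2), of m] that by (simp add: mons_def)
  then have "(\<Sum>m\<in>mons 2. scale (cf p m) (monom3 m - (\<Sum>b\<in>deg_part B 2. scale (hilb_coord B m b J) (monom3 b)))) \<in> J"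
    by (intro cvs.subspace_sum[OF ideal_cvs_subspace[OF homogeneous_idealD(1)[OF J(1)]]]
        cvs.subspace_scale[OF ideal_cvs_subspace[OF homogeneous_idealD(1)[OF J(1)]]])
  also have "(\<Sum>m\<in>mons 2. scale (cf p m) (monom3 m - (\<Sum>b\<in>deg_part B 2. scale (hilb_coord B m b J) (monom3 b)))) =
      (\<Sum>m\<in>mons 2. scale (cf p m) (monom3 m)) - (\<Sum>m\<in>mons 2. \<Sum>b\<in>deg_part B 2. scale (cf p m * hilb_coord B m b J) (monom3 b))"
    by (simp add: cvs.scale_right_diff_distrib sum_subtractf cvs.scale_sum_right)
  also have "(\<Sum>m\<in>mons 2. scale (cf p m) (monom3 m)) = p"
    by (rule sum_monom_expand[symmetric]) (use p in \<open>simp_all add: forms_iff\<close>)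
  also have "(\<Sum>m\<in>mons 2. \<Sum>b\<in>deg_part B 2. scale (cf p m * hilb_coord B m b J) (monom3 b)) =
      (\<Sum>b\<in>deg_part B 2. scale (normal_coeff B b p J) (monom3 b))"
    unfolding normal_coeff_def cvs.scale_sum_left by (rule sum.swap)
  finally show ?thesis .
qed

lemma normal_coeff_zero_iff:
  assumes J: "homogeneous_ideal J" "J \<in> hilb_chart 2 B" and p: "p \<in> forms 2"
  shows "p \<in> J \<longleftrightarrow> (\<forall>b\<in>deg_part B 2. normal_coeff B b p J = 0)"
proof
  let ?n = "\<Sum>b\<in>deg_part B 2. scale (normal_coeff B b p J) (monom3 b)"
  assume "p \<in> J"
  then have "p - (p - ?n) \<in> J"
    by (rule idl.subspace_diff[OF homogeneous_idealD(1)[OF J(1)] _ normal_coeff_spec[OF assms]])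
  then show "\<forall>b\<in>deg_part B 2. normal_coeff B b p J = 0"
    using hilb_chartD(2)[OF J order_refl] by simp
qed (use normal_coeff_spec[OF assms] in simp)

section \<open>The net of annihilating conics and its dual plane\<close>

definition comb :: "(3 \<Rightarrow> poly3) \<Rightarrow> (3 \<Rightarrow>\<^sub>0 complex) \<Rightarrow> poly3" where
  "comb q c = (\<Sum>j\<in>UNIV. scale (cf c j) (q j))"

lemma comb_add: "comb q (c + d) = comb q c + comb q d"
  and comb_scale: "comb q (scale k c) = scale k (comb q c)"
  by (simp_all add: comb_def lookup_add sum.distrib cvs.scale_left_distrib cvs.scale_sum_right)

lemma comb_diff: "comb q (c - d) = comb q c - comb q d"
  using comb_add[of q "c - d" d] by simp

lemma comb_single [simp]: "comb q (Poly_Mapping.single j k) = scale k (q j)"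
  unfolding comb_def lookup_single when_def by (simp add: if_distrib[of "\<lambda>x. scale x _"] cong: if_cong)

lemma dot_sum: "dot a c = (\<Sum>j\<in>UNIV. cf a j * cf c j)"
  by (simp add: dot_def sum3)

lemma dot_single [simp]: "dot a (Poly_Mapping.single j k) = cf a j * k"
  unfolding dot_sum lookup_single when_def by (simp add: if_distrib[of "\<lambda>x. _ * x"] cong: if_cong)

lemma Ann_quad_basis:
  assumes nsq: "no_square_polar F" and F: "F \<in> forms 3"
  shows "\<exists>q. (\<forall>j. q j \<in> Ann F \<inter> forms 2) \<and> (\<forall>c. comb q c = 0 \<longrightarrow> c = 0) \<and> (\<forall>x\<in>Ann F \<inter> forms 2. \<exists>c. x = comb q c)"
proof -
  obtain B where B: "B \<subseteq> Ann F \<inter> forms 2" "finite B" "cvs.independent B" "cvs.span B = Ann F \<inter> forms 2" "card B = cvs.dim (Ann F \<inter> forms 2)"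
    by (rule subspace_finite_basis[OF subspace_piece[OF Ann_subspace] order_trans[OF Int_lower2 forms_fin(1)] forms_fin(2)])
  have "card (UNIV :: 3 set) = card B" using B(5) dim_Ann_quad[OF assms] by simp
  then obtain q where q: "bij_betw q (UNIV :: 3 set) B" using finite_same_card_bij[OF finite B(2)] by blast
  then have im: "q ` UNIV = B" and inj: "inj q" by (auto simp: bij_betw_def)
  show ?thesis
  proof (intro exI[of _ q] conjI allI impI ballI)
    show "q j \<in> Ann F \<inter> forms 2" for j using im B(1) by blast
    show "c = 0" if "comb q c = 0" for c
      using independent_family_zero[OF inj _ finite that[unfolded comb_def]] B(3) im by (intro poly_mapping_eqI) simp
    fix x assume "x \<in> Ann F \<inter> forms 2"
    then have "x \<in> cvs.span (q ` UNIV)" using im B(4) by simp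
    from span_image_sum[OF this finite] obtain c where c: "x = (\<Sum>i\<in>UNIV. scale (c i) (q i))" ..
    have "cf (v3 (c 0) (c 1) (c 2)) j = c j" for j
      using all3[of "\<lambda>j. cf (v3 (c 0) (c 1) (c 2)) j = c j"] by simp
    then show "\<exists>c. x = comb q c" using c unfolding comb_def by (intro exI[of _ "v3 (c 0) (c 1) (c 2)"]) simp
  qed
qed

locale conic_net =
  fixes F :: poly3 and q :: "3 \<Rightarrow> poly3"
  assumes nsq: "no_square_polar F" and cubic: "F \<in> forms 3"
    and gen_Ann: "q j \<in> Ann F" and gen_forms: "q j \<in> forms 2"
    and comb_zero: "comb q c = 0 \<Longrightarrow> c = 0"
    and comb_onto: "x \<in> Ann F \<Longrightarrow> x \<in> forms 2 \<Longrightarrow> \<exists>c. x = comb q c"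
begin

text \<open>A point of the plane is read as a linear functional on the coefficient vectors of the
  net, determined up to a scalar; its kernel is a pencil.\<close>

definition pencil_ideal :: "(3 \<Rightarrow>\<^sub>0 complex) set \<Rightarrow> poly3 set" where
  "pencil_ideal p = idl.span {comb q c | c. \<forall>a\<in>p. dot a c = 0}"

text \<open>The annihilator of the part of the net contained in J; when that part is a pencil, the
  annihilator is one line.\<close>

definition pencil_point :: "poly3 set \<Rightarrow> (3 \<Rightarrow>\<^sub>0 complex) set" where
  "pencil_point J = {a. \<forall>c. comb q c \<in> J \<longrightarrow> dot a c = 0}"

lemma comb_Ann: "comb q c \<in> Ann F"
  unfolding comb_def
  by (intro cvs.subspace_sum[OF ideal_cvs_subspace[OF Ann_subspace]] cvs.subspace_scale[OF ideal_cvs_subspace[OF Ann_subspace]] gen_Ann)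

lemma comb_forms: "comb q c \<in> forms 2"
  unfolding comb_def by (intro cvs.subspace_sum[OF subspace_forms] forms_scale gen_forms)

lemma comb_indep2:
  assumes "cross c d \<noteq> 0" shows "indep2 (comb q c) (comb q d)"
  unfolding indep2_def
proof (intro allI impI)
  fix s t assume "scale s (comb q c) + scale t (comb q d) = 0"
  then have 0: "scale s c + scale t d = 0" by (intro comb_zero) (simp add: comb_add comb_scale)
  from frame_extend2[OF assms] obtain a b e w where fr: "frame a b e c d w" by (elim exE)
  from arg_cong[OF 0, of "dot a"] arg_cong[OF 0, of "dot b"] fr
  show "s = 0 \<and> t = 0" by (simp add: frame_def dot_add dot_scale)
qed

lemma frame_cross: "frame a b c u v w \<Longrightarrow> cross b c \<noteq> 0"
proof
  assume "frame a b c u v w" "cross b c = 0"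
  from frame_det[OF frame_swap[OF this(1)]] this(2) show False by simp
qed

lemma span_dot: "(\<forall>x\<in>cvs.span {a}. dot x c = 0) \<longleftrightarrow> dot a c = 0"
  using cvs.span_base[of a "{a}"] by (auto simp: cvs.span_singleton dot_scale)

lemma pencil_ideal_frame:
  assumes fr: "frame a b c u v w"
  shows "pencil_ideal (cvs.span {u}) = idl.span {comb q b, comb q c}"
  unfolding pencil_ideal_def span_dot
proof (rule antisym; rule idl.span_minimal[OF _ idl.subspace_span])
  show "{comb q c | c. dot u c = 0} \<subseteq> idl.span {comb q b, comb q c}"
  proof
    fix x assume "x \<in> {comb q c | c. dot u c = 0}"
    then obtain d where d: "x = comb q d" "dot u d = 0" by blast
    have "d = scale (dot v d) b + scale (dot w d) c" using frame_expand[OF frame_swap[OF fr], of d] d(2) by simp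
    from arg_cong[OF this, of "comb q"]
    have "x = const3 (dot v d) * comb q b + const3 (dot w d) * comb q c" by (simp add: d(1) comb_add comb_scale scale_const3)
    also have "\<dots> \<in> idl.span {comb q b, comb q c}" by (intro idl.span_add idl.span_scale idl.span_base) simp_all
    finally show "x \<in> idl.span {comb q b, comb q c}" .
  qed
  have "dot u b = 0" "dot u c = 0" using frame_swap[OF fr] by (simp_all add: frame_def)
  then show "{comb q b, comb q c} \<subseteq> idl.span {comb q c | c. dot u c = 0}" by (auto intro!: idl.span_base)
qed

lemma pencil_ideal_VSP:
  assumes "a \<noteq> 0" shows "pencil_ideal (cvs.span {a}) \<in> border_VSP F 4"
proof -
  from frame_extend1[OF assms] obtain x b c v w where fr: "frame x b c a v w" by (elim exE)
  have "idl.span {comb q b, comb q c} \<in> Slip 4"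
    by (rule pencil_Slip_4[OF nsq cubic comb_Ann comb_forms comb_Ann comb_forms comb_indep2[OF frame_cross[OF fr]]])
  moreover have "idl.span {comb q b, comb q c} \<subseteq> Ann F"
    by (rule idl.span_minimal[OF _ Ann_subspace]) (simp add: comb_Ann)
  ultimately show ?thesis unfolding border_VSP_def pencil_ideal_frame[OF fr] by simp
qed

lemma VSP_Hilb: "J \<in> border_VSP F 4 \<Longrightarrow> J \<in> Hilb 4"
  using Slip_subset_Hilb by (auto simp: border_VSP_def)

lemma VSP_ideal: "J \<in> border_VSP F 4 \<Longrightarrow> idl.subspace J"
  by (rule homogeneous_idealD(1)[OF Hilb_homogeneous[OF VSP_Hilb]])

text \<open>One conic of the net outside the pencil would bring the whole net into the ideal, whose
  degree 2 piece has dimension 6 - 4 = 2 and not 3.\<close>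

lemma comb_mem_iff:
  assumes a: "a \<noteq> 0" shows "comb q c \<in> pencil_ideal (cvs.span {a}) \<longleftrightarrow> dot a c = 0"
proof
  let ?J = "pencil_ideal (cvs.span {a})"
  have mem: "dot a d = 0 \<Longrightarrow> comb q d \<in> ?J" for d
    unfolding pencil_ideal_def span_dot by (rule idl.span_base) blast
  then show "dot a c = 0 \<Longrightarrow> comb q c \<in> ?J" .
  assume c: "comb q c \<in> ?J"
  show "dot a c = 0"
  proof (rule ccontr)
    assume nz: "dot a c \<noteq> 0"
    have sub: "cvs.subspace ?J" by (rule ideal_cvs_subspace[OF VSP_ideal[OF pencil_ideal_VSP[OF a]]])
    have "comb q d \<in> ?J" for d
    proof -
      let ?k = "dot a d / dot a c"
      have "dot a (d - scale ?k c) = 0" using nz by (simp add: dot_diff dot_scale)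
      from cvs.subspace_add[OF sub mem[OF this] cvs.subspace_scale[OF sub c, of ?k]]
      show ?thesis by (simp flip: comb_add comb_scale)
    qed
    then have "Ann F \<inter> forms 2 \<subseteq> ?J \<inter> forms 2" using comb_onto by blast
    from dim_mono_fin[OF this order_trans[OF Int_lower2 forms_fin(1)] forms_fin(2)]
    show False using dim_Ann_quad[OF nsq cubic] Hilb_dims(2)[OF VSP_Hilb[OF pencil_ideal_VSP[OF a]]] by simp
  qed
qed

lemma point_of_pencil:
  assumes a: "a \<noteq> 0" shows "pencil_point (pencil_ideal (cvs.span {a})) = cvs.span {a}"
proof -
  from frame_extend1[OF a] obtain r s t v w where fr: "frame r s t a v w" by (elim exE)
  have ast: "dot a s = 0" "dot a t = 0" using frame_swap[OF fr] by (simp_all add: frame_def)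
  have "x \<in> cvs.span {a}" if x: "\<forall>c. dot a c = 0 \<longrightarrow> dot x c = 0" for x
  proof -
    have "dot s x = 0" "dot t x = 0" using x ast by (simp_all add: dot_commute[of _ x])
    with frame_expand[OF fr, of x] have "x = scale (dot r x) a" by simp
    then show ?thesis by (auto simp: cvs.span_singleton)
  qed
  moreover have "dot x c = 0" if "x \<in> cvs.span {a}" "dot a c = 0" for x c
    using that by (auto simp: cvs.span_singleton dot_scale)
  ultimately show ?thesis unfolding pencil_point_def comb_mem_iff[OF a] by blast
qed

text \<open>J has dimension 2 in degree 2. Two independent conics of J generate an ideal inside J
  which already has the same Hilbert function, so the two ideals agree.\<close>

lemma VSP_pencil:
  assumes J: "J \<in> border_VSP F 4" shows "\<exists>a. a \<noteq> 0 \<and> J = pencil_ideal (cvs.span {a})"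
proof -
  have "2 \<le> cvs.dim (J \<inter> forms 2)" using Hilb_dims(2)[OF VSP_Hilb[OF J]] by simp
  from indep2_exists[OF subspace_piece[OF VSP_ideal[OF J]] order_trans[OF Int_lower2 forms_fin(1)] forms_fin(2) this]
  obtain g h where gh: "g \<in> J" "g \<in> forms 2" "h \<in> J" "h \<in> forms 2" "indep2 g h" by blast
  have "J \<subseteq> Ann F" using J by (simp add: border_VSP_def)
  with gh comb_onto obtain c d where cd: "g = comb q c" "h = comb q d" by (meson subsetD)
  have "cross c d \<noteq> 0"
  proof
    assume x: "cross c d = 0"
    show False
    proof (cases "c = 0")
      case True
      then have "scale 1 g + scale 0 h = 0" by (simp add: cd comb_def)
      then show False using gh(5) unfolding indep2_def by fastforce
    next
      case False
      from cross_0_multiple[OF x False] obtain k where "d = scale k c" ..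
      then have "scale (- k) g + scale 1 h = 0" by (simp add: cd comb_scale)
      then show False using gh(5) unfolding indep2_def by fastforce
    qed
  qed
  from frame_extend2[OF this] obtain r s a w where fr: "frame r s a c d w" by (elim exE)
  note fr' = frame_rotate[OF frame_rotate[OF frame_swap[OF fr]]]
  have e: "pencil_ideal (cvs.span {a}) = idl.span {g, h}" unfolding cd by (rule pencil_ideal_frame[OF fr'])
  have "a \<noteq> 0" using frame_nonzero[OF fr] by simp
  moreover have "idl.span {g, h} \<subseteq> J" by (rule idl.span_minimal[OF _ VSP_ideal[OF J]]) (simp add: gh)
  with Hilb_eqI[OF VSP_Hilb[OF pencil_ideal_VSP[OF \<open>a \<noteq> 0\<close>]] VSP_Hilb[OF J]] e
  have "J = pencil_ideal (cvs.span {a})" by simp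
  ultimately show ?thesis by blast
qed

lemma P2_point: "p \<in> P2 \<longleftrightarrow> (\<exists>a. a \<noteq> 0 \<and> p = cvs.span {a})"
  by (auto simp: P2_def proj_def)

text \<open>These generators have coefficients that are polynomials in the affine coordinates of the
  point. The generator with j = i is 0 and is kept for uniformity.\<close>

lemma pencil_ideal_chart:
  assumes a: "cf a i \<noteq> 0"
  shows "pencil_ideal (cvs.span {a}) = idl.span ((\<lambda>j. q j - scale (coord_ratio i j (cvs.span {a})) (q i)) ` UNIV)"
  unfolding pencil_ideal_def span_dot coord_ratio_span[OF a]
proof (rule antisym; rule idl.span_minimal[OF _ idl.subspace_span])
  let ?g = "\<lambda>j. q j - scale (cf a j / cf a i) (q i)"
  show "{comb q c | c. dot a c = 0} \<subseteq> idl.span (?g ` UNIV)"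
  proof
    fix x assume "x \<in> {comb q c | c. dot a c = 0}"
    then obtain c where c: "x = comb q c" "dot a c = 0" by blast
    have "(\<Sum>j\<in>UNIV. scale (cf c j) (?g j)) = comb q c - scale ((\<Sum>j\<in>UNIV. cf a j * cf c j) / cf a i) (q i)"
      by (simp add: comb_def cvs.scale_right_diff_distrib sum_subtractf cvs.scale_sum_left[symmetric] sum_divide_distrib mult.commute)
    also have "\<dots> = x" using c by (simp add: dot_sum)
    finally have e: "x = (\<Sum>j\<in>UNIV. scale (cf c j) (?g j))" ..
    show "x \<in> idl.span (?g ` UNIV)"
      unfolding e by (intro cvs.subspace_sum[OF ideal_cvs_subspace[OF idl.subspace_span]]
          cvs.subspace_scale[OF ideal_cvs_subspace[OF idl.subspace_span]] idl.span_base rangeI)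
  qed
  show "?g ` UNIV \<subseteq> idl.span {comb q c | c. dot a c = 0}"
  proof (rule image_subsetI, rule idl.span_base)
    fix j
    let ?c = "Poly_Mapping.single j 1 - scale (cf a j / cf a i) (Poly_Mapping.single i 1)"
    have "dot a ?c = 0" using a by (simp add: dot_diff dot_scale)
    moreover have "?g j = comb q ?c" by (simp add: comb_diff comb_scale)
    ultimately show "?g j \<in> {comb q c | c. dot a c = 0}" by blast
  qed
qed

text \<open>\<open>family_chart\<close> is applied to the generators of
  \<open>pencil_ideal_chart\<close>, with the algebra generated by the affine coordinates of the
  plane in the role of \<open>R\<close>.\<close>

lemma morph_pencil_ideal: "morph proj_atlas P2 hilb_atlas (border_VSP F 4) pencil_ideal"
  unfolding morph_def
proof (intro conjI ballI, safe)
  show "pencil_ideal p \<in> border_VSP F 4" if "p \<in> P2" for p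
    using that pencil_ideal_VSP by (auto simp: P2_point)
  fix p U' C' assume p: "p \<in> P2" and chart: "(U', C') \<in> hilb_atlas" "pencil_ideal p \<in> U'"
  from chart obtain d B where dB: "U' = hilb_chart d B" "C' = {hilb_coord B m b | m b. mdeg m \<le> d}"
    by (auto simp: hilb_atlas_def)
  from p obtain a where a: "a \<noteq> 0" "p = cvs.span {a}" by (auto simp: P2_point)
  from a(1) obtain i where i: "cf a i \<noteq> 0" by (metis lookup_zero poly_mapping_eqI)
  let ?U = "{p. \<exists>v\<in>p. cf v i \<noteq> (0::complex)}" and ?C = "range (\<lambda>j. coord_ratio i j)"
  let ?Y = "P2 \<inter> ?U" and ?R = "generated_algebra ?C"
  let ?g = "\<lambda>j y. q j - scale (coord_ratio i j y) (q i)"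
  \<comment> \<open>Defined by the generators for every y, as \<open>family_chart\<close> requires;
    it is identified with the ideal of the pencil only for points of the chart.\<close>
  define J where "J y = idl.span ((\<lambda>j. ?g j y) ` UNIV)" for y
  have atlas: "(?U, ?C) \<in> proj_atlas" by (auto simp: proj_atlas_def)
  have J: "J y = pencil_ideal y" if "y \<in> ?Y" for y
  proof -
    from that obtain b where b: "y = cvs.span {b}" by (auto simp: P2_point)
    with that have "cf b i \<noteq> 0" using chart_span_iff[of b i] by blast
    from pencil_ideal_chart[OF this] show ?thesis unfolding J_def b ..
  qed
  have H: "pencil_ideal y \<in> Hilb 4" if "y \<in> ?Y" for y
    using that pencil_ideal_VSP VSP_Hilb by (auto simp: P2_point)
  have pY: "p \<in> ?Y" using p i chart_span_iff[of a i] by (simp add: a(2))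
  have "\<exists>D\<in>?R. D p \<noteq> 0 \<and> (\<forall>y\<in>?Y. D y \<noteq> 0 \<longrightarrow> J y \<in> hilb_chart d B) \<and>
     (\<forall>m b. mdeg m \<le> d \<longrightarrow> (\<exists>N\<in>?R. \<exists>Q\<in>?R. \<forall>y. D y \<noteq> 0 \<longrightarrow> Q y \<noteq> 0 \<and>
        (y \<in> ?Y \<longrightarrow> hilb_coord B m b (J y) = N y / Q y)))"
  proof (rule family_chart[where g = ?g and e = "\<lambda>_. 2" and I = UNIV])
    show "fun_algebra ?R" by (rule fun_algebra_generated)
    show "\<forall>j\<in>UNIV. \<forall>y. ?g j y \<in> forms 2" by (intro ballI allI forms_diff forms_scale gen_forms)
    show "\<forall>j\<in>UNIV. \<forall>m. (\<lambda>y. cf (?g j y) m) \<in> ?R"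
      unfolding lookup_minus lookup_scale
      by (intro ballI allI fun_algebra_diff[OF fun_algebra_generated] generated_algebra.mult generated_algebra.const generated_algebra.coord rangeI)
    show "J p \<in> hilb_chart d B" using chart(2) unfolding J[OF pY] dB .
    show "\<forall>y\<in>?Y. \<forall>k. cvs.dim (J y \<inter> forms k) = cvs.dim (J p \<inter> forms k)"
    proof (intro ballI allI)
      fix y k assume y: "y \<in> ?Y"
      from Hilb_dim_eq[OF H[OF y] H[OF pY]] show "cvs.dim (J y \<inter> forms k) = cvs.dim (J p \<inter> forms k)"
        unfolding J[OF y] J[OF pY] .
    qed
    show "\<forall>y. J y = idl.span ((\<lambda>j. ?g j y) ` UNIV)" unfolding J_def by (rule allI) (rule refl)
  qed (rule finite)
  then obtain D where D: "D \<in> ?R" "D p \<noteq> 0" "\<forall>y\<in>?Y. D y \<noteq> 0 \<longrightarrow> J y \<in> hilb_chart d B"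
     "\<forall>m b. mdeg m \<le> d \<longrightarrow> (\<exists>N\<in>?R. \<exists>Q\<in>?R. \<forall>y. D y \<noteq> 0 \<longrightarrow> Q y \<noteq> 0 \<and> (y \<in> ?Y \<longrightarrow> hilb_coord B m b (J y) = N y / Q y))"
    by (elim bexE conjE)
  let ?V = "{x \<in> ?Y. D x \<noteq> 0}"
  have op: "openin (zariski proj_atlas P2) ?V" by (rule openin_zariski_basic[OF atlas D(1)])
  have "\<forall>f\<in>C'. \<exists>p\<in>?R. \<exists>Q\<in>?R. \<forall>y\<in>?V. Q y \<noteq> 0 \<and> f (pencil_ideal y) = p y / Q y"
  proof
    fix f assume "f \<in> C'"
    then obtain m b where f: "f = hilb_coord B m b" "mdeg m \<le> d" unfolding dB by blast
    from D(4)[rule_format, OF f(2), of b] obtain N Q where NQ: "N \<in> ?R" "Q \<in> ?R" "\<forall>y. D y \<noteq> 0 \<longrightarrow> Q y \<noteq> 0 \<and> (y \<in> ?Y \<longrightarrow> hilb_coord B m b (J y) = N y / Q y)" by (elim bexE)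
    have "Q y \<noteq> 0 \<and> f (pencil_ideal y) = N y / Q y" if "y \<in> ?V" for y
    proof -
      from that have y: "y \<in> ?Y" "D y \<noteq> 0" by simp_all
      from NQ(3) y show ?thesis unfolding f(1) J[OF y(1), symmetric] by simp
    qed
    with NQ(1,2) show "\<exists>p\<in>?R. \<exists>Q\<in>?R. \<forall>y\<in>?V. Q y \<noteq> 0 \<and> f (pencil_ideal y) = p y / Q y" by blast
  qed
  moreover have "pencil_ideal ` ?V \<subseteq> U'"
  proof (rule image_subsetI)
    fix y assume y: "y \<in> ?V"
    then have y: "y \<in> ?Y" "D y \<noteq> 0" by simp_all
    from D(3) y show "pencil_ideal y \<in> U'" unfolding dB J[OF y(1), symmetric] by blast
  qed
  moreover have "p \<in> ?V" "?V \<subseteq> ?U" using pY D(2) by auto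
  ultimately show "\<exists>U C V. (U, C) \<in> proj_atlas \<and> openin (zariski proj_atlas P2) V \<and> p \<in> V \<and> V \<subseteq> U \<and> pencil_ideal ` V \<subseteq> U' \<and>
       (\<forall>f\<in>C'. \<exists>p\<in>generated_algebra C. \<exists>q\<in>generated_algebra C. \<forall>y\<in>V. q y \<noteq> 0 \<and> f (pencil_ideal y) = p y / q y)"
    using atlas op by (intro exI[of _ ?U] exI[of _ ?C] exI[of _ ?V]) (intro conjI)
qed

text \<open>The combination a_i q_j - a_j q_i belongs to the pencil of a, so its normal form is
  0.\<close>

lemma normal_coeff_ratio:
  assumes a: "a \<noteq> 0" and ch: "pencil_ideal (cvs.span {a}) \<in> hilb_chart 2 B" and b: "b \<in> deg_part B 2"
  shows "cf a i * normal_coeff B b (q j) (pencil_ideal (cvs.span {a})) = cf a j * normal_coeff B b (q i) (pencil_ideal (cvs.span {a}))"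
proof -
  let ?J = "pencil_ideal (cvs.span {a})"
  let ?c = "Poly_Mapping.single j (cf a i) + Poly_Mapping.single i (- cf a j)"
  have "comb q ?c \<in> ?J" unfolding comb_mem_iff[OF a] by (simp add: dot_add)
  then have "normal_coeff B b (comb q ?c) ?J = 0"
    using normal_coeff_zero_iff[OF Hilb_homogeneous[OF VSP_Hilb[OF pencil_ideal_VSP[OF a]]] ch comb_forms] b by blast
  then have "cf a i * normal_coeff B b (q j) ?J + (- cf a j) * normal_coeff B b (q i) ?J = 0"
    by (simp only: comb_add comb_single normal_coeff_add normal_coeff_scale)
  then show ?thesis by simp
qed

text \<open>By \<open>normal_coeff_ratio\<close> the affine coordinates of the point are ratios of
  normal form coefficients at a single standard monomial b. Since \<open>q i\<close> is not in J, b
  can be chosen with nonzero denominator at J, and the denominator stays nonzero on an open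
  neighbourhood.\<close>

lemma morph_pencil_point: "morph hilb_atlas (border_VSP F 4) proj_atlas P2 pencil_point"
  unfolding morph_def
proof (intro conjI ballI, safe)
  show "pencil_point J \<in> P2" if "J \<in> border_VSP F 4" for J
    using VSP_pencil[OF that] point_of_pencil by (auto simp: P2_point)
  fix J U' C' assume J: "J \<in> border_VSP F 4" and chart: "(U', C') \<in> proj_atlas" "pencil_point J \<in> U'"
  from chart obtain i where i: "U' = {p. \<exists>v\<in>p. cf v i \<noteq> 0}" "C' = range (\<lambda>j. coord_ratio i j)" by (auto simp: proj_atlas_def)
  from VSP_pencil[OF J] obtain a where a: "a \<noteq> 0" "J = pencil_ideal (cvs.span {a})" by blast
  have ai: "cf a i \<noteq> 0" using chart(2) unfolding i a(2) point_of_pencil[OF a(1)] mem_Collect_eq chart_span_iff .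
  note hom = Hilb_homogeneous[OF VSP_Hilb]
  from hilb_chart_exists[OF hom[OF J]] obtain B where B: "J \<in> hilb_chart 2 B" ..
  let ?C = "{hilb_coord B m b | m b. mdeg m \<le> 2}"
  have atlas: "(hilb_chart 2 B, ?C) \<in> hilb_atlas" by (auto simp: hilb_atlas_def)
  have "q i \<notin> J"
  proof
    assume "q i \<in> J"
    then have "comb q (Poly_Mapping.single i 1) \<in> J" by simp
    then show False using ai unfolding a(2) comb_mem_iff[OF a(1)] by simp
  qed
  then obtain b where b: "b \<in> deg_part B 2" "normal_coeff B b (q i) J \<noteq> 0"
    using normal_coeff_zero_iff[OF hom[OF J] B gen_forms] by blast
  have reg: "normal_coeff B b (q j) \<in> generated_algebra ?C" for j
    unfolding normal_coeff_def[abs_def]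
  proof (rule fun_algebra_sum[OF fun_algebra_generated], rule generated_algebra.mult[OF generated_algebra.const generated_algebra.coord])
    show "hilb_coord B m b \<in> ?C" if "m \<in> mons 2" for m using that by (auto simp: mons_def)
  qed
  let ?V = "{x \<in> border_VSP F 4 \<inter> hilb_chart 2 B. normal_coeff B b (q i) x \<noteq> 0}"
  have op: "openin (zariski hilb_atlas (border_VSP F 4)) ?V" by (rule openin_zariski_basic[OF atlas reg])
  have V: "\<exists>e. cf e i \<noteq> 0 \<and> pencil_point K = cvs.span {e} \<and> (\<forall>j. coord_ratio i j (pencil_point K) = normal_coeff B b (q j) K / normal_coeff B b (q i) K)"
    if K: "K \<in> ?V" for K
  proof -
    from K have "K \<in> border_VSP F 4" by simp
    from VSP_pencil[OF this] obtain e where e: "e \<noteq> 0" "K = pencil_ideal (cvs.span {e})" by blast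
    have r: "cf e i * normal_coeff B b (q j) K = cf e j * normal_coeff B b (q i) K" for j
      using normal_coeff_ratio[OF e(1) _ b(1)] K by (simp add: e(2))
    have nz: "normal_coeff B b (q i) K \<noteq> 0" using K by simp
    \<comment> \<open>Otherwise proportionality with a nonzero coefficient of \<open>q i\<close>
      would make every coordinate of e vanish.\<close>
    have ei: "cf e i \<noteq> 0"
    proof
      assume "cf e i = 0"
      with r nz have "cf e j = 0" for j by (metis mult_eq_0_iff)
      then have "e = 0" by (intro poly_mapping_eqI) simp
      with e(1) show False by simp
    qed
    have "coord_ratio i j (cvs.span {e}) = normal_coeff B b (q j) K / normal_coeff B b (q i) K" for j
      unfolding coord_ratio_span[OF ei] using r[of j] ei nz by (simp add: field_simps)
    with ei point_of_pencil[OF e(1)] show ?thesis unfolding e(2)[symmetric] by auto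
  qed
  have "\<forall>f\<in>C'. \<exists>N\<in>generated_algebra ?C. \<exists>Q\<in>generated_algebra ?C. \<forall>y\<in>?V. Q y \<noteq> 0 \<and> f (pencil_point y) = N y / Q y"
  proof
    fix f assume "f \<in> C'"
    then obtain j where f: "f = coord_ratio i j" unfolding i by blast
    have "\<forall>y\<in>?V. normal_coeff B b (q i) y \<noteq> 0 \<and> f (pencil_point y) = normal_coeff B b (q j) y / normal_coeff B b (q i) y"
      using V unfolding f by blast
    with reg show "\<exists>N\<in>generated_algebra ?C. \<exists>Q\<in>generated_algebra ?C. \<forall>y\<in>?V. Q y \<noteq> 0 \<and> f (pencil_point y) = N y / Q y" by blast
  qed
  moreover have "pencil_point ` ?V \<subseteq> U'"
  proof (rule image_subsetI)
    fix y assume "y \<in> ?V"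
    from V[OF this] obtain e where "cf e i \<noteq> 0" "pencil_point y = cvs.span {e}" by blast
    then show "pencil_point y \<in> U'" unfolding i using chart_span_iff[of e i] by simp
  qed
  moreover have "J \<in> ?V" "?V \<subseteq> hilb_chart 2 B" using J B b(2) by auto
  ultimately show "\<exists>U C V. (U, C) \<in> hilb_atlas \<and> openin (zariski hilb_atlas (border_VSP F 4)) V \<and> J \<in> V \<and> V \<subseteq> U \<and> pencil_point ` V \<subseteq> U' \<and>
       (\<forall>f\<in>C'. \<exists>p\<in>generated_algebra C. \<exists>q\<in>generated_algebra C. \<forall>y\<in>V. q y \<noteq> 0 \<and> f (pencil_point y) = p y / q y)"
    using atlas op by (intro exI[of _ "hilb_chart 2 B"] exI[of _ ?C] exI[of _ ?V]) (intro conjI)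
qed

lemma VSP_isomorphic_plane: "isomorphic_varieties hilb_atlas (border_VSP F 4) proj_atlas P2"
  unfolding isomorphic_varieties_def
proof (rule exI, rule morph_inverse_iso[OF morph_pencil_point morph_pencil_ideal])
  show "pencil_ideal (pencil_point J) = J" if "J \<in> border_VSP F 4" for J
    using VSP_pencil[OF that] point_of_pencil by auto
  show "pencil_point (pencil_ideal p) = p" if "p \<in> P2" for p
    using that point_of_pencil by (auto simp: P2_point)
  show "topspace (zariski hilb_atlas (border_VSP F 4)) = border_VSP F 4"
    by (rule topspace_hilb[OF Hilb_homogeneous[OF VSP_Hilb]])
  show "topspace (zariski proj_atlas P2) = P2" unfolding P2_def by (rule topspace_proj)
qed

end

theorem theorem8p3:
  fixes F :: poly3
  assumes "F \<in> forms 3" and "F \<noteq> 0"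
  shows "isomorphic_varieties hilb_atlas (border_VSP F (border_rank F)) proj_atlas P2 \<or>
         (\<exists>J. border_VSP F (border_rank F) = {J})"
proof (cases "no_square_polar F")
  case True
  from Ann_quad_basis[OF True assms(1)] obtain q where q: "\<forall>j. q j \<in> Ann F \<inter> forms 2"
    "\<forall>c. comb q c = 0 \<longrightarrow> c = 0" "\<forall>x\<in>Ann F \<inter> forms 2. \<exists>c. x = comb q c" by (elim exE conjE)
  interpret conic_net F q by unfold_locales (use True assms(1) q in auto)
  from product_annihilator[OF True assms(1)] obtain a b c u v w where "frame a b c u v w" "D a (D b F) = 0" by (elim exE conjE)
  from border_rank_eq_4[OF True assms(1) this] VSP_isomorphic_plane show ?thesis by simp
next
  case False
  then obtain s y where "s \<noteq> 0" "D s F = linear_form y ^ 2" by (auto simp: no_square_polar_def)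
  from special_cubic_exists[OF assms this] obtain a b c u v w where "frame a b c u v w" "special_cubic u v w F" by (elim exE conjE)
  from VSP_special_cubic[OF this] show ?thesis ..
qed

end
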